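(* Any Borel subgroup of $G$ is conjugate in $G$ to $B$.
   Context: $R=\mathbb{C}\langle x,y\rangle$ is the free associative $\mathbb{C}$-algebra on $x,y$, and $G$ is the group of all $\mathbb{C}$-algebra automorphisms $\sigma$ of $R$ with $\sigma([x,y])=[x,y]$. An endomorphism $\sigma$ of $R$ is written as the pair $(\sigma(x),\sigma(y))\in R\times R$. $B\subset G$ is the subgroup of triangular transformations $(ax+q(y),\,a^{-1}y+h)$ with $a\in\mathbb{C}^*$, $h\in\mathbb{C}$, $q\in\mathbb{C}[y]$. Topology on $G$ (ind-Zariski topology): let $R^{(k)}$ be the finite-dimensional space of elements of $R$ of degree $\le k$ in $x,y$. Regard $G\subset R\times R$ and put $G^{(k)}=G\cap(R^{(k)}\times R^{(k)})$, a Zariski closed subset of the affine space $R^{(k)}\times R^{(k)}$. A subset $S\subseteq G$ is closed iff $S\cap G^{(k)}$ is Zariski closed in $G^{(k)}$ for all $k\geq 0$. Subgroups carry the subspace topology. A Borel subgroup of a group with such a topology is a connected solvable subgroup that is maximal among all connected solvable subgroups. *)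

theory Defs
  imports
    "HOL-Analysis.Analysis"
    "HOL-Library.Poly_Mapping"
    "HOL-Computational_Algebra.Polynomial"
    "HOL-Algebra.Solvable_Groups"
begin

section \<open>The free associative algebra on two generators\<close>

text \<open>
  The free algebra is the monoid algebra of the free monoid on two letters. Making lists a
  (non-commutative) additive monoid under concatenation turns finitely supported functions on
  words, with the convolution product of \<^theory>\<open>HOL-Library.Poly_Mapping\<close>, into this algebra.
\<close>

instantiation list :: (type) monoid_add
begin

definition zero_list :: "'a list" where "0 = []"

definition plus_list :: "'a list \<Rightarrow> 'a list \<Rightarrow> 'a list" where "u + v = u @ v"

instance by standard (simp_all add: zero_list_def plus_list_def)

end

datatype letter = Letter_x | Letter_y

type_synonym free_alg = "letter list \<Rightarrow>\<^sub>0 complex"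

definition scalar :: "complex \<Rightarrow> free_alg" where
  "scalar c = Poly_Mapping.single [] c"

definition gen_x :: free_alg where "gen_x = Poly_Mapping.single [Letter_x] 1"

definition gen_y :: free_alg where "gen_y = Poly_Mapping.single [Letter_y] 1"

definition commutator :: "free_alg \<Rightarrow> free_alg \<Rightarrow> free_alg" where
  "commutator p q = p * q - q * p"

definition degree_le :: "nat \<Rightarrow> free_alg set" where
  "degree_le k = {p. \<forall>w \<in> Poly_Mapping.keys p. length w \<le> k}"

definition alg_endo :: "(free_alg \<Rightarrow> free_alg) \<Rightarrow> bool" where
  "alg_endo \<sigma> \<longleftrightarrow>
     \<sigma> 1 = 1 \<and>
     (\<forall>p q. \<sigma> (p + q) = \<sigma> p + \<sigma> q) \<and>
     (\<forall>p q. \<sigma> (p * q) = \<sigma> p * \<sigma> q) \<and>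
     (\<forall>c p. \<sigma> (scalar c * p) = scalar c * \<sigma> p)"

lemma alg_endo_id: "alg_endo id"
  by (simp add: alg_endo_def)

lemma alg_endo_comp: "alg_endo \<sigma> \<Longrightarrow> alg_endo \<tau> \<Longrightarrow> alg_endo (\<sigma> \<circ> \<tau>)"
  unfolding alg_endo_def comp_def by metis

lemma free_alg_monomial_Cons:
  "(Poly_Mapping.single (a # w) c :: free_alg) =
     (case a of Letter_x \<Rightarrow> gen_x | Letter_y \<Rightarrow> gen_y) * Poly_Mapping.single w c"
  by (cases a) (simp_all add: gen_x_def gen_y_def mult_single plus_list_def)

lemma alg_endo_eqI:
  assumes "alg_endo \<sigma>" "alg_endo \<tau>" "\<sigma> gen_x = \<tau> gen_x" "\<sigma> gen_y = \<tau> gen_y"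
  shows "\<sigma> = \<tau>"
proof
  have mon: "\<sigma> (Poly_Mapping.single w c) = \<tau> (Poly_Mapping.single w c)" for w c
  proof (induction w)
    case Nil
    have nil: "\<rho> (Poly_Mapping.single [] c) = scalar c" if "alg_endo \<rho>" for \<rho>
    proof -
      have "\<rho> (scalar c * 1) = scalar c * \<rho> 1" "\<rho> 1 = 1"
        using that unfolding alg_endo_def by blast+
      then show ?thesis by (simp add: scalar_def)
    qed
    show ?case using nil assms(1,2) by metis
  next
    case (Cons a w)
    have mult: "\<rho> (p * q) = \<rho> p * \<rho> q" if "alg_endo \<rho>" for \<rho> p q
      using that unfolding alg_endo_def by blast
    show ?case
      using Cons assms(3,4)
      by (cases a) (simp_all add: free_alg_monomial_Cons mult assms(1,2))
  qed
  have add: "\<rho> (p + q) = \<rho> p + \<rho> q" if "alg_endo \<rho>" for \<rho> p q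
    using that unfolding alg_endo_def by blast
  fix p
  show "\<sigma> p = \<tau> p"
  proof (induction p rule: update_induct)
    case const
    show ?case using mon[of "[]" 0] by simp
  next
    case (update p w c)
    then have "Poly_Mapping.update w c p = p + Poly_Mapping.single w c"
      by (intro poly_mapping_eqI) (auto simp: lookup_update lookup_add lookup_single in_keys_iff)
    then show ?case by (simp add: add assms(1,2) mon update)
  qed
qed


section \<open>The automorphism group and its triangular subgroup\<close>

definition sympl_aut :: "(free_alg \<Rightarrow> free_alg) monoid" where
  "sympl_aut =
     \<lparr>carrier = {\<sigma>. alg_endo \<sigma> \<and> bij \<sigma> \<and> \<sigma> (commutator gen_x gen_y) = commutator gen_x gen_y},
      mult = (\<circ>), one = id\<rparr>"

lemma group_sympl_aut: "group sympl_aut"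
proof (rule groupI)
  fix \<sigma> assume "\<sigma> \<in> carrier sympl_aut"
  then have \<sigma>: "alg_endo \<sigma>" "bij \<sigma>" "\<sigma> (commutator gen_x gen_y) = commutator gen_x gen_y"
    by (simp_all add: sympl_aut_def)
  define \<tau> where "\<tau> = inv_into UNIV \<sigma>"
  have inv: "\<tau> q = p \<longleftrightarrow> q = \<sigma> p" for p q
    unfolding \<tau>_def using \<sigma>(2) by (metis bij_inv_eq_iff)
  have s: "\<sigma> (\<tau> p) = p" for p
    using inv by metis
  have "alg_endo \<tau>"
    using \<sigma>(1) s unfolding alg_endo_def inv by metis
  moreover have "bij \<tau>"
    unfolding \<tau>_def using \<sigma>(2) by (rule bij_imp_bij_inv)
  ultimately have "\<tau> \<in> carrier sympl_aut"
    using \<sigma>(3) inv by (simp add: sympl_aut_def)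
  moreover have "\<tau> \<circ> \<sigma> = id"
    using inv by auto
  ultimately show "\<exists>\<tau>\<in>carrier sympl_aut. \<tau> \<otimes>\<^bsub>sympl_aut\<^esub> \<sigma> = \<one>\<^bsub>sympl_aut\<^esub>"
    by (intro bexI[of _ \<tau>]) (simp_all add: sympl_aut_def)
qed (simp_all add: sympl_aut_def alg_endo_id alg_endo_comp bij_comp comp_assoc)

definition poly_in_y :: "complex poly \<Rightarrow> free_alg" where
  "poly_in_y q = (\<Sum>i\<le>degree q. scalar (coeff q i) * gen_y ^ i)"

definition triangular :: "(free_alg \<Rightarrow> free_alg) set" where
  "triangular =
     {\<sigma> \<in> carrier sympl_aut.
        \<exists>a h q. a \<noteq> 0 \<and>
          \<sigma> gen_x = scalar a * gen_x + poly_in_y q \<and>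
          \<sigma> gen_y = scalar (inverse a) * gen_y + scalar h}"


section \<open>The ind-Zariski topology\<close>

text \<open>
  On pairs of elements of degree at most \<open>k\<close>, the coefficients of words of length at most \<open>k\<close>
  are linear coordinates and all other coefficients vanish; so restricting the functions below
  to these pairs gives precisely the polynomial functions on a finite-dimensional space.
\<close>

inductive_set poly_functions :: "(free_alg \<times> free_alg \<Rightarrow> complex) set" where
  const: "(\<lambda>_. c) \<in> poly_functions"
| coord_fst: "(\<lambda>v. Poly_Mapping.lookup (fst v) w) \<in> poly_functions"
| coord_snd: "(\<lambda>v. Poly_Mapping.lookup (snd v) w) \<in> poly_functions"
| add: "\<lbrakk>f \<in> poly_functions; g \<in> poly_functions\<rbrakk> \<Longrightarrow> (\<lambda>v. f v + g v) \<in> poly_functions"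
| mult: "\<lbrakk>f \<in> poly_functions; g \<in> poly_functions\<rbrakk> \<Longrightarrow> (\<lambda>v. f v * g v) \<in> poly_functions"

definition zariski_closed :: "nat \<Rightarrow> (free_alg \<times> free_alg) set \<Rightarrow> bool" where
  "zariski_closed k Z \<longleftrightarrow>
     (\<exists>F \<subseteq> poly_functions. Z = {v \<in> degree_le k \<times> degree_le k. \<forall>f\<in>F. f v = 0})"

definition zariski :: "nat \<Rightarrow> (free_alg \<times> free_alg) topology" where
  "zariski k = topology (\<lambda>U.
     U \<subseteq> degree_le k \<times> degree_le k \<and> zariski_closed k (degree_le k \<times> degree_le k - U))"

lemma zariski_closed_Un:
  assumes "zariski_closed k Z" "zariski_closed k W"
  shows "zariski_closed k (Z \<union> W)"
proof -
  from assms(1) obtain F where F: "F \<subseteq> poly_functions"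
      "Z = {v \<in> degree_le k \<times> degree_le k. \<forall>f\<in>F. f v = 0}"
    unfolding zariski_closed_def by (elim exE conjE)
  from assms(2) obtain H where H: "H \<subseteq> poly_functions"
      "W = {v \<in> degree_le k \<times> degree_le k. \<forall>f\<in>H. f v = 0}"
    unfolding zariski_closed_def by (elim exE conjE)
  define P where "P = (\<lambda>(f, h) v. f v * h v) ` (F \<times> H)"
  have "P \<subseteq> poly_functions"
    unfolding P_def
  proof (intro image_subsetI, clarify)
    fix f h assume "f \<in> F" "h \<in> H"
    then show "(\<lambda>v. f v * h v) \<in> poly_functions"
      using F(1) H(1) poly_functions.mult[of f h] by auto
  qed
  moreover have "Z \<union> W = {v \<in> degree_le k \<times> degree_le k. \<forall>p\<in>P. p v = 0}"
  proof -
    have "(\<forall>p\<in>P. p v = 0) \<longleftrightarrow> (\<forall>f\<in>F. f v = 0) \<or> (\<forall>h\<in>H. h v = 0)" for v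
    proof -
      have "(\<forall>p\<in>P. p v = 0) \<longleftrightarrow> (\<forall>f\<in>F. \<forall>h\<in>H. f v * h v = 0)"
        by (simp add: P_def)
      also have "\<dots> \<longleftrightarrow> (\<forall>f\<in>F. f v = 0) \<or> (\<forall>h\<in>H. h v = 0)"
        unfolding mult_eq_0_iff by blast
      finally show ?thesis .
    qed
    then show ?thesis
      unfolding F(2) H(2) by blast
  qed
  ultimately show ?thesis
    unfolding zariski_closed_def by (intro exI[of _ P] conjI)
qed

lemma zariski_closed_Inter:
  assumes "\<And>Z. Z \<in> \<Z> \<Longrightarrow> zariski_closed k Z"
  shows "zariski_closed k (degree_le k \<times> degree_le k \<inter> \<Inter>\<Z>)"
proof -
  obtain F where F: "\<forall>Z\<in>\<Z>. F Z \<subseteq> poly_functions \<and>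
      Z = {v \<in> degree_le k \<times> degree_le k. \<forall>f\<in>F Z. f v = 0}"
  proof -
    have "\<forall>Z\<in>\<Z>. \<exists>F. F \<subseteq> poly_functions \<and>
        Z = {v \<in> degree_le k \<times> degree_le k. \<forall>f\<in>F. f v = 0}"
      using assms unfolding zariski_closed_def by simp
    from bchoice[OF this] show ?thesis
      by (rule exE) (rule that)
  qed
  have mem: "v \<in> Z \<longleftrightarrow> v \<in> degree_le k \<times> degree_le k \<and> (\<forall>f\<in>F Z. f v = 0)" if "Z \<in> \<Z>" for v Z
    using bspec[OF F that] by blast
  have "(\<Union>Z\<in>\<Z>. F Z) \<subseteq> poly_functions"
    using F by blast
  moreover have "degree_le k \<times> degree_le k \<inter> \<Inter>\<Z> =
      {v \<in> degree_le k \<times> degree_le k. \<forall>f\<in>\<Union>Z\<in>\<Z>. F Z. f v = 0}"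
    using mem by blast
  ultimately show ?thesis
    unfolding zariski_closed_def by blast
qed

lemma zariski_closed_space: "zariski_closed k (degree_le k \<times> degree_le k)"
  using zariski_closed_Inter[of "{}"] by simp

lemma openin_zariski:
  "openin (zariski k) U \<longleftrightarrow>
     U \<subseteq> degree_le k \<times> degree_le k \<and> zariski_closed k (degree_le k \<times> degree_le k - U)"
proof -
  let ?A = "degree_le k \<times> degree_le k"
  have "istopology (\<lambda>U. U \<subseteq> ?A \<and> zariski_closed k (?A - U))"
    unfolding istopology_def
  proof (intro conjI allI impI; (elim conjE)?)
    fix S T assume "zariski_closed k (?A - S)" "zariski_closed k (?A - T)"
    then show "zariski_closed k (?A - S \<inter> T)"
      using zariski_closed_Un by (simp add: Diff_Int)
  next
    fix \<K> assume "\<forall>K\<in>\<K>. K \<subseteq> ?A \<and> zariski_closed k (?A - K)"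
    then have "zariski_closed k (?A \<inter> \<Inter>((\<lambda>K. ?A - K) ` \<K>))"
      by (intro zariski_closed_Inter) auto
    moreover have "?A \<inter> \<Inter>((\<lambda>K. ?A - K) ` \<K>) = ?A - \<Union>\<K>"
      by blast
    ultimately show "zariski_closed k (?A - \<Union>\<K>)"
      by simp
  qed auto
  then show ?thesis
    by (simp add: zariski_def topology_inverse')
qed

lemma topspace_zariski: "topspace (zariski k) = degree_le k \<times> degree_le k"
proof -
  have "zariski_closed k {}"
    unfolding zariski_closed_def
    by (intro exI[of _ "{\<lambda>_. 1}"]) (auto intro: poly_functions.const)
  then have "openin (zariski k) (degree_le k \<times> degree_le k)"
    by (simp add: openin_zariski)
  then show ?thesis
    by (auto simp: topspace_def openin_zariski)
qed

lemma closedin_zariski: "closedin (zariski k) Z \<longleftrightarrow> zariski_closed k Z"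
proof -
  have "Z \<subseteq> degree_le k \<times> degree_le k" if "zariski_closed k Z"
    using that unfolding zariski_closed_def by auto
  then show ?thesis
    by (auto simp: closedin_def topspace_zariski openin_zariski double_diff)
qed

definition as_pair :: "(free_alg \<Rightarrow> free_alg) \<Rightarrow> free_alg \<times> free_alg" where
  "as_pair \<sigma> = (\<sigma> gen_x, \<sigma> gen_y)"

lemma inj_on_as_pair: "inj_on as_pair (carrier sympl_aut)"
  by (rule inj_onI) (simp add: as_pair_def sympl_aut_def alg_endo_eqI)

definition filtration :: "nat \<Rightarrow> (free_alg \<Rightarrow> free_alg) set" where
  "filtration k = {\<sigma> \<in> carrier sympl_aut. as_pair \<sigma> \<in> degree_le k \<times> degree_le k}"

text \<open>
  As \<^const>\<open>as_pair\<close> is injective on the group, pulling back along it is the same as taking the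
  subspace topology on the image.
\<close>

definition filtration_top :: "nat \<Rightarrow> (free_alg \<Rightarrow> free_alg) topology" where
  "filtration_top k = pullback_topology (filtration k) as_pair (zariski k)"

definition ind_zariski :: "(free_alg \<Rightarrow> free_alg) topology" where
  "ind_zariski = topology (\<lambda>U. U \<subseteq> carrier sympl_aut \<and>
     (\<forall>k. closedin (filtration_top k) ((carrier sympl_aut - U) \<inter> filtration k)))"

lemma topspace_filtration_top: "topspace (filtration_top k) = filtration k"
  by (auto simp: filtration_top_def topspace_pullback_topology topspace_zariski filtration_def)

lemma openin_ind_zariski:
  "openin ind_zariski U \<longleftrightarrow> U \<subseteq> carrier sympl_aut \<and>
     (\<forall>k. closedin (filtration_top k) ((carrier sympl_aut - U) \<inter> filtration k))"
proof -
  have op: "closedin (filtration_top k) ((carrier sympl_aut - U) \<inter> filtration k) \<longleftrightarrow>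
      openin (filtration_top k) (U \<inter> filtration k)" for k U
  proof -
    have "filtration k - (carrier sympl_aut - U) \<inter> filtration k = U \<inter> filtration k"
      by (auto simp: filtration_def)
    then show ?thesis
      by (simp add: closedin_def topspace_filtration_top)
  qed
  have "istopology (\<lambda>U. U \<subseteq> carrier sympl_aut \<and>
      (\<forall>k. openin (filtration_top k) (U \<inter> filtration k)))"
    unfolding istopology_def
  proof (intro conjI allI impI; (elim conjE)?)
    fix S T k
    assume "\<forall>k. openin (filtration_top k) (S \<inter> filtration k)"
      "\<forall>k. openin (filtration_top k) (T \<inter> filtration k)"
    then have "openin (filtration_top k) ((S \<inter> filtration k) \<inter> (T \<inter> filtration k))"
      by blast
    then show "openin (filtration_top k) (S \<inter> T \<inter> filtration k)"
      by (simp add: Int_ac)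
  next
    fix \<K> k
    assume "\<forall>K\<in>\<K>. K \<subseteq> carrier sympl_aut \<and> (\<forall>k. openin (filtration_top k) (K \<inter> filtration k))"
    then have "openin (filtration_top k) (\<Union>K\<in>\<K>. K \<inter> filtration k)"
      by blast
    then show "openin (filtration_top k) (\<Union>\<K> \<inter> filtration k)"
      by (simp add: Int_commute Int_Union)
  qed auto
  then show ?thesis
    by (simp add: ind_zariski_def op topology_inverse')
qed

lemma closedin_ind_zariski:
  "closedin ind_zariski S \<longleftrightarrow> S \<subseteq> carrier sympl_aut \<and>
     (\<forall>k. closedin (filtration_top k) (S \<inter> filtration k))"
proof -
  have "filtration k \<inter> carrier sympl_aut = filtration k" for k
    by (auto simp: filtration_def)
  then have "openin ind_zariski (carrier sympl_aut)"
    by (simp add: openin_ind_zariski)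
  then have "topspace ind_zariski = carrier sympl_aut"
    by (auto simp: topspace_def openin_ind_zariski)
  then show ?thesis
    by (auto simp: closedin_def[of ind_zariski] openin_ind_zariski double_diff)
qed


section \<open>Borel subgroups\<close>

definition connected_solvable_subgroup ::
    "('a, 'b) monoid_scheme \<Rightarrow> 'a topology \<Rightarrow> 'a set \<Rightarrow> bool" where
  "connected_solvable_subgroup G T H \<longleftrightarrow>
     subgroup H G \<and> connectedin T H \<and> solvable (G\<lparr>carrier := H\<rparr>)"

definition borel_subgroup ::
    "('a, 'b) monoid_scheme \<Rightarrow> 'a topology \<Rightarrow> 'a set \<Rightarrow> bool" where
  "borel_subgroup G T H \<longleftrightarrow>
     connected_solvable_subgroup G T H \<and>
     (\<forall>K. connected_solvable_subgroup G T K \<longrightarrow> H \<subseteq> K \<longrightarrow> K = H)"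

end

theory Submission
  imports Defs "HOL-Computational_Algebra.Fundamental_Theorem_Algebra"
begin

text \<open>
  Let \<open>G\<close> be the group of automorphisms fixing \<open>[x, y]\<close>. The theorem holds because \<open>G\<close> acts on a tree in
  which \<open>triangular\<close> is the stabiliser of a vertex, the distance by which an element moves the root is
  bounded by its degree, and long paths have finite stabilisers. As a connected set is
  infinite unless it is a point, these finite stabilisers force a connected solvable group to fix a vertex.

  \<^emph>\<open>Generators.\<close> The tree rests on the fact that \<open>G\<close> is generated by affine and triangular automorphisms
  (\<open>autG_eq_tame\<close>). For \<open>\<sigma>\<close> in \<open>G\<close> the derivation \<open>\<sigma> \<partial>\<^sub>x \<sigma>\<inverse>\<close> is locally nilpotent and kills \<open>[x, y]\<close>. Let \<open>D\<close> be any
  such derivation and record for each of its terms the shift of bidegree which it causes. The terms at a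
  corner of the Newton polygon of these shifts form a derivation of the same kind, and for a derivation with
  a single shift \<open>(i, j)\<close> the last nonzero iterates on \<open>x\<close> and on \<open>y\<close> commute, because \<open>[x, y]\<close> is killed.
  Commuting bihomogeneous elements of a free algebra have proportional bidegrees, whence \<open>i = -1\<close> or \<open>j = -1\<close>
  (\<open>single_shift_on_axis\<close>). So the outer corners are a power of \<open>y\<close> in \<open>D x\<close> and a power of \<open>x\<close> in \<open>D y\<close>;
  integral curves show that the edge between them has integral or reciprocal integral slope (\<open>edge_slope\<close>),
  and then conjugation by some \<open>y \<mapsto> y + c x\<^sup>p\<close> shortens it (\<open>shorten_edge\<close>). At the end \<open>D\<close> is \<open>r(y) \<partial>\<^sub>x\<close>, and an
  automorphism that carries \<open>\<partial>\<^sub>x\<close> to \<open>r(y) \<partial>\<^sub>x\<close> is triangular (\<open>triangular_of_lnd\<close>).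

  \<^emph>\<open>The tree.\<close> Its vertices are the images of \<open>\<complex> + \<complex>x + \<complex>y\<close> (planes) and of \<open>\<complex> + \<complex>y\<close> (lines), with inclusion as
  adjacency. The degrees along a reduced word in the generators increase (\<open>autG_eq_chain\<close>); this
  gives every vertex other than the root \<open>\<complex> + \<complex>x + \<complex>y\<close> exactly one neighbour nearer to the root, and it also
  shows that the inverse of an automorphism has no larger degree. The automorphisms fixing a path of length
  seven form a finite set (\<open>finite_far_stabilizer\<close>): those fixing its middle are, up to
  conjugation, affine and diagonal up to translations, and the two outer lines leave finitely many values for
  the parameters.

  \<^emph>\<open>Topology.\<close> Composition and inversion are polynomial on automorphisms of bounded degree. Hence the derived
  subgroups of a connected group are connected (\<open>connected_derived\<close>), and a connected set with finitely many
  elements in each degree is at most a point (\<open>connected_finite_levels\<close>).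

  \<^emph>\<open>Conclusion.\<close> Let \<open>H\<close> be connected and solvable and let \<open>N\<close> be its last nontrivial derived subgroup.
  Then \<open>N\<close> is abelian and contains infinitely many elements of some bounded degree. These move the root a bounded
  distance and, commuting with \<open>N\<close>, move all its images under \<open>N\<close> by the same distances; if some image
  were far away, infinitely many of them would agree on a long path. So the \<open>N\<close>-orbit of the root is bounded, and
  as \<open>N\<close> is infinite and normal, the same argument bounds the \<open>H\<close>-orbit. A bounded orbit in a tree has a centre, so \<open>H\<close> fixes a vertex
  (\<open>css_fixes_vertex\<close>). If this is a plane, \<open>H\<close> is conjugate to a group of affine automorphisms, and the argument
  of Lie and Kolchin gives a fixed line (\<open>css_affine_fixes_line\<close>). The stabiliser of a line is a conjugate
  of \<open>triangular\<close>, which is itself connected and solvable; maximality of \<open>H\<close> gives equality.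
\<close>

section \<open>Coefficients and scalars\<close>

abbreviation coef :: "free_alg \<Rightarrow> letter list \<Rightarrow> complex" where
  "coef \<equiv> Poly_Mapping.lookup"

abbreviation words :: "free_alg \<Rightarrow> letter list set" where
  "words \<equiv> Poly_Mapping.keys"

abbreviation term1 :: "letter list \<Rightarrow> complex \<Rightarrow> free_alg" where
  "term1 \<equiv> Poly_Mapping.single"

lemma free_alg_induct [case_names monomial add]:
  assumes "\<And>w c. P (term1 w c)" and "\<And>p q. P p \<Longrightarrow> P q \<Longrightarrow> P (p + q)"
  shows "P p"
proof (induction p rule: update_induct)
  case const
  show ?case using assms(1)[of "[]" 0] by simp
next
  case (update p w c)
  then have "Poly_Mapping.update w c p = p + term1 w c"
    by (intro poly_mapping_eqI) (auto simp: lookup_update lookup_add lookup_single in_keys_iff)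
  with update assms show ?case by simp
qed

lemma coef_mult: "coef (p * q) w = (\<Sum>i\<le>length w. coef p (take i w) * coef q (drop i w))"
proof (induction p rule: free_alg_induct)
  case (monomial u a)
  show ?case
  proof (induction q rule: free_alg_induct)
    case (monomial v b)
    have eq: "coef (term1 u a) (take i w) * coef (term1 v b) (drop i w)
        = (if i = length u then (if w = u @ v then a * b else 0) else 0)" if "i \<le> length w" for i
    proof (cases "u = take i w \<and> v = drop i w")
      case True
      then show ?thesis using that by auto
    next
      case False
      then have "coef (term1 u a) (take i w) * coef (term1 v b) (drop i w) = 0"
        by (auto simp: lookup_single)
      moreover have "\<not> (i = length u \<and> w = u @ v)" using False by auto
      ultimately show ?thesis by auto
    qed
    have "(\<Sum>i\<le>length w. coef (term1 u a) (take i w) * coef (term1 v b) (drop i w))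
        = (\<Sum>i\<le>length w. if i = length u then (if w = u @ v then a * b else 0) else 0)"
      using eq by (intro sum.cong) auto
    also have "\<dots> = (if w = u @ v then a * b else 0)"
      by (auto simp: sum.delta)
    finally show ?case by (auto simp: mult_single lookup_single plus_list_def when_def)
  next
    case (add p q)
    then show ?case by (simp add: distrib_left lookup_add sum.distrib)
  qed
next
  case (add p q)
  then show ?case by (simp add: distrib_right lookup_add sum.distrib)
qed

lemma coef_scalar_mult [simp]: "coef (scalar c * p) w = c * coef p w"
proof -
  have "coef (scalar c * p) w = (\<Sum>i\<le>length w. if i = 0 then c * coef p w else 0)"
    unfolding coef_mult by (intro sum.cong) (auto simp: scalar_def lookup_single when_def)
  then show ?thesis by (simp add: sum.delta)
qed

lemma scalar_commute: "p * scalar c = scalar c * p"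
proof (rule poly_mapping_eqI)
  fix w
  have "coef (p * scalar c) w = (\<Sum>i\<le>length w. if i = length w then c * coef p w else 0)"
    unfolding coef_mult by (intro sum.cong) (auto simp: scalar_def lookup_single when_def)
  then show "coef (p * scalar c) w = coef (scalar c * p) w" by (simp add: sum.delta)
qed

lemma scalar_left_commute: "p * (scalar c * q) = scalar c * (p * q)"
  by (metis mult.assoc scalar_commute)

lemma scalar_0 [simp]: "scalar 0 = 0"
  and scalar_1 [simp]: "scalar 1 = 1"
  by (simp_all add: scalar_def zero_list_def[symmetric])

lemma scalar_add: "scalar (a + b) = scalar a + scalar b"
  and scalar_diff: "scalar (a - b) = scalar a - scalar b"
  and scalar_minus: "scalar (- a) = - scalar a"
  and scalar_mult: "scalar (a * b) = scalar a * scalar b"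
  by (simp_all add: scalar_def single_add single_diff single_uminus mult_single plus_list_def)

lemma scalar_power: "scalar (a ^ n) = scalar a ^ n"
  by (induction n) (simp_all add: scalar_mult)

lemma coef_scalar: "coef (scalar c) w = (if w = [] then c else 0)"
  by (simp add: scalar_def lookup_single when_def)

lemma scalar_eq_iff [simp]: "scalar a = scalar b \<longleftrightarrow> a = b"
  by (metis coef_scalar)

lemma scalar_eq_0_iff [simp]: "scalar a = 0 \<longleftrightarrow> a = 0"
  by (metis scalar_0 scalar_eq_iff)

lemma coef_gens:
  "coef gen_x w = (if w = [Letter_x] then 1 else 0)"
  "coef gen_y w = (if w = [Letter_y] then 1 else 0)"
  by (simp_all add: gen_x_def gen_y_def lookup_single when_def)

lemma term1_eq: "term1 w c = scalar c * term1 w 1"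
  by (simp add: scalar_def mult_single plus_list_def)

lemma term1_append: "term1 (u @ v) 1 = term1 u 1 * term1 v 1"
  by (simp add: mult_single plus_list_def)

lemma term1_gens: "term1 [Letter_x] 1 = gen_x" "term1 [Letter_y] 1 = gen_y" "term1 [] 1 = 1"
  by (simp_all add: gen_x_def gen_y_def zero_list_def[symmetric])

lemma term1_Cons: "term1 (a # w) c = (case a of Letter_x \<Rightarrow> gen_x | Letter_y \<Rightarrow> gen_y) * term1 w c"
  by (rule free_alg_monomial_Cons)

lemma term1_replicate: "term1 (replicate n Letter_x) 1 = gen_x ^ n" "term1 (replicate n Letter_y) 1 = gen_y ^ n"
  by (induction n) (simp_all add: term1_Cons term1_gens)

section \<open>Degree\<close>

definition dg :: "free_alg \<Rightarrow> nat" where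
  "dg p = (LEAST k. p \<in> degree_le k)"

lemma degree_le_mono: "j \<le> k \<Longrightarrow> degree_le j \<subseteq> degree_le k"
  by (force simp: degree_le_def)

lemma ex_degree_le: "\<exists>k. p \<in> degree_le k"
proof -
  have "\<forall>w\<in>words p. length w \<le> Max (length ` words p)" by simp
  then show ?thesis unfolding degree_le_def by blast
qed

lemma degree_le_iff: "p \<in> degree_le k \<longleftrightarrow> dg p \<le> k"
proof
  show "p \<in> degree_le k \<Longrightarrow> dg p \<le> k" unfolding dg_def by (rule Least_le)
  have "p \<in> degree_le (dg p)" unfolding dg_def using ex_degree_le by (rule LeastI_ex)
  then show "dg p \<le> k \<Longrightarrow> p \<in> degree_le k" using degree_le_mono by blast
qed

lemma degree_leI: "(\<And>w. coef p w \<noteq> 0 \<Longrightarrow> length w \<le> k) \<Longrightarrow> dg p \<le> k"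
  unfolding degree_le_iff[symmetric] by (auto simp: degree_le_def in_keys_iff)

lemma coef_eq_0_above_dg: "dg p < length w \<Longrightarrow> coef p w = 0"
  using degree_le_iff[of p "dg p"] by (force simp: degree_le_def in_keys_iff)

lemma ex_word_of_dg: assumes "p \<noteq> 0" shows "\<exists>w\<in>words p. length w = dg p"
proof (cases "dg p")
  case 0
  from assms obtain w where "w \<in> words p" by (metis keys_eq_empty ex_in_conv)
  then show ?thesis using coef_eq_0_above_dg[of p w] 0 by (auto simp: in_keys_iff)
next
  case (Suc k)
  then have "\<not> dg p \<le> k" by simp
  then obtain w where "w \<in> words p" "length w > k"
    unfolding degree_le_iff[symmetric] by (force simp: degree_le_def)
  then show ?thesis using coef_eq_0_above_dg[of p w] Suc by (force simp: in_keys_iff)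
qed

text \<open>In top degree a word splits into its two factors in only one way, so no cancellation can occur; this makes the
  free algebra a domain in which degrees add.\<close>

lemma top_coef_mult:
  assumes "dg p \<le> length u" "dg q \<le> length v"
  shows "coef (p * q) (u @ v) = coef p u * coef q v"
proof -
  have "coef p (take i (u @ v)) * coef q (drop i (u @ v)) = (if i = length u then coef p u * coef q v else 0)"
    if "i \<le> length (u @ v)" for i
  proof -
    consider "i < length u" | "i = length u" | "i > length u" by linarith
    then show ?thesis
    proof cases
      case 1
      then have "coef q (drop i (u @ v)) = 0" using assms by (intro coef_eq_0_above_dg) auto
      then show ?thesis using 1 by simp
    next
      case 3
      then have "coef p (take i (u @ v)) = 0" using assms that by (intro coef_eq_0_above_dg) auto
      then show ?thesis using 3 by simp
    qed auto
  qed
  then show ?thesis by (simp add: coef_mult sum.delta)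
qed

lemma dg_mult_le: "dg (p * q) \<le> dg p + dg q"
proof (rule degree_leI)
  fix w assume "coef (p * q) w \<noteq> 0"
  then obtain i where i: "i \<le> length w" "coef p (take i w) * coef q (drop i w) \<noteq> 0"
    unfolding coef_mult by (metis (no_types, lifting) atMost_iff sum.neutral)
  then have "length (take i w) \<le> dg p" "length (drop i w) \<le> dg q"
    using coef_eq_0_above_dg by (metis mult_zero_left not_le, metis mult_zero_right not_le)
  then show "length w \<le> dg p + dg q" using i by simp
qed

lemma mult_nonzero: assumes "p \<noteq> 0" "q \<noteq> 0" shows "p * q \<noteq> (0::free_alg)"
  and dg_mult: "dg (p * q) = dg p + dg q"
proof -
  obtain u where u: "u \<in> words p" "length u = dg p" using ex_word_of_dg assms by blast
  obtain v where v: "v \<in> words q" "length v = dg q" using ex_word_of_dg assms by blast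
  have ne: "coef (p * q) (u @ v) \<noteq> 0"
    using top_coef_mult[of p u q v] u v by (simp add: in_keys_iff)
  then show "p * q \<noteq> 0" by auto
  have "dg (p * q) \<ge> length (u @ v)"
    using ne coef_eq_0_above_dg by (meson not_le)
  then show "dg (p * q) = dg p + dg q" using dg_mult_le[of p q] u v by simp
qed

lemma dg_0 [simp]: "dg 0 = 0" by (rule le_zero_eq[THEN iffD1], rule degree_leI) simp
lemma dg_scalar [simp]: "dg (scalar c) = 0"
  by (rule le_zero_eq[THEN iffD1], rule degree_leI) (simp add: coef_scalar split: if_splits)
lemma dg_1 [simp]: "dg 1 = 0" using dg_scalar[of 1] by simp
lemma dg_gens [simp]: "dg gen_x = 1" "dg gen_y = 1"
proof -
  have "dg gen_x \<le> 1" "dg gen_y \<le> 1" by (rule degree_leI, simp add: coef_gens split: if_splits)+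
  moreover have "length [Letter_x] \<le> dg gen_x" "length [Letter_y] \<le> dg gen_y"
    using coef_eq_0_above_dg[of gen_x "[Letter_x]"] coef_eq_0_above_dg[of gen_y "[Letter_y]"]
    by (metis coef_gens(1) not_le one_neq_zero, metis coef_gens(2) not_le one_neq_zero)
  ultimately show "dg gen_x = 1" "dg gen_y = 1" by simp_all
qed

lemma power_nonzero: "p \<noteq> 0 \<Longrightarrow> p ^ n \<noteq> (0::free_alg)"
  by (induction n) (simp_all add: mult_nonzero)

lemma dg_power: "dg (p ^ n) = n * dg p"
proof (cases "p = 0")
  case True then show ?thesis by (cases n) simp_all
next
  case False
  then show ?thesis by (induction n) (simp_all add: dg_mult power_nonzero)
qed

lemma dg_add_le: "dg p \<le> k \<Longrightarrow> dg q \<le> k \<Longrightarrow> dg (p + q) \<le> k"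
proof (rule degree_leI, rule ccontr)
  fix w assume le: "dg p \<le> k" "dg q \<le> k" and ne: "coef (p + q) w \<noteq> 0" and "\<not> length w \<le> k"
  then have "coef p w = 0" "coef q w = 0" by (auto intro: coef_eq_0_above_dg)
  with ne show False by (simp add: lookup_add)
qed

lemma dg_sum_le: "(\<And>i. i \<in> I \<Longrightarrow> dg (f i) \<le> k) \<Longrightarrow> dg (sum f I) \<le> k"
  by (induction I rule: infinite_finite_induct) (simp_all add: dg_add_le)

lemma dg_scalar_mult_le: "dg (scalar c * p) \<le> dg p"
  using dg_mult_le[of "scalar c" p] by simp

lemma dg_scalar_mult: "c \<noteq> 0 \<Longrightarrow> dg (scalar c * p) = dg p"
  by (cases "p = 0") (simp_all add: dg_mult)

lemma dg_minus [simp]: "dg (- p) = dg p"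
  using dg_scalar_mult[of "-1" p] by (simp add: scalar_minus)

lemma dg_add_eq: assumes "dg p < dg q" shows "dg (p + q) = dg q" "dg (q + p) = dg q"
proof -
  have "dg q \<le> dg (p + q)"
  proof (rule ccontr)
    assume "\<not> dg q \<le> dg (p + q)"
    then have "dg (p + q + - p) \<le> dg q - 1" using assms by (intro dg_add_le[of "p + q"]) auto
    moreover have "p + q + - p = q" by simp
    ultimately have "dg q \<le> dg q - 1" by metis
    then show False using assms by linarith
  qed
  moreover have "dg (p + q) \<le> dg q" using assms by (intro dg_add_le) auto
  ultimately show "dg (p + q) = dg q" "dg (q + p) = dg q" by (simp_all add: add.commute)
qed

lemma dg_0_iff: "dg p = 0 \<longleftrightarrow> (\<exists>c. p = scalar c)"
proof
  assume "dg p = 0"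
  then have "p = scalar (coef p [])"
    using coef_eq_0_above_dg[of p] by (intro poly_mapping_eqI) (auto simp: coef_scalar)
  then show "\<exists>c. p = scalar c" by blast
qed auto

section \<open>Commuting elements\<close>

definition nx :: "letter list \<Rightarrow> nat" where "nx w = count_list w Letter_x"
definition ny :: "letter list \<Rightarrow> nat" where "ny w = count_list w Letter_y"

lemma nx_simps [simp]: "nx [] = 0" "nx (a # w) = (if a = Letter_x then Suc (nx w) else nx w)"
    "nx (u @ v) = nx u + nx v" "nx (replicate n Letter_x) = n" "nx (replicate n Letter_y) = 0"
  by (induction u; induction n; simp add: nx_def)+

lemma ny_simps [simp]: "ny [] = 0" "ny (a # w) = (if a = Letter_y then Suc (ny w) else ny w)"
    "ny (u @ v) = ny u + ny v" "ny (replicate n Letter_y) = n" "ny (replicate n Letter_x) = 0"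
  by (induction u; induction n; simp add: ny_def)+

lemma length_nx_ny: "length w = nx w + ny w"
proof (induction w)
  case (Cons a w) then show ?case by (cases a) simp_all
qed simp

lemma Cons_neq_replicate [simp]: "Letter_x # w \<noteq> replicate n Letter_y" "Letter_y # w \<noteq> replicate n Letter_x"
  by (cases n; simp)+

lemma ny_0_iff: "ny w = 0 \<longleftrightarrow> w = replicate (nx w) Letter_x"
proof (induction w)
  case (Cons a w) then show ?case by (cases a) auto
qed simp

lemma nx_0_iff: "nx w = 0 \<longleftrightarrow> w = replicate (ny w) Letter_y"
proof (induction w)
  case (Cons a w) then show ?case by (cases a) auto
qed simp

text \<open>Homogeneity in each of the two letters, with bidegree \<open>(a, b)\<close>.\<close>

definition bihom :: "nat \<Rightarrow> nat \<Rightarrow> free_alg \<Rightarrow> bool" where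
  "bihom a b p \<longleftrightarrow> (\<forall>w\<in>words p. nx w = a \<and> ny w = b)"

lemma words_multE:
  assumes "w \<in> words (p * q)" obtains u v where "u \<in> words p" "v \<in> words q" "w = u @ v"
proof -
  have "\<exists>i. i \<le> length w \<and> coef p (take i w) * coef q (drop i w) \<noteq> 0"
    using assms unfolding in_keys_iff coef_mult by (metis (no_types, lifting) atMost_iff sum.neutral)
  then obtain i where "take i w \<in> words p" "drop i w \<in> words q" by (auto simp: in_keys_iff)
  then show ?thesis using that by (metis append_take_drop_id)
qed

lemma bihom_power: "bihom a b p \<Longrightarrow> bihom (n * a) (n * b) (p ^ n)"
proof (induction n)
  case 0 then show ?case by (auto simp: bihom_def zero_list_def)
next
  case (Suc n)
  show ?case unfolding bihom_def power_Suc
  proof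
    fix w assume "w \<in> words (p * p ^ n)"
    then obtain u v where "u \<in> words p" "v \<in> words (p ^ n)" "w = u @ v" by (rule words_multE)
    then show "nx w = Suc n * a \<and> ny w = Suc n * b" using Suc by (simp add: bihom_def)
  qed
qed

lemma ex_word: "p \<noteq> 0 \<Longrightarrow> \<exists>w. w \<in> words p"
  using ex_word_of_dg by blast

text \<open>For words \<open>a\<close>, \<open>b\<close> of length \<open>n\<close> the coefficient of \<open>ab\<close> in \<open>u v = v u\<close> is \<open>u\<^sub>a v\<^sub>b = v\<^sub>a u\<^sub>b\<close>, so \<open>u\<close> and \<open>v\<close>
  are proportional; only the supports matter below.\<close>

lemma commuting_same_words:
  assumes uv: "u * v = v * u" and ne: "u \<noteq> 0" "v \<noteq> 0"
    and len: "\<forall>w\<in>words u. length w = n" "\<forall>w\<in>words v. length w = n"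
  shows "words u \<subseteq> words v"
proof
  fix a assume a: "a \<in> words u"
  obtain b where b: "b \<in> words v" using ne ex_word by blast
  have d: "dg u \<le> n" "dg v \<le> n" using len by (auto intro!: degree_leI simp: in_keys_iff)
  have "coef u a * coef v b = coef v a * coef u b"
    using top_coef_mult[of u a v b] top_coef_mult[of v a u b] uv a b len d by simp
  then show "a \<in> words v" using a b by (auto simp: in_keys_iff)
qed

text \<open>Suitable powers of two commuting elements have the same total degree, so they are proportional and have the
  same bidegree.\<close>

lemma commuting_bihom:
  assumes uv: "u * v = v * u" and ne: "u \<noteq> 0" "v \<noteq> 0" and h: "bihom a b u" "bihom c d v"
  shows "a * d = b * c"
proof -
  define m where "m = a + b" define n where "n = c + d"
  have hu: "bihom (n * a) (n * b) (u ^ n)" and hv: "bihom (m * c) (m * d) (v ^ m)"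
    using h by (simp_all add: bihom_power)
  have "\<forall>w\<in>words (u ^ n). length w = n * m" "\<forall>w\<in>words (v ^ m). length w = n * m"
    using hu hv by (auto simp: bihom_def length_nx_ny m_def n_def algebra_simps)
  moreover have "u ^ n * v ^ m = v ^ m * u ^ n"
    using uv by (metis power_commuting_commutes)
  ultimately have "words (u ^ n) \<subseteq> words (v ^ m)"
    using commuting_same_words ne power_nonzero by metis
  then obtain w where "w \<in> words (u ^ n)" "w \<in> words (v ^ m)" using ex_word power_nonzero ne by blast
  then have "n * a = m * c" using hu hv by (auto simp: bihom_def)
  then show ?thesis by (simp add: m_def n_def algebra_simps)
qed

section \<open>Homomorphisms out of the free algebra\<close>

lemma alg_endo_simps:
  assumes "alg_endo \<sigma>"
  shows "\<sigma> 1 = 1" "\<sigma> (p + q) = \<sigma> p + \<sigma> q" "\<sigma> (p * q) = \<sigma> p * \<sigma> q" "\<sigma> (scalar c) = scalar c"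
    "\<sigma> 0 = 0" "\<sigma> (- p) = - \<sigma> p" "\<sigma> (p - q) = \<sigma> p - \<sigma> q" "\<sigma> (p ^ n) = \<sigma> p ^ n"
    "\<sigma> (sum f I) = (\<Sum>i\<in>I. \<sigma> (f i))"
proof -
  show 1: "\<sigma> 1 = 1" and add: "\<sigma> (p + q) = \<sigma> p + \<sigma> q" and mult: "\<sigma> (p * q) = \<sigma> p * \<sigma> q" for p q
    using assms unfolding alg_endo_def by blast+
  have s: "\<sigma> (scalar c * p) = scalar c * \<sigma> p" for c p using assms unfolding alg_endo_def by blast
  show "\<sigma> (scalar c) = scalar c" using s[of c 1] 1 by simp
  show z: "\<sigma> 0 = 0" using s[of 0 1] by simp
  show m: "\<sigma> (- p) = - \<sigma> p" for p using s[of "-1" p] by (simp add: scalar_minus)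
  show "\<sigma> (p - q) = \<sigma> p - \<sigma> q" using add[of p "-q"] m[of q] by simp
  show "\<sigma> (p ^ n) = \<sigma> p ^ n" by (induction n) (simp_all add: 1 mult)
  show "\<sigma> (sum f I) = (\<Sum>i\<in>I. \<sigma> (f i))"
    by (induction I rule: infinite_finite_induct) (simp_all add: z add)
qed

text \<open>Linear extension of a function on words.\<close>

definition linext :: "(letter list \<Rightarrow> free_alg) \<Rightarrow> free_alg \<Rightarrow> free_alg" where
  "linext \<phi> p = (\<Sum>w\<in>words p. scalar (coef p w) * \<phi> w)"

lemma linext_single: "linext \<phi> (term1 w c) = scalar c * \<phi> w"
  by (cases "c = 0") (simp_all add: linext_def)

lemma linext_add: "linext \<phi> (p + q) = linext \<phi> p + linext \<phi> q"
  unfolding linext_def by (rule setsum_keys_plus_distrib) (simp_all add: scalar_add distrib_right)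

lemma linext_scalar: "linext \<phi> (scalar c * p) = scalar c * linext \<phi> p"
proof (induction p rule: free_alg_induct)
  case (monomial w d)
  have "scalar c * term1 w d = term1 w (c * d)" by (simp add: scalar_def mult_single plus_list_def)
  then show ?case by (simp add: linext_single scalar_mult mult.assoc)
next
  case (add p q) then show ?case by (simp add: linext_add distrib_left)
qed

definition subst :: "free_alg \<Rightarrow> free_alg \<Rightarrow> free_alg \<Rightarrow> free_alg" where
  "subst f g = linext (\<lambda>w. prod_list (map (case_letter f g) w))"

lemma alg_endo_subst: "alg_endo (subst f g)"
proof -
  have "subst f g (p * q) = subst f g p * subst f g q" for p q
  proof (induction p rule: free_alg_induct)
    case (monomial u a)
    show ?case
    proof (induction q rule: free_alg_induct)
      case (monomial v b)
      show ?case by (simp add: subst_def mult_single plus_list_def linext_single scalar_mult mult.assoc)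
          (metis mult.assoc scalar_commute)
    next
      case (add p q) then show ?case by (simp add: subst_def distrib_left linext_add)
    qed
  next
    case (add p q) then show ?case by (simp add: subst_def distrib_right linext_add)
  qed
  moreover have "subst f g 1 = 1"
    using linext_single[of "\<lambda>w. prod_list (map (case_letter f g) w)" "[]" 1] by (simp add: subst_def term1_gens)
  moreover have "subst f g (p + q) = subst f g p + subst f g q" "subst f g (scalar c * p) = scalar c * subst f g p" for c p q
    by (simp_all add: subst_def linext_add linext_scalar)
  ultimately show ?thesis by (simp add: alg_endo_def)
qed

lemmas subst_simps = alg_endo_simps[OF alg_endo_subst]

lemma subst_gens [simp]: "subst f g gen_x = f" "subst f g gen_y = g"
  by (simp_all add: subst_def gen_x_def gen_y_def linext_single)

lemma subst_eqI: "alg_endo \<sigma> \<Longrightarrow> \<sigma> gen_x = f \<Longrightarrow> \<sigma> gen_y = g \<Longrightarrow> \<sigma> = subst f g"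
  by (rule alg_endo_eqI) (simp_all add: alg_endo_subst)

text \<open>The homomorphism to \<open>\<complex>[t]\<close> with \<open>x \<mapsto> F\<close> and \<open>y \<mapsto> G\<close>. It factors through the commutative
  polynomial ring, which is where calculus becomes available.\<close>

definition evp :: "complex poly \<Rightarrow> complex poly \<Rightarrow> free_alg \<Rightarrow> complex poly" where
  "evp F G p = (\<Sum>w\<in>words p. smult (coef p w) (F ^ nx w * G ^ ny w))"

lemma evp_single: "evp F G (term1 w c) = smult c (F ^ nx w * G ^ ny w)"
  by (cases "c = 0") (simp_all add: evp_def)

lemma evp_add: "evp F G (p + q) = evp F G p + evp F G q"
  unfolding evp_def by (rule setsum_keys_plus_distrib) (simp_all add: smult_add_left)

lemma evp_mult: "evp F G (p * q) = evp F G p * evp F G q"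
proof (induction p rule: free_alg_induct)
  case (monomial u a)
  show ?case
  proof (induction q rule: free_alg_induct)
    case (monomial v b)
    show ?case by (simp add: mult_single plus_list_def evp_single power_add mult_ac)
  next
    case (add p q) then show ?case by (simp add: distrib_left evp_add)
  qed
next
  case (add p q) then show ?case by (simp add: distrib_right evp_add)
qed

lemma evp_scalar [simp]: "evp F G (scalar c) = [:c:]"
  by (simp add: scalar_def evp_single)

lemma evp_0 [simp]: "evp F G 0 = 0" by (simp add: evp_def)
lemma evp_1 [simp]: "evp F G 1 = 1" using evp_scalar[of F G 1] by (simp add: one_pCons)
lemma evp_gens [simp]: "evp F G gen_x = F" "evp F G gen_y = G"
  by (simp_all add: gen_x_def gen_y_def evp_single)

lemma evp_minus: "evp F G (- p) = - evp F G p"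
  using evp_add[of F G p "- p"] by (simp add: eq_neg_iff_add_eq_0 add.commute)
lemma evp_diff: "evp F G (p - q) = evp F G p - evp F G q"
  using evp_add[of F G p "- q"] by (simp add: evp_minus)
lemma evp_power: "evp F G (p ^ n) = evp F G p ^ n"
  by (induction n) (simp_all add: evp_mult)
lemma evp_sum: "evp F G (sum f I) = (\<Sum>i\<in>I. evp F G (f i))"
  by (induction I rule: infinite_finite_induct) (simp_all add: evp_add)
lemma evp_scalar_mult: "evp F G (scalar c * p) = smult c (evp F G p)"
  by (simp add: evp_mult)

lemmas evp_simps = evp_add evp_mult evp_minus evp_diff evp_power evp_sum

lemma evp_unique:
  assumes add: "\<And>p q. h (p + q) = h p + h q" and mult: "\<And>p q. h (p * q) = h p * h q"
    and sc: "\<And>c. h (scalar c) = [:c:]"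
  shows "h p = evp (h gen_x) (h gen_y) p"
proof (induction p rule: free_alg_induct)
  case (monomial w c)
  have "h (term1 w 1) = evp (h gen_x) (h gen_y) (term1 w 1)"
  proof (induction w)
    case Nil
    show ?case using sc[of 1] by (simp add: term1_gens one_pCons)
  next
    case (Cons a w)
    then show ?case by (cases a) (simp_all add: term1_Cons mult evp_mult)
  qed
  then show ?case by (simp only: term1_eq[of w c] mult sc evp_mult evp_scalar)
next
  case (add p q) then show ?case by (simp add: assms(1) evp_add)
qed

lemma evp_endo:
  assumes "alg_endo \<sigma>"
  shows "evp F G (\<sigma> p) = evp (evp F G (\<sigma> gen_x)) (evp F G (\<sigma> gen_y)) p"
  by (rule evp_unique) (simp_all add: alg_endo_simps[OF assms] evp_add evp_mult)

text \<open>The value at the point \<open>(a, b)\<close> of the associated commutative polynomial.\<close>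

definition ev :: "complex \<Rightarrow> complex \<Rightarrow> free_alg \<Rightarrow> complex" where
  "ev a b p = (\<Sum>w\<in>words p. coef p w * (a ^ nx w * b ^ ny w))"

lemma poly_evp: "poly (evp F G p) t = ev (poly F t) (poly G t) p"
  by (simp add: evp_def ev_def poly_sum)

abbreviation tvar :: "complex poly" where "tvar \<equiv> [:0, 1:]"

lemma tvar_power: "tvar ^ n = monom 1 n"
  by (simp add: monom_altdef)

text \<open>Setting \<open>y = 0\<close> isolates the words in \<open>x\<close> alone, and no two of these have the same image.\<close>

lemma coeff_evp_pure_x: "coeff (evp tvar 0 p) k = coef p (replicate k Letter_x)"
proof -
  have "coeff (evp tvar 0 p) k = (\<Sum>w\<in>words p. if w = replicate k Letter_x then coef p w else 0)"
    unfolding evp_def coeff_sum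
  proof (rule sum.cong)
    fix w
    show "coeff (smult (coef p w) (tvar ^ nx w * 0 ^ ny w)) k = (if w = replicate k Letter_x then coef p w else 0)"
      using ny_0_iff[of w] by (cases "ny w = 0") (auto simp: tvar_power power_0_left)
  qed simp
  then show ?thesis by (simp add: sum.delta' in_keys_iff)
qed

lemma coeff_evp_pure_y: "coeff (evp 0 tvar p) k = coef p (replicate k Letter_y)"
proof -
  have "coeff (evp 0 tvar p) k = (\<Sum>w\<in>words p. if w = replicate k Letter_y then coef p w else 0)"
    unfolding evp_def coeff_sum
  proof (rule sum.cong)
    fix w
    show "coeff (smult (coef p w) (0 ^ nx w * tvar ^ ny w)) k = (if w = replicate k Letter_y then coef p w else 0)"
      using nx_0_iff[of w] by (cases "nx w = 0") (auto simp: tvar_power power_0_left)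
  qed simp
  then show ?thesis by (simp add: sum.delta' in_keys_iff)
qed

section \<open>Polynomials in one element\<close>

definition pol :: "complex poly \<Rightarrow> free_alg \<Rightarrow> free_alg" where
  "pol q g = (\<Sum>i\<le>degree q. scalar (coeff q i) * g ^ i)"

lemma poly_in_y_eq: "poly_in_y q = pol q gen_y"
  by (simp add: poly_in_y_def pol_def)

lemma pol_le: assumes "degree q \<le> n" shows "pol q g = (\<Sum>i\<le>n. scalar (coeff q i) * g ^ i)"
  unfolding pol_def using assms
  by (intro sum.mono_neutral_left) (auto simp: coeff_eq_0)

lemma pol_add: "pol (p + q) g = pol p g + pol q g"
proof -
  define n where "n = max (degree p) (degree q)"
  have "degree (p + q) \<le> n" "degree p \<le> n" "degree q \<le> n" by (simp_all add: n_def degree_add_le_max)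
  then show ?thesis by (simp add: pol_le[of _ n] sum.distrib scalar_add distrib_right)
qed

lemma pol_smult: "pol (smult c q) g = scalar c * pol q g"
proof -
  have "degree (smult c q) \<le> degree q" by (rule degree_smult_le)
  then show ?thesis by (simp add: pol_le[of _ "degree q"] sum_distrib_left scalar_mult mult.assoc)
qed

lemma pol_pCons: "pol (pCons a q) g = scalar a + pol q g * g"
proof -
  have "pol (pCons a q) g = (\<Sum>i\<le>Suc (degree q). scalar (coeff (pCons a q) i) * g ^ i)"
    by (rule pol_le) (rule degree_pCons_le)
  also have "\<dots> = scalar a + (\<Sum>i\<le>degree q. scalar (coeff q i) * g ^ i) * g"
    by (subst sum.atMost_Suc_shift) (simp add: power_Suc2 sum_distrib_right mult.assoc del: power_Suc)
  finally show ?thesis by (simp add: pol_def)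
qed

lemma pol_0 [simp]: "pol 0 g = 0" by (simp add: pol_def)
lemma pol_const [simp]: "pol [:c:] g = scalar c" by (simp add: pol_def)
lemma pol_monom: "pol (monom c n) g = scalar c * g ^ n"
proof -
  have "pol (monom c n) g = (\<Sum>i\<le>n. if i = n then scalar c * g ^ n else 0)"
    unfolding pol_le[OF degree_monom_le] by (intro sum.cong) auto
  then show ?thesis by simp
qed

lemma pol_minus: "pol (- q) g = - pol q g"
  using pol_smult[of "-1" q g] by (simp add: scalar_minus)

lemma pol_endo: "alg_endo \<sigma> \<Longrightarrow> \<sigma> (pol q g) = pol q (\<sigma> g)"
  by (simp add: pol_def alg_endo_simps)

lemma pol_commute: "g * p = p * g \<Longrightarrow> pol q g * p = p * pol q g"
proof (induction q rule: pCons_induct)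
  case (pCons a q)
  have "pol q g * g * p = p * (pol q g * g)" using pCons by (metis mult.assoc)
  then show ?case by (simp add: pol_pCons distrib_left distrib_right scalar_commute[of p])
qed simp

lemma evp_pol: "evp F G (pol q g) = pcompose q (evp F G g)"
proof (induction q rule: pCons_induct)
  case (pCons a q)
  have "evp F G (pol q g * g) = evp F G g * pcompose q (evp F G g)"
    by (simp only: evp_mult pCons.IH mult.commute)
  then show ?case by (simp add: pol_pCons evp_add pcompose_pCons)
qed simp

lemma pol_pcompose: "pol q (pol r g) = pol (pcompose q r) g"
proof (induction q rule: pCons_induct)
  case (pCons a q)
  have mult: "pol (u * v) g = pol u g * pol v g" for u v
  proof (induction u rule: pCons_induct)
    case (pCons a u)
    have "pol u g * g * pol v g = pol u g * pol v g * g"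
      using pol_commute[of g g v] by (simp add: mult.assoc)
    then show ?case using pCons by (simp add: pol_pCons pol_add pol_smult distrib_right)
  qed simp
  have "pol (r * pcompose q r) g = pol (pcompose q r) g * pol r g" by (subst mult.commute) (rule mult)
  then show ?case using pCons by (simp add: pol_pCons pcompose_pCons pol_add)
qed simp

lemma dg_pol_le: "dg (pol q g) \<le> degree q * dg g"
  unfolding pol_def
proof (rule dg_sum_le)
  fix i assume "i \<in> {..degree q}"
  then have "dg (g ^ i) \<le> degree q * dg g" by (simp add: dg_power)
  then show "dg (scalar (coeff q i) * g ^ i) \<le> degree q * dg g"
    using dg_scalar_mult_le order_trans by blast
qed

lemma dg_pol: assumes "dg g \<ge> 1" shows "dg (pol q g) = degree q * dg g"
proof (induction q rule: pCons_induct)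
  case (pCons a q)
  show ?case
  proof (cases "q = 0")
    case False
    have g0: "g \<noteq> 0" using assms by auto
    have p0: "pol q g \<noteq> 0"
    proof
      assume *: "pol q g = 0"
      then have "degree q = 0" using pCons assms by simp
      then obtain c where "q = [:c:]" by (metis degree_eq_zeroE)
      then show False using * False by simp
    qed
    have "dg (pol q g * g) = Suc (degree q) * dg g" using pCons by (simp add: dg_mult p0 g0)
    moreover have "dg (scalar a + pol q g * g) = dg (pol q g * g)"
      using assms calculation by (intro dg_add_eq) simp
    ultimately show ?thesis using False by (simp add: pol_pCons)
  qed simp
qed simp

lemma pol_eq_0_iff: assumes "dg g \<ge> 1" shows "pol q g = 0 \<longleftrightarrow> q = 0"
proof
  assume *: "pol q g = 0"
  then have "degree q * dg g = 0" using dg_pol[OF assms, of q] by simp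
  then obtain c where "q = [:c:]" using assms by (auto elim: degree_eq_zeroE)
  then show "q = 0" using * by simp
qed simp

lemma pol_of_pure_y:
  assumes "\<And>w. coef p w \<noteq> 0 \<Longrightarrow> nx w = 0"
  shows "p = pol (evp 0 tvar p) gen_y"
proof (rule poly_mapping_eqI)
  fix w
  define q where "q = evp 0 tvar p"
  have "coef (pol q gen_y) w = (\<Sum>i\<le>degree q. if w = replicate i Letter_y then coeff q i else 0)"
    unfolding pol_def lookup_sum
    by (intro sum.cong) (auto simp: term1_replicate(2)[symmetric] lookup_single when_def)
  also have "\<dots> = coef p w"
  proof (cases "nx w = 0")
    case True
    then have w: "w = replicate (ny w) Letter_y" by (simp add: nx_0_iff)
    have "(w = replicate i Letter_y) \<longleftrightarrow> i = ny w" for i using w by (metis length_replicate)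
    then have "(\<Sum>i\<le>degree q. if w = replicate i Letter_y then coeff q i else 0) = coeff q (ny w)"
      by (auto simp: sum.delta coeff_eq_0)
    then show ?thesis using w unfolding q_def coeff_evp_pure_y by metis
  next
    case False
    then have "w \<noteq> replicate i Letter_y" for i by auto
    moreover have "coef p w = 0" using assms[of w] False by auto
    ultimately show ?thesis by simp
  qed
  finally show "coef p w = coef (pol (evp 0 tvar p) gen_y) w" by (simp add: q_def)
qed

text \<open>Comparing \<open>p y\<close> with \<open>y p\<close> rotates a leading letter \<open>y\<close> to the end of a word. A word that contains \<open>x\<close> is rotated
  in this way to one that begins with \<open>x\<close>, and such words do not occur in \<open>y p\<close>.\<close>

lemma centralizer_gen_y:
  assumes "p * gen_y = gen_y * p" shows "\<exists>q. p = pol q gen_y"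
proof -
  have last: "coef (p * gen_y) (w @ [Letter_y]) = coef p w" for w
  proof -
    have "coef (p * gen_y) (w @ [Letter_y])
        = (\<Sum>i\<le>Suc (length w). if i = length w then coef p w else 0)"
      unfolding coef_mult
    proof (intro sum.cong)
      fix i assume "i \<in> {..Suc (length w)}"
      then consider "i < length w" | "i = length w" | "i = Suc (length w)" by fastforce
      then show "coef p (take i (w @ [Letter_y])) * coef gen_y (drop i (w @ [Letter_y]))
          = (if i = length w then coef p w else 0)"
        by cases (auto simp: coef_gens)
    qed simp
    then show ?thesis by (simp add: sum.delta)
  qed
  have first: "coef (gen_y * p) (a # w) = (if a = Letter_y then coef p w else 0)" for a w
  proof -
    have "coef (gen_y * p) (a # w)
        = (\<Sum>i\<le>Suc (length w). if i = 1 then (if a = Letter_y then coef p w else 0) else 0)"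
      unfolding coef_mult
    proof (intro sum.cong)
      fix i assume i: "i \<in> {..Suc (length w)}"
      consider "i = 0" | "i = 1" | j where "i = Suc (Suc j)" by (metis One_nat_def not0_implies_Suc)
      then show "coef gen_y (take i (a # w)) * coef p (drop i (a # w))
          = (if i = 1 then (if a = Letter_y then coef p w else 0) else 0)"
        using i by cases (auto simp: coef_gens take_Suc)
    qed simp
    then show ?thesis by (simp add: sum.delta del: sum.atMost_Suc)
  qed
  have x0: "coef p (Letter_x # w) = 0" for w
    using first[of Letter_x "w @ [Letter_y]"] last[of "Letter_x # w"] assms by simp
  have rot: "coef p (Letter_y # w) = coef p (w @ [Letter_y])" for w
    using first[of Letter_y "w @ [Letter_y]"] last[of "Letter_y # w"] assms by simp
  have "coef p (replicate n Letter_y @ Letter_x # w) = 0" for n w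
  proof (induction n arbitrary: w)
    case (Suc n)
    then show ?case using rot[of "replicate n Letter_y @ Letter_x # w"] Suc[of "w @ [Letter_y]"] by simp
  qed (simp add: x0)
  moreover have "\<exists>n v. w = replicate n Letter_y @ Letter_x # v" if "nx w \<noteq> 0" for w
    using that
  proof (induction w)
    case (Cons a w)
    show ?case
    proof (cases a)
      case Letter_x
      then have "a # w = replicate 0 Letter_y @ Letter_x # w" by simp
      then show ?thesis by blast
    next
      case Letter_y
      then obtain n v where "w = replicate n Letter_y @ Letter_x # v" using Cons by auto
      then have "a # w = replicate (Suc n) Letter_y @ Letter_x # v" using Letter_y by simp
      then show ?thesis by blast
    qed
  qed simp
  ultimately have "coef p w \<noteq> 0 \<Longrightarrow> nx w = 0" for w by force
  then show ?thesis using pol_of_pure_y by blast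
qed

section \<open>Elements of the group\<close>

text \<open>This keeps the numeral one, which otherwise becomes a successor in exponents and word lengths.\<close>

declare One_nat_def [simp del]

abbreviation autG :: "(free_alg \<Rightarrow> free_alg) set" where "autG \<equiv> carrier sympl_aut"

abbreviation finv :: "('a \<Rightarrow> 'a) \<Rightarrow> 'a \<Rightarrow> 'a" where "finv \<sigma> \<equiv> inv_into UNIV \<sigma>"

interpretation G: group sympl_aut by (rule group_sympl_aut)

lemma mult_sympl_aut [simp]: "\<sigma> \<otimes>\<^bsub>sympl_aut\<^esub> \<tau> = \<sigma> \<circ> \<tau>"
  and one_sympl_aut [simp]: "\<one>\<^bsub>sympl_aut\<^esub> = id"
  by (simp_all add: sympl_aut_def)

lemma autG_alg_endo: "\<sigma> \<in> autG \<Longrightarrow> alg_endo \<sigma>"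
  and autG_bij: "\<sigma> \<in> autG \<Longrightarrow> bij \<sigma>"
  and autG_commutator: "\<sigma> \<in> autG \<Longrightarrow> \<sigma> (commutator gen_x gen_y) = commutator gen_x gen_y"
  by (simp_all add: sympl_aut_def)

lemma autG_comp: "\<sigma> \<in> autG \<Longrightarrow> \<tau> \<in> autG \<Longrightarrow> \<sigma> \<circ> \<tau> \<in> autG"
  using G.m_closed by simp

lemma autG_id: "id \<in> autG"
  using G.one_closed by simp

lemma inv_sympl_aut: assumes "\<sigma> \<in> autG" shows "inv\<^bsub>sympl_aut\<^esub> \<sigma> = finv \<sigma>"
proof -
  have "\<sigma> \<circ> inv\<^bsub>sympl_aut\<^esub> \<sigma> = id" "inv\<^bsub>sympl_aut\<^esub> \<sigma> \<circ> \<sigma> = id"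
    using assms G.r_inv G.l_inv by simp_all
  then show ?thesis by (metis inv_unique_comp)
qed

lemma autG_inv: "\<sigma> \<in> autG \<Longrightarrow> finv \<sigma> \<in> autG"
  using G.inv_closed inv_sympl_aut by metis

lemma autG_inv_simps [simp]:
  assumes "\<sigma> \<in> autG" shows "\<sigma> (finv \<sigma> p) = p" "finv \<sigma> (\<sigma> p) = p"
  using autG_bij[OF assms] by (simp_all add: bij_is_surj surj_f_inv_f bij_is_inj)

lemma autG_inv_comp:
  assumes "\<sigma> \<in> autG" shows "\<sigma> \<circ> finv \<sigma> = id" "finv \<sigma> \<circ> \<sigma> = id" "finv (finv \<sigma>) = \<sigma>"
  using assms autG_bij[OF assms] by (auto simp: inv_inv_eq)

lemma inv_comp: "\<sigma> \<in> autG \<Longrightarrow> \<tau> \<in> autG \<Longrightarrow> finv (\<sigma> \<circ> \<tau>) = finv \<tau> \<circ> finv \<sigma>"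
  by (simp add: o_inv_distrib autG_bij)

lemmas autG_simps = alg_endo_simps[OF autG_alg_endo]

lemma autG_pol: "\<sigma> \<in> autG \<Longrightarrow> \<sigma> (pol q g) = pol q (\<sigma> g)"
  using pol_endo autG_alg_endo by blast

lemma autG_eqI: "\<sigma> \<in> autG \<Longrightarrow> \<tau> \<in> autG \<Longrightarrow> \<sigma> gen_x = \<tau> gen_x \<Longrightarrow> \<sigma> gen_y = \<tau> gen_y \<Longrightarrow> \<sigma> = \<tau>"
  using alg_endo_eqI autG_alg_endo by blast

text \<open>Membership and the inverse in one step, for automorphisms given together with their inverses on generators.\<close>

lemma autG_I:
  assumes "alg_endo \<sigma>" "alg_endo \<tau>"
    and "\<sigma> (\<tau> gen_x) = gen_x" "\<sigma> (\<tau> gen_y) = gen_y" "\<tau> (\<sigma> gen_x) = gen_x" "\<tau> (\<sigma> gen_y) = gen_y"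
    and "commutator (\<sigma> gen_x) (\<sigma> gen_y) = commutator gen_x gen_y"
  shows "\<sigma> \<in> autG" "finv \<sigma> = \<tau>"
proof -
  have 1: "\<sigma> \<circ> \<tau> = id" using assms by (intro alg_endo_eqI alg_endo_comp alg_endo_id) simp_all
  have 2: "\<tau> \<circ> \<sigma> = id" using assms by (intro alg_endo_eqI alg_endo_comp alg_endo_id) simp_all
  show "finv \<sigma> = \<tau>" using 1 2 by (metis inv_unique_comp)
  have "bij \<sigma>" using 1 2 o_bij by blast
  moreover have "\<sigma> (commutator gen_x gen_y) = commutator (\<sigma> gen_x) (\<sigma> gen_y)"
    by (simp add: commutator_def alg_endo_simps[OF assms(1)])
  ultimately show "\<sigma> \<in> autG" using assms by (simp add: sympl_aut_def)
qed

lemma autG_commutator': "\<sigma> \<in> autG \<Longrightarrow> commutator (\<sigma> gen_x) (\<sigma> gen_y) = commutator gen_x gen_y"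
  using autG_commutator[of \<sigma>] by (simp add: commutator_def autG_simps)

lemma commutator_simps:
  "commutator (p + q) r = commutator p r + commutator q r"
  "commutator r (p + q) = commutator r p + commutator r q"
  "commutator (scalar c * p) r = scalar c * commutator p r"
  "commutator r (scalar c * p) = scalar c * commutator r p"
  "commutator (scalar c) r = 0" "commutator r (scalar c) = 0" "commutator r r = 0"
  "commutator (p - q) r = commutator p r - commutator q r"
  by (simp_all add: commutator_def distrib_left distrib_right right_diff_distrib left_diff_distrib
      mult.assoc scalar_left_commute scalar_commute[of r])

lemma commutator_flip: "commutator q p = - commutator p q"
  by (simp add: commutator_def)

lemma commutator_gens_neq_0: "commutator gen_x gen_y \<noteq> 0"
proof
  assume "commutator gen_x gen_y = 0"
  then have "coef (gen_x * gen_y) [Letter_x, Letter_y] = coef (gen_y * gen_x) [Letter_x, Letter_y]"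
    by (simp add: commutator_def)
  then show False by (simp add: coef_mult coef_gens)
qed

definition affine :: "complex \<Rightarrow> complex \<Rightarrow> complex \<Rightarrow> free_alg" where
  "affine a b e = scalar a * gen_x + scalar b * gen_y + scalar e"

lemma coef_affine: "coef (affine a b e) w =
    (if w = [Letter_x] then a else if w = [Letter_y] then b else if w = [] then e else 0)"
  by (simp add: affine_def lookup_add coef_gens coef_scalar)

lemma affine_eq_iff: "affine a b e = affine a' b' e' \<longleftrightarrow> a = a' \<and> b = b' \<and> e = e'"
proof
  assume *: "affine a b e = affine a' b' e'"
  have "coef (affine a b e) w = coef (affine a' b' e') w" for w using * by simp
  from this[of "[Letter_x]"] this[of "[Letter_y]"] this[of "[]"]
  show "a = a' \<and> b = b' \<and> e = e'" by (simp add: coef_affine)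
qed simp

lemma affine_gens: "gen_x = affine 1 0 0" "gen_y = affine 0 1 0" "scalar c = affine 0 0 c"
  by (simp_all add: affine_def)

lemma affine_add: "affine a b e + affine a' b' e' = affine (a + a') (b + b') (e + e')"
  and affine_scalar: "scalar c * affine a b e = affine (c * a) (c * b) (c * e)"
  by (rule poly_mapping_eqI; simp add: coef_affine lookup_add)+

lemma dg_affine_le: "dg (affine a b e) \<le> 1"
  by (rule degree_leI) (auto simp: coef_affine split: if_splits)

lemma dg_le_1D: assumes "dg p \<le> 1" shows "\<exists>a b e. p = affine a b e"
proof -
  have "p = affine (coef p [Letter_x]) (coef p [Letter_y]) (coef p [])"
  proof (rule poly_mapping_eqI)
    fix w :: "letter list"
    consider "w = []" | "w = [Letter_x]" | "w = [Letter_y]" | "length w > 1"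
    proof (cases w)
      case (Cons a v)
      then show ?thesis using that by (cases v; cases a) auto
    qed (use that in auto)
    then show "coef p w = coef (affine (coef p [Letter_x]) (coef p [Letter_y]) (coef p [])) w"
    proof cases
      case 4
      then have "coef p w = 0" using assms by (intro coef_eq_0_above_dg) simp
      moreover have "w \<noteq> []" "w \<noteq> [Letter_x]" "w \<noteq> [Letter_y]" using 4 by auto
      ultimately show ?thesis by (simp add: coef_affine)
    qed (simp_all add: coef_affine)
  qed
  then show ?thesis by blast
qed

lemma commutator_affine:
  "commutator (affine a b e) (affine c d h) = scalar (a * d - b * c) * commutator gen_x gen_y"
proof -
  have "commutator (affine a b e) (affine c d h)
      = scalar (d * a) * commutator gen_x gen_y + scalar (c * b) * commutator gen_y gen_x"
    by (simp add: affine_def commutator_simps distrib_left scalar_mult mult.assoc)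
  then show ?thesis
    by (simp add: commutator_flip[of gen_y gen_x] scalar_diff left_diff_distrib mult.commute)
qed

text \<open>The affine map \<open>x \<mapsto> a x + b y + e\<close>, \<open>y \<mapsto> c x + d y + h\<close>.\<close>

definition aff :: "complex \<Rightarrow> complex \<Rightarrow> complex \<Rightarrow> complex \<Rightarrow> complex \<Rightarrow> complex \<Rightarrow> free_alg \<Rightarrow> free_alg" where
  "aff a b e c d h = subst (affine a b e) (affine c d h)"

lemma aff_affine: "aff a b e c d h (affine u v w) = affine (u * a + v * c) (u * b + v * d) (u * e + v * h + w)"
proof -
  have "aff a b e c d h (affine u v w)
      = scalar u * affine a b e + scalar v * affine c d h + affine 0 0 w"
    unfolding affine_def[of u v w] affine_gens(3)[symmetric] by (simp add: aff_def subst_simps)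
  then show ?thesis by (simp add: affine_scalar affine_add)
qed

lemma alg_endo_aff: "alg_endo (aff a b e c d h)"
  by (simp add: aff_def alg_endo_subst)

lemma aff_gens: "aff a b e c d h gen_x = affine a b e" "aff a b e c d h gen_y = affine c d h"
  by (simp_all add: aff_def)

lemma aff_in_autG:
  assumes "a * d - b * c = 1"
  shows "aff a b e c d h \<in> autG"
    and "finv (aff a b e c d h) = aff d (- b) (b * h - d * e) (- c) a (c * e - a * h)"
proof -
  have t: "a * (b * h - d * e) + b * (c * e - a * h) + e = 0" "c * (b * h - d * e) + d * (c * e - a * h) + h = 0"
  proof -
    have "a * (b * h - d * e) + b * (c * e - a * h) + e = (1 - (a * d - b * c)) * e"
      "c * (b * h - d * e) + d * (c * e - a * h) + h = (1 - (a * d - b * c)) * h" by algebra+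
    then show "a * (b * h - d * e) + b * (c * e - a * h) + e = 0" "c * (b * h - d * e) + d * (c * e - a * h) + h = 0"
      using assms by simp_all
  qed
  have *: "aff a b e c d h (affine d (- b) (b * h - d * e)) = affine 1 0 0"
       "aff a b e c d h (affine (- c) a (c * e - a * h)) = affine 0 1 0"
       "aff d (- b) (b * h - d * e) (- c) a (c * e - a * h) (affine a b e) = affine 1 0 0"
       "aff d (- b) (b * h - d * e) (- c) a (c * e - a * h) (affine c d h) = affine 0 1 0"
    unfolding aff_affine affine_eq_iff using assms t by (simp_all add: algebra_simps)
  show "aff a b e c d h \<in> autG"
    by (rule autG_I(1)[OF alg_endo_aff alg_endo_aff, of _ _ _ _ _ _ d "- b" "b * h - d * e" "- c" a "c * e - a * h"])
      (simp_all add: aff_gens * commutator_affine assms affine_gens(1,2)[symmetric])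
  show "finv (aff a b e c d h) = aff d (- b) (b * h - d * e) (- c) a (c * e - a * h)"
    by (rule autG_I(2)[OF alg_endo_aff alg_endo_aff])
      (simp_all add: aff_gens * commutator_affine assms affine_gens(1,2)[symmetric])
qed

text \<open>The elementary automorphism \<open>x \<mapsto> x + q(y)\<close>, \<open>y \<mapsto> y\<close>.\<close>

definition el :: "complex poly \<Rightarrow> free_alg \<Rightarrow> free_alg" where
  "el q = subst (gen_x + pol q gen_y) gen_y"

lemma alg_endo_el: "alg_endo (el q)"
  by (simp add: el_def alg_endo_subst)

lemma el_gens [simp]: "el q gen_x = gen_x + pol q gen_y" "el q gen_y = gen_y"
  by (simp_all add: el_def)

lemma el_in_autG: "el q \<in> autG" and inv_el: "finv (el q) = el (- q)"
proof -
  have c: "commutator (pol q gen_y) gen_y = 0"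
    using pol_commute[of gen_y gen_y q] by (simp add: commutator_def)
  note I = autG_I[OF alg_endo_el alg_endo_el, of q "- q"]
  show "el q \<in> autG" "finv (el q) = el (- q)"
    by (rule I; simp add: alg_endo_simps[OF alg_endo_el] pol_endo[OF alg_endo_el] pol_minus commutator_simps c)+
qed

lemma el_comp: "el q \<circ> el r = el (q + r)"
  by (rule autG_eqI) (simp_all add: el_in_autG autG_comp autG_simps autG_pol pol_add add.assoc)

lemma el_0: "el 0 = id"
  by (rule autG_eqI) (simp_all add: el_in_autG autG_id)

text \<open>The sign keeps \<open>[x, y]\<close> fixed.\<close>

definition swap :: "free_alg \<Rightarrow> free_alg" where "swap = aff 0 1 0 (- 1) 0 0"

lemma swap_in_autG: "swap \<in> autG" and inv_swap: "finv swap = aff 0 (- 1) 0 1 0 0"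
  using aff_in_autG[of 0 0 1 "- 1" 0 0] by (simp_all add: swap_def)

lemma swap_gens [simp]: "swap gen_x = gen_y" "swap gen_y = - gen_x" "finv swap gen_x = - gen_y" "finv swap gen_y = gen_x"
  unfolding inv_swap by (simp_all add: swap_def aff_gens affine_def scalar_minus)

definition Aff :: "(free_alg \<Rightarrow> free_alg) set" where
  "Aff = {\<sigma> \<in> autG. dg (\<sigma> gen_x) \<le> 1 \<and> dg (\<sigma> gen_y) \<le> 1}"

lemma Aff_D: assumes "\<sigma> \<in> Aff"
  shows "\<exists>a b e c d h. a * d - b * c = 1 \<and> \<sigma> = aff a b e c d h"
proof -
  obtain a b e where x: "\<sigma> gen_x = affine a b e" using assms dg_le_1D by (fastforce simp: Aff_def)
  obtain c d h where y: "\<sigma> gen_y = affine c d h" using assms dg_le_1D by (fastforce simp: Aff_def)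
  have s: "\<sigma> \<in> autG" using assms by (simp add: Aff_def)
  have "scalar (a * d - b * c - 1) * commutator gen_x gen_y = 0"
    using autG_commutator'[OF s] unfolding x y commutator_affine by (simp add: scalar_diff left_diff_distrib)
  then have "a * d - b * c - 1 = 0" using mult_nonzero commutator_gens_neq_0 scalar_eq_0_iff by blast
  moreover have "\<sigma> = aff a b e c d h"
    using x y autG_alg_endo[OF s] by (intro alg_endo_eqI) (simp_all add: alg_endo_aff aff_gens)
  ultimately show ?thesis by (metis eq_iff_diff_eq_0)
qed

lemma Aff_I: "a * d - b * c = 1 \<Longrightarrow> aff a b e c d h \<in> Aff"
  by (simp add: Aff_def aff_in_autG aff_gens dg_affine_le)

lemma Aff_subset: "\<sigma> \<in> Aff \<Longrightarrow> \<sigma> \<in> autG" by (simp add: Aff_def)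

lemma Aff_affine: "\<sigma> \<in> Aff \<Longrightarrow> dg p \<le> 1 \<Longrightarrow> dg (\<sigma> p) \<le> 1"
  using Aff_D dg_le_1D by (metis aff_affine dg_affine_le)

lemma Aff_comp: "\<sigma> \<in> Aff \<Longrightarrow> \<tau> \<in> Aff \<Longrightarrow> \<sigma> \<circ> \<tau> \<in> Aff"
  by (simp add: Aff_def autG_comp) (metis (no_types, lifting) Aff_affine Aff_def mem_Collect_eq)

lemma Aff_inv: assumes "\<sigma> \<in> Aff" shows "finv \<sigma> \<in> Aff"
proof -
  obtain a b e c d h where s: "a * d - b * c = 1" "\<sigma> = aff a b e c d h" using Aff_D[OF assms] by blast
  then have "d * a - (- b) * (- c) = 1" by (simp add: mult.commute)
  then show ?thesis unfolding s(2) aff_in_autG(2)[OF s(1)] by (rule Aff_I)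
qed

lemma Aff_id: "id \<in> Aff" by (simp add: Aff_def autG_id)

lemma swap_in_Aff: "swap \<in> Aff" unfolding swap_def by (rule Aff_I) simp

lemma triangular_el: "el q \<in> triangular"
  unfolding triangular_def
  by (intro CollectI conjI exI[of _ 1] exI[of _ 0] exI[of _ q]) (simp_all add: el_in_autG poly_in_y_eq)

lemma triangular_subset: "\<sigma> \<in> triangular \<Longrightarrow> \<sigma> \<in> autG" by (simp add: triangular_def)

text \<open>Since \<open>[x, y]\<close> is fixed, \<open>c \<sigma>(x) - x\<close> commutes with \<open>y\<close> and so is a polynomial in \<open>y\<close>. The shape of the image of
  \<open>y\<close> alone therefore decides whether an automorphism is triangular.\<close>

lemma triangularI:
  assumes s: "\<sigma> \<in> autG" and y: "\<sigma> gen_y = scalar c * gen_y + scalar h"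
  shows "\<sigma> \<in> triangular" and "c \<noteq> 0"
proof -
  have *: "scalar c * commutator (\<sigma> gen_x) gen_y = commutator gen_x gen_y"
    using autG_commutator'[OF s] unfolding y by (simp add: commutator_simps)
  then show c: "c \<noteq> 0" using commutator_gens_neq_0 by auto
  have "commutator (\<sigma> gen_x) gen_y = scalar (inverse c) * (scalar c * commutator (\<sigma> gen_x) gen_y)"
    using c by (simp add: mult.assoc[symmetric] scalar_mult[symmetric])
  then have "commutator (\<sigma> gen_x - scalar (inverse c) * gen_x) gen_y = 0"
    using * by (simp add: commutator_simps)
  then obtain q where "\<sigma> gen_x - scalar (inverse c) * gen_x = pol q gen_y"
    using centralizer_gen_y by (auto simp: commutator_def)
  then have "\<sigma> gen_x = scalar (inverse c) * gen_x + poly_in_y q" by (simp add: poly_in_y_eq algebra_simps)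
  then show "\<sigma> \<in> triangular" unfolding triangular_def
    using c s y by (intro CollectI conjI exI[of _ "inverse c"] exI[of _ h] exI[of _ q]) simp_all
qed

lemma triangular_iff:
  "\<sigma> \<in> triangular \<longleftrightarrow> \<sigma> \<in> autG \<and> (\<exists>c h. \<sigma> gen_y = scalar c * gen_y + scalar h)"
  using triangularI by (auto simp: triangular_def)

lemma triangular_comp: "\<sigma> \<in> triangular \<Longrightarrow> \<tau> \<in> triangular \<Longrightarrow> \<sigma> \<circ> \<tau> \<in> triangular"
proof -
  assume "\<sigma> \<in> triangular" "\<tau> \<in> triangular"
  then obtain c h d k where s: "\<sigma> \<in> autG" "\<tau> \<in> autG" "\<sigma> gen_y = scalar c * gen_y + scalar h"
    "\<tau> gen_y = scalar d * gen_y + scalar k" unfolding triangular_iff by blast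
  then have "(\<sigma> \<circ> \<tau>) gen_y = scalar (d * c) * gen_y + scalar (d * h + k)"
    by (simp add: autG_simps distrib_left scalar_mult scalar_add mult.assoc add.assoc)
  then show ?thesis unfolding triangular_iff using s autG_comp by blast
qed

lemma triangular_inv: assumes "\<sigma> \<in> triangular" shows "finv \<sigma> \<in> triangular"
proof -
  obtain c h where s: "\<sigma> \<in> autG" "\<sigma> gen_y = scalar c * gen_y + scalar h"
    using assms unfolding triangular_iff by blast
  have c: "c \<noteq> 0" using triangularI s by blast
  have "gen_y = scalar c * finv \<sigma> gen_y + scalar h"
    using arg_cong[OF s(2), of "finv \<sigma>"] s(1) autG_inv[OF s(1)] by (simp add: autG_simps)
  then have "scalar (inverse c) * gen_y = scalar (inverse c) * (scalar c * finv \<sigma> gen_y + scalar h)" by metis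
  also have "\<dots> = finv \<sigma> gen_y + scalar (inverse c * h)"
    using c by (simp add: distrib_left mult.assoc[symmetric] scalar_mult[symmetric])
  finally have "finv \<sigma> gen_y = scalar (inverse c) * gen_y + scalar (- (inverse c * h))"
    by (simp add: scalar_minus)
  then show ?thesis unfolding triangular_iff using s autG_inv by blast
qed

lemma triangular_decomp:
  assumes "\<sigma> \<in> triangular" shows "\<exists>a h q. a \<noteq> 0 \<and> \<sigma> gen_x = scalar a * gen_x + pol q gen_y \<and>
     \<sigma> gen_y = scalar (inverse a) * gen_y + scalar h"
  using assms by (auto simp: triangular_def poly_in_y_eq)

section \<open>Locally nilpotent derivations\<close>

definition derivation :: "(free_alg \<Rightarrow> free_alg) \<Rightarrow> bool" where
  "derivation D \<longleftrightarrow> (\<forall>p q. D (p + q) = D p + D q) \<and> (\<forall>p q. D (p * q) = D p * q + p * D q) \<and>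
     (\<forall>c. D (scalar c) = 0)"

text \<open>Symplectic locally nilpotent derivations: the infinitesimal counterparts of unipotent one-parameter subgroups of the group.\<close>

definition symp_lnd :: "(free_alg \<Rightarrow> free_alg) \<Rightarrow> bool" where
  "symp_lnd D \<longleftrightarrow> derivation D \<and> (\<forall>p. \<exists>n. (D ^^ n) p = 0) \<and> D (commutator gen_x gen_y) = 0"

lemma derivation_simps:
  assumes "derivation D"
  shows "D (p + q) = D p + D q" "D (p * q) = D p * q + p * D q" "D (scalar c) = 0"
    "D (scalar c * p) = scalar c * D p" "D 0 = 0" "D (- p) = - D p" "D (p - q) = D p - D q"
    "D (sum f I) = (\<Sum>i\<in>I. D (f i))"
proof -
  show add: "D (p + q) = D p + D q" and mult: "D (p * q) = D p * q + p * D q" and sc: "D (scalar c) = 0"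
    for p q c using assms by (auto simp: derivation_def)
  show s: "D (scalar c * p) = scalar c * D p" for c p by (simp add: mult sc)
  show z: "D 0 = 0" using sc[of 0] by simp
  show m: "D (- p) = - D p" for p using s[of "-1" p] by (simp add: scalar_minus)
  show "D (p - q) = D p - D q" using add[of p "-q"] m[of q] by simp
  show "D (sum f I) = (\<Sum>i\<in>I. D (f i))"
    by (induction I rule: infinite_finite_induct) (simp_all add: z add)
qed

lemma derivation_power_simps:
  assumes "derivation D"
  shows "(D ^^ n) (p + q) = (D ^^ n) p + (D ^^ n) q" "(D ^^ n) (scalar c * p) = scalar c * (D ^^ n) p"
    "(D ^^ n) 0 = 0"
  by (induction n) (simp_all add: derivation_simps[OF assms])

lemma derivation_power_0_mono:
  assumes "derivation D" "(D ^^ n) p = 0" "n \<le> k" shows "(D ^^ k) p = 0"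
proof -
  have "(D ^^ k) p = (D ^^ (k - n)) ((D ^^ n) p)"
    using assms(3) by (simp add: funpow_add[symmetric, THEN fun_cong, simplified])
  then show ?thesis using assms by (simp add: derivation_power_simps)
qed

lemma symp_lnd_D: "symp_lnd D \<Longrightarrow> derivation D" "symp_lnd D \<Longrightarrow> \<exists>n. (D ^^ n) p = 0"
  "symp_lnd D \<Longrightarrow> D (commutator gen_x gen_y) = 0"
  by (simp_all add: symp_lnd_def)

lemma derivation_const: "derivation D \<Longrightarrow> D 1 = 0"
  using derivation_simps(3)[of D 1] by simp

lemma derivation_eqI:
  assumes "derivation D" "derivation E" "D gen_x = E gen_x" "D gen_y = E gen_y" shows "D = E"
proof
  fix p
  show "D p = E p"
  proof (induction p rule: free_alg_induct)
    case (monomial w c)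
    have "D (term1 w 1) = E (term1 w 1)"
    proof (induction w)
      case Nil
      then show ?case by (simp add: term1_gens derivation_const assms)
    next
      case (Cons a w)
      then show ?case
        by (cases a) (simp_all add: term1_Cons derivation_simps[OF assms(1)] derivation_simps[OF assms(2)] assms)
    qed
    then show ?case
      by (simp add: term1_eq[of w c] derivation_simps(4)[OF assms(1)] derivation_simps(4)[OF assms(2)])
  next
    case (add p q)
    then show ?case by (simp add: derivation_simps(1)[OF assms(1)] derivation_simps(1)[OF assms(2)])
  qed
qed

fun der_word :: "free_alg \<Rightarrow> free_alg \<Rightarrow> letter list \<Rightarrow> free_alg" where
  "der_word u v [] = 0"
| "der_word u v (a # w) = (case a of Letter_x \<Rightarrow> u | Letter_y \<Rightarrow> v) * term1 w 1 + term1 [a] 1 * der_word u v w"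

lemma der_word_append: "der_word u v (s @ t) = der_word u v s * term1 t 1 + term1 s 1 * der_word u v t"
proof (induction s)
  case Nil
  then show ?case by (simp add: term1_gens)
next
  case (Cons a s)
  have "term1 (a # s) 1 = term1 [a] 1 * term1 s 1" using term1_append[of "[a]" s] by simp
  then show ?case using Cons by (simp add: term1_append distrib_left distrib_right mult.assoc add.assoc)
qed

text \<open>The derivation with \<open>x \<mapsto> u\<close> and \<open>y \<mapsto> v\<close>.\<close>

definition der :: "free_alg \<Rightarrow> free_alg \<Rightarrow> free_alg \<Rightarrow> free_alg" where
  "der u v = linext (der_word u v)"

lemma der_gens [simp]: "der u v gen_x = u" "der u v gen_y = v"
  by (simp_all add: der_def gen_x_def gen_y_def linext_single term1_gens(3))

lemma derivation_der: "derivation (der u v)"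
proof -
  have "der u v (p * q) = der u v p * q + p * der u v q" for p q
  proof (induction p rule: free_alg_induct)
    case (monomial s a)
    show ?case
    proof (induction q rule: free_alg_induct)
      case (monomial t b)
      have "der u v (term1 s a * term1 t b) = scalar (a * b) * der_word u v (s @ t)"
        by (simp add: mult_single plus_list_def der_def linext_single)
      also have "\<dots> = scalar (a * b) * (der_word u v s * term1 t 1) + scalar (a * b) * (term1 s 1 * der_word u v t)"
        by (simp add: der_word_append distrib_left)
      also have "scalar (a * b) * (der_word u v s * term1 t 1) = (scalar a * der_word u v s) * (scalar b * term1 t 1)"
        by (simp add: scalar_mult mult.assoc scalar_left_commute[of "der_word u v s"])
      also have "scalar (a * b) * (term1 s 1 * der_word u v t) = (scalar a * term1 s 1) * (scalar b * der_word u v t)"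
        by (simp add: scalar_mult mult.assoc scalar_left_commute[of "term1 s 1"])
      finally show ?case by (simp add: der_def linext_single term1_eq[symmetric])
    next
      case (add p q) then show ?case by (simp add: der_def distrib_left linext_add)
    qed
  next
    case (add p q) then show ?case by (simp add: der_def distrib_right linext_add)
  qed
  moreover have "der u v (scalar c) = 0" for c by (simp add: der_def scalar_def linext_single)
  ultimately show ?thesis by (simp add: derivation_def) (simp add: der_def linext_add)
qed

abbreviation "dx \<equiv> der 1 0"
abbreviation "dy \<equiv> der 0 1"

text \<open>Over a commutative target a derivation along \<open>evp F G\<close> obeys the chain rule with the formal partial derivatives
  \<open>dx\<close> and \<open>dy\<close>.\<close>

lemma evp_chain:
  assumes add: "\<And>p q. h (p + q) = h p + h q" and sc: "\<And>c. h (scalar c) = 0"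
    and mult: "\<And>p q. h (p * q) = h p * evp F G q + evp F G p * h q"
  shows "h p = h gen_x * evp F G (dx p) + h gen_y * evp F G (dy p)"
proof (induction p rule: free_alg_induct)
  case (monomial w c)
  have "h (term1 w 1) = h gen_x * evp F G (dx (term1 w 1)) + h gen_y * evp F G (dy (term1 w 1))"
  proof (induction w)
    case Nil
    show ?case using sc[of 1] by (simp add: term1_gens derivation_const derivation_der)
  next
    case (Cons a w)
    then show ?case by (cases a)
        (simp_all add: term1_Cons mult evp_add evp_mult derivation_simps[OF derivation_der] algebra_simps)
  qed
  then show ?case
    by (simp only: term1_eq[of w c] mult sc derivation_simps(4)[OF derivation_der] evp_mult evp_scalar)
       (simp add: algebra_simps smult_add_right)
next
  case (add p q) then show ?case by (simp add: assms(1) derivation_simps[OF derivation_der] evp_add algebra_simps)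
qed

lemma evp_derivation:
  assumes "derivation D"
  shows "evp F G (D p) = evp F G (D gen_x) * evp F G (dx p) + evp F G (D gen_y) * evp F G (dy p)"
  by (rule evp_chain) (simp_all add: derivation_simps[OF assms] evp_add evp_mult)

lemma pderiv_evp: "pderiv (evp F G p) = pderiv F * evp F G (dx p) + pderiv G * evp F G (dy p)"
proof -
  have "pderiv (evp F G p) = pderiv (evp F G gen_x) * evp F G (dx p) + pderiv (evp F G gen_y) * evp F G (dy p)"
    by (rule evp_chain[where h = "\<lambda>p. pderiv (evp F G p)"])
      (simp_all add: evp_add evp_mult pderiv_add pderiv_mult pderiv_pCons algebra_simps)
  then show ?thesis by simp
qed

lemma evp_derivation_power:
  assumes "derivation D"
  shows "evp F G (D (r ^ k)) = of_nat k * evp F G r ^ (k - 1) * evp F G (D r)"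
proof (induction k)
  case 0
  then show ?case by (simp add: derivation_const assms)
next
  case (Suc k)
  then show ?case by (cases k) (simp_all add: derivation_simps[OF assms] evp_add evp_mult evp_power algebra_simps derivation_const assms)
qed

subsection \<open>Divided powers\<close>

text \<open>Dividing by factorials removes the binomial coefficients from the Leibniz rule; these are the coefficients of
  the one-parameter group \<open>exp (t D)\<close>.\<close>

definition dpow :: "(free_alg \<Rightarrow> free_alg) \<Rightarrow> nat \<Rightarrow> free_alg \<Rightarrow> free_alg" where
  "dpow D k p = scalar (1 / fact k) * (D ^^ k) p"

lemma dpow_0 [simp]: "dpow D 0 p = p" by (simp add: dpow_def)

lemma dpow_Suc: assumes "derivation D" shows "scalar (of_nat (Suc k)) * dpow D (Suc k) p = D (dpow D k p)"
proof -
  have "of_nat (Suc k) * (1 / fact (Suc k)) = (1 / fact k :: complex)"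
    by (simp add: fact_Suc of_nat_neq_0 del: of_nat_Suc)
  then show ?thesis
    by (simp add: dpow_def derivation_simps(4)[OF assms] mult.assoc[symmetric] scalar_mult[symmetric] del: of_nat_Suc)
qed

lemma dpow_Suc': assumes "derivation D" shows "scalar (of_nat (Suc k)) * dpow D (Suc k) p = dpow D k (D p)"
proof -
  have "of_nat (Suc k) * (1 / fact (Suc k)) = (1 / fact k :: complex)"
    by (simp add: fact_Suc of_nat_neq_0 del: of_nat_Suc)
  then show ?thesis
    by (simp add: dpow_def funpow_swap1 mult.assoc[symmetric] scalar_mult[symmetric] del: of_nat_Suc)
qed

lemma scalar_cancel: "c \<noteq> 0 \<Longrightarrow> scalar c * p = scalar c * q \<Longrightarrow> p = q"
proof -
  assume c: "c \<noteq> 0" and e: "scalar c * p = scalar c * q"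
  have "r = scalar (inverse c) * (scalar c * r)" for r
    using c by (simp add: mult.assoc[symmetric] scalar_mult[symmetric])
  then show "p = q" using e by metis
qed

lemma dpow_mult:
  assumes D: "derivation D" shows "dpow D n (p * q) = (\<Sum>k\<le>n. dpow D k p * dpow D (n - k) q)"
proof (induction n)
  case 0 then show ?case by simp
next
  case (Suc n)
  let ?t = "\<lambda>k. dpow D k p * dpow D (Suc n - k) q"
  have "scalar (of_nat (Suc n)) * dpow D (Suc n) (p * q)
     = (\<Sum>k\<le>n. D (dpow D k p) * dpow D (n - k) q + dpow D k p * D (dpow D (n - k) q))"
    using Suc by (simp add: dpow_Suc[OF D] derivation_simps[OF D] sum.distrib del: of_nat_Suc)
  also have "\<dots> = (\<Sum>k\<le>n. scalar (of_nat (Suc k)) * ?t (Suc k)) + (\<Sum>k\<le>n. scalar (of_nat (Suc n - k)) * ?t k)"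
    unfolding sum.distrib[symmetric]
  proof (rule sum.cong)
    fix k assume "k \<in> {..n}"
    then have "Suc n - k = Suc (n - k)" by auto
    then show "D (dpow D k p) * dpow D (n - k) q + dpow D k p * D (dpow D (n - k) q)
       = scalar (of_nat (Suc k)) * ?t (Suc k) + scalar (of_nat (Suc n - k)) * ?t k"
      by (simp add: dpow_Suc[OF D, symmetric] mult.assoc scalar_left_commute[of "dpow D k p"] del: of_nat_Suc)
  qed simp
  also have "(\<Sum>k\<le>n. scalar (of_nat (Suc k)) * ?t (Suc k)) = (\<Sum>k\<le>Suc n. scalar (of_nat k) * ?t k)"
    by (subst sum.atMost_Suc_shift) simp
  also have "(\<Sum>k\<le>n. scalar (of_nat (Suc n - k)) * ?t k) = (\<Sum>k\<le>Suc n. scalar (of_nat (Suc n - k)) * ?t k)"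
    by simp
  also have "(\<Sum>k\<le>Suc n. scalar (of_nat k) * ?t k) + (\<Sum>k\<le>Suc n. scalar (of_nat (Suc n - k)) * ?t k)
      = (\<Sum>k\<le>Suc n. scalar (of_nat (Suc n)) * ?t k)"
    unfolding sum.distrib[symmetric]
  proof (rule sum.cong)
    fix k assume "k \<in> {..Suc n}"
    then have "of_nat (Suc n) = (of_nat k + of_nat (Suc n - k) :: complex)" by (simp add: of_nat_diff)
    then show "scalar (of_nat k) * ?t k + scalar (of_nat (Suc n - k)) * ?t k = scalar (of_nat (Suc n)) * ?t k"
      by (simp add: scalar_add distrib_right del: of_nat_Suc)
  qed simp
  finally have "scalar (of_nat (Suc n)) * dpow D (Suc n) (p * q) = scalar (of_nat (Suc n)) * (\<Sum>k\<le>Suc n. ?t k)"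
    by (simp only: sum_distrib_left)
  then show ?case using scalar_cancel[of "of_nat (Suc n)"] by (simp del: of_nat_Suc add: of_nat_neq_0)
qed

lemma dpow_eq_0_iff: "dpow D k p = 0 \<longleftrightarrow> (D ^^ k) p = 0"
proof
  show "dpow D k p = 0 \<Longrightarrow> (D ^^ k) p = 0"
    using scalar_cancel[of "1 / fact k" "(D ^^ k) p" 0] by (simp add: dpow_def)
qed (simp add: dpow_def)

lemma ex_nilpotency_degree:
  assumes D: "symp_lnd D" and "p \<noteq> 0"
  shows "\<exists>a. dpow D a p \<noteq> 0 \<and> (\<forall>k>a. dpow D k p = 0)"
proof -
  define n where "n = (LEAST n. (D ^^ n) p = 0)"
  have n: "(D ^^ n) p = 0" unfolding n_def using symp_lnd_D(2)[OF D] by (rule LeastI_ex)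
  then obtain a where a: "n = Suc a" using assms(2) by (cases n) auto
  have "(D ^^ a) p \<noteq> 0" using not_less_Least[of a "\<lambda>n. (D ^^ n) p = 0"] a by (simp add: n_def[symmetric])
  moreover have "(D ^^ k) p = 0" if "k > a" for k
    using derivation_power_0_mono[OF symp_lnd_D(1)[OF D] n] a that by simp
  ultimately show ?thesis unfolding dpow_eq_0_iff by blast
qed

lemma dpow_mult_top:
  assumes D: "derivation D" and "\<forall>k>a. dpow D k p = 0" "\<forall>k>b. dpow D k q = 0"
  shows "dpow D (a + b) (p * q) = dpow D a p * dpow D b q"
proof -
  have "dpow D k p * dpow D (a + b - k) q = (if k = a then dpow D a p * dpow D b q else 0)" if "k \<le> a + b" for k
    using that assms(2,3) by (cases "k < a"; cases "k > a") auto
  then show ?thesis by (simp add: dpow_mult[OF D] sum.delta)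
qed

text \<open>Of the Leibniz expansion of \<open>D\<^sup>a\<^sup>+\<^sup>b [x, y] = 0\<close> only the product of the last nonzero iterates survives.\<close>

lemma top_terms_commute:
  assumes D: "symp_lnd D" and x: "\<forall>k>a. dpow D k gen_x = 0" and y: "\<forall>k>b. dpow D k gen_y = 0" and ab: "a + b \<ge> 1"
  shows "dpow D a gen_x * dpow D b gen_y = dpow D b gen_y * dpow D a gen_x"
proof -
  note d = symp_lnd_D(1)[OF D]
  have "(D ^^ 1) (commutator gen_x gen_y) = 0" using symp_lnd_D(3)[OF D] by (simp add: One_nat_def)
  then have "dpow D (a + b) (commutator gen_x gen_y) = 0"
    unfolding dpow_eq_0_iff using derivation_power_0_mono[OF d _ ab] by blast
  moreover have "dpow D n (p - q) = dpow D n p - dpow D n q" for n p q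
  proof -
    have "(D ^^ n) (p - q) = (D ^^ n) p - (D ^^ n) q" by (induction n) (simp_all add: derivation_simps[OF d])
    then show ?thesis by (simp add: dpow_def right_diff_distrib)
  qed
  ultimately have "dpow D (a + b) (gen_x * gen_y) = dpow D (b + a) (gen_y * gen_x)"
    by (simp add: commutator_def add.commute)
  then show ?thesis using dpow_mult_top[OF d x y] dpow_mult_top[OF d y x] by simp
qed

subsection \<open>Weights\<close>

definition wt :: "int \<Rightarrow> int \<Rightarrow> letter list \<Rightarrow> int" where
  "wt A B w = A * int (nx w) + B * int (ny w)"

lemma wt_simps [simp]: "wt A B [] = 0" "wt A B (u @ v) = wt A B u + wt A B v"
  "wt A B [Letter_x] = A" "wt A B [Letter_y] = B"
  by (simp_all add: wt_def algebra_simps)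

definition wle :: "int \<Rightarrow> int \<Rightarrow> int \<Rightarrow> free_alg \<Rightarrow> bool" where
  "wle A B c p \<longleftrightarrow> (\<forall>w\<in>words p. wt A B w \<le> c)"

lemma wle_0 [simp]: "wle A B c 0" by (simp add: wle_def)

lemma wle_add: "wle A B c p \<Longrightarrow> wle A B c q \<Longrightarrow> wle A B c (p + q)"
  using Poly_Mapping.keys_add[of p q] by (fastforce simp: wle_def)

lemma wle_mult: "wle A B c p \<Longrightarrow> wle A B d q \<Longrightarrow> wle A B (c + d) (p * q)"
  unfolding wle_def by (fastforce elim!: words_multE intro: add_mono)

lemma wle_scalar_mult: "wle A B c p \<Longrightarrow> wle A B c (scalar a * p)"
  by (simp add: wle_def in_keys_iff)

lemma wle_sum: "(\<And>i. i \<in> I \<Longrightarrow> wle A B c (f i)) \<Longrightarrow> wle A B c (sum f I)"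
  by (induction I rule: infinite_finite_induct) (simp_all add: wle_add)

lemma wle_term1: "wt A B w \<le> c \<Longrightarrow> wle A B c (term1 w a)"
  by (simp add: wle_def in_keys_iff lookup_single when_def)

lemma wle_gens: "wle A B A gen_x" "wle A B B gen_y"
  by (simp_all add: gen_x_def gen_y_def wle_term1)

lemma free_alg_as_sum: "p = (\<Sum>w\<in>words p. scalar (coef p w) * term1 w 1)"
proof (rule poly_mapping_eqI)
  fix v
  have "coef (\<Sum>w\<in>words p. scalar (coef p w) * term1 w 1) v = (\<Sum>w\<in>words p. if w = v then coef p v else 0)"
    unfolding lookup_sum by (intro sum.cong) (auto simp: lookup_single)
  then show "coef p v = coef (\<Sum>w\<in>words p. scalar (coef p w) * term1 w 1) v"
    by (simp add: in_keys_iff)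
qed

text \<open>A derivation that raises the weights of \<open>x\<close> and \<open>y\<close> by at most \<open>d\<close> does so for every word.\<close>

lemma derivation_term_wle:
  assumes D: "derivation D" and "wle A B (A + d) (D gen_x)" "wle A B (B + d) (D gen_y)"
  shows "wle A B (wt A B w + d) (D (term1 w 1))"
proof (induction w)
  case Nil
  then show ?case by (simp add: term1_gens derivation_const D)
next
  case (Cons a w)
  have w: "wle A B (wt A B w) (term1 w 1)" by (rule wle_term1) simp
  show ?case
  proof (cases a)
    case Letter_x
    have "wle A B ((A + d) + wt A B w) (D gen_x * term1 w 1)" "wle A B (A + (wt A B w + d)) (gen_x * D (term1 w 1))"
      using assms w Cons wle_gens by (auto intro!: wle_mult)
    then show ?thesis using Letter_x wt_simps(2)[of A B "[Letter_x]" w]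
      by (simp add: term1_Cons derivation_simps[OF D] wle_add algebra_simps)
  next
    case Letter_y
    have "wle A B ((B + d) + wt A B w) (D gen_y * term1 w 1)" "wle A B (B + (wt A B w + d)) (gen_y * D (term1 w 1))"
      using assms w Cons wle_gens by (auto intro!: wle_mult)
    then show ?thesis using Letter_y wt_simps(2)[of A B "[Letter_y]" w]
      by (simp add: term1_Cons derivation_simps[OF D] wle_add algebra_simps)
  qed
qed

lemma wle_mono: "wle A B c p \<Longrightarrow> c \<le> d \<Longrightarrow> wle A B d p"
  by (fastforce simp: wle_def)

lemma derivation_wle:
  assumes D: "derivation D" "wle A B (A + d) (D gen_x)" "wle A B (B + d) (D gen_y)" and p: "wle A B c p"
  shows "wle A B (c + d) (D p)"
proof -
  have "wle A B (c + d) (\<Sum>w\<in>words p. scalar (coef p w) * D (term1 w 1))"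
  proof (intro wle_sum wle_scalar_mult)
    fix w assume "w \<in> words p"
    then show "wle A B (c + d) (D (term1 w 1))"
      using p by (intro wle_mono[OF derivation_term_wle[OF D, of w]]) (simp add: wle_def)
  qed
  then show ?thesis
    by (subst free_alg_as_sum[of p]) (simp add: derivation_simps[OF D(1)])
qed

lemma derivation_power_wle:
  assumes D: "derivation D" "wle A B (A + d) (D gen_x)" "wle A B (B + d) (D gen_y)" and p: "wle A B c p"
  shows "wle A B (c + int n * d) ((D ^^ n) p)"
proof (induction n)
  case (Suc n)
  then show ?case using derivation_wle[OF D Suc] by (simp add: algebra_simps)
qed (simp add: p)

text \<open>The part of weight \<open>c\<close>, where \<open>x\<close> has weight \<open>A\<close> and \<open>y\<close> has weight \<open>B\<close>.\<close>

definition comp :: "int \<Rightarrow> int \<Rightarrow> int \<Rightarrow> free_alg \<Rightarrow> free_alg" where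
  "comp A B c = linext (\<lambda>w. if wt A B w = c then term1 w 1 else 0)"

lemma coef_comp: "coef (comp A B c p) w = (if wt A B w = c then coef p w else 0)"
proof (induction p rule: free_alg_induct)
  case (monomial v a)
  then show ?case by (auto simp: comp_def linext_single lookup_single when_def)
next
  case (add p q) then show ?case by (simp add: comp_def linext_add lookup_add)
qed

lemma comp_add: "comp A B c (p + q) = comp A B c p + comp A B c q"
  by (simp add: comp_def linext_add)

lemma comp_scalar: "comp A B c (scalar a * p) = scalar a * comp A B c p"
  by (simp add: comp_def linext_scalar)

lemma comp_0 [simp]: "comp A B c 0 = 0" by (rule poly_mapping_eqI) (simp add: coef_comp)

lemma comp_sum: "comp A B c (sum f I) = (\<Sum>i\<in>I. comp A B c (f i))"
  by (induction I rule: infinite_finite_induct) (simp_all add: comp_add)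

lemma comp_mult:
  assumes "wle A B c p" "wle A B d q"
  shows "comp A B (c + d) (p * q) = comp A B c p * comp A B d q"
proof (rule poly_mapping_eqI)
  fix w
  have "(if wt A B w = c + d then coef p (take i w) * coef q (drop i w) else 0)
      = coef (comp A B c p) (take i w) * coef (comp A B d q) (drop i w)" for i
  proof (cases "coef p (take i w) = 0 \<or> coef q (drop i w) = 0")
    case False
    then have le: "wt A B (take i w) \<le> c" "wt A B (drop i w) \<le> d"
      using assms by (auto simp: wle_def in_keys_iff)
    have "wt A B w = wt A B (take i w) + wt A B (drop i w)" using wt_simps(2)[of A B "take i w" "drop i w"] by simp
    then show ?thesis using le by (auto simp: coef_comp)
  qed (auto simp: coef_comp)
  then show "coef (comp A B (c + d) (p * q)) w = coef (comp A B c p * comp A B d q) w"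
    unfolding coef_comp[of _ _ _ "p * q"] coef_mult by (simp add: if_distrib[symmetric] cong: if_cong)
      (metis (no_types, lifting) sum.cong sum.neutral)
qed

lemma comp_term1: "comp A B c (term1 w a) = (if wt A B w = c then term1 w a else 0)"
  by (simp add: comp_def linext_single term1_eq[symmetric])

text \<open>The part of a derivation that raises weights by exactly \<open>d\<close>, for a derivation raising them by at most \<open>d\<close>.\<close>

definition top_der :: "int \<Rightarrow> int \<Rightarrow> int \<Rightarrow> (free_alg \<Rightarrow> free_alg) \<Rightarrow> free_alg \<Rightarrow> free_alg" where
  "top_der A B d D = der (comp A B (A + d) (D gen_x)) (comp A B (B + d) (D gen_y))"

lemma comp_wle_less: "wle A B c p \<Longrightarrow> c < d \<Longrightarrow> comp A B d p = 0"
  by (rule poly_mapping_eqI) (force simp: coef_comp wle_def in_keys_iff)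

lemma top_der_term1:
  assumes D: "derivation D" "wle A B (A + d) (D gen_x)" "wle A B (B + d) (D gen_y)"
  shows "top_der A B d D (term1 w 1) = comp A B (wt A B w + d) (D (term1 w 1))"
proof (induction w)
  case Nil
  then show ?case by (simp add: term1_gens derivation_const D top_der_def derivation_der)
next
  case (Cons a w)
  have w: "wle A B (wt A B w) (term1 w 1)" by (rule wle_term1) simp
  note Dw = derivation_term_wle[OF D, of w]
  have E: "derivation (top_der A B d D)" by (simp add: top_der_def derivation_der)
  have main: "top_der A B d D (g * term1 w 1) = comp A B (c + wt A B w + d) (D (g * term1 w 1))"
    if g: "wle A B c g" "comp A B c g = g" and Dg: "wle A B (c + d) (D g)" "top_der A B d D g = comp A B (c + d) (D g)" for g c
  proof -
    have "comp A B ((c + d) + wt A B w) (D g * term1 w 1) = comp A B (c + d) (D g) * term1 w 1"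
      by (subst comp_mult[OF Dg(1) w]) (simp add: comp_term1)
    moreover have "comp A B (c + (wt A B w + d)) (g * D (term1 w 1)) = g * comp A B (wt A B w + d) (D (term1 w 1))"
      by (subst comp_mult[OF g(1) Dw]) (simp add: g(2))
    ultimately show ?thesis
      by (simp add: derivation_simps[OF E] derivation_simps[OF D(1)] Cons comp_add Dg(2) algebra_simps)
  qed
  show ?case
  proof (cases a)
    case Letter_x
    have "comp A B A gen_x = gen_x" by (simp add: gen_x_def comp_term1)
    then show ?thesis using main[of A gen_x] D(2) wle_gens Letter_x wt_simps(2)[of A B "[Letter_x]" w]
      by (simp add: term1_Cons top_der_def)
  next
    case Letter_y
    have "comp A B B gen_y = gen_y" by (simp add: gen_y_def comp_term1)
    then show ?thesis using main[of B gen_y] D(3) wle_gens Letter_y wt_simps(2)[of A B "[Letter_y]" w]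
      by (simp add: term1_Cons top_der_def)
  qed
qed

lemma top_der_comp:
  assumes D: "derivation D" "wle A B (A + d) (D gen_x)" "wle A B (B + d) (D gen_y)" and p: "wle A B c p"
  shows "top_der A B d D (comp A B c p) = comp A B (c + d) (D p)"
proof -
  have E: "derivation (top_der A B d D)" by (simp add: top_der_def derivation_der)
  have *: "top_der A B d D (comp A B c (term1 w 1)) = comp A B (c + d) (D (term1 w 1))" if "w \<in> words p" for w
  proof (cases "wt A B w = c")
    case True
    then show ?thesis using top_der_term1[OF D, of w] by (simp add: comp_term1)
  next
    case False
    then have "wt A B w + d < c + d" using p that by (force simp: wle_def)
    then show ?thesis using comp_wle_less[OF derivation_term_wle[OF D]] False
      by (simp add: comp_term1 derivation_simps(5)[OF E])
  qed
  have "top_der A B d D (comp A B c p) = (\<Sum>w\<in>words p. scalar (coef p w) * top_der A B d D (comp A B c (term1 w 1)))"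
    by (subst free_alg_as_sum[of p]) (simp add: comp_sum comp_scalar derivation_simps[OF E])
  also have "\<dots> = (\<Sum>w\<in>words p. scalar (coef p w) * comp A B (c + d) (D (term1 w 1)))"
    using * by simp
  also have "\<dots> = comp A B (c + d) (D p)"
    by (subst (3) free_alg_as_sum[of p]) (simp add: comp_sum comp_scalar derivation_simps[OF D(1)])
  finally show ?thesis .
qed

text \<open>Passing to highest weights commutes with iteration and \<open>[x, y]\<close> is homogeneous, so both nilpotency and the
  vanishing on \<open>[x, y]\<close> are inherited.\<close>

lemma symp_lnd_top_der:
  assumes D: "symp_lnd D" and le: "wle A B (A + d) (D gen_x)" "wle A B (B + d) (D gen_y)"
  shows "symp_lnd (top_der A B d D)"
  unfolding symp_lnd_def
proof (intro conjI allI)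
  let ?E = "top_der A B d D"
  note d = symp_lnd_D(1)[OF D]
  show E: "derivation ?E" by (simp add: top_der_def derivation_der)
  have c: "comp A B (A + B) (commutator gen_x gen_y) = commutator gen_x gen_y"
  proof (rule poly_mapping_eqI)
    fix w
    have "commutator gen_x gen_y = term1 [Letter_x, Letter_y] 1 - term1 [Letter_y, Letter_x] 1"
      by (simp add: commutator_def gen_x_def gen_y_def mult_single plus_list_def)
    then show "coef (comp A B (A + B) (commutator gen_x gen_y)) w = coef (commutator gen_x gen_y) w"
      by (auto simp: coef_comp lookup_minus lookup_single when_def wt_def)
  qed
  have wc: "wle A B (A + B) (commutator gen_x gen_y)"
    unfolding wle_def
  proof
    fix w
    have "coef (commutator gen_x gen_y) w = (if wt A B w = A + B then coef (commutator gen_x gen_y) w else 0)"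
      using coef_comp[of A B "A + B" "commutator gen_x gen_y" w] unfolding c .
    moreover assume "w \<in> words (commutator gen_x gen_y)"
    ultimately show "wt A B w \<le> A + B" by (auto simp: in_keys_iff split: if_splits)
  qed
  show "?E (commutator gen_x gen_y) = 0"
    using top_der_comp[OF d le wc] symp_lnd_D(3)[OF D] by (simp add: c)
  fix p
  show "\<exists>n. (?E ^^ n) p = 0"
  proof (induction p rule: free_alg_induct)
    case (monomial w a)
    obtain n where n: "(D ^^ n) (term1 w a) = 0" using symp_lnd_D(2)[OF D] by blast
    have w: "wle A B (wt A B w) (term1 w a)" by (rule wle_term1) simp
    have "(?E ^^ k) (term1 w a) = comp A B (wt A B w + int k * d) ((D ^^ k) (term1 w a))" for k
    proof (induction k)
      case 0 then show ?case by (simp add: comp_term1)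
    next
      case (Suc k)
      then show ?case using top_der_comp[OF d le derivation_power_wle[OF d le w, of k]] by (simp add: algebra_simps)
    qed
    then show ?case using n by (metis comp_0)
  next
    case (add p q)
    then obtain m n where "(?E ^^ m) p = 0" "(?E ^^ n) q = 0" by blast
    then have "(?E ^^ max m n) (p + q) = 0"
      using derivation_power_0_mono[OF E, of m p "max m n"] derivation_power_0_mono[OF E, of n q "max m n"]
      by (simp add: derivation_power_simps[OF E])
    then show ?case by blast
  qed
qed

section \<open>The support of a locally nilpotent derivation\<close>

text \<open>The shifts of bidegree caused by the terms of a derivation: a term \<open>x\<^sup>m y\<^sup>n\<close> of \<open>D x\<close> replaces a letter \<open>x\<close> and
  so causes the shift \<open>(m - 1, n)\<close>, and similarly for \<open>D y\<close>.\<close>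

definition supp :: "(free_alg \<Rightarrow> free_alg) \<Rightarrow> (int \<times> int) set" where
  "supp D = (\<lambda>w. (int (nx w) - 1, int (ny w))) ` words (D gen_x)
          \<union> (\<lambda>w. (int (nx w), int (ny w) - 1)) ` words (D gen_y)"

lemma finite_supp: "finite (supp D)" by (simp add: supp_def)

lemma supp_x: "w \<in> words (D gen_x) \<Longrightarrow> (int (nx w) - 1, int (ny w)) \<in> supp D"
  and supp_y: "w \<in> words (D gen_y) \<Longrightarrow> (int (nx w), int (ny w) - 1) \<in> supp D"
  by (auto simp: supp_def)

lemma supp_wle:
  assumes "\<And>i j. (i, j) \<in> supp D \<Longrightarrow> A * i + B * j \<le> d"
  shows "wle A B (A + d) (D gen_x)" "wle A B (B + d) (D gen_y)"
  unfolding wle_def wt_def using assms[OF supp_x] assms[OF supp_y]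
  by (fastforce simp: algebra_simps)+

text \<open>The iterates \<open>D\<^sup>a x\<close> and \<open>D\<^sup>b y\<close> have the bidegrees \<open>(1 + a i, a j)\<close> and \<open>(b i, 1 + b j)\<close>. The last nonzero ones commute,
  so these are proportional, which says \<open>1 + a i + b j = 0\<close>; this is impossible for \<open>i, j \<ge> 0\<close>.\<close>

lemma single_shift_on_axis:
  assumes D: "symp_lnd D" and ne: "D gen_x \<noteq> 0 \<or> D gen_y \<noteq> 0" and S: "supp D \<subseteq> {(i, j)}"
  shows "i = - 1 \<or> j = - 1"
proof (rule ccontr)
  assume n: "\<not> (i = - 1 \<or> j = - 1)"
  note d = symp_lnd_D(1)[OF D]
  have x: "int (nx w) = i + 1 \<and> int (ny w) = j" if "w \<in> words (D gen_x)" for w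
    using supp_x[of w D, OF that] S by auto
  have y: "int (nx w) = i \<and> int (ny w) = j + 1" if "w \<in> words (D gen_y)" for w
    using supp_y[of w D, OF that] S by auto
  have ij: "i \<ge> 0" "j \<ge> 0"
  proof -
    consider w where "w \<in> words (D gen_x)" | w where "w \<in> words (D gen_y)" using ne ex_word by blast
    then have "i \<ge> 0 \<and> j \<ge> 0"
    proof cases
      case 1 then show ?thesis using x[OF 1] n by linarith
    next
      case 2 then show ?thesis using y[OF 2] n by linarith
    qed
    then show "i \<ge> 0" "j \<ge> 0" by auto
  qed
  have le: "wle A B (A + (A * i + B * j)) (D gen_x)" "wle A B (B + (A * i + B * j)) (D gen_y)" for A B
    using S by (intro supp_wle; force)+
  have bih: "bihom (1 + a * nat i) (a * nat j) (dpow D a gen_x)" "bihom (a * nat i) (1 + a * nat j) (dpow D a gen_y)" for a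
  proof -
    have W: "wt A B w \<le> wt A B [l] + int a * (A * i + B * j)"
      if "w \<in> words (dpow D a (term1 [l] 1))" for A B w l
    proof -
      have "wle A B (wt A B [l] + int a * (A * i + B * j)) (dpow D a (term1 [l] 1))"
        unfolding dpow_def by (intro wle_scalar_mult derivation_power_wle[OF d le] wle_term1) simp
      then show ?thesis using that by (simp add: wle_def)
    qed
    have N: "int (a * nat i) = int a * i" "int (a * nat j) = int a * j" using ij by simp_all
    have "int (nx w) = int (1 + a * nat i) \<and> int (ny w) = int (a * nat j)" if "w \<in> words (dpow D a gen_x)" for w
      using W[of w Letter_x 1 0] W[of w Letter_x "-1" 0] W[of w Letter_x 0 1] W[of w Letter_x 0 "-1"] that N ij
      by (simp add: wt_def term1_gens)
    moreover have "int (nx w) = int (a * nat i) \<and> int (ny w) = int (1 + a * nat j)" if "w \<in> words (dpow D a gen_y)" for w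
      using W[of w Letter_y 1 0] W[of w Letter_y "-1" 0] W[of w Letter_y 0 1] W[of w Letter_y 0 "-1"] that N ij
      by (simp add: wt_def term1_gens)
    ultimately show "bihom (1 + a * nat i) (a * nat j) (dpow D a gen_x)" "bihom (a * nat i) (1 + a * nat j) (dpow D a gen_y)"
      unfolding bihom_def of_nat_eq_iff by blast+
  qed
  have "gen_x \<noteq> 0" "gen_y \<noteq> 0" using dg_gens dg_0 by (metis zero_neq_one)+
  then obtain a b where a: "dpow D a gen_x \<noteq> 0" "\<forall>k>a. dpow D k gen_x = 0"
    and b: "dpow D b gen_y \<noteq> 0" "\<forall>k>b. dpow D k gen_y = 0"
    using ex_nilpotency_degree[OF D] by metis
  have "a + b \<ge> 1"
  proof (rule ccontr)
    assume "\<not> a + b \<ge> 1"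
    then have "dpow D 1 gen_x = 0" "dpow D 1 gen_y = 0" using a b by auto
    then show False using ne by (auto simp: dpow_def One_nat_def)
  qed
  then have "dpow D a gen_x * dpow D b gen_y = dpow D b gen_y * dpow D a gen_x"
    using top_terms_commute[OF D] a b by blast
  from commuting_bihom[OF this a(1) b(1) bih(1) bih(2)]
  have "(1 + a * nat i) * (1 + b * nat j) = a * nat j * (b * nat i)" .
  then have "1 + a * nat i + b * nat j = 0" by (simp add: algebra_simps)
  then show False by simp
qed

lemma lex_pos:
  fixes M u v K :: int
  assumes "M = 2 * K + 2" "\<bar>v\<bar> \<le> 2 * K" "M * u + v \<ge> 0" shows "u \<ge> 0"
proof (rule ccontr)
  assume "\<not> u \<ge> 0"
  then have "u \<le> - 1" by simp
  then have "M * u \<le> M * (- 1)" using assms by (intro mult_left_mono) auto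
  then show False using assms by linarith
qed

text \<open>The point of a finite set that is extremal in the direction \<open>(A, B)\<close>, with ties broken by the coordinates, is
  the unique extremal point for a nearby direction \<open>(A', B')\<close>.\<close>

lemma corner_exists:
  fixes S :: "(int \<times> int) set"
  assumes "finite S" "S \<noteq> {}"
  obtains A' B' i j where "(i, j) \<in> S"
    "\<And>i' j'. (i', j') \<in> S \<Longrightarrow> A' * i' + B' * j' \<le> A' * i + B' * j"
    "\<And>i' j'. (i', j') \<in> S \<Longrightarrow> A' * i' + B' * j' = A' * i + B' * j \<Longrightarrow> i' = i \<and> j' = j"
    "\<And>i' j'. (i', j') \<in> S \<Longrightarrow> A * i' + B * j' \<le> A * i + B * j"
    "\<And>i' j'. (i', j') \<in> S \<Longrightarrow> A * i' + B * j' = A * i + B * j \<Longrightarrow> i' \<le> i"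
proof -
  \<comment> \<open>The weights (A', B') compare A i + B j, then i, then j lexicographically, as digits in a base M larger than all differences.\<close>
  define f where "f = (\<lambda>(i, j). \<bar>A * i + B * j\<bar> + \<bar>i\<bar> + \<bar>j\<bar>)"
  define K where "K = Max (f ` S)"
  have K: "f s \<le> K" if "s \<in> S" for s unfolding K_def using assms that by simp
  define M where "M = 2 * K + 2"
  define A' B' where AB: "A' = M * (M * A + 1)" "B' = M * (M * B) + 1"
  define g where "g = (\<lambda>(i, j). A' * i + B' * j)"
  have "\<exists>s\<in>S. \<forall>t\<in>S. g t \<le> g s"
  proof -
    have "Max (g ` S) \<in> g ` S" using assms by simp
    then obtain s where "s \<in> S" "Max (g ` S) = g s" by auto
    then show ?thesis using assms by (metis Max_ge finite_imageI imageI)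
  qed
  then obtain i j where ij: "(i, j) \<in> S" "\<forall>t\<in>S. g t \<le> g (i, j)" by auto
  have key: "A * (i - i') + B * (j - j') \<ge> 0 \<and> (A * (i - i') + B * (j - j') = 0 \<longrightarrow> i - i' \<ge> 0) \<and>
     (g (i', j') = g (i, j) \<longrightarrow> i' = i \<and> j' = j)" if t: "(i', j') \<in> S" for i' j'
  proof -
    define u v w where uvw: "u = A * (i - i') + B * (j - j')" "v = i - i'" "w = j - j'"
    have bd: "\<bar>u\<bar> \<le> 2 * K" "\<bar>v\<bar> \<le> 2 * K" "\<bar>w\<bar> \<le> 2 * K"
      using K[OF t] K[OF ij(1)] unfolding f_def uvw by (simp_all add: right_diff_distrib)
    have g: "g (i, j) - g (i', j') = M * (M * u + v) + w"
      unfolding g_def AB uvw by (simp add: algebra_simps)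
    have "M * (M * u + v) + w \<ge> 0" using g ij(2) t by force
    then have 1: "M * u + v \<ge> 0" using lex_pos[OF M_def] bd by blast
    then have 2: "u \<ge> 0" using lex_pos[OF M_def] bd by blast
    have 3: "u = 0 \<longrightarrow> v \<ge> 0" using 1 by auto
    have 4: "v = 0 \<and> w = 0" if "g (i', j') = g (i, j)"
    proof -
      have z: "M * (M * u + v) + w = 0" using g that by simp
      have "M * (- (M * u + v)) + (- w) = - (M * (M * u + v) + w)" by (simp add: algebra_simps)
      then have "M * (- (M * u + v)) + (- w) \<ge> 0" using z by simp
      then have "- (M * u + v) \<ge> 0" by (rule lex_pos[OF M_def, rotated]) (use bd in simp)
      then have z1: "M * u + v = 0" using 1 by simp
      then have "M * (- u) + (- v) \<ge> 0" by simp
      then have "- u \<ge> 0" by (rule lex_pos[OF M_def, rotated]) (use bd in simp)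
      then have "u = 0" using 2 by simp
      then show ?thesis using z z1 by simp
    qed
    show ?thesis using 2 3 4 unfolding uvw by auto
  qed
  show ?thesis
  proof (rule that[OF ij(1)])
    fix i' j' assume t: "(i', j') \<in> S"
    note k = key[OF t]
    show "A' * i' + B' * j' \<le> A' * i + B' * j" using ij(2) t by (force simp: g_def)
    show "A * i' + B * j' \<le> A * i + B * j" using k by (simp add: right_diff_distrib)
    show "i' = i \<and> j' = j" if "A' * i' + B' * j' = A' * i + B' * j" using k that by (simp add: g_def)
    show "i' \<le> i" if "A * i' + B * j' = A * i + B * j" using k that by (simp add: right_diff_distrib)
  qed
qed

text \<open>The top part of \<open>D\<close> for the nearby direction has a single shift, so the corner lies on one of the lines
  \<open>i = -1\<close> and \<open>j = -1\<close>, where only powers of \<open>y\<close> in \<open>D x\<close> and powers of \<open>x\<close> in \<open>D y\<close> live.\<close>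

lemma corner_on_axis:
  assumes D: "symp_lnd D" and ne: "D gen_x \<noteq> 0 \<or> D gen_y \<noteq> 0"
  obtains (ypower) n where "coef (D gen_x) (replicate n Letter_y) \<noteq> 0"
      "\<And>i j. (i, j) \<in> supp D \<Longrightarrow> A * i + B * j \<le> B * int n - A"
      "\<And>i j. (i, j) \<in> supp D \<Longrightarrow> A * i + B * j = B * int n - A \<Longrightarrow> i \<le> - 1"
  | (xpower) m where "coef (D gen_y) (replicate m Letter_x) \<noteq> 0"
      "\<And>i j. (i, j) \<in> supp D \<Longrightarrow> A * i + B * j \<le> A * int m - B"
      "\<And>i j. (i, j) \<in> supp D \<Longrightarrow> A * i + B * j = A * int m - B \<Longrightarrow> i \<le> int m"
proof -
  have ne': "supp D \<noteq> {}" using ne ex_word by (force simp: supp_def)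
  obtain A' B' i j where ij: "(i, j) \<in> supp D"
    and 1: "\<And>i' j'. (i', j') \<in> supp D \<Longrightarrow> A' * i' + B' * j' \<le> A' * i + B' * j"
    and 2: "\<And>i' j'. (i', j') \<in> supp D \<Longrightarrow> A' * i' + B' * j' = A' * i + B' * j \<Longrightarrow> i' = i \<and> j' = j"
    and 3: "\<And>i' j'. (i', j') \<in> supp D \<Longrightarrow> A * i' + B * j' \<le> A * i + B * j"
           "\<And>i' j'. (i', j') \<in> supp D \<Longrightarrow> A * i' + B * j' = A * i + B * j \<Longrightarrow> i' \<le> i"
    by (rule corner_exists[OF finite_supp ne', of A B]) (rule that)
  define d where "d = A' * i + B' * j"
  define E where "E = top_der A' B' d D"
  have le: "wle A' B' (A' + d) (D gen_x)" "wle A' B' (B' + d) (D gen_y)"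
    using supp_wle[of D A' B' d] 1 d_def by blast+
  have E: "symp_lnd E" unfolding E_def by (rule symp_lnd_top_der[OF D le])
  have cx: "coef (E gen_x) w = (if wt A' B' w = A' + d then coef (D gen_x) w else 0)"
    and cy: "coef (E gen_y) w = (if wt A' B' w = B' + d then coef (D gen_y) w else 0)" for w
    by (simp_all add: E_def top_der_def coef_comp)
  have "supp E \<subseteq> {(i, j)}"
  proof -
    have "(i', j') = (i, j)" if "(i', j') \<in> supp E" for i' j'
    proof -
      from that consider w where "w \<in> words (E gen_x)" "i' = int (nx w) - 1" "j' = int (ny w)"
        | w where "w \<in> words (E gen_y)" "i' = int (nx w)" "j' = int (ny w) - 1" by (auto simp: supp_def)
      then have "(i', j') \<in> supp D \<and> A' * i' + B' * j' = A' * i + B' * j"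
      proof cases
        case 1
        then have "w \<in> words (D gen_x)" "wt A' B' w = A' + d" by (auto simp: in_keys_iff cx split: if_splits)
        then show ?thesis unfolding 1(2,3) using supp_x[of w D] by (simp add: wt_def d_def algebra_simps)
      next
        case 2
        then have "w \<in> words (D gen_y)" "wt A' B' w = B' + d" by (auto simp: in_keys_iff cy split: if_splits)
        then show ?thesis unfolding 2(2,3) using supp_y[of w D] by (simp add: wt_def d_def algebra_simps)
      qed
      then show ?thesis using 2 by blast
    qed
    then show ?thesis by auto
  qed
  moreover have "E gen_x \<noteq> 0 \<or> E gen_y \<noteq> 0"
  proof -
    from ij consider w where "w \<in> words (D gen_x)" "i = int (nx w) - 1" "j = int (ny w)"
        | w where "w \<in> words (D gen_y)" "i = int (nx w)" "j = int (ny w) - 1" by (auto simp: supp_def)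
    then show ?thesis
    proof cases
      case 1
      have "coef (E gen_x) w \<noteq> 0" using 1(1) unfolding cx d_def wt_def 1(2,3) by (simp add: in_keys_iff algebra_simps)
      then show ?thesis by auto
    next
      case 2
      have "coef (E gen_y) w \<noteq> 0" using 2(1) unfolding cy d_def wt_def 2(2,3) by (simp add: in_keys_iff algebra_simps)
      then show ?thesis by auto
    qed
  qed
  ultimately have ax: "i = - 1 \<or> j = - 1" using single_shift_on_axis[OF E] by blast
  from ij consider w where "w \<in> words (D gen_x)" "i = int (nx w) - 1" "j = int (ny w)"
    | w where "w \<in> words (D gen_y)" "i = int (nx w)" "j = int (ny w) - 1" by (auto simp: supp_def)
  then show thesis
  proof cases
    case 1
    then have "nx w = 0" using ax by auto
    then have w: "w = replicate (ny w) Letter_y" by (simp add: nx_0_iff)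
    show thesis
    proof (rule ypower[of "ny w"])
      show "coef (D gen_x) (replicate (ny w) Letter_y) \<noteq> 0" using 1 w by (metis in_keys_iff)
    qed (use 3 1 \<open>nx w = 0\<close> in \<open>force simp: algebra_simps\<close>)+
  next
    case 2
    then have "ny w = 0" using ax by auto
    then have w: "w = replicate (nx w) Letter_x" by (simp add: ny_0_iff)
    show thesis
    proof (rule xpower[of "nx w"])
      show "coef (D gen_y) (replicate (nx w) Letter_x) \<noteq> 0" using 2 w by (metis in_keys_iff)
    qed (use 3 2 \<open>ny w = 0\<close> in \<open>force simp: algebra_simps\<close>)+
  qed
qed

text \<open>The polynomials \<open>Pd D\<close> and \<open>Qd D\<close> collect the powers of \<open>x\<close> in \<open>D y\<close> and the powers of \<open>y\<close> in \<open>D x\<close>; their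
  degrees locate the two outer corners \<open>(m, -1)\<close> and \<open>(-1, n)\<close> of the support.\<close>

definition Pd :: "(free_alg \<Rightarrow> free_alg) \<Rightarrow> complex poly" where "Pd D = evp tvar 0 (D gen_y)"
definition Qd :: "(free_alg \<Rightarrow> free_alg) \<Rightarrow> complex poly" where "Qd D = evp 0 tvar (D gen_x)"

text \<open>Without powers of \<open>x\<close> in \<open>D y\<close> every corner in direction \<open>(1, 0)\<close> has \<open>i = -1\<close>, and then so does the support.\<close>

lemma Pd_0:
  assumes D: "symp_lnd D" and "Pd D = 0"
  shows "D gen_y = 0" "\<And>w. w \<in> words (D gen_x) \<Longrightarrow> nx w = 0"
proof -
  have no: "coef (D gen_y) (replicate m Letter_x) = 0" for m
    using assms(2) coeff_evp_pure_x[of "D gen_y" m] by (simp add: Pd_def)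
  have *: "D gen_y = 0 \<and> (\<forall>w \<in> words (D gen_x). nx w = 0)"
  proof (cases "D gen_x \<noteq> 0 \<or> D gen_y \<noteq> 0")
    case True
    from D True show ?thesis
    proof (cases rule: corner_on_axis[where A = 1 and B = 0])
      case (ypower n)
      have "D gen_y = 0"
      proof (rule ccontr)
        assume "D gen_y \<noteq> 0"
        then obtain w where "w \<in> words (D gen_y)" using ex_word by blast
        from ypower(2)[OF supp_y[of w D, OF this]] show False by simp
      qed
      moreover have "nx w = 0" if "w \<in> words (D gen_x)" for w using ypower(2)[OF supp_x[of w D, OF that]] by simp
      ultimately show ?thesis by blast
    next
      case (xpower m) then show ?thesis using no by blast
    qed
  qed simp
  then show "D gen_y = 0" "\<And>w. w \<in> words (D gen_x) \<Longrightarrow> nx w = 0" by auto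
qed

lemma Qd_0:
  assumes D: "symp_lnd D" and "Qd D = 0"
  shows "D gen_x = 0" "\<And>w. w \<in> words (D gen_y) \<Longrightarrow> ny w = 0"
proof -
  have no: "coef (D gen_x) (replicate m Letter_y) = 0" for m
    using assms(2) coeff_evp_pure_y[of "D gen_x" m] by (simp add: Qd_def)
  have *: "D gen_x = 0 \<and> (\<forall>w \<in> words (D gen_y). ny w = 0)"
  proof (cases "D gen_x \<noteq> 0 \<or> D gen_y \<noteq> 0")
    case True
    from D True show ?thesis
    proof (cases rule: corner_on_axis[where A = 0 and B = 1])
      case (xpower n)
      have "D gen_x = 0"
      proof (rule ccontr)
        assume "D gen_x \<noteq> 0"
        then obtain w where "w \<in> words (D gen_x)" using ex_word by blast
        from xpower(2)[OF supp_x[of w D, OF this]] show False by simp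
      qed
      moreover have "ny w = 0" if "w \<in> words (D gen_y)" for w using xpower(2)[OF supp_y[of w D, OF that]] by simp
      ultimately show ?thesis by blast
    next
      case (ypower m) then show ?thesis using no by blast
    qed
  qed simp
  then show "D gen_x = 0" "\<And>w. w \<in> words (D gen_y) \<Longrightarrow> ny w = 0" by auto
qed

text \<open>The weights are chosen such that the corners \<open>(m, -1)\<close> and \<open>(-1, n)\<close> have the same weight \<open>m n - 1\<close>.\<close>

lemma weight_bound:
  assumes D: "symp_lnd D" and PQ: "Pd D \<noteq> 0" "Qd D \<noteq> 0"
    and mn: "m = degree (Pd D)" "n = degree (Qd D)" and ij: "(i, j) \<in> supp D"
  shows "int (n + 1) * i + int (m + 1) * j \<le> int m * int n - 1"
proof -
  have "D gen_x \<noteq> 0" using PQ by (auto simp: Qd_def)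
  then have ne: "D gen_x \<noteq> 0 \<or> D gen_y \<noteq> 0" by blast
  from D ne show ?thesis
  proof (cases rule: corner_on_axis[where A = "int (n + 1)" and B = "int (m + 1)"])
    case (ypower k)
    then have "coeff (Qd D) k \<noteq> 0" by (simp add: Qd_def coeff_evp_pure_y)
    then have "k \<le> n" using mn le_degree by blast
    then have "int (m + 1) * int k \<le> int (m + 1) * int n" by (intro mult_left_mono) auto
    then show ?thesis using ypower(2)[OF ij] by (simp add: algebra_simps)
  next
    case (xpower k)
    then have "coeff (Pd D) k \<noteq> 0" by (simp add: Pd_def coeff_evp_pure_x)
    then have "k \<le> m" using mn le_degree by blast
    then have "int (n + 1) * int k \<le> int (n + 1) * int m" by (intro mult_left_mono) auto
    then show ?thesis using xpower(2)[OF ij] by (simp add: algebra_simps)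
  qed
qed

section \<open>Integral curves\<close>

lemma ev_simps: "ev a b (p + q) = ev a b p + ev a b q" "ev a b (p * q) = ev a b p * ev a b q"
  "ev a b (scalar c) = c" "ev a b 0 = 0" "ev a b (sum f I) = (\<Sum>i\<in>I. ev a b (f i))"
  using poly_evp[of "[:a:]" "[:b:]" _ 0, symmetric] by (simp_all add: evp_simps poly_sum)

text \<open>The function \<open>t \<mapsto> p (exp (t D) (a, b))\<close>. It is a polynomial because \<open>D\<close> is locally nilpotent, and it is the value
  of \<open>p\<close> along the integral curve through \<open>(a, b)\<close>.\<close>

definition curve :: "(free_alg \<Rightarrow> free_alg) \<Rightarrow> complex \<Rightarrow> complex \<Rightarrow> free_alg \<Rightarrow> complex poly" where
  "curve D a b p = Abs_poly (\<lambda>k. ev a b (dpow D k p))"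

lemma coeff_curve:
  assumes D: "symp_lnd D" shows "coeff (curve D a b p) k = ev a b (dpow D k p)"
proof -
  obtain n where n: "(D ^^ n) p = 0" using symp_lnd_D(2)[OF D] by blast
  have "\<forall>k>n. ev a b (dpow D k p) = 0"
    using derivation_power_0_mono[OF symp_lnd_D(1)[OF D] n] by (simp add: dpow_def ev_simps)
  then have "\<forall>\<^sub>\<infinity>k. ev a b (dpow D k p) = 0" by (auto simp: MOST_nat)
  then show ?thesis unfolding curve_def by (subst Abs_poly_inverse) auto
qed

lemma curve_evp:
  assumes D: "symp_lnd D"
  shows "curve D a b p = evp (curve D a b gen_x) (curve D a b gen_y) p"
proof (rule evp_unique)
  note d = symp_lnd_D(1)[OF D]
  show "curve D a b (p + q) = curve D a b p + curve D a b q" for p q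
    by (rule poly_eqI) (simp add: coeff_curve[OF D] dpow_def derivation_power_simps[OF d] distrib_left ev_simps)
  show "curve D a b (p * q) = curve D a b p * curve D a b q" for p q
    by (rule poly_eqI) (simp add: coeff_curve[OF D] coeff_mult dpow_mult[OF d] ev_simps)
  show "curve D a b (scalar c) = [:c:]" for c
  proof (rule poly_eqI)
    fix k
    have "(D ^^ k) (scalar c) = 0" if "k \<ge> 1"
      using derivation_power_0_mono[OF d _ that, of "scalar c"] by (simp add: derivation_simps[OF d] One_nat_def)
    then show "coeff (curve D a b (scalar c)) k = coeff [:c:] k"
      by (cases k) (simp_all add: coeff_curve[OF D] dpow_def ev_simps)
  qed
qed

lemma pderiv_curve:
  assumes D: "symp_lnd D" shows "pderiv (curve D a b p) = curve D a b (D p)"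
proof (rule poly_eqI)
  fix k
  have "ev a b (scalar (of_nat (Suc k)) * dpow D (Suc k) p) = ev a b (dpow D k (D p))"
    using dpow_Suc'[OF symp_lnd_D(1)[OF D]] by metis
  then show "coeff (pderiv (curve D a b p)) k = coeff (curve D a b (D p)) k"
    by (simp add: coeff_pderiv coeff_curve[OF D] ev_simps del: of_nat_Suc)
qed

lemma coeff_evp_1:
  assumes "\<And>w. w \<in> words p \<Longrightarrow> ny w = k \<Longrightarrow> w = v" "ny v = k"
  shows "coeff (evp 1 tvar p) k = coef p v"
proof -
  have "coeff (evp 1 tvar p) k = (\<Sum>w\<in>words p. if w = v then coef p v else 0)"
    unfolding evp_def coeff_sum
  proof (rule sum.cong)
    fix w assume w: "w \<in> words p"
    show "coeff (smult (coef p w) (1 ^ nx w * tvar ^ ny w)) k = (if w = v then coef p v else 0)"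
    proof (cases "ny w = k")
      case True
      then show ?thesis using assms(1)[OF w] by (simp add: tvar_power)
    next
      case False
      then have "w \<noteq> v" using assms(2) by blast
      then show ?thesis using False by (simp add: tvar_power)
    qed
  qed simp
  then show ?thesis by (simp add: in_keys_iff)
qed

text \<open>Each word of \<open>D g\<close> contains at least \<open>q\<close> factors whose values along the curve are divisible by \<open>Y\<close>, so \<open>Y\<^sup>q\<close> divides the
  derivative of the value of \<open>g\<close>, which is not zero.\<close>

lemma curve_degree_bound:
  assumes D: "symp_lnd D" and q: "\<And>w. w \<in> words (D g) \<Longrightarrow> h w \<ge> q"
    and h: "\<And>w. Y ^ h w dvd evp (curve D a b gen_x) (curve D a b gen_y) (term1 w 1)"
    and ne: "ev a b (D g) \<noteq> 0"
  shows "degree (curve D a b g) \<ge> 1 + q * degree Y"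
proof -
  let ?X = "curve D a b g"
  have c: "coeff (pderiv ?X) 0 \<noteq> 0" using ne by (simp add: pderiv_curve[OF D] coeff_curve[OF D])
  then have ne0: "pderiv ?X \<noteq> 0" by auto
  then have "degree ?X \<noteq> 0" by (metis pderiv_eq_0_iff)
  moreover have "Y ^ q dvd pderiv ?X"
  proof -
    let ?e = "evp (curve D a b gen_x) (curve D a b gen_y)"
    have "?e (D g) = (\<Sum>w\<in>words (D g). smult (coef (D g) w) (?e (term1 w 1)))"
      by (subst free_alg_as_sum[of "D g"]) (simp add: evp_simps)
    moreover have "Y ^ q dvd smult (coef (D g) w) (?e (term1 w 1))" if "w \<in> words (D g)" for w
      using h[of w] q[OF that] by (meson dvd_smult dvd_trans le_imp_power_dvd)
    ultimately have "Y ^ q dvd ?e (D g)" by (simp add: dvd_sum)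
    then show ?thesis using pderiv_curve[OF D] curve_evp[OF D] by metis
  qed
  then have "degree (Y ^ q) \<le> degree (pderiv ?X)" using ne0 by (rule dvd_imp_degree_le)
  moreover have "degree (Y ^ q) = q * degree Y"
    by (cases "Y = 0") (simp_all add: degree_power_eq power_0_left)
  ultimately show ?thesis by (simp add: degree_pderiv)
qed

text \<open>Write \<open>n + 1 = e q\<close> and \<open>m + 1 = e p\<close> with \<open>p\<close>, \<open>q\<close> coprime. On the edge between the outer corners all words of \<open>D x\<close>
  contain at least \<open>q - 1\<close> letters \<open>y\<close>, and all words of \<open>D y\<close> at least \<open>p - 1\<close> letters \<open>x\<close>. For an integral curve \<open>(X, Y)\<close>
  of the top part this gives \<open>deg X \<ge> 1 + (q - 1) deg Y\<close> and \<open>deg Y \<ge> 1 + (p - 1) deg X\<close>, which is absurd if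
  \<open>p, q \<ge> 2\<close>.\<close>

lemma edge_slope:
  assumes D: "symp_lnd D" and PQ: "Pd D \<noteq> 0" "Qd D \<noteq> 0"
    and mn: "m = degree (Pd D)" "n = degree (Qd D)"
  shows "(n + 1) dvd (m + 1) \<or> (m + 1) dvd (n + 1)"
proof (rule ccontr)
  assume no: "\<not> ((n + 1) dvd (m + 1) \<or> (m + 1) dvd (n + 1))"
  define e where "e = gcd (n + 1) (m + 1)"
  obtain q where q: "n + 1 = e * q" unfolding e_def by (meson dvd_def gcd_dvd1)
  obtain p where p: "m + 1 = e * p" unfolding e_def by (meson dvd_def gcd_dvd2)
  have e0: "e > 0" unfolding e_def by simp
  have cop: "coprime p q"
  proof -
    have "gcd (e * q) (e * p) = e" by (subst q[symmetric], subst p[symmetric]) (simp add: e_def)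
    then have "e * gcd q p = e" using gcd_mult_distrib_nat[of e q p] by simp
    then show ?thesis using e0 by (simp add: coprime_iff_gcd_eq_1 gcd.commute)
  qed
  have pq2: "p \<ge> 2" "q \<ge> 2"
  proof -
    have "p \<noteq> 0" using p by (cases p) auto
    moreover have "q \<noteq> 0" using q by (cases q) auto
    moreover have "p \<noteq> 1" using no p q by (metis dvd_triv_left mult.right_neutral)
    moreover have "q \<noteq> 1" using no p q by (metis dvd_triv_left mult.right_neutral)
    ultimately show "p \<ge> 2" "q \<ge> 2" by auto
  qed
  let ?A = "int (n + 1)" and ?B = "int (m + 1)" and ?d = "int m * int n - 1"
  define E where "E = top_der ?A ?B ?d D"
  have le: "wle ?A ?B (?A + ?d) (D gen_x)" "wle ?A ?B (?B + ?d) (D gen_y)"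
    using supp_wle[of D ?A ?B ?d] weight_bound[OF D PQ mn] by blast+
  have E: "symp_lnd E" unfolding E_def by (rule symp_lnd_top_der[OF D le])
  have cx: "coef (E gen_x) w = (if wt ?A ?B w = ?A + ?d then coef (D gen_x) w else 0)"
    and cy: "coef (E gen_y) w = (if wt ?A ?B w = ?B + ?d then coef (D gen_y) w else 0)" for w
    by (simp_all add: E_def top_der_def coef_comp)
  have wx: "(n + 1) * nx w + (m + 1) * ny w = (m + 1) * n" if "w \<in> words (E gen_x)" for w
  proof -
    have "wt ?A ?B w = ?A + ?d" using that by (auto simp: in_keys_iff cx split: if_splits)
    then have "int ((n + 1) * nx w + (m + 1) * ny w) = int ((m + 1) * n)" by (simp add: wt_def algebra_simps)
    then show ?thesis by (simp only: of_nat_eq_iff)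
  qed
  have wy: "(n + 1) * nx w + (m + 1) * ny w = (n + 1) * m" if "w \<in> words (E gen_y)" for w
  proof -
    have "wt ?A ?B w = ?B + ?d" using that by (auto simp: in_keys_iff cy split: if_splits)
    then have "int ((n + 1) * nx w + (m + 1) * ny w) = int ((n + 1) * m)" by (simp add: wt_def algebra_simps)
    then show ?thesis by (simp only: of_nat_eq_iff)
  qed
  have px: "q - 1 \<le> ny w" if "w \<in> words (E gen_x)" for w
  proof -
    have "e * (q * nx w + p * ny w) = e * (p * n)" using wx[OF that] unfolding q p by (simp add: algebra_simps)
    then have 1: "q * nx w + p * ny w = p * n" using e0 by simp
    have "p dvd q * nx w" by (metis 1 dvd_add_left_iff dvd_triv_left)
    then obtain k where k: "nx w = p * k" using cop by (metis coprime_dvd_mult_right_iff dvd_def)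
    have "p * (q * k + ny w) = p * n" using 1 k by (simp add: algebra_simps)
    then have "q * k + ny w + 1 = e * q" using pq2 q by auto
    moreover have "(e - k) * q = e * q - q * k" by (simp add: algebra_simps diff_mult_distrib)
    ultimately have *: "ny w + 1 = (e - k) * q" by linarith
    then have "e - k \<ge> 1" by (cases "e - k") auto
    then have "1 * q \<le> (e - k) * q" by (intro mult_right_mono) auto
    then show ?thesis unfolding mult_1 using * by linarith
  qed
  have py: "p - 1 \<le> nx w" if "w \<in> words (E gen_y)" for w
  proof -
    have "e * (q * nx w + p * ny w) = e * (q * m)" using wy[OF that] unfolding q p by (simp add: algebra_simps)
    then have 1: "q * nx w + p * ny w = q * m" using e0 by simp
    have "q dvd p * ny w" by (metis 1 dvd_add_right_iff dvd_triv_left)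
    then obtain k where k: "ny w = q * k" using cop by (metis coprime_commute coprime_dvd_mult_right_iff dvd_def)
    have "q * (p * k + nx w) = q * m" using 1 k by (simp add: algebra_simps)
    then have "p * k + nx w + 1 = e * p" using pq2 p by auto
    moreover have "(e - k) * p = e * p - p * k" by (simp add: algebra_simps diff_mult_distrib)
    ultimately have *: "nx w + 1 = (e - k) * p" by linarith
    then have "e - k \<ge> 1" by (cases "e - k") auto
    then have "1 * p \<le> (e - k) * p" by (intro mult_right_mono) auto
    then show ?thesis unfolding mult_1 using * by linarith
  qed
  have "coeff (Qd D) n \<noteq> 0" "coeff (Pd D) m \<noteq> 0" using PQ mn by simp_all
  then have top: "coef (E gen_x) (replicate n Letter_y) \<noteq> 0" "coef (E gen_y) (replicate m Letter_x) \<noteq> 0"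
    by (simp_all add: cx cy Qd_def Pd_def coeff_evp_pure_y coeff_evp_pure_x wt_def algebra_simps)
  have "coeff (evp 1 tvar (E gen_x)) n \<noteq> 0"
  proof (subst coeff_evp_1)
    fix w assume w: "w \<in> words (E gen_x)" "ny w = n"
    then have "nx w = 0" using wx[OF w(1)] by simp
    then show "w = replicate n Letter_y" using w by (simp add: nx_0_iff)
  qed (use top in auto)
  moreover have "coeff (evp 1 tvar (E gen_y)) 0 \<noteq> 0"
  proof (subst coeff_evp_1)
    fix w assume w: "w \<in> words (E gen_y)" "ny w = 0"
    then have "(n + 1) * nx w = (n + 1) * m" using wy[OF w(1)] by simp
    then have "nx w = m" by simp
    then show "w = replicate m Letter_x" using w by (simp add: ny_0_iff)
  qed (use top in auto)
  ultimately have "evp 1 tvar (E gen_x) * evp 1 tvar (E gen_y) \<noteq> 0" by auto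
  then obtain b where "poly (evp 1 tvar (E gen_x) * evp 1 tvar (E gen_y)) b \<noteq> 0"
    using poly_all_0_iff_0 by blast
  then have b: "ev 1 b (E gen_x) \<noteq> 0" "ev 1 b (E gen_y) \<noteq> 0" by (simp_all add: poly_evp)
  let ?X = "curve E 1 b gen_x" and ?Y = "curve E 1 b gen_y"
  have "degree ?X \<ge> 1 + (q - 1) * degree ?Y"
    by (rule curve_degree_bound[where h = ny]) (use E px b in \<open>auto simp: evp_single\<close>)
  moreover have "degree ?Y \<ge> 1 + (p - 1) * degree ?X"
    by (rule curve_degree_bound[where h = nx]) (use E py b in \<open>auto simp: evp_single\<close>)
  moreover have "1 * degree ?Y \<le> (q - 1) * degree ?Y" "1 * degree ?X \<le> (p - 1) * degree ?X"
    using pq2 by (intro mult_right_mono; simp)+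
  ultimately show False by linarith
qed

section \<open>Reduction of locally nilpotent derivations\<close>

definition tame :: "(free_alg \<Rightarrow> free_alg) set" where
  "tame = generate sympl_aut (Aff \<union> triangular)"

lemma tame_subset: "\<sigma> \<in> tame \<Longrightarrow> \<sigma> \<in> autG"
  unfolding tame_def using Aff_subset triangular_subset by (intro G.generate_in_carrier) auto

lemma tame_Aff: "\<sigma> \<in> Aff \<Longrightarrow> \<sigma> \<in> tame" and tame_triangular: "\<sigma> \<in> triangular \<Longrightarrow> \<sigma> \<in> tame"
  unfolding tame_def by (auto intro: generate.incl)

lemma tame_comp: "\<sigma> \<in> tame \<Longrightarrow> \<tau> \<in> tame \<Longrightarrow> \<sigma> \<circ> \<tau> \<in> tame"
  unfolding tame_def using generate.eng[of \<sigma> sympl_aut _ \<tau>] by simp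

text \<open>The order of the factors makes this a right action.\<close>

definition conjd :: "(free_alg \<Rightarrow> free_alg) \<Rightarrow> (free_alg \<Rightarrow> free_alg) \<Rightarrow> free_alg \<Rightarrow> free_alg" where
  "conjd D \<tau> = finv \<tau> \<circ> D \<circ> \<tau>"

lemma symp_lnd_conjd:
  assumes t: "\<tau> \<in> autG" and D: "symp_lnd D" shows "symp_lnd (conjd D \<tau>)"
  unfolding symp_lnd_def
proof (intro conjI allI)
  note d = symp_lnd_D(1)[OF D] and i = autG_inv[OF t]
  show "derivation (conjd D \<tau>)"
    unfolding derivation_def conjd_def using t
    by (simp add: autG_simps[OF t] autG_simps[OF i] derivation_simps[OF d])
  show "conjd D \<tau> (commutator gen_x gen_y) = 0"
    using autG_commutator[OF t] symp_lnd_D(3)[OF D] by (simp add: conjd_def autG_simps[OF i])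
  fix p
  obtain n where n: "(D ^^ n) (\<tau> p) = 0" using symp_lnd_D(2)[OF D] by blast
  have "(conjd D \<tau> ^^ n) p = finv \<tau> ((D ^^ n) (\<tau> p))" for n
    by (induction n) (simp_all add: t conjd_def)
  then show "\<exists>n. (conjd D \<tau> ^^ n) p = 0" using n autG_simps(5)[OF i] by metis
qed

lemma conjd_comp: "\<tau> \<in> autG \<Longrightarrow> \<rho> \<in> autG \<Longrightarrow> conjd (conjd D \<tau>) \<rho> = conjd D (\<tau> \<circ> \<rho>)"
  by (auto simp: conjd_def inv_comp)

lemma pcompose_evp: "pcompose (evp F G p) r = evp (pcompose F r) (pcompose G r) p"
proof -
  have "pcompose (evp F G p) r = evp (pcompose (evp F G gen_x) r) (pcompose (evp F G gen_y) r) p"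
    by (rule evp_unique) (simp_all add: evp_simps pcompose_add pcompose_mult)
  then show ?thesis by simp
qed

text \<open>One more than the degree, so that the zero polynomial is smaller than the constants.\<close>

definition sz :: "complex poly \<Rightarrow> nat" where "sz p = (if p = 0 then 0 else Suc (degree p))"

lemma swap_PQ:
  assumes D: "symp_lnd D"
  shows "Pd (conjd D swap) = - Qd D" "Qd (conjd D swap) = pcompose (Pd D) (- tvar)"
    "degree (Qd (conjd D swap)) = degree (Pd D)" "Qd (conjd D swap) = 0 \<longleftrightarrow> Pd D = 0"
proof -
  note s = swap_in_autG and i = autG_simps[OF autG_inv[OF swap_in_autG]]
  have e: "evp F G (finv swap p) = evp (- G) F p" for F G p
    by (subst evp_endo) (simp_all add: autG_alg_endo autG_inv s evp_minus)
  show "Pd (conjd D swap) = - Qd D"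
    by (simp add: Pd_def Qd_def conjd_def i derivation_simps[OF symp_lnd_D(1)[OF D]] evp_minus e)
  show *: "Qd (conjd D swap) = pcompose (Pd D) (- tvar)"
    unfolding Qd_def Pd_def pcompose_evp by (simp add: conjd_def e pcompose_pCons)
  show "degree (Qd (conjd D swap)) = degree (Pd D)"
    unfolding * by (simp add: degree_pcompose)
  show "Qd (conjd D swap) = 0 \<longleftrightarrow> Pd D = 0"
    unfolding * using pcompose_eq_0[of "Pd D" "- tvar"] by auto
qed

text \<open>The automorphism \<open>x \<mapsto> x\<close>, \<open>y \<mapsto> y + c x\<^sup>p\<close>.\<close>

definition eu :: "complex \<Rightarrow> nat \<Rightarrow> free_alg \<Rightarrow> free_alg" where
  "eu c p = swap \<circ> el (monom (c * (- 1) ^ p) p) \<circ> finv swap"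

lemma eu_tame: "eu c p \<in> tame"
  unfolding eu_def by (intro tame_comp tame_Aff tame_triangular triangular_el swap_in_Aff Aff_inv)

lemma eu_gens: "eu c p gen_x = gen_x" "eu c p gen_y = gen_y + scalar c * gen_x ^ p"
proof -
  note s = autG_simps[OF swap_in_autG] and l = autG_simps[OF el_in_autG]
  show "eu c p gen_x = gen_x" by (simp add: eu_def s l)
  have "(- gen_x :: free_alg) ^ p = scalar ((- 1) ^ p) * gen_x ^ p"
    by (subst power_minus) (simp add: scalar_power scalar_minus)
  then have "scalar (c * (- 1) ^ p) * (- gen_x) ^ p = scalar (c * (- 1) ^ p * (- 1) ^ p) * gen_x ^ p"
    by (simp only: scalar_mult mult.assoc)
  also have "c * (- 1) ^ p * (- 1) ^ p = c" by (simp add: mult.assoc power_mult_distrib[symmetric])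
  finally show "eu c p gen_y = gen_y + scalar c * gen_x ^ p"
    by (simp add: eu_def s autG_pol[OF swap_in_autG] pol_monom)
qed

lemma finv_eu: "finv (eu c p) = eu (- c) p"
  by (rule autG_I(2)[OF autG_alg_endo autG_alg_endo])
    (simp_all add: eu_gens tame_subset[OF eu_tame] autG_simps[OF tame_subset[OF eu_tame]] scalar_minus
      autG_commutator'[OF tame_subset[OF eu_tame], unfolded eu_gens])

text \<open>Conjugation by \<open>y \<mapsto> y + c x\<^sup>p\<close> preserves \<open>Qd D\<close> and does not raise the degree \<open>m\<close> of \<open>Pd D\<close>. The new coefficient of degree \<open>m\<close> is
  a polynomial in \<open>c\<close>, and it is not constant since the leading term of \<open>Qd D\<close> contributes to \<open>c\<^sup>n\<^sup>+\<^sup>1\<close>; so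
  some \<open>c\<close> makes the degree drop.\<close>

lemma shorten_edge:
  assumes D: "symp_lnd D" and PQ: "Pd D \<noteq> 0" "Qd D \<noteq> 0"
    and dvd: "(degree (Qd D) + 1) dvd (degree (Pd D) + 1)"
  shows "\<exists>\<tau>\<in>tame. sz (Pd (conjd D \<tau>)) + sz (Qd (conjd D \<tau>)) < sz (Pd D) + sz (Qd D)"
proof -
  define m n where mn: "m = degree (Pd D)" "n = degree (Qd D)"
  obtain p where p: "m + 1 = (n + 1) * p" using dvd unfolding mn dvd_def by blast
  have p0: "p \<ge> 1" using p by (cases p) auto
  have m: "m = p * n + (p - 1)" using p p0 by (cases p) (auto simp: algebra_simps)
  note d = symp_lnd_D(1)[OF D]
  note wb = weight_bound[OF D PQ mn]
  have wx: "nx w + p * ny w \<le> p * n" if "w \<in> words (D gen_x)" for w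
  proof -
    have "int (n + 1) * (int (nx w) - 1) + int (m + 1) * int (ny w) \<le> int m * int n - 1"
      by (rule wb) (rule supp_x[of w D, OF that])
    then have "int ((n + 1) * nx w + (m + 1) * ny w) \<le> int ((m + 1) * n)" by (simp add: algebra_simps)
    then have "(n + 1) * (nx w + p * ny w) \<le> (n + 1) * (p * n)"
      unfolding p of_nat_le_iff by (simp add: algebra_simps)
    then show ?thesis by (simp only: mult_le_cancel1)
  qed
  have wy: "nx w + p * ny w \<le> m" if "w \<in> words (D gen_y)" for w
  proof -
    have "int (n + 1) * int (nx w) + int (m + 1) * (int (ny w) - 1) \<le> int m * int n - 1"
      by (rule wb) (rule supp_y[of w D, OF that])
    then have "int ((n + 1) * nx w + (m + 1) * ny w) \<le> int (m * (n + 1))" by (simp add: algebra_simps)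
    then have "(n + 1) * (nx w + p * ny w) \<le> (n + 1) * m"
      unfolding p of_nat_le_iff by (simp add: algebra_simps)
    then show ?thesis by (simp only: mult_le_cancel1)
  qed
  let ?G = "\<lambda>c. smult (- c) (tvar ^ p)"
  \<comment> \<open>The polynomial P of the conjugated derivation, by the chain rule.\<close>
  define R where "R c = evp tvar (?G c) (D gen_y) + smult (c * of_nat p) (tvar ^ (p - 1) * evp tvar (?G c) (D gen_x))" for c
  have e: "evp F H (finv (eu c p) r) = evp F (H - smult c (F ^ p)) r" for F H c r
    unfolding finv_eu by (subst evp_endo)
      (simp_all add: autG_alg_endo tame_subset[OF eu_tame] eu_gens evp_simps evp_scalar_mult)
  have P: "Pd (conjd D (eu c p)) = R c" for c
  proof -
    have "Pd (conjd D (eu c p)) = evp tvar (0 - smult c (tvar ^ p)) (D gen_y + scalar c * D (gen_x ^ p))"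
      by (simp only: Pd_def conjd_def o_apply e eu_gens derivation_simps(1,4)[OF d])
    then show ?thesis
      by (simp add: R_def evp_add evp_scalar_mult evp_derivation_power[OF d] of_nat_poly mult.assoc)
  qed
  have Q: "Qd (conjd D (eu c p)) = Qd D" for c
    using p0 by (simp add: Qd_def conjd_def e eu_gens power_0_left)
  have mono: "tvar ^ a * ?G c ^ b = monom ((- c) ^ b) (a + p * b)" for a b c
    by (simp add: tvar_power smult_monom monom_power mult_monom mult.commute)
  have evw: "evp tvar (?G c) r = (\<Sum>w\<in>words r. monom (coef r w * (- c) ^ ny w) (nx w + p * ny w))" for c r
    unfolding evp_def mono by (simp add: smult_monom)
  have t1: "tvar ^ (p - 1) * evp tvar (?G c) (D gen_x)
      = (\<Sum>w\<in>words (D gen_x). monom (coef (D gen_x) w * (- c) ^ ny w) (p - 1 + (nx w + p * ny w)))" for c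
    by (subst evw) (simp add: sum_distrib_left tvar_power mult_monom)
  have deg: "degree (R c) \<le> m" for c
    unfolding R_def unfolding t1 unfolding evw
  proof (rule degree_add_le, rule degree_sum_le, simp_all only: finite_keys, goal_cases)
    case (1 w)
    then show ?case using wy[of w] by (intro order.trans[OF degree_monom_le]) simp
  next
    case 2
    show ?case
    proof (rule order.trans[OF degree_smult_le], rule degree_sum_le, simp)
    fix w assume "w \<in> words (D gen_x)"
    then show "degree (monom (coef (D gen_x) w * (- c) ^ ny w) (p - 1 + (nx w + p * ny w))) \<le> m"
      using wx[of w] m by (intro order.trans[OF degree_monom_le]) simp
    qed
  qed
  \<comment> \<open>The coefficient of degree m as a polynomial in c.\<close>
  define K where "K = (\<Sum>w\<in>{w\<in>words (D gen_y). nx w + p * ny w = m}. monom (coef (D gen_y) w * (- 1) ^ ny w) (ny w))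
      + (\<Sum>w\<in>{w\<in>words (D gen_x). nx w + p * ny w = p * n}. monom (of_nat p * coef (D gen_x) w * (- 1) ^ ny w) (ny w + 1))"
  have top: "coeff (R c) m = poly K c" for c
  proof -
    have 1: "coeff (evp tvar (?G c) (D gen_y)) m
        = (\<Sum>w\<in>{w\<in>words (D gen_y). nx w + p * ny w = m}. coef (D gen_y) w * (- c) ^ ny w)"
      unfolding evw coeff_sum coeff_monom by (subst sum.inter_filter) simp_all
    have eq: "p - 1 + (nx w + p * ny w) = m \<longleftrightarrow> nx w + p * ny w = p * n" for w using m by linarith
    have 2: "coeff (tvar ^ (p - 1) * evp tvar (?G c) (D gen_x)) m
        = (\<Sum>w\<in>{w\<in>words (D gen_x). nx w + p * ny w = p * n}. coef (D gen_x) w * (- c) ^ ny w)"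
      unfolding t1 coeff_sum coeff_monom eq by (subst sum.inter_filter) simp_all
    have 3: "(- c) ^ k = (- 1) ^ k * c ^ k" for k using power_minus by blast
    show ?thesis unfolding R_def K_def coeff_add coeff_smult 1 2
      by (simp add: poly_sum poly_monom sum_distrib_left 3 power_add mult_ac)
  qed
  have "coeff K (n + 1) = of_nat p * coef (D gen_x) (replicate n Letter_y) * (- 1) ^ n"
  proof -
    have "coeff (monom (coef (D gen_y) w * (- 1) ^ ny w) (ny w)) (n + 1) = 0"
      if "nx w + p * ny w = m" for w
    proof -
      have "ny w \<noteq> n + 1"
      proof
        assume "ny w = n + 1"
        then have "p * (n + 1) \<le> m" using that by simp
        then show False using p by (simp add: mult.commute)
      qed
      then show ?thesis by simp
    qed
    moreover have "(\<Sum>w\<in>{w\<in>words (D gen_x). nx w + p * ny w = p * n}.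
        coeff (monom (of_nat p * coef (D gen_x) w * (- 1) ^ ny w) (ny w + 1)) (n + 1))
      = (\<Sum>w\<in>{w\<in>words (D gen_x). nx w + p * ny w = p * n}.
          if w = replicate n Letter_y then of_nat p * coef (D gen_x) w * (- 1) ^ n else 0)"
    proof (rule sum.cong)
      fix w assume w: "w \<in> {w\<in>words (D gen_x). nx w + p * ny w = p * n}"
      show "coeff (monom (of_nat p * coef (D gen_x) w * (- 1) ^ ny w) (ny w + 1)) (n + 1)
        = (if w = replicate n Letter_y then of_nat p * coef (D gen_x) w * (- 1) ^ n else 0)"
      proof (cases "ny w = n")
        case True
        then have "nx w = 0" using w by simp
        then show ?thesis using True nx_0_iff[of w] by simp
      next
        case False
        then show ?thesis by auto
      qed
    qed simp
    ultimately show ?thesis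
      unfolding K_def coeff_add coeff_sum by (simp add: in_keys_iff sum.delta)
  qed
  moreover have "coef (D gen_x) (replicate n Letter_y) \<noteq> 0"
    using PQ(2) mn(2) coeff_evp_pure_y[of "D gen_x" n] by (metis Qd_def leading_coeff_0_iff)
  ultimately have "coeff K (n + 1) \<noteq> 0" using p0 by simp
  then have "degree K \<ge> 1" using le_degree by fastforce
  then have "\<not> constant (poly K)" by (simp add: constant_degree)
  then obtain c where c: "poly K c = 0" using fundamental_theorem_of_algebra by blast
  have "sz (R c) < sz (Pd D)"
  proof (cases "R c = 0")
    case False
    then have "degree (R c) \<noteq> m" using top[of c] c by auto
    then show ?thesis using deg[of c] False PQ mn by (simp add: sz_def)
  qed (use PQ in \<open>simp add: sz_def\<close>)
  then show ?thesis using P[of c] Q[of c] eu_tame[of c p] by (intro bexI[of _ "eu c p"]) simp_all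
qed

text \<open>In the final form \<open>D y = 0\<close>, and \<open>D x\<close> is a polynomial in \<open>y\<close>.\<close>

lemma lnd_normal_form:
  assumes "symp_lnd D"
  shows "\<exists>\<tau>\<in>tame. conjd D \<tau> gen_y = 0 \<and> (\<forall>w\<in>words (conjd D \<tau> gen_x). nx w = 0)"
  using assms
proof (induction "sz (Pd D) + sz (Qd D)" arbitrary: D rule: less_induct)
  case less
  note D = less.prems
  have sw: "swap \<in> tame" "id \<in> tame" by (simp_all add: tame_Aff swap_in_Aff Aff_id)
  have S: "symp_lnd (conjd D swap)" by (rule symp_lnd_conjd[OF swap_in_autG D])
  have step: ?case if "\<rho> \<in> tame" "sz (Pd (conjd D \<rho>)) + sz (Qd (conjd D \<rho>)) < sz (Pd D) + sz (Qd D)" for \<rho>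
  proof -
    from less.hyps[OF that(2) symp_lnd_conjd[OF tame_subset[OF that(1)] D]] obtain \<tau> where t: "\<tau> \<in> tame"
      "conjd (conjd D \<rho>) \<tau> gen_y = 0" "\<forall>w\<in>words (conjd (conjd D \<rho>) \<tau> gen_x). nx w = 0" by blast
    then show ?thesis
      using conjd_comp[OF tame_subset[OF that(1)] tame_subset[OF t(1)], of D] tame_comp[OF that(1) t(1)] by auto
  qed
  consider "Pd D = 0" | "Qd D = 0" | "Pd D \<noteq> 0" "Qd D \<noteq> 0" "(degree (Qd D) + 1) dvd (degree (Pd D) + 1)"
    | "Pd D \<noteq> 0" "Qd D \<noteq> 0" "(degree (Pd D) + 1) dvd (degree (Qd D) + 1)"
    using edge_slope[OF D _ _ refl refl] by blast
  then show ?case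
  proof cases
    case 1
    have "conjd D id = D" by (simp add: conjd_def)
    then show ?thesis using Pd_0[OF D 1] sw by (intro bexI[of _ id]) auto
  next
    case 2
    then have "Pd (conjd D swap) = 0" by (simp add: swap_PQ[OF D])
    then show ?thesis using Pd_0[OF S] sw by blast
  next
    case 3
    then show ?thesis using shorten_edge[OF D] step by blast
  next
    case 4
    note e = swap_PQ[OF D]
    have "\<exists>\<tau>\<in>tame. sz (Pd (conjd (conjd D swap) \<tau>)) + sz (Qd (conjd (conjd D swap) \<tau>))
        < sz (Pd (conjd D swap)) + sz (Qd (conjd D swap))"
      by (rule shorten_edge[OF S]) (use 4 e in simp_all)
    then obtain \<tau> where t: "\<tau> \<in> tame" "sz (Pd (conjd (conjd D swap) \<tau>)) + sz (Qd (conjd (conjd D swap) \<tau>))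
        < sz (Pd (conjd D swap)) + sz (Qd (conjd D swap))" by blast
    moreover have "sz (Pd (conjd D swap)) + sz (Qd (conjd D swap)) = sz (Pd D) + sz (Qd D)"
      unfolding sz_def e(3,4) by (simp add: e(1))
    ultimately show ?thesis
      using step[of "swap \<circ> \<tau>"] sw tame_comp conjd_comp[OF swap_in_autG tame_subset[OF t(1)], of D] by simp
  qed
qed

section \<open>Generation by affine and triangular automorphisms\<close>

lemma wle_iff_dg: "wle 1 1 (int k) p \<longleftrightarrow> dg p \<le> k"
proof -
  have "wt 1 1 w = int (length w)" for w by (simp add: wt_def length_nx_ny)
  then show ?thesis unfolding degree_le_iff[symmetric] by (simp add: wle_def degree_le_def)
qed

lemma derivation_pol_0: "derivation D \<Longrightarrow> D g = 0 \<Longrightarrow> D (pol q g) = 0"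
  by (induction q rule: pCons_induct) (simp_all add: pol_pCons derivation_simps)

lemma symp_lnd_der_y: "symp_lnd (der (pol q gen_y) 0)"
  unfolding symp_lnd_def
proof (intro conjI allI)
  let ?D = "der (pol q gen_y) 0"
  show d: "derivation ?D" by (rule derivation_der)
  show "?D (commutator gen_x gen_y) = 0"
    using pol_commute[of gen_y gen_y q] by (simp add: commutator_def derivation_simps[OF d])
  fix p
  have y: "wle 1 0 0 (pol q gen_y)"
  proof (induction q rule: pCons_induct)
    case (pCons a q)
    have "wle 1 0 (0 + 0) (pol q gen_y * gen_y)" using pCons.IH wle_gens(2) by (rule wle_mult)
    moreover have "wle 1 0 0 (scalar a)" by (simp add: scalar_def wle_term1)
    ultimately show ?case by (simp add: pol_pCons wle_add)
  qed simp
  have "wle 1 0 (int (dg p)) p"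
    unfolding wle_def wt_def using coef_eq_0_above_dg[of p]
    by (force simp: in_keys_iff length_nx_ny)
  then have "wle 1 0 (int (dg p) + int n * (- 1)) ((?D ^^ n) p)" for n
    using y by (intro derivation_power_wle[OF d]) simp_all
  from this[of "Suc (dg p)"] have "\<forall>w\<in>words ((?D ^^ Suc (dg p)) p). False"
    by (simp add: wle_def wt_def del: funpow.simps)
  then have "(?D ^^ Suc (dg p)) p = 0" using ex_word by blast
  then show "\<exists>n. (?D ^^ n) p = 0" by blast
qed

lemma commuting_derivations:
  assumes A: "derivation A" and B: "derivation B"
    and "A (B gen_x) = B (A gen_x)" "A (B gen_y) = B (A gen_y)"
  shows "A (B p) = B (A p)"
proof -
  have "derivation (\<lambda>p. A (B p) - B (A p))"
    unfolding derivation_def by (simp add: derivation_simps[OF A] derivation_simps[OF B] algebra_simps)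
  moreover have "derivation (\<lambda>p. 0)" by (simp add: derivation_def)
  ultimately have "(\<lambda>p. A (B p) - B (A p)) = (\<lambda>p. 0)"
    by (rule derivation_eqI) (simp_all add: assms)
  then show ?thesis by (metis eq_iff_diff_eq_0)
qed

text \<open>In commutative terms, a polynomial with constant derivative \<open>u\<close> in \<open>x\<close> is \<open>u x\<close> plus a polynomial in \<open>y\<close>.\<close>

lemma evp_of_dx_const:
  assumes "dx p = scalar u" shows "evp F G p = smult u F + evp 0 G p"
proof -
  have ev: "ev a b p = ev 0 b p + u * a" for a b
  proof -
    have "pderiv (evp tvar [:b:] p) = [:u:]"
      unfolding pderiv_evp assms by (simp add: pderiv_pCons)
    also have "[:u:] = pderiv [:0, u:]" by (simp add: pderiv_pCons)
    finally have "pderiv (evp tvar [:b:] p - [:0, u:]) = 0" by (simp add: pderiv_diff)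
    then obtain v where v: "evp tvar [:b:] p - [:0, u:] = [:v:]"
      by (metis pderiv_eq_0_iff degree_eq_zeroE)
    have "ev a b p = v + a * u" for a
      using arg_cong[OF v, of "\<lambda>q. poly q a"] by (simp add: poly_evp algebra_simps)
    from this[of a] this[of 0] show ?thesis by simp
  qed
  have "poly (evp F G p) = poly (smult u F + evp 0 G p)"
    using ev[of "poly F _" "poly G _"] by (simp add: fun_eq_iff poly_evp add.commute)
  then show ?thesis by (simp only: poly_eq_poly_eq_iff)
qed

text \<open>Let \<open>f = \<sigma> x\<close>, \<open>g = \<sigma> y\<close>. The derivations \<open>D\<^sub>N = \<sigma> (y\<^sup>N \<partial>\<^sub>x) \<sigma>\<inverse>\<close> commute with each other and send \<open>f\<close> to \<open>g\<^sup>N\<close> and \<open>g\<close> to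
  \<open>0\<close>. By assumption \<open>D\<^sub>0 = r(y) \<partial>\<^sub>x\<close>, and \<open>D\<^sub>0 f = 1\<close> makes \<open>r\<close> a constant \<open>c\<close>. What commutes with \<open>\<partial>\<^sub>x\<close> is described by its
  support: \<open>D\<^sub>N y\<close> is constant and \<open>D\<^sub>N x\<close> is a polynomial in \<open>y\<close>. The constants vanish, and then \<open>D\<^sub>N x = c S(y)\<^sup>N\<close>,
  where \<open>S\<close> is the value of \<open>g\<close> at \<open>x = 0\<close> and has degree one. So \<open>D\<^sub>N\<close> raises degrees by at most \<open>N - 1\<close>, and
  \<open>N deg g \<le> deg f + N - 1\<close> for large \<open>N\<close> shows that \<open>g\<close> is affine.\<close>

lemma triangular_of_lnd:
  assumes s: "\<sigma> \<in> autG" and D1y: "conjd dx (finv \<sigma>) gen_y = 0"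
    and D1x: "\<forall>w\<in>words (conjd dx (finv \<sigma>) gen_x). nx w = 0"
  shows "\<sigma> \<in> triangular"
proof -
  define f g where fg: "f = \<sigma> gen_x" "g = \<sigma> gen_y"
  note i = autG_inv[OF s]
  define DD where "DD N = conjd (der (gen_y ^ N) 0) (finv \<sigma>)" for N
  have DD: "symp_lnd (DD N)" for N
    using symp_lnd_conjd[OF i symp_lnd_der_y[of "monom 1 N"]] by (simp add: DD_def pol_monom)
  note dd = symp_lnd_D(1)[OF DD]
  have DDf: "DD N f = g ^ N" and DDg: "DD N g = 0" for N
    by (simp_all add: DD_def conjd_def fg autG_inv_comp(3) s autG_simps[OF s])
  define r where "r = evp 0 tvar (DD 0 gen_x)"
  have D0x: "DD 0 gen_x = pol r gen_y" unfolding r_def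
    by (rule pol_of_pure_y) (use D1x in \<open>simp add: DD_def in_keys_iff\<close>)
  have D0y: "DD 0 gen_y = 0" using D1y by (simp add: DD_def)
  \<comment> \<open>At a root b of r the derivation would vanish for y = b, but its value on f is 1.\<close>
  have "constant (poly r)"
  proof (rule ccontr)
    assume "\<not> constant (poly r)"
    then obtain b where b: "poly r b = 0" using fundamental_theorem_of_algebra by blast
    have "pcompose r [:b:] = 0" using b by (simp add: poly_eq_poly_eq_iff[symmetric] fun_eq_iff poly_pcompose)
    then have "evp 0 [:b:] (DD 0 f) = 0"
      unfolding evp_derivation[OF dd, of _ _ _ f] by (simp add: D0x D0y evp_pol)
    then show False by (simp add: DDf)
  qed
  then have "degree r = 0" by (simp add: constant_degree)
  then obtain c where c: "r = [:c:]" by (rule degree_eq_zeroE)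
  have D0: "DD 0 p = scalar c * dx p" for p
  proof -
    have "derivation (\<lambda>p. scalar c * dx p)"
      unfolding derivation_def
      by (simp add: derivation_simps[OF derivation_der] distrib_left mult.assoc scalar_left_commute[of _ c, symmetric])
    then have "DD 0 = (\<lambda>p. scalar c * dx p)"
      by (rule derivation_eqI[OF dd]) (simp_all add: D0x D0y c)
    then show ?thesis by metis
  qed
  have one: "scalar c * dx f = 1" using DDf[of 0] D0 by simp
  then have c0: "c \<noteq> 0" by auto
  have cancel: "p = scalar (inverse c) * (scalar c * p)" for p
    using c0 by (simp add: mult.assoc[symmetric] scalar_mult[symmetric])
  have dxf: "dx f = scalar (inverse c)" using cancel[of "dx f"] one by simp
  have dxg: "dx g = 0" using cancel[of "dx g"] DDg[of 0] D0 by simp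
  have comm0: "DD M (DD N p) = DD N (DD M p)" for M N p
  proof -
    have z: "der (gen_y ^ N) 0 (gen_y ^ M) = 0" for M N
      using derivation_pol_0[OF derivation_der, of _ _ gen_y "monom 1 M"] by (simp add: pol_monom)
    have "der (gen_y ^ M) 0 (der (gen_y ^ N) 0 q) = der (gen_y ^ N) 0 (der (gen_y ^ M) 0 q)" for q
      by (rule commuting_derivations) (simp_all add: derivation_der z derivation_simps(5)[OF derivation_der])
    then show ?thesis by (simp add: DD_def conjd_def s autG_inv_comp(3) i)
  qed
  have shape: "\<exists>k. DD N gen_y = scalar k" "\<exists>q. DD N gen_x = pol q gen_y" for N
  proof -
    have "dx (DD N gen_y) = 0"
      using cancel[of "dx (DD N gen_y)"] comm0[of 0 N gen_y] D0 D0y by (simp add: derivation_simps[OF dd])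
    then have "pderiv (Pd (DD N)) = 0" unfolding Pd_def pderiv_evp by simp
    then have deg: "degree (Pd (DD N)) = 0" by (simp add: pderiv_eq_0_iff)
    have "(\<exists>k. DD N gen_y = scalar k) \<and> (\<forall>w\<in>words (DD N gen_x). nx w = 0)"
    proof -
      consider "Pd (DD N) = 0" | "Qd (DD N) = 0" | "Pd (DD N) \<noteq> 0" "Qd (DD N) \<noteq> 0" by blast
      then show ?thesis
      proof cases
        case 1
        then have "DD N gen_y = scalar 0" using Pd_0[OF DD] by simp
        then show ?thesis using Pd_0[OF DD 1] by blast
      next
        case 2
        have "coef (DD N gen_y) w = 0" if "w \<noteq> []" for w
        proof (cases "ny w = 0")
          case True
          then have w: "w = replicate (nx w) Letter_x" by (simp add: ny_0_iff)
          then have "nx w > 0" using that by (cases "nx w") auto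
          then have "coeff (Pd (DD N)) (nx w) = 0" using deg by (intro coeff_eq_0) simp
          then show ?thesis using w coeff_evp_pure_x[of "DD N gen_y" "nx w"] by (simp add: Pd_def)
        next
          case False
          then show ?thesis using Qd_0(2)[OF DD 2, of w] by (auto simp: in_keys_iff)
        qed
        then have "dg (DD N gen_y) \<le> 0" by (intro degree_leI) fastforce
        then show ?thesis using Qd_0(1)[OF DD 2] by (auto simp: dg_0_iff)
      next
        case 3
        note wb = weight_bound[OF DD 3 refl refl, unfolded deg, simplified]
        define n where "n = int (degree (Qd (DD N)))"
        have nn: "n \<ge> 0" by (simp add: n_def)
        have "length w \<le> 0" if "coef (DD N gen_y) w \<noteq> 0" for w
        proof -
          have "w \<in> words (DD N gen_y)" using that by (simp add: in_keys_iff)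
          from wb[OF supp_y[of w "DD N", OF this]] have "(1 + n) * int (nx w) + int (ny w) \<le> 0"
            by (simp add: n_def algebra_simps)
          moreover have "(1 + n) * int (nx w) = int (nx w) + n * int (nx w)" by (simp add: algebra_simps)
          moreover have "n * int (nx w) \<ge> 0" using nn by simp
          ultimately show ?thesis unfolding length_nx_ny by linarith
        qed
        then have "dg (DD N gen_y) \<le> 0" by (rule degree_leI)
        moreover have "nx w = 0" if "w \<in> words (DD N gen_x)" for w
        proof (rule ccontr)
          assume "nx w \<noteq> 0"
          then have "(1 + n) * (int (nx w) - 1) \<ge> 0" using nn by simp
          then show False using wb[OF supp_x[of w "DD N", OF that]] by (simp add: n_def algebra_simps)
        qed
        ultimately show ?thesis by (auto simp: dg_0_iff)
      qed
    qed
    then show "\<exists>k. DD N gen_y = scalar k" "\<exists>q. DD N gen_x = pol q gen_y"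
      using pol_of_pure_y[of "DD N gen_x"] by (auto simp: in_keys_iff)
  qed
  obtain k where k: "\<And>N. DD N gen_y = scalar (k N)" using shape(1) by metis
  obtain q where q: "\<And>N. DD N gen_x = pol (q N) gen_y" using shape(2) by metis
  have DDpol: "DD N (pol u gen_y) = pol (smult (k N) (pderiv u)) gen_y" for N u
  proof (induction u rule: pCons_induct)
    case (pCons a u)
    have "DD N (pol (pCons a u) gen_y) = pol (smult (k N) (pderiv u)) gen_y * gen_y + scalar (k N) * pol u gen_y"
      using pCons by (simp add: pol_pCons derivation_simps[OF dd] k scalar_commute)
    then show ?case by (simp add: pderiv_pCons smult_add_right pol_add pol_smult pol_pCons add.commute)
  qed (simp add: derivation_simps[OF dd])
  have g1: "dg g \<ge> 1"
  proof (rule ccontr)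
    assume "\<not> dg g \<ge> 1"
    then obtain h where "g = scalar h" using dg_0_iff[of g] by auto
    then have "commutator f g = 0" by (simp add: commutator_simps)
    then show False using autG_commutator'[OF s] commutator_gens_neq_0 by (simp add: fg)
  qed
  \<comment> \<open>Commuting of two of the derivations makes a combination of them and of dx vanish, which gives a polynomial relation for g unless the constants are zero.\<close>
  have k0: "k N = 0" for N
  proof (rule ccontr)
    assume kN: "k N \<noteq> 0"
    define M where "M = Suc N"
    have "pol (smult (k N) (pderiv (q M))) gen_y = pol (smult (k M) (pderiv (q N))) gen_y"
      using comm0[of N M gen_x] by (simp add: q DDpol)
    then have "pol (smult (k N) (pderiv (q M)) - smult (k M) (pderiv (q N))) gen_y = 0"
      by (simp only: diff_conv_add_uminus pol_add pol_minus) simp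
    then have "pderiv (smult (k N) (q M) - smult (k M) (q N)) = 0"
      using pol_eq_0_iff[of gen_y] by (simp add: pderiv_diff pderiv_smult)
    then obtain u where u: "smult (k N) (q M) - smult (k M) (q N) = [:u:]"
      by (metis pderiv_eq_0_iff degree_eq_zeroE)
    define E where "E p = scalar (k N) * DD M p - scalar (k M) * DD N p - scalar u * dx p" for p
    have "derivation E"
      unfolding derivation_def E_def
      by (simp add: derivation_simps[OF dd] derivation_simps[OF derivation_der] algebra_simps scalar_left_commute)
    moreover have "derivation (\<lambda>p. 0)" by (simp add: derivation_def)
    moreover have "E gen_x = 0"
    proof -
      have "E gen_x = pol (smult (k N) (q M) - smult (k M) (q N)) gen_y - scalar u"
        unfolding diff_conv_add_uminus[of "smult (k N) (q M)"] pol_add pol_minus by (simp add: E_def q pol_smult)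
      then show ?thesis by (simp add: u)
    qed
    moreover have "E gen_y = 0"
      by (simp add: E_def k scalar_mult[symmetric] mult.commute)
    ultimately have "E = (\<lambda>p. 0)" by (intro derivation_eqI) simp_all
    then have "E f = 0" by metis
    then have "pol (monom (k N) M - monom (k M) N - [:u * inverse c:]) g = 0"
      by (simp add: E_def DDf dxf pol_add pol_minus pol_monom diff_conv_add_uminus scalar_mult del: add_uminus_conv_diff minus_pCons)
    then have "coeff (monom (k N) M - monom (k M) N - [:u * inverse c:]) M = 0"
      using pol_eq_0_iff[OF g1] by (metis coeff_0)
    then show False using kN by (simp add: M_def)
  qed
  define S where "S = evp 0 tvar g"
  have qN: "q N = smult c (S ^ N)" for N
  proof -
    have "S ^ N = evp 0 tvar (DD N f)" by (simp add: DDf S_def evp_power)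
    also have "\<dots> = smult (inverse c) (q N)"
      unfolding evp_derivation[OF dd, of _ _ _ f] by (simp add: q k k0 dxf evp_pol)
    finally show ?thesis using c0 by simp
  qed
  \<comment> \<open>Along the curve on which f vanishes the inverse automorphism recovers the parameter from S, so S is linear.\<close>
  have degS: "degree S = 1"
  proof -
    define F where "F = smult (- c) (evp 0 tvar f)"
    define P where "P = finv \<sigma> gen_y"
    have "evp F tvar f = 0" using evp_of_dx_const[OF dxf, of F tvar] c0 by (simp add: F_def)
    moreover have "evp F tvar g = S" using evp_of_dx_const[of g 0 F tvar] dxg by (simp add: S_def)
    moreover have "evp F tvar (\<sigma> P) = tvar" by (simp add: P_def s)
    ultimately have "evp 0 S P = tvar"
      using evp_endo[OF autG_alg_endo[OF s], of F tvar P] by (simp add: fg)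
    then have "pcompose (evp 0 tvar P) S = tvar" unfolding pcompose_evp by (simp add: pcompose_pCons)
    then have "degree (pcompose (evp 0 tvar P) S) = degree tvar" by simp
    then have "degree (evp 0 tvar P) * degree S = 1" by (simp add: degree_pcompose)
    then show ?thesis by simp
  qed
  have "dg g \<le> 1"
  proof (rule ccontr)
    assume "\<not> dg g \<le> 1"
    \<comment> \<open>For N > deg f the bound N deg g \<le> deg f + N - 1 leaves only deg g \<le> 1.\<close>
    define N where "N = Suc (dg f)"
    have "degree (q N) \<le> N" using degree_power_le[of S N] degS by (simp add: qN)
    then have "dg (pol (q N) gen_y) \<le> N" using dg_pol_le[of "q N" gen_y] by simp
    then have "wle 1 1 (1 + (int N - 1)) (DD N gen_x)" "wle 1 1 (1 + (int N - 1)) (DD N gen_y)"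
      using wle_iff_dg[of N] by (simp_all add: q k k0)
    then have "wle 1 1 (int (dg f) + (int N - 1)) (DD N f)"
      by (rule derivation_wle[OF dd]) (simp add: wle_iff_dg)
    then have "wle 1 1 (int (2 * dg f)) (g ^ N)" by (simp add: DDf N_def)
    then have "dg (g ^ N) \<le> 2 * dg f" by (simp only: wle_iff_dg)
    then have "N * dg g \<le> 2 * dg f" by (simp add: dg_power)
    moreover have "N * 2 \<le> N * dg g" using \<open>\<not> dg g \<le> 1\<close> by (intro mult_left_mono) auto
    ultimately show False by (simp add: N_def)
  qed
  then obtain a b e where ab: "g = affine a b e" using dg_le_1D by blast
  have "dx g = scalar a" unfolding ab affine_def by (simp add: derivation_simps[OF derivation_der])
  then have "a = 0" using dxg by (metis scalar_eq_0_iff)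
  then show ?thesis using triangularI[OF s, of b e] ab fg by (simp add: affine_def)
qed

text \<open>The normal form of \<open>\<sigma> \<partial>\<^sub>x \<sigma>\<inverse>\<close> is reached by conjugation with a tame automorphism \<open>\<tau>\<close>, and it is the conjugate of
  \<open>\<partial>\<^sub>x\<close> by \<open>\<tau>\<inverse> \<sigma>\<close>; so the latter is triangular.\<close>

theorem autG_eq_tame: "autG = tame"
proof
  show "tame \<subseteq> autG" using tame_subset by blast
  show "autG \<subseteq> tame"
  proof
    fix \<sigma> assume s: "\<sigma> \<in> autG"
    have "symp_lnd dx" using symp_lnd_der_y[of "[:1:]"] by simp
    then have D: "symp_lnd (conjd dx (finv \<sigma>))" using symp_lnd_conjd autG_inv s by blast
    obtain \<tau> where t: "\<tau> \<in> tame" "conjd (conjd dx (finv \<sigma>)) \<tau> gen_y = 0"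
      "\<forall>w\<in>words (conjd (conjd dx (finv \<sigma>)) \<tau> gen_x). nx w = 0" using lnd_normal_form[OF D] by blast
    have tG: "\<tau> \<in> autG" using t tame_subset by blast
    define \<rho> where "\<rho> = finv \<tau> \<circ> \<sigma>"
    have r: "\<rho> \<in> autG" "finv \<rho> = finv \<sigma> \<circ> \<tau>"
      using s tG by (simp_all add: \<rho>_def autG_comp autG_inv inv_comp autG_inv_comp(3))
    have "conjd (conjd dx (finv \<sigma>)) \<tau> = conjd dx (finv \<rho>)"
      using conjd_comp[OF autG_inv[OF s] tG] r by simp
    then have "\<rho> \<in> triangular" using triangular_of_lnd[OF r(1)] t by simp
    moreover have "\<sigma> = \<tau> \<circ> \<rho>" using tG by (auto simp: \<rho>_def)
    ultimately show "\<sigma> \<in> tame" using t tame_comp tame_triangular by blast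
  qed
qed

section \<open>Degree growth along words in affine and triangular automorphisms\<close>

text \<open>Words in affine and elementary automorphisms in which every nonaffine elementary factor makes the degree grow.\<close>

inductive_set chain :: "(free_alg \<Rightarrow> free_alg) set" where
  base: "\<sigma> \<in> Aff \<Longrightarrow> \<sigma> \<in> chain"
| step: "\<lbrakk>\<sigma> \<in> chain; dg (\<sigma> gen_x) \<le> dg (\<sigma> gen_y); degree q \<ge> 2; \<alpha> \<in> Aff\<rbrakk> \<Longrightarrow> \<sigma> \<circ> el q \<circ> \<alpha> \<in> chain"

lemma chain_subset: "\<sigma> \<in> chain \<Longrightarrow> \<sigma> \<in> autG"
  by (induction rule: chain.induct) (blast intro: Aff_subset autG_comp el_in_autG)+

lemma dg_gens_ge_1:
  assumes s: "\<sigma> \<in> autG" shows "dg (\<sigma> gen_x) \<ge> 1" "dg (\<sigma> gen_y) \<ge> 1"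
proof -
  have "\<not> dg (\<sigma> gen_x) = 0"
    using autG_commutator'[OF s] commutator_gens_neq_0 by (auto simp: dg_0_iff commutator_simps)
  moreover have "\<not> dg (\<sigma> gen_y) = 0"
    using autG_commutator'[OF s] commutator_gens_neq_0 by (auto simp: dg_0_iff commutator_simps)
  ultimately show "dg (\<sigma> gen_x) \<ge> 1" "dg (\<sigma> gen_y) \<ge> 1" by simp_all
qed

lemma dg_step:
  assumes s: "\<sigma> \<in> autG" and le: "dg (\<sigma> gen_x) \<le> dg (\<sigma> gen_y)" and q: "degree q \<ge> 2"
  shows "dg (\<sigma> (el q gen_x)) = degree q * dg (\<sigma> gen_y)" "dg (\<sigma> (el q gen_x)) > dg (\<sigma> gen_y)"
proof -
  note y = dg_gens_ge_1(2)[OF s]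
  have *: "dg (pol q (\<sigma> gen_y)) = degree q * dg (\<sigma> gen_y)" by (rule dg_pol[OF y])
  have "2 * dg (\<sigma> gen_y) \<le> degree q * dg (\<sigma> gen_y)" using q by (intro mult_right_mono) auto
  then have lt: "dg (\<sigma> gen_y) < degree q * dg (\<sigma> gen_y)" using y by linarith
  then have "dg (\<sigma> gen_x) < dg (pol q (\<sigma> gen_y))" using le * by linarith
  then show "dg (\<sigma> (el q gen_x)) = degree q * dg (\<sigma> gen_y)"
    using dg_add_eq(1)[of "\<sigma> gen_x" "pol q (\<sigma> gen_y)"] * by (simp add: autG_simps[OF s] autG_pol[OF s])
  then show "dg (\<sigma> (el q gen_x)) > dg (\<sigma> gen_y)" using lt by simp
qed

lemma el_Aff: "degree q \<le> 1 \<Longrightarrow> el q \<in> Aff"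
  using dg_pol_le[of q gen_y] by (simp add: Aff_def el_in_autG dg_add_le)

lemma chain_Aff: "\<sigma> \<in> chain \<Longrightarrow> \<alpha> \<in> Aff \<Longrightarrow> \<sigma> \<circ> \<alpha> \<in> chain"
  by (induction rule: chain.cases) (auto simp: o_assoc[symmetric] intro: chain.intros Aff_comp chain.step[unfolded o_assoc[symmetric]])

lemma autG_affine: "\<sigma> \<in> autG \<Longrightarrow> \<sigma> (affine a b e) = scalar a * \<sigma> gen_x + scalar b * \<sigma> gen_y + scalar e"
  by (simp add: affine_def autG_simps)

text \<open>If the last affine factor preserves the line of \<open>y\<close>, it can be moved past the new elementary factor, which merges with
  the preceding one. Otherwise it moves the dominating degree to the image of \<open>y\<close>, as the next factor requires.\<close>

lemma chain_el: assumes t: "\<tau> \<in> chain" shows "\<tau> \<circ> el q \<in> chain"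
proof (cases "degree q \<le> 1")
  case True
  then show ?thesis using t chain_Aff el_Aff by blast
next
  case False
  then have q: "degree q \<ge> 2" by simp
  have *: "\<tau> \<circ> el q \<in> chain" if "dg (\<tau> gen_x) \<le> dg (\<tau> gen_y)"
    using chain.step[OF t that q Aff_id] by simp
  from t show ?thesis
  proof cases
    case base
    then have "dg (\<tau> gen_x) \<le> dg (\<tau> gen_y)" using dg_gens_ge_1(2)[OF Aff_subset[OF base]] by (simp add: Aff_def)
    then show ?thesis using * by blast
  next
    case (step \<sigma> q0 \<alpha>)
    note s = chain_subset[OF step(2)]
    obtain a b e c d h where al: "a * d - b * c = 1" "\<alpha> = aff a b e c d h" using Aff_D step(5) by blast
    have al': "\<alpha> \<in> autG" using step(5) Aff_subset by blast
    show ?thesis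
    proof (cases "c = 0")
      case True
      \<comment> \<open>The elementary factor that results from moving el q to the left past the affine one.\<close>
      define q' where "q' = smult d (pcompose q [:h, d:])"
      have ad: "a * d = 1" using al True by simp
      have y: "\<alpha> gen_y = pol [:h, d:] gen_y"
        using True al by (simp add: aff_gens affine_def pol_pCons)
      have "\<alpha> \<circ> el q = el q' \<circ> \<alpha>"
      proof (rule autG_eqI)
        show "\<alpha> \<circ> el q \<in> autG" "el q' \<circ> \<alpha> \<in> autG" using al' by (simp_all add: autG_comp el_in_autG)
        have x: "\<alpha> gen_x = affine a b e" by (simp add: al aff_gens)
        have "scalar a * pol q' gen_y = pol q (\<alpha> gen_y)"
          unfolding y pol_pcompose using ad
          by (simp add: q'_def pol_smult mult.assoc[symmetric] scalar_mult[symmetric])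
        then show "(\<alpha> \<circ> el q) gen_x = (el q' \<circ> \<alpha>) gen_x"
          by (simp add: x autG_simps[OF al'] autG_pol[OF al'] autG_affine[OF el_in_autG] distrib_left)
            (simp add: affine_def)
        show "(\<alpha> \<circ> el q) gen_y = (el q' \<circ> \<alpha>) gen_y"
          by (simp add: y autG_pol[OF el_in_autG])
      qed
      then have "\<tau> \<circ> el q = \<sigma> \<circ> (el q0 \<circ> el q') \<circ> \<alpha>" using step(1) by (metis o_assoc)
      then have eq: "\<tau> \<circ> el q = \<sigma> \<circ> el (q0 + q') \<circ> \<alpha>" by (simp only: el_comp)
      show ?thesis
      proof (cases "degree (q0 + q') \<le> 1")
        case True
        then show ?thesis unfolding eq using step chain_Aff el_Aff by blast
      next
        case False
        then show ?thesis unfolding eq using step by (intro chain.step) auto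
      qed
    next
      case False
      define F where "F = \<sigma> (el q0 gen_x)"
      note ds = dg_step[OF s step(3,4), folded F_def]
      have se: "\<sigma> \<circ> el q0 \<in> autG" using s by (simp add: autG_comp el_in_autG)
      have "\<tau> gen_x = (\<sigma> \<circ> el q0) (affine a b e)" "\<tau> gen_y = (\<sigma> \<circ> el q0) (affine c d h)"
        using step(1) al(2) by (simp_all add: aff_gens)
      then have x: "\<tau> gen_x = scalar a * F + scalar b * \<sigma> gen_y + scalar e"
        and y: "\<tau> gen_y = scalar c * F + (scalar d * \<sigma> gen_y + scalar h)"
        unfolding autG_affine[OF se] by (simp_all add: F_def add.assoc)
      have "dg (scalar d * \<sigma> gen_y + scalar h) \<le> dg (\<sigma> gen_y)"
        by (intro dg_add_le dg_scalar_mult_le) simp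
      then have "dg (\<tau> gen_y) = dg (scalar c * F)"
        unfolding y using False ds(2) by (intro dg_add_eq) (simp add: dg_scalar_mult)
      then have "dg (\<tau> gen_y) = dg F" using False by (simp add: dg_scalar_mult)
      moreover have "dg (scalar b * \<sigma> gen_y) \<le> dg F" using dg_scalar_mult_le[of b "\<sigma> gen_y"] ds(2) by linarith
      then have "dg (\<tau> gen_x) \<le> dg F"
        unfolding x by (intro dg_add_le dg_scalar_mult_le) simp_all
      ultimately show ?thesis using * by simp
    qed
  qed
qed

lemma triangular_el_Aff: assumes "\<sigma> \<in> triangular" shows "\<exists>q. \<exists>\<alpha>\<in>Aff. \<sigma> = el q \<circ> \<alpha>"
proof -
  obtain a h q where s: "a \<noteq> 0" "\<sigma> gen_x = scalar a * gen_x + pol q gen_y" "\<sigma> gen_y = scalar (inverse a) * gen_y + scalar h"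
    using triangular_decomp[OF assms] by blast
  define \<alpha> where "\<alpha> = aff a 0 0 0 (inverse a) h"
  have al: "\<alpha> \<in> Aff" unfolding \<alpha>_def by (rule Aff_I) (use s in simp)
  have "\<sigma> = el (smult (inverse a) q) \<circ> \<alpha>"
  proof (rule autG_eqI)
    show "\<sigma> \<in> autG" "el (smult (inverse a) q) \<circ> \<alpha> \<in> autG"
      using assms al by (simp_all add: triangular_subset autG_comp el_in_autG Aff_subset)
    show "\<sigma> gen_x = (el (smult (inverse a) q) \<circ> \<alpha>) gen_x" "\<sigma> gen_y = (el (smult (inverse a) q) \<circ> \<alpha>) gen_y"
      using s(1) unfolding s \<alpha>_def
      by (simp_all add: aff_gens autG_affine[OF el_in_autG] distrib_left pol_smult mult.assoc[symmetric] scalar_mult[symmetric])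
  qed
  then show ?thesis using al by blast
qed

lemma chain_triangular: "\<tau> \<in> chain \<Longrightarrow> \<sigma> \<in> triangular \<Longrightarrow> \<tau> \<circ> \<sigma> \<in> chain"
  using triangular_el_Aff[of \<sigma>] chain_el chain_Aff by (metis o_assoc)

theorem autG_eq_chain: "autG = chain"
proof
  show "chain \<subseteq> autG" using chain_subset by blast
  have gen: "\<tau> \<circ> \<sigma> \<in> chain" if "\<sigma> \<in> generate sympl_aut (Aff \<union> triangular)" "\<tau> \<in> chain" for \<sigma> \<tau>
    using that
  proof (induction arbitrary: \<tau> rule: generate.induct)
    case one then show ?case by simp
  next
    case (incl h) then show ?case using chain_Aff chain_triangular by blast
  next
    case (inv h)
    then have "inv\<^bsub>sympl_aut\<^esub> h = finv h" "finv h \<in> Aff \<union> triangular"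
      using inv_sympl_aut Aff_subset triangular_subset Aff_inv triangular_inv by blast+
    then show ?case using inv(2) chain_Aff chain_triangular by (metis UnE)
  next
    case (eng h1 h2)
    have "\<tau> \<circ> (h1 \<circ> h2) = (\<tau> \<circ> h1) \<circ> h2" by (simp add: o_assoc)
    then show ?case using eng by (simp only: mult_sympl_aut)
  qed
  show "autG \<subseteq> chain"
  proof
    fix \<sigma> assume "\<sigma> \<in> autG"
    then have "\<sigma> \<in> generate sympl_aut (Aff \<union> triangular)" using autG_eq_tame by (simp add: tame_def)
    from gen[OF this chain.base[OF Aff_id]] show "\<sigma> \<in> chain" by simp
  qed
qed

lemma dg_endo_le:
  assumes s: "alg_endo \<sigma>" and M: "dg (\<sigma> gen_x) \<le> M" "dg (\<sigma> gen_y) \<le> M"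
  shows "dg (\<sigma> p) \<le> dg p * M"
proof -
  have w: "dg (\<sigma> (term1 w 1)) \<le> length w * M" for w
  proof (induction w)
    case Nil then show ?case by (simp add: term1_gens alg_endo_simps[OF s])
  next
    case (Cons a w)
    have "dg (\<sigma> (case a of Letter_x \<Rightarrow> gen_x | Letter_y \<Rightarrow> gen_y)) \<le> M" using M by (cases a) auto
    then show ?case using Cons dg_mult_le[of "\<sigma> (case a of Letter_x \<Rightarrow> gen_x | Letter_y \<Rightarrow> gen_y)" "\<sigma> (term1 w 1)"]
      by (simp add: term1_Cons alg_endo_simps[OF s])
  qed
  have "\<sigma> p = (\<Sum>w\<in>words p. scalar (coef p w) * \<sigma> (term1 w 1))"
    by (subst free_alg_as_sum[of p]) (simp add: alg_endo_simps[OF s])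
  also have "dg \<dots> \<le> dg p * M"
  proof (rule dg_sum_le)
    fix u assume "u \<in> words p"
    then have "length u \<le> dg p" using coef_eq_0_above_dg[of p u] by (force simp: in_keys_iff)
    then have "length u * M \<le> dg p * M" by (rule mult_right_mono) simp
    then show "dg (scalar (coef p u) * \<sigma> (term1 u 1)) \<le> dg p * M"
      using w[of u] dg_scalar_mult_le[of "coef p u" "\<sigma> (term1 u 1)"] by linarith
  qed
  finally show ?thesis .
qed

text \<open>The degree of an automorphism.\<close>

definition mdeg :: "(free_alg \<Rightarrow> free_alg) \<Rightarrow> nat" where
  "mdeg \<sigma> = max (dg (\<sigma> gen_x)) (dg (\<sigma> gen_y))"

lemma dg_le_mdeg: "alg_endo \<sigma> \<Longrightarrow> dg (\<sigma> p) \<le> dg p * mdeg \<sigma>"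
  by (rule dg_endo_le) (simp_all add: mdeg_def)

lemma mdeg_comp_le: "\<sigma> \<in> autG \<Longrightarrow> \<tau> \<in> autG \<Longrightarrow> mdeg (\<sigma> \<circ> \<tau>) \<le> mdeg \<tau> * mdeg \<sigma>"
proof -
  assume s: "\<sigma> \<in> autG" and "\<tau> \<in> autG"
  have "dg (\<sigma> p) \<le> mdeg \<tau> * mdeg \<sigma>" if "dg p \<le> mdeg \<tau>" for p
    using dg_le_mdeg[OF autG_alg_endo[OF s], of p] mult_right_mono[OF that, of "mdeg \<sigma>"] by linarith
  then show ?thesis by (simp add: mdeg_def)
qed

text \<open>Along a chain the degree of the image of \<open>x\<close> is multiplied exactly by the degree of the elementary factor, while for
  the inverse this factor is an upper bound.\<close>

lemma mdeg_inv_le: assumes "\<sigma> \<in> autG" shows "mdeg (finv \<sigma>) \<le> mdeg \<sigma>"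
proof -
  have "\<sigma> \<in> chain" using assms autG_eq_chain by simp
  then show ?thesis
  proof induction
    case (base \<sigma>)
    have "mdeg (finv \<sigma>) \<le> 1" using Aff_inv[OF base] by (simp add: mdeg_def Aff_def)
    also have "1 \<le> mdeg \<sigma>" using dg_gens_ge_1[OF Aff_subset[OF base]] by (simp add: mdeg_def le_max_iff_disj)
    finally show ?case .
  next
    case (step \<sigma> q \<alpha>)
    note s = chain_subset[OF step(1)] and a = Aff_subset[OF step(4)]
    have inv: "finv (\<sigma> \<circ> el q \<circ> \<alpha>) = finv \<alpha> \<circ> (el (- q) \<circ> finv \<sigma>)"
      using s a by (simp add: inv_comp autG_comp el_in_autG inv_el)
    have "mdeg (finv \<alpha>) \<le> 1" using Aff_inv[OF step(4)] by (simp add: mdeg_def Aff_def)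
    have "mdeg (el (- q)) \<le> degree q"
    proof -
      have "dg (pol (- q) gen_y) \<le> degree q" using dg_pol_le[of "- q" gen_y] by simp
      then show ?thesis using step(3) by (simp add: mdeg_def dg_add_le)
    qed
    have "mdeg (finv (\<sigma> \<circ> el q \<circ> \<alpha>)) \<le> mdeg (el (- q) \<circ> finv \<sigma>) * mdeg (finv \<alpha>)"
      unfolding inv using s a by (intro mdeg_comp_le autG_comp autG_inv el_in_autG)
    also have "\<dots> \<le> mdeg (el (- q) \<circ> finv \<sigma>) * 1"
      using \<open>mdeg (finv \<alpha>) \<le> 1\<close> by (intro mult_left_mono) auto
    also have "\<dots> \<le> mdeg (finv \<sigma>) * mdeg (el (- q))"
      using mdeg_comp_le[OF el_in_autG autG_inv[OF s]] by simp
    also have "\<dots> \<le> dg (\<sigma> gen_y) * degree q"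
      using step(2,5) \<open>mdeg (el (- q)) \<le> degree q\<close> by (intro mult_mono) (simp_all add: mdeg_def)
    also have "\<dots> = dg (\<sigma> (el q gen_x))" using dg_step(1)[OF s step(2,3)] by simp
    also have "\<dots> = dg ((\<sigma> \<circ> el q \<circ> \<alpha>) (finv \<alpha> gen_x))" using a by simp
    also have "\<dots> \<le> dg (finv \<alpha> gen_x) * mdeg (\<sigma> \<circ> el q \<circ> \<alpha>)"
      using s a by (intro dg_le_mdeg autG_alg_endo autG_comp el_in_autG)
    also have "\<dots> \<le> 1 * mdeg (\<sigma> \<circ> el q \<circ> \<alpha>)"
      using Aff_inv[OF step(4)] by (intro mult_right_mono) (simp_all add: Aff_def)
    finally show ?case by (simp only: mult_1)
  qed
qed

section \<open>Rooted trees\<close>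

text \<open>A tree given by the parents of its vertices; the height decreases towards the root, which is therefore reached.\<close>

locale rooted_tree =
  fixes V :: "'a set" and r :: 'a and p :: "'a \<Rightarrow> 'a" and ht :: "'a \<Rightarrow> nat"
  assumes root_in: "r \<in> V" and root [simp]: "p r = r"
    and p_in: "v \<in> V \<Longrightarrow> p v \<in> V"
    and ht_less: "v \<in> V \<Longrightarrow> v \<noteq> r \<Longrightarrow> ht (p v) < ht v"
begin

definition anc :: "'a \<Rightarrow> 'a set" where "anc v = {u. \<exists>n. u = (p ^^ n) v}"

text \<open>The number of ancestors (a vertex counting as its own ancestor) that are not shared. Integers are used since
  differences of distances occur throughout.\<close>

definition d :: "'a \<Rightarrow> 'a \<Rightarrow> int" where
  "d u v = int (card (anc u)) + int (card (anc v)) - 2 * int (card (anc u \<inter> anc v))"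

definition adj :: "'a \<Rightarrow> 'a \<Rightarrow> bool" where "adj u v \<longleftrightarrow> u \<noteq> v \<and> (p u = v \<or> p v = u)"

lemma anc_self: "v \<in> anc v" unfolding anc_def by (rule CollectI, rule exI[of _ 0]) simp

lemma anc_p: "u \<in> anc v \<Longrightarrow> p u \<in> anc v"
  unfolding anc_def by (auto intro: exI[of _ "Suc _"])

lemma anc_insert: "anc v = insert v (anc (p v))"
proof -
  have "u \<in> anc v \<Longrightarrow> u = v \<or> u \<in> anc (p v)" for u
  proof -
    assume "u \<in> anc v"
    then obtain n where "u = (p ^^ n) v" by (auto simp: anc_def)
    then show ?thesis by (cases n) (auto simp: anc_def funpow_swap1)
  qed
  moreover have "u \<in> anc (p v) \<Longrightarrow> u \<in> anc v" for u
  proof -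
    assume "u \<in> anc (p v)"
    then obtain n where "u = (p ^^ n) (p v)" by (auto simp: anc_def)
    then have "u = (p ^^ Suc n) v" by (simp add: funpow_swap1)
    then show "u \<in> anc v" unfolding anc_def by blast
  qed
  ultimately show ?thesis using anc_self by blast
qed

lemma anc_root: "anc r = {r}"
proof -
  have "(p ^^ n) r = r" for n by (induction n) simp_all
  then show ?thesis by (auto simp: anc_def)
qed

lemma anc_ht: "v \<in> V \<Longrightarrow> u \<in> anc v \<Longrightarrow> u \<in> V \<and> ht u \<le> ht v \<and> (ht u = ht v \<longrightarrow> u = v)"
proof (induction "ht v" arbitrary: v rule: less_induct)
  case less
  show ?case
  proof (cases "v = r \<or> u = v")
    case True
    then show ?thesis using less anc_root by auto
  next
    case False
    then have "u \<in> anc (p v)" using less anc_insert by blast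
    then show ?thesis using less.hyps[OF ht_less p_in] ht_less less.prems False by fastforce
  qed
qed

lemma finite_anc: "v \<in> V \<Longrightarrow> finite (anc v) \<and> card (anc v) \<le> ht v + 1 \<and> r \<in> anc v"
proof (induction "ht v" arbitrary: v rule: less_induct)
  case less
  show ?case
  proof (cases "v = r")
    case True
    then show ?thesis by (simp add: anc_root)
  next
    case False
    then have lt: "ht (p v) < ht v" and "p v \<in> V" using less.prems ht_less p_in by blast+
    then have "finite (anc (p v))" "card (anc (p v)) \<le> ht (p v) + 1" "r \<in> anc (p v)" using less.hyps by blast+
    then show ?thesis unfolding anc_insert[of v] using lt by (simp add: card_insert_if)
  qed
qed

lemma not_in_anc_p: "v \<in> V \<Longrightarrow> v \<noteq> r \<Longrightarrow> v \<notin> anc (p v)"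
  using anc_ht[of "p v" v] p_in ht_less[of v] by fastforce

lemma card_anc: "v \<in> V \<Longrightarrow> v \<noteq> r \<Longrightarrow> card (anc v) = Suc (card (anc (p v)))"
  using not_in_anc_p finite_anc p_in unfolding anc_insert[of v] by simp

lemma anc_trans: assumes "u \<in> anc v" shows "anc u \<subseteq> anc v"
proof
  fix w assume "w \<in> anc u"
  then obtain m n where "w = (p ^^ m) u" "u = (p ^^ n) v" using assms by (auto simp: anc_def)
  then have "w = (p ^^ (m + n)) v" by (simp add: funpow_add)
  then show "w \<in> anc v" unfolding anc_def by blast
qed

lemma anc_comparable:
  assumes "u \<in> anc v" "w \<in> anc v" shows "u \<in> anc w \<or> w \<in> anc u"
proof -
  obtain m n where mn: "u = (p ^^ m) v" "w = (p ^^ n) v" using assms by (auto simp: anc_def)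
  show ?thesis
  proof (cases "m \<le> n")
    case True
    then have "w = (p ^^ (n - m)) u" using mn by (simp add: funpow_add[symmetric, THEN fun_cong, simplified])
    then show ?thesis by (auto simp: anc_def)
  next
    case False
    then have "u = (p ^^ (m - n)) w" using mn by (simp add: funpow_add[symmetric, THEN fun_cong, simplified])
    then show ?thesis by (auto simp: anc_def)
  qed
qed

text \<open>Two sets of common ancestors inside one ancestor chain are nested, so their sizes behave like an ultrametric.\<close>

lemma ultra:
  assumes V: "u \<in> V" "v \<in> V" "w \<in> V"
  shows "min (card (anc u \<inter> anc v)) (card (anc v \<inter> anc w)) \<le> card (anc u \<inter> anc w)"
proof -
  have "anc u \<inter> anc v \<subseteq> anc w \<or> anc v \<inter> anc w \<subseteq> anc u"
  proof (rule ccontr)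
    assume "\<not> ?thesis"
    then obtain a b where "a \<in> anc u" "a \<in> anc v" "a \<notin> anc w" "b \<in> anc v" "b \<in> anc w" "b \<notin> anc u" by blast
    then show False using anc_comparable[of a v b] anc_trans by blast
  qed
  then show ?thesis
  proof
    assume "anc u \<inter> anc v \<subseteq> anc w"
    then have "card (anc u \<inter> anc v) \<le> card (anc u \<inter> anc w)"
      using finite_anc V by (intro card_mono) auto
    then show ?thesis by simp
  next
    assume "anc v \<inter> anc w \<subseteq> anc u"
    then have "card (anc v \<inter> anc w) \<le> card (anc u \<inter> anc w)"
      using finite_anc V by (intro card_mono) auto
    then show ?thesis by simp
  qed
qed

lemma d_sym: "d u v = d v u" by (simp add: d_def Int_commute)

lemma d_self [simp]: "d u u = 0" by (simp add: d_def)

text \<open>This condition characterises tree metrics; uniqueness on geodesics and the centre of a bounded orbit follow from it.\<close>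

lemma four_point:
  assumes V: "x \<in> V" "y \<in> V" "z \<in> V" "w \<in> V"
  shows "d x y + d z w \<le> max (d x z + d y w) (d x w + d y z)"
proof -
  define m where "m a b = int (card (anc a \<inter> anc b))" for a b
  have c: "m a b = m b a" for a b by (simp add: m_def Int_commute)
  have u: "m a b \<le> m a e \<or> m b e \<le> m a e" if "a \<in> V" "b \<in> V" "e \<in> V" for a b e
    using ultra[OF that] by (auto simp: m_def min_le_iff_disj)
  have "m x z + m y w \<le> m x y + m z w \<or> m x w + m y z \<le> m x y + m z w"
    using u[OF V(1,3,2)] u[OF V(1,4,2)] u[OF V(3,1,4)] u[OF V(3,2,4)]
    unfolding c[of z x] c[of z y] c[of w y] by linarith
  moreover have dm: "d a b = int (card (anc a)) + int (card (anc b)) - 2 * m a b" for a b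
    by (simp add: d_def m_def)
  ultimately show ?thesis unfolding le_max_iff_disj dm by linarith
qed

lemma d_nonneg: "u \<in> V \<Longrightarrow> v \<in> V \<Longrightarrow> 0 \<le> d u v"
proof -
  assume "u \<in> V" "v \<in> V"
  then have "card (anc u \<inter> anc v) \<le> card (anc u)" "card (anc u \<inter> anc v) \<le> card (anc v)"
    using finite_anc by (auto intro: card_mono)
  then show ?thesis by (simp add: d_def)
qed

lemma d_0: assumes "u \<in> V" "v \<in> V" "d u v = 0" shows "u = v"
proof -
  have "card (anc u \<inter> anc v) \<le> card (anc u)" "card (anc u \<inter> anc v) \<le> card (anc v)"
    using finite_anc assms by (auto intro: card_mono)
  then have "card (anc u \<inter> anc v) = card (anc u)" "card (anc u \<inter> anc v) = card (anc v)"
    using assms(3) by (simp_all add: d_def)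
  then have "anc u \<inter> anc v = anc u" "anc u \<inter> anc v = anc v"
    using finite_anc assms by (simp_all add: card_subset_eq)
  then have "u \<in> anc v" "v \<in> anc u" using anc_self by blast+
  then show ?thesis using anc_ht[OF assms(2), of u] anc_ht[OF assms(1), of v] by force
qed

lemma d_triangle: "x \<in> V \<Longrightarrow> y \<in> V \<Longrightarrow> z \<in> V \<Longrightarrow> d x y \<le> d x z + d z y"
  using four_point[of x y z z] by (simp add: d_sym)

lemma d_p: assumes "v \<in> V" "v \<noteq> r" shows "d v (p v) = 1"
proof -
  have "anc v \<inter> anc (p v) = anc (p v)" using anc_insert by blast
  then show ?thesis using card_anc[OF assms] by (simp add: d_def)
qed

lemma d_adj: assumes "u \<in> V" "v \<in> V" "adj u v" shows "d u v = 1"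
proof -
  have "u \<noteq> r \<and> v = p u \<or> v \<noteq> r \<and> u = p v" using assms(3) by (auto simp: adj_def)
  then show ?thesis using d_p[OF assms(1)] d_p[OF assms(2)] d_sym[of u v] by fastforce
qed

lemma adj_sym: "adj u v \<longleftrightarrow> adj v u" by (auto simp: adj_def)

lemma step_up: assumes V: "u \<in> V" "v \<in> V" and "u \<notin> anc v" shows "u \<noteq> r" "d (p u) v = d u v - 1"
proof -
  show r: "u \<noteq> r" using finite_anc[OF V(2)] assms(3) by blast
  have "anc u \<inter> anc v = anc (p u) \<inter> anc v" by (subst anc_insert[of u]) (use assms(3) in blast)
  then show "d (p u) v = d u v - 1" using card_anc[OF V(1) r] by (simp add: d_def)
qed

lemma step_exists:
  assumes V: "u \<in> V" "v \<in> V" and "u \<noteq> v"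
  shows "(\<exists>u'\<in>V. adj u u' \<and> d u' v = d u v - 1) \<or> (\<exists>v'\<in>V. adj v v' \<and> d u v' = d u v - 1)"
proof -
  have "u \<notin> anc v \<or> v \<notin> anc u"
    using anc_ht[OF V(2), of u] anc_ht[OF V(1), of v] assms(3) by force
  then show ?thesis
  proof
    assume "u \<notin> anc v"
    from step_up[OF V this] d_p[OF V(1)] have "adj u (p u)" "d (p u) v = d u v - 1" by (auto simp: adj_def)
    then show ?thesis using p_in V by blast
  next
    assume "v \<notin> anc u"
    from step_up[OF V(2,1) this] d_p[OF V(2)] have "adj v (p v)" "d u (p v) = d u v - 1" by (auto simp: adj_def d_sym)
    then show ?thesis using p_in V by blast
  qed
qed

definition adj_map :: "('a \<Rightarrow> 'a) \<Rightarrow> bool" where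
  "adj_map g \<longleftrightarrow> (\<forall>v\<in>V. g v \<in> V) \<and> (\<forall>u\<in>V. \<forall>v\<in>V. adj u v \<longrightarrow> adj (g u) (g v))"

definition isom :: "('a \<Rightarrow> 'a) \<Rightarrow> bool" where
  "isom g \<longleftrightarrow> (\<forall>v\<in>V. g v \<in> V) \<and> (\<forall>u\<in>V. \<forall>v\<in>V. d (g u) (g v) = d u v)"

text \<open>A map that preserves adjacency does not increase the length of a path.\<close>

lemma adj_map_d_le: assumes g: "adj_map g" shows "u \<in> V \<Longrightarrow> v \<in> V \<Longrightarrow> d (g u) (g v) \<le> d u v"
proof (induction "nat (d u v)" arbitrary: u v rule: less_induct)
  case less
  have gV: "g w \<in> V" if "w \<in> V" for w using g that by (simp add: adj_map_def)
  show ?case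
  proof (cases "u = v")
    case False
    have pos: "d u v > 0" using d_nonneg[OF less.prems] d_0[OF less.prems] False by force
    from step_exists[OF less.prems False] show ?thesis
    proof (elim disjE bexE conjE)
      fix u' assume u': "u' \<in> V" "adj u u'" "d u' v = d u v - 1"
      then have "d (g u') (g v) \<le> d u' v" using less.hyps[of u' v] less.prems pos by simp
      moreover have "d (g u) (g u') = 1" using g u' less.prems by (intro d_adj gV) (auto simp: adj_map_def)
      ultimately show ?thesis using d_triangle[of "g u" "g v" "g u'"] u' less.prems gV by fastforce
    next
      fix v' assume v': "v' \<in> V" "adj v v'" "d u v' = d u v - 1"
      then have "d (g u) (g v') \<le> d u v'" using less.hyps[of u v'] less.prems pos by simp
      moreover have "d (g v) (g v') = 1" using g v' less.prems by (intro d_adj gV) (auto simp: adj_map_def)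
      ultimately show ?thesis using d_triangle[of "g u" "g v" "g v'"] d_sym[of "g v" "g v'"] v' less.prems gV by fastforce
    qed
  qed simp
qed

lemma isomI:
  assumes "adj_map g" "adj_map h" "\<And>v. v \<in> V \<Longrightarrow> h (g v) = v" shows "isom g"
  unfolding isom_def
proof (intro conjI ballI)
  fix u v assume uv: "u \<in> V" "v \<in> V"
  show "g v \<in> V" using assms(1) uv by (simp add: adj_map_def)
  have "d (h (g u)) (h (g v)) \<le> d (g u) (g v)"
    using assms(1) uv by (intro adj_map_d_le[OF assms(2)]) (simp_all add: adj_map_def)
  then show "d (g u) (g v) = d u v" using adj_map_d_le[OF assms(1) uv] assms(3) uv by simp
qed

lemma geodesic:
  assumes "u \<in> V" "v \<in> V" "0 \<le> k" "k \<le> d u v"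
  shows "\<exists>m\<in>V. d u m = k \<and> d m v = d u v - k"
  using assms
proof (induction "nat (d u v)" arbitrary: u v k rule: less_induct)
  case less
  show ?case
  proof (cases "u = v \<or> k = 0 \<or> k = d u v")
    case True
    then have "k = 0 \<or> k = d u v" using less.prems by fastforce
    then have "d u u = k \<and> d u v = d u v - k \<or> d u v = k \<and> d v v = d u v - k" by auto
    then show ?thesis using less.prems by blast
  next
    case False
    have pos: "d u v > 0" using False less.prems by linarith
    have uv: "u \<noteq> v" using False by blast
    from step_exists[OF less.prems(1,2) uv] show ?thesis
    proof (elim disjE bexE conjE)
      fix u' assume u': "u' \<in> V" "adj u u'" "d u' v = d u v - 1"
      then obtain m where m: "m \<in> V" "d u' m = k - 1" "d m v = d u' v - (k - 1)"
        using less.hyps[of u' v "k - 1"] less.prems pos False by auto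
      have "d u m \<le> 1 + d u' m" using d_triangle[of u m u'] d_adj[of u u'] u' m less.prems by simp
      moreover have "d u v \<le> d u m + d m v" using d_triangle m less.prems by blast
      ultimately show ?thesis using m u' by (intro bexI[of _ m]) auto
    next
      fix v' assume v': "v' \<in> V" "adj v v'" "d u v' = d u v - 1"
      then obtain m where m: "m \<in> V" "d u m = k" "d m v' = d u v' - k"
        using less.hyps[of u v' k] less.prems pos False by auto
      have "d m v \<le> d m v' + 1" using d_triangle[of m v v'] d_adj[of v v'] d_sym[of v v'] v' m less.prems by simp
      moreover have "d u v \<le> d u m + d m v" using d_triangle m less.prems by blast
      ultimately show ?thesis using m v' by (intro bexI[of _ m]) auto
    qed
  qed
qed

definition between :: "'a \<Rightarrow> 'a \<Rightarrow> 'a set" where "between u v = {x \<in> V. d u x + d x v = d u v}"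

lemma between_inj:
  assumes "u \<in> V" "v \<in> V" "x \<in> between u v" "y \<in> between u v" "d u x = d u y" shows "x = y"
proof -
  have V: "x \<in> V" "y \<in> V" using assms by (auto simp: between_def)
  have "d x y + d u v \<le> max (d x u + d y v) (d x v + d y u)" by (rule four_point) (use assms V in auto)
  then have "d x y \<le> 0" using assms by (auto simp: between_def d_sym)
  then show ?thesis using d_nonneg[OF V] d_0[OF V] by simp
qed

lemma finite_between: assumes "u \<in> V" "v \<in> V" shows "finite (between u v)"
proof -
  have "inj_on (d u) (between u v)" using between_inj[OF assms] by (auto intro: inj_onI)
  moreover have "d u ` between u v \<subseteq> {0..d u v}"
    using d_nonneg assms by (force simp: between_def)
  ultimately show ?thesis by (meson finite_atLeastAtMost_int finite_imageD finite_subset)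
qed

lemma between_sym: "between u v = between v u"
  by (auto simp: between_def d_sym)

text \<open>A point of the segment from \<open>u\<close> to \<open>v\<close> farther from \<open>u\<close> than \<open>u'\<close> is also passed on the way from \<open>u'\<close> to \<open>v\<close>.\<close>

lemma between_change:
  assumes V: "u \<in> V" "v \<in> V" "u' \<in> V" and x: "x \<in> between u v" and lt: "d u u' < d u x"
  shows "x \<in> between u' v"
proof -
  have xV: "x \<in> V" using x by (simp add: between_def)
  have "d u v + d u' x \<le> max (d u u' + d v x) (d u x + d v u')" by (rule four_point) (use V xV in auto)
  moreover have "d u' v \<le> d u' x + d x v" using d_triangle V xV by blast
  moreover have "d u x + d x v = d u v" using x by (simp add: between_def)
  ultimately have "d u' x + d x v = d u' v"
    using lt d_nonneg[OF V(3) xV] d_sym[of v x] d_sym[of v u'] by linarith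
  then show ?thesis using xV by (simp add: between_def)
qed

lemma between_image:
  assumes s: "isom s" and V: "u \<in> V" "w \<in> V" and x: "x \<in> between u w"
    and D: "d u (s u) \<le> D" "d w (s w) \<le> D" "D < d u x" "D < d x w"
  shows "s x \<in> between u w"
proof -
  have xV: "x \<in> V" using x by (simp add: between_def)
  have sV: "s u \<in> V" "s w \<in> V" "s x \<in> V" using s V xV by (simp_all add: isom_def)
  have iso: "d (s a) (s b) = d a b" if "a \<in> V" "b \<in> V" for a b using s that by (simp add: isom_def)
  have "s x \<in> between (s u) (s w)" using x V xV sV by (simp add: between_def iso)
  moreover have "d (s u) u < d (s u) (s x)" using D V xV by (simp add: iso d_sym)
  ultimately have "s x \<in> between u (s w)" using between_change[OF sV(1,2) V(1)] by blast
  then have "s x \<in> between (s w) u" by (simp add: between_sym)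
  moreover have "d (s w) w < d (s w) (s x)" using D V xV by (simp add: iso d_sym)
  ultimately show ?thesis using between_change[OF sV(2) V(1,2)] between_sym by blast
qed

text \<open>Points in the middle of the segment remain on it, as they are farther from the ends than the ends are moved. So
  there are finitely many choices for their images, and the pigeonhole principle applies.\<close>

lemma agree_on_segment:
  assumes S: "infinite S" "\<And>s. s \<in> S \<Longrightarrow> isom s" and V: "u \<in> V" "w \<in> V"
    and D: "\<And>s. s \<in> S \<Longrightarrow> d u (s u) \<le> D \<and> d w (s w) \<le> D" and long: "d u w \<ge> 2 * D + l + 2" and l: "l \<ge> 0"
  shows "\<exists>a\<in>V. \<exists>b\<in>V. d a b \<ge> l \<and> (\<exists>T\<subseteq>S. infinite T \<and> (\<forall>s\<in>T. \<forall>t\<in>T. s a = t a \<and> s b = t b))"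
proof -
  obtain s0 where "s0 \<in> S" using S(1) by (metis finite.emptyI ex_in_conv)
  then have D0: "D \<ge> 0" using D[of s0] d_nonneg[OF V(1), of "s0 u"] S(2) V by (force simp: isom_def)
  obtain a where a: "a \<in> V" "d u a = D + 1" "d a w = d u w - (D + 1)"
    using geodesic[OF V, of "D + 1"] D0 long l by auto
  obtain b where b: "b \<in> V" "d u b = D + 1 + l" "d b w = d u w - (D + 1 + l)"
    using geodesic[OF V, of "D + 1 + l"] D0 long l by auto
  have ab: "a \<in> between u w" "b \<in> between u w" using a b by (simp_all add: between_def)
  have im: "s a \<in> between u w \<and> s b \<in> between u w" if "s \<in> S" for s
    using between_image[OF S(2)[OF that] V ab(1), of D] between_image[OF S(2)[OF that] V ab(2), of D] D[OF that] a b long l D0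
    by simp
  have "finite ((\<lambda>s. (s a, s b)) ` S)"
    using im by (intro finite_subset[OF _ finite_cartesian_product[OF finite_between[OF V] finite_between[OF V]]]) auto
  from pigeonhole_infinite[OF S(1) this] obtain s0 where s0: "s0 \<in> S" "infinite {s \<in> S. (s a, s b) = (s0 a, s0 b)}" by blast
  have "d a b \<ge> l" using d_triangle[of u b a] V a b by simp
  moreover have "\<exists>T\<subseteq>S. infinite T \<and> (\<forall>s\<in>T. \<forall>t\<in>T. s a = t a \<and> s b = t b)"
    using s0 by (intro exI[of _ "{s \<in> S. (s a, s b) = (s0 a, s0 b)}"]) auto
  ultimately show ?thesis using a b by blast
qed

text \<open>A vertex from which \<open>O'\<close> has minimal radius is fixed: if it were moved by \<open>2 n\<close>, the midpoint of
  the displacement would give a smaller radius. Even displacements exclude inversions of edges, for which the midpoint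
  is not a vertex.\<close>

lemma bounded_orbit_fixed_point:
  assumes G: "\<And>g. g \<in> \<Gamma> \<Longrightarrow> isom g" and even: "\<And>g v. g \<in> \<Gamma> \<Longrightarrow> v \<in> V \<Longrightarrow> even (d v (g v))"
    and O: "O' \<subseteq> V" "O' \<noteq> {}" "\<And>g. g \<in> \<Gamma> \<Longrightarrow> g ` O' = O'"
    and bd: "v0 \<in> V" "\<And>x. x \<in> O' \<Longrightarrow> d v0 x \<le> B"
  shows "\<exists>v\<in>V. \<forall>g\<in>\<Gamma>. g v = v"
proof -
  define P where "P R \<longleftrightarrow> (\<exists>v\<in>V. \<forall>x\<in>O'. d v x \<le> int R)" for R
  have "P (nat B)" unfolding P_def using bd by (intro bexI[of _ v0]) force+
  then have PR: "P (LEAST R. P R)" by (rule LeastI)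
  define R where "R = (LEAST R. P R)"
  obtain v where v: "v \<in> V" "\<forall>x\<in>O'. d v x \<le> int R"
    using PR unfolding R_def[symmetric] unfolding P_def by blast
  have "g v = v" if g: "g \<in> \<Gamma>" for g
  proof (rule ccontr)
    assume ne: "g v \<noteq> v"
    have gv: "g v \<in> V" using G[OF g] v by (simp add: isom_def)
    have gR: "d (g v) x \<le> int R" if "x \<in> O'" for x
    proof -
      obtain y where y: "y \<in> O'" "x = g y" using O(3)[OF g] \<open>x \<in> O'\<close> by blast
      then have "d (g v) x = d v y" using G[OF g] v O(1) by (auto simp: isom_def)
      then show ?thesis using v y by simp
    qed
    obtain n where n: "d v (g v) = 2 * n" using even[OF g v(1)] by blast
    have n1: "n \<ge> 1" using d_nonneg[OF v(1) gv] d_0[OF v(1) gv] ne n by force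
    obtain m where m: "m \<in> V" "d v m = n" "d m (g v) = n" using geodesic[OF v(1) gv, of n] n n1 by auto
    have mR: "d m x \<le> int R - n" if x: "x \<in> O'" for x
    proof -
      have "d m x + d v (g v) \<le> max (d m v + d x (g v)) (d m (g v) + d x v)"
        by (rule four_point) (use m v gv x O in auto)
      moreover have "d v x \<le> int R" "d (g v) x \<le> int R" using v(2) gR x by blast+
      ultimately show ?thesis using m(2,3) n d_sym[of m v] d_sym[of x v] d_sym[of x "g v"] by linarith
    qed
    obtain x where "x \<in> O'" using O by blast
    then have "int R - n \<ge> 0" using mR[of x] d_nonneg[OF m(1), of x] O(1) by force
    then have "P (nat (int R - n))" unfolding P_def using m mR by (intro bexI[of _ m]) auto
    then have "R \<le> nat (int R - n)" unfolding R_def by (rule Least_le)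
    then show False using n1 \<open>int R - n \<ge> 0\<close> by linarith
  qed
  then show ?thesis using v by blast
qed

lemma d_1_adj: assumes "u \<in> V" "v \<in> V" "d u v = 1" shows "adj u v"
proof -
  have "u \<noteq> v" using assms(3) by auto
  from step_exists[OF assms(1,2) this] show ?thesis
  proof (elim disjE bexE conjE)
    fix u' assume "u' \<in> V" "adj u u'" "d u' v = d u v - 1"
    then show ?thesis using d_0[of u' v] assms by simp
  next
    fix v' assume "v' \<in> V" "adj v v'" "d u v' = d u v - 1"
    then show ?thesis using d_0[of u v'] assms adj_sym by simp
  qed
qed

text \<open>A geodesic is determined by its ends, so an isometry fixing these fixes all its vertices.\<close>

lemma geodesic_sequence:
  assumes u: "u \<in> V" and w: "w \<in> V" and n: "int n \<le> d u w"
  obtains x where "\<And>i. i \<le> n \<Longrightarrow> x i \<in> V" "\<And>i. i < n \<Longrightarrow> adj (x i) (x (Suc i))"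
    "\<And>i. Suc i < n \<Longrightarrow> x i \<noteq> x (Suc (Suc i))"
    "\<And>g i. isom g \<Longrightarrow> g u = u \<Longrightarrow> g w = w \<Longrightarrow> i \<le> n \<Longrightarrow> g (x i) = x i"
proof -
  define x where "x i = (SOME m. m \<in> V \<and> d u m = int i \<and> d m w = d u w - int i)" for i
  have x: "x i \<in> V \<and> d u (x i) = int i \<and> d (x i) w = d u w - int i" if "i \<le> n" for i
    unfolding x_def by (rule someI_ex) (use geodesic[OF u w, of "int i"] that n in auto)
  have b: "x i \<in> between u w" if "i \<le> n" for i using x[OF that] by (simp add: between_def)
  have dist: "d (x i) (x (Suc i)) = 1" if "i < n" for i
  proof -
    have i: "i \<le> n" "Suc i \<le> n" using that by auto
    have le: "1 \<le> d (x i) w" using x[OF i(1)] n i by linarith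
    obtain y where y: "y \<in> V" "d (x i) y = 1" "d y w = d (x i) w - 1"
      using geodesic[of "x i" w 1] x[OF i(1)] w le by auto
    have "d u y \<le> int i + 1" using d_triangle[OF u y(1), of "x i"] x[OF i(1)] y by simp
    moreover have "d u w \<le> d u y + d y w" using d_triangle u w y by blast
    ultimately have "d u y = int (Suc i)" "y \<in> between u w"
      using y x[OF i(1)] by (auto simp: between_def)
    then have "y = x (Suc i)" using between_inj[OF u w _ b[OF i(2)]] x[OF i(2)] by simp
    then show ?thesis using y by simp
  qed
  show thesis
  proof (rule that[of x])
    fix i
    show "i \<le> n \<Longrightarrow> x i \<in> V" using x by blast
    show "i < n \<Longrightarrow> adj (x i) (x (Suc i))" using dist x by (intro d_1_adj) auto
    show "Suc i < n \<Longrightarrow> x i \<noteq> x (Suc (Suc i))" using x[of i] x[of "Suc (Suc i)"] by auto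
    fix g assume g: "isom g" "g u = u" "g w = w" "i \<le> n"
    have iso: "d (g a) (g b) = d a b" if "a \<in> V" "b \<in> V" for a b using g that by (simp add: isom_def)
    have "g (x i) \<in> V" using g x by (auto simp: isom_def)
    moreover have "d u (g (x i)) = d u (x i)" "d (g (x i)) w = d (x i) w"
      using iso[of u "x i"] iso[of "x i" w] g u w x by auto
    ultimately show "g (x i) = x i" using between_inj[OF u w _ b[OF g(4)]] b[OF g(4)] by (simp add: between_def)
  qed
qed

end

section \<open>The tree of coordinate lines and planes\<close>

text \<open>Constants are included, since the affine group contains the translations.\<close>

definition line :: "free_alg \<Rightarrow> free_alg set" where
  "line p = {q. \<exists>c h. q = scalar c * p + scalar h}"

abbreviation W0 :: "free_alg set" where "W0 \<equiv> degree_le 1"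

definition planes :: "free_alg set set" where "planes = (\<lambda>\<sigma>. \<sigma> ` W0) ` autG"
definition lines :: "free_alg set set" where "lines = (\<lambda>\<sigma>. line (\<sigma> gen_y)) ` autG"

lemma W0_iff: "p \<in> W0 \<longleftrightarrow> (\<exists>a b e. p = affine a b e)"
  using dg_le_1D dg_affine_le degree_le_iff by metis

lemma plane_mem:
  assumes "\<sigma> \<in> autG"
  shows "p \<in> \<sigma> ` W0 \<longleftrightarrow> (\<exists>a b e. p = scalar a * \<sigma> gen_x + scalar b * \<sigma> gen_y + scalar e)"
proof
  assume "p \<in> \<sigma> ` W0"
  then obtain q where "q \<in> W0" "p = \<sigma> q" by blast
  then obtain a b e where "p = \<sigma> (affine a b e)" unfolding W0_iff by blast
  then show "\<exists>a b e. p = scalar a * \<sigma> gen_x + scalar b * \<sigma> gen_y + scalar e"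
    unfolding autG_affine[OF assms] by blast
next
  assume "\<exists>a b e. p = scalar a * \<sigma> gen_x + scalar b * \<sigma> gen_y + scalar e"
  then obtain a b e where "p = \<sigma> (affine a b e)" unfolding autG_affine[OF assms] by blast
  moreover have "affine a b e \<in> W0" using W0_iff by blast
  ultimately show "p \<in> \<sigma> ` W0" by blast
qed

lemma line_self: "p \<in> line p"
  unfolding line_def by (intro CollectI exI[of _ 1] exI[of _ 0]) simp

lemma line_image: assumes "\<sigma> \<in> autG" shows "\<sigma> ` line p = line (\<sigma> p)"
proof
  show "\<sigma> ` line p \<subseteq> line (\<sigma> p)"
  proof
    fix q assume "q \<in> \<sigma> ` line p"
    then obtain c h where "q = \<sigma> (scalar c * p + scalar h)" unfolding line_def by blast
    then have "q = scalar c * \<sigma> p + scalar h" by (simp add: autG_simps[OF assms])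
    then show "q \<in> line (\<sigma> p)" unfolding line_def by blast
  qed
  show "line (\<sigma> p) \<subseteq> \<sigma> ` line p"
  proof
    fix q assume "q \<in> line (\<sigma> p)"
    then obtain c h where "q = \<sigma> (scalar c * p + scalar h)" by (auto simp: line_def autG_simps[OF assms])
    then show "q \<in> \<sigma> ` line p" unfolding line_def by blast
  qed
qed

lemma line_eqI: assumes "c \<noteq> 0" shows "line (scalar c * p + scalar h) = line p"
proof
  show "line (scalar c * p + scalar h) \<subseteq> line p"
  proof
    fix q assume "q \<in> line (scalar c * p + scalar h)"
    then obtain a e where "q = scalar a * (scalar c * p + scalar h) + scalar e" by (auto simp: line_def)
    then have "q = scalar (a * c) * p + scalar (a * h + e)"
      by (simp add: distrib_left scalar_mult scalar_add mult.assoc add.assoc)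
    then show "q \<in> line p" by (auto simp: line_def)
  qed
  show "line p \<subseteq> line (scalar c * p + scalar h)"
  proof
    fix q assume "q \<in> line p"
    then obtain a e where q: "q = scalar a * p + scalar e" by (auto simp: line_def)
    have "q = scalar (a / c) * (scalar c * p + scalar h) + scalar (e - a / c * h)"
      unfolding q using assms
      by (simp add: distrib_left mult.assoc[symmetric] scalar_mult[symmetric] scalar_diff)
    then show "q \<in> line (scalar c * p + scalar h)" unfolding line_def by blast
  qed
qed

lemma line_eq_of_mem:
  assumes "q \<in> line p" "dg q \<ge> 1" shows "line q = line p"
proof -
  obtain c h where q: "q = scalar c * p + scalar h" using assms by (auto simp: line_def)
  have "c \<noteq> 0" using q assms(2) by auto
  then show ?thesis unfolding q by (rule line_eqI)
qed

text \<open>The maximal degree of the elements.\<close>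

definition vdeg :: "free_alg set \<Rightarrow> nat" where "vdeg v = (LEAST k. v \<subseteq> degree_le k)"

lemma vdeg_eqI: "v \<subseteq> degree_le k \<Longrightarrow> p \<in> v \<Longrightarrow> dg p = k \<Longrightarrow> vdeg v = k"
  unfolding vdeg_def by (rule Least_equality) (auto simp: degree_le_iff)

lemma vdeg_line: "vdeg (line p) = dg p"
proof (rule vdeg_eqI)
  show "line p \<subseteq> degree_le (dg p)"
    by (auto simp: line_def degree_le_iff intro!: dg_add_le dg_scalar_mult_le)
qed (simp_all add: line_self)

lemma gens_in_plane: "\<sigma> \<in> autG \<Longrightarrow> \<sigma> gen_x \<in> \<sigma> ` W0" "\<sigma> \<in> autG \<Longrightarrow> \<sigma> gen_y \<in> \<sigma> ` W0"
  by (simp_all add: degree_le_iff)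

lemma vdeg_plane: assumes "\<sigma> \<in> autG" shows "vdeg (\<sigma> ` W0) = mdeg \<sigma>"
proof (rule vdeg_eqI)
  show "\<sigma> ` W0 \<subseteq> degree_le (mdeg \<sigma>)"
  proof
    fix p assume "p \<in> \<sigma> ` W0"
    then obtain q where "p = \<sigma> q" "dg q \<le> 1" by (auto simp: degree_le_iff)
    have "dg (\<sigma> q) \<le> dg q * mdeg \<sigma>" by (rule dg_le_mdeg[OF autG_alg_endo[OF assms]])
    also have "\<dots> \<le> 1 * mdeg \<sigma>" using \<open>dg q \<le> 1\<close> by (rule mult_right_mono) simp
    finally show "p \<in> degree_le (mdeg \<sigma>)" using \<open>p = \<sigma> q\<close> by (simp add: degree_le_iff)
  qed
  show "(if dg (\<sigma> gen_x) \<le> dg (\<sigma> gen_y) then \<sigma> gen_y else \<sigma> gen_x) \<in> \<sigma> ` W0"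
    using gens_in_plane[OF assms] by simp
qed (auto simp: mdeg_def)

lemma Aff_iff: assumes "\<sigma> \<in> autG" shows "\<sigma> \<in> Aff \<longleftrightarrow> \<sigma> ` W0 = W0"
proof
  assume s: "\<sigma> \<in> Aff"
  have "\<sigma> ` W0 \<subseteq> W0" using Aff_affine[OF s] by (auto simp: degree_le_iff)
  moreover have "W0 \<subseteq> \<sigma> ` W0"
  proof
    fix p assume "p \<in> W0"
    then have "finv \<sigma> p \<in> W0" using Aff_affine[OF Aff_inv[OF s]] by (simp add: degree_le_iff)
    moreover have "p = \<sigma> (finv \<sigma> p)" using assms by simp
    ultimately show "p \<in> \<sigma> ` W0" by blast
  qed
  ultimately show "\<sigma> ` W0 = W0" by blast
next
  assume *: "\<sigma> ` W0 = W0"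
  have "\<sigma> gen_x \<in> W0" "\<sigma> gen_y \<in> W0" using gens_in_plane[OF assms] unfolding * by blast+
  then show "\<sigma> \<in> Aff" using assms by (simp add: Aff_def degree_le_iff)
qed

lemma triangular_iff_line: assumes "\<sigma> \<in> autG" shows "\<sigma> \<in> triangular \<longleftrightarrow> \<sigma> ` line gen_y = line gen_y"
proof
  assume "\<sigma> \<in> triangular"
  then obtain c h where c: "\<sigma> gen_y = scalar c * gen_y + scalar h" using triangular_iff by blast
  then have "c \<noteq> 0" using triangularI assms by blast
  then show "\<sigma> ` line gen_y = line gen_y" unfolding line_image[OF assms] c by (rule line_eqI)
next
  assume "\<sigma> ` line gen_y = line gen_y"
  then have "\<sigma> gen_y \<in> line gen_y" using line_self line_image[OF assms] by metis
  then show "\<sigma> \<in> triangular" using assms triangular_iff by (auto simp: line_def)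
qed

lemma planes_image: "\<sigma> \<in> autG \<Longrightarrow> W \<in> planes \<Longrightarrow> \<sigma> ` W \<in> planes"
proof -
  assume s: "\<sigma> \<in> autG" and "W \<in> planes"
  then obtain \<tau> where "\<tau> \<in> autG" "W = \<tau> ` W0" by (auto simp: planes_def)
  then have "\<sigma> ` W = (\<sigma> \<circ> \<tau>) ` W0" "\<sigma> \<circ> \<tau> \<in> autG" using s autG_comp by (simp_all only: image_comp)
  then show ?thesis unfolding planes_def by (rule image_eqI)
qed

lemma lines_image: "\<sigma> \<in> autG \<Longrightarrow> L \<in> lines \<Longrightarrow> \<sigma> ` L \<in> lines"
proof -
  assume s: "\<sigma> \<in> autG" and "L \<in> lines"
  then obtain \<tau> where "\<tau> \<in> autG" "L = line (\<tau> gen_y)" by (auto simp: lines_def)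
  then have "\<sigma> ` L = line ((\<sigma> \<circ> \<tau>) gen_y)" "\<sigma> \<circ> \<tau> \<in> autG" using s autG_comp by (simp_all add: line_image)
  then show ?thesis unfolding lines_def by (rule image_eqI)
qed

lemma image_finv: "\<sigma> \<in> autG \<Longrightarrow> finv \<sigma> ` \<sigma> ` v = v" "\<sigma> \<in> autG \<Longrightarrow> \<sigma> ` finv \<sigma> ` v = v"
  by (simp_all add: image_image)

lemma lines_planes_disjoint: assumes "v \<in> lines" "v \<in> planes" shows False
proof -
  obtain \<sigma> \<tau> where st: "\<sigma> \<in> autG" "\<tau> \<in> autG" "v = line (\<sigma> gen_y)" "v = \<tau> ` W0"
    using assms by (auto simp: lines_def planes_def)
  have "\<tau> gen_x \<in> line (\<sigma> gen_y)" "\<tau> gen_y \<in> line (\<sigma> gen_y)"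
    using gens_in_plane[OF st(2)] st(3,4) by blast+
  then obtain c h d k where "\<tau> gen_x = scalar c * \<sigma> gen_y + scalar h" "\<tau> gen_y = scalar d * \<sigma> gen_y + scalar k"
    by (auto simp: line_def)
  then have "commutator (\<tau> gen_x) (\<tau> gen_y) = 0" by (simp add: commutator_simps)
  then show False using autG_commutator'[OF st(2)] commutator_gens_neq_0 by simp
qed

lemma line_subset_plane: assumes "\<tau> \<in> autG" "p \<in> \<tau> ` W0" shows "line p \<subseteq> \<tau> ` W0"
proof
  fix q assume "q \<in> line p"
  then obtain c h where q: "q = scalar c * p + scalar h" by (auto simp: line_def)
  obtain p' where p': "p = \<tau> p'" "dg p' \<le> 1" using assms by (auto simp: degree_le_iff)
  have "q = \<tau> (scalar c * p' + scalar h)" by (simp add: q p' autG_simps[OF assms(1)])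
  moreover have "dg (scalar c * p' + scalar h) \<le> 1"
    using p' dg_scalar_mult_le[of c p'] by (intro dg_add_le) auto
  ultimately show "q \<in> \<tau> ` W0" by (auto simp: degree_le_iff)
qed

lemma Aff_with_gen_y:
  assumes "u \<noteq> 0 \<or> v \<noteq> 0" shows "\<exists>\<alpha>\<in>Aff. \<alpha> gen_y = affine u v w"
proof (cases "u = 0")
  case True
  then have "aff (1 / v) 0 0 u v w \<in> Aff" using assms by (intro Aff_I) simp
  then show ?thesis using aff_gens(2) by blast
next
  case False
  then have "aff 0 (- 1 / u) 0 u v w \<in> Aff" by (intro Aff_I) simp
  then show ?thesis using aff_gens(2) by blast
qed

lemma autG_affine_nonconst:
  assumes "\<tau> \<in> autG" "dg (\<tau> (affine u v w)) \<ge> 1" shows "u \<noteq> 0 \<or> v \<noteq> 0"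
  using assms by (auto simp: autG_affine)

text \<open>Two planes through the line of \<open>\<rho>(y)\<close> differ by an automorphism fixing \<open>y\<close>, that is, by an elementary one after
  a change of coordinates in one of them.\<close>

lemma planes_over_line:
  assumes r: "\<rho> \<in> autG" and W: "W \<in> planes" "\<rho> gen_y \<in> W"
  shows "\<exists>q. W = (\<rho> \<circ> el q) ` W0 \<and> (q = 0 \<or> degree q \<ge> 2)"
proof -
  obtain \<tau> where t: "\<tau> \<in> autG" "W = \<tau> ` W0" using W by (auto simp: planes_def)
  then obtain u v w where uvw: "\<rho> gen_y = \<tau> (affine u v w)" using W(2) by (auto simp: W0_iff image_iff)
  then have "u \<noteq> 0 \<or> v \<noteq> 0" using autG_affine_nonconst[OF t(1)] dg_gens_ge_1(2)[OF r] by metis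
  then obtain \<alpha> where a: "\<alpha> \<in> Aff" "\<alpha> gen_y = affine u v w" using Aff_with_gen_y by blast
  have aG: "\<alpha> \<in> autG" using a Aff_subset by blast
  define \<beta> where "\<beta> = finv \<rho> \<circ> (\<tau> \<circ> \<alpha>)"
  have b: "\<beta> \<in> autG" using r t aG by (simp add: \<beta>_def autG_comp autG_inv)
  have by1: "\<beta> gen_y = gen_y" using r uvw[symmetric] a by (simp add: \<beta>_def)
  then have "\<beta> \<in> triangular" using b triangular_iff_line line_image by metis
  then obtain a' h q where q: "a' \<noteq> 0" "\<beta> gen_x = scalar a' * gen_x + pol q gen_y"
    "\<beta> gen_y = scalar (inverse a') * gen_y + scalar h" using triangular_decomp by blast
  have "affine 0 (inverse a') h = affine 0 1 0" using q(3) by1 by (simp add: affine_def)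
  then have "a' = 1" by (simp add: affine_eq_iff)
  then have bel: "\<beta> = el q" using b q by1 by (intro autG_eqI) (simp_all add: el_in_autG)
  have "\<rho> \<circ> el q = \<tau> \<circ> \<alpha>" unfolding bel[symmetric] \<beta>_def using r by (simp add: o_assoc autG_inv_comp)
  then have "(\<rho> \<circ> el q) ` W0 = \<tau> ` \<alpha> ` W0" by (simp only: image_comp)
  then have W': "W = (\<rho> \<circ> el q) ` W0" using t(2) Aff_iff[OF aG] a(1) by metis
  show ?thesis
  proof (cases "degree q \<ge> 2")
    case True then show ?thesis using W' by blast
  next
    case False
    then have "el q ` W0 = W0" using Aff_iff[OF el_in_autG] el_Aff[of q] by simp
    then have "W = (\<rho> \<circ> el 0) ` W0" unfolding W' el_0 comp_id by (metis image_comp)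
    then show ?thesis by blast
  qed
qed

lemma mdeg_el_comp:
  assumes "\<rho> \<in> autG" "dg (\<rho> gen_x) \<le> dg (\<rho> gen_y)" "degree q \<ge> 2"
  shows "mdeg (\<rho> \<circ> el q) > dg (\<rho> gen_y)"
  using dg_step(2)[OF assms] by (simp add: mdeg_def)

text \<open>A coordinate always has a complementary one of no larger degree.\<close>

lemma line_rep:
  assumes "L \<in> lines" shows "\<exists>\<rho>\<in>autG. L = line (\<rho> gen_y) \<and> dg (\<rho> gen_x) \<le> dg (\<rho> gen_y)"
proof -
  obtain \<tau> where t: "\<tau> \<in> autG" "L = line (\<tau> gen_y)" using assms by (auto simp: lines_def)
  then have "\<tau> \<in> chain" using autG_eq_chain by simp
  then show ?thesis
  proof cases
    case base
    then have "dg (\<tau> gen_x) \<le> dg (\<tau> gen_y)" using dg_gens_ge_1(2)[OF t(1)] by (simp add: Aff_def)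
    then show ?thesis using t by blast
  next
    case (step \<sigma> q \<alpha>)
    note s = chain_subset[OF step(2)]
    obtain a b e c d h where al: "a * d - b * c = 1" "\<alpha> = aff a b e c d h" using Aff_D step(5) by blast
    have se: "\<sigma> \<circ> el q \<in> autG" using s by (simp add: autG_comp el_in_autG)
    have x: "\<tau> gen_x = (\<sigma> \<circ> el q) (affine a b e)" and y: "\<tau> gen_y = (\<sigma> \<circ> el q) (affine c d h)"
      using step(1) al(2) by (simp_all add: aff_gens)
    show ?thesis
    proof (cases "c = 0")
      case True
      then have "\<tau> gen_y = scalar d * \<sigma> gen_y + scalar h" unfolding y autG_affine[OF se] by simp
      moreover have "d \<noteq> 0" using al True by auto
      ultimately have "L = line (\<sigma> gen_y)" using t(2) line_eqI by simp
      then show ?thesis using s step(3) by blast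
    next
      case False
      define F where "F = \<sigma> (el q gen_x)"
      note lt = dg_step(2)[OF s step(3,4), folded F_def]
      have "dg (scalar d * \<sigma> gen_y + scalar h) \<le> dg (\<sigma> gen_y)"
        by (intro dg_add_le dg_scalar_mult_le) simp
      then have "dg (scalar c * F + (scalar d * \<sigma> gen_y + scalar h)) = dg (scalar c * F)"
        using False lt by (intro dg_add_eq) (simp add: dg_scalar_mult)
      then have "dg (\<tau> gen_y) = dg F"
        unfolding y autG_affine[OF se] using False by (simp add: F_def add.assoc dg_scalar_mult)
      moreover have "dg (\<tau> gen_x) \<le> dg F"
        unfolding x autG_affine[OF se] using lt dg_scalar_mult_le[of b "\<sigma> gen_y"] dg_scalar_mult_le[of a F]
        by (intro dg_add_le) (simp_all add: F_def)
      ultimately have "dg (\<tau> gen_x) \<le> dg (\<tau> gen_y)" by simp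
      then show ?thesis using t by blast
    qed
  qed
qed

definition over :: "free_alg set \<Rightarrow> free_alg set \<Rightarrow> bool" where
  "over W L \<longleftrightarrow> W \<in> planes \<and> L \<in> lines \<and> L \<subseteq> W"

text \<open>Every other plane through the line has larger degree, since its elementary factor raises the degree.\<close>

lemma unique_plane_of_same_degree:
  assumes "L \<in> lines" shows "\<exists>!W. over W L \<and> vdeg W = vdeg L" "over W L \<Longrightarrow> vdeg L \<le> vdeg W"
proof -
  obtain \<rho> where r: "\<rho> \<in> autG" "L = line (\<rho> gen_y)" "dg (\<rho> gen_x) \<le> dg (\<rho> gen_y)"
    using line_rep[OF assms] by blast
  have key: "W = \<rho> ` W0 \<or> vdeg W > vdeg L" if "over W L" for W
  proof -
    have "W \<in> planes" "\<rho> gen_y \<in> W" using that line_self r by (auto simp: over_def)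
    then obtain q where q: "W = (\<rho> \<circ> el q) ` W0" "q = 0 \<or> degree q \<ge> 2" using planes_over_line[OF r(1)] by blast
    from q(2) show ?thesis
    proof
      assume "q = 0" then show ?thesis using q(1) by (simp add: el_0)
    next
      assume "degree q \<ge> 2"
      then have "vdeg W > vdeg L"
        unfolding q(1) r(2) vdeg_line vdeg_plane[OF autG_comp[OF r(1) el_in_autG]]
        using mdeg_el_comp[OF r(1,3)] by blast
      then show ?thesis ..
    qed
  qed
  have o: "over (\<rho> ` W0) L" "vdeg (\<rho> ` W0) = vdeg L"
    using assms r line_subset_plane[OF r(1) gens_in_plane(2)[OF r(1)]]
    by (auto simp: over_def planes_def vdeg_plane vdeg_line mdeg_def)
  then show "\<exists>!W. over W L \<and> vdeg W = vdeg L" using key nat_neq_iff by (intro ex1I[of _ "\<rho> ` W0"]) blast+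
  show "over W L \<Longrightarrow> vdeg L \<le> vdeg W" using key[of W] o by auto
qed

lemma W0_plane: "W0 \<in> planes"
  unfolding planes_def by (rule image_eqI[of _ _ id]) (simp_all add: autG_id)

lemma over_W0: "over W0 L \<Longrightarrow> vdeg L = 1"
proof -
  assume o: "over W0 L"
  then obtain \<rho> where r: "\<rho> \<in> autG" "L = line (\<rho> gen_y)" by (auto simp: over_def lines_def)
  then have "\<rho> gen_y \<in> W0" using o line_self by (auto simp: over_def)
  then show ?thesis using dg_gens_ge_1(2)[OF r(1)] r by (simp add: vdeg_line degree_le_iff)
qed

lemma vdeg_W0: "vdeg W0 = 1"
  using vdeg_plane[OF autG_id] by (simp add: mdeg_def)

text \<open>The last elementary factor of a chain leaves just one line of the plane in lower degree.\<close>

lemma unique_line_of_lower_degree: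
  assumes W: "W \<in> planes" "W \<noteq> W0" shows "\<exists>!L. over W L \<and> vdeg L < vdeg W"
proof -
  obtain \<tau> where t: "\<tau> \<in> autG" "W = \<tau> ` W0" using W by (auto simp: planes_def)
  then have "\<tau> \<in> chain" using autG_eq_chain by simp
  then show ?thesis
  proof cases
    case base
    then show ?thesis using t W Aff_iff by simp
  next
    case (step \<sigma> q \<alpha>)
    note s = chain_subset[OF step(2)]
    have se: "\<sigma> \<circ> el q \<in> autG" using s by (simp add: autG_comp el_in_autG)
    have "\<alpha> ` W0 = W0" using Aff_iff Aff_subset step(5) by blast
    then have Ws: "W = (\<sigma> \<circ> el q) ` W0" using t step(1) by (metis image_comp)
    define F where "F = \<sigma> (el q gen_x)"
    note lt = dg_step(2)[OF s step(3,4), folded F_def]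
    have vW: "vdeg W = dg F" unfolding Ws vdeg_plane[OF se] using lt by (simp add: mdeg_def F_def)
    have o: "over W (line (\<sigma> gen_y))"
      unfolding over_def using W(1) s line_subset_plane[OF se gens_in_plane(2)[OF se]] Ws by (auto simp: lines_def)
    have uniq: "L = line (\<sigma> gen_y)" if L: "over W L" "vdeg L < vdeg W" for L
    proof -
      obtain \<rho> where r: "\<rho> \<in> autG" "L = line (\<rho> gen_y)" using L by (auto simp: over_def lines_def)
      then have "\<rho> gen_y \<in> W" using L line_self by (auto simp: over_def)
      then obtain a b e where ab: "\<rho> gen_y = scalar a * F + scalar b * \<sigma> gen_y + scalar e"
        unfolding Ws plane_mem[OF se] by (auto simp: F_def)
      have "a = 0"
      proof (rule ccontr)
        assume a: "a \<noteq> 0"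
        have "dg (scalar b * \<sigma> gen_y + scalar e) \<le> dg (\<sigma> gen_y)"
          by (intro dg_add_le dg_scalar_mult_le) simp
        then have "dg (scalar a * F + (scalar b * \<sigma> gen_y + scalar e)) = dg (scalar a * F)"
          using a lt by (intro dg_add_eq) (simp add: dg_scalar_mult)
        then have "dg (\<rho> gen_y) = dg F" unfolding ab using a by (simp add: add.assoc dg_scalar_mult)
        then show False using L vW r by (simp add: vdeg_line)
      qed
      then have "\<rho> gen_y \<in> line (\<sigma> gen_y)" unfolding ab by (auto simp: line_def)
      then show ?thesis using r line_eq_of_mem dg_gens_ge_1(2)[OF r(1)] by simp
    qed
    show ?thesis
    proof (rule ex1I[of _ "line (\<sigma> gen_y)"])
      show "over W (line (\<sigma> gen_y)) \<and> vdeg (line (\<sigma> gen_y)) < vdeg W" using o lt vW by (simp add: vdeg_line)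
    qed (use uniq in blast)
  qed
qed

definition verts :: "free_alg set set" where "verts = planes \<union> lines"

text \<open>The degree orders the vertices: from a line one moves to the plane through it of the same degree, and from a
  plane to the line in it of lower degree.\<close>

definition parent :: "free_alg set \<Rightarrow> free_alg set" where
  "parent v = (if v = W0 then W0
     else if v \<in> lines then (THE W. over W v \<and> vdeg W = vdeg v)
     else (THE L. over v L \<and> vdeg L < vdeg v))"

definition height :: "free_alg set \<Rightarrow> nat" where
  "height v = 2 * vdeg v + (if v \<in> lines then 1 else 0)"

lemma parent_line: assumes "L \<in> lines"
  shows "over (parent L) L" "vdeg (parent L) = vdeg L" "over W L \<Longrightarrow> vdeg W = vdeg L \<Longrightarrow> parent L = W"
proof -
  have ne: "L \<noteq> W0" using lines_planes_disjoint[OF assms] W0_plane by blast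
  have p: "parent L = (THE W. over W L \<and> vdeg W = vdeg L)" using assms ne by (simp add: parent_def)
  have *: "over (parent L) L \<and> vdeg (parent L) = vdeg L"
    unfolding p by (rule theI') (rule unique_plane_of_same_degree[OF assms])
  then show "over (parent L) L" "vdeg (parent L) = vdeg L" by auto
  show "over W L \<Longrightarrow> vdeg W = vdeg L \<Longrightarrow> parent L = W"
    using * unique_plane_of_same_degree(1)[OF assms] by blast
qed

lemma parent_plane: assumes "W \<in> planes" "W \<noteq> W0"
  shows "over W (parent W)" "vdeg (parent W) < vdeg W" "over W L \<Longrightarrow> vdeg L < vdeg W \<Longrightarrow> parent W = L"
proof -
  have "W \<notin> lines" using lines_planes_disjoint assms by blast
  then have p: "parent W = (THE L. over W L \<and> vdeg L < vdeg W)" using assms by (simp add: parent_def)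
  have *: "over W (parent W) \<and> vdeg (parent W) < vdeg W"
    unfolding p by (rule theI') (rule unique_line_of_lower_degree[OF assms])
  then show "over W (parent W)" "vdeg (parent W) < vdeg W" by auto
  show "over W L \<Longrightarrow> vdeg L < vdeg W \<Longrightarrow> parent W = L"
    using * unique_line_of_lower_degree[OF assms] by blast
qed

interpretation T: rooted_tree verts W0 parent height
proof
  show "W0 \<in> verts" using W0_plane by (simp add: verts_def)
  show "parent W0 = W0" by (simp add: parent_def)
  show "parent v \<in> verts" if "v \<in> verts" for v
  proof (cases "v = W0")
    case True then show ?thesis using W0_plane by (simp add: verts_def parent_def)
  next
    case False
    then show ?thesis using that parent_line(1)[of v] parent_plane(1)[of v] by (auto simp: verts_def over_def)
  qed
  show "height (parent v) < height v" if v: "v \<in> verts" "v \<noteq> W0" for v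
  proof (cases "v \<in> lines")
    case True
    then have "parent v \<notin> lines" using parent_line(1)[OF True] lines_planes_disjoint by (auto simp: over_def)
    then show ?thesis using parent_line(2)[OF True] True by (simp add: height_def)
  next
    case False
    then have "vdeg (parent v) < vdeg v" using v parent_plane(2) by (auto simp: verts_def)
    then show ?thesis using False by (simp add: height_def)
  qed
qed

lemma adj_iff: assumes "u \<in> verts" "v \<in> verts" shows "T.adj u v \<longleftrightarrow> over u v \<or> over v u"
proof
  have *: "over u v \<or> over v u" if "u \<in> verts" "u \<noteq> v" "parent u = v" for u v
  proof (cases "u \<in> lines")
    case True
    then show ?thesis using parent_line(1)[OF True] that by simp
  next
    case False
    then have "u \<in> planes" using that by (simp add: verts_def)
    moreover have "u \<noteq> W0" using that by (auto simp: parent_def)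
    ultimately show ?thesis using parent_plane(1)[of u] that by simp
  qed
  show "T.adj u v \<Longrightarrow> over u v \<or> over v u" using * assms unfolding T.adj_def by metis
  have "T.adj W L" if o: "over W L" for W L
  proof -
    have WL: "W \<in> planes" "L \<in> lines" using o by (auto simp: over_def)
    then have ne: "W \<noteq> L" using lines_planes_disjoint by blast
    show ?thesis
    proof (cases "vdeg W = vdeg L")
      case True then show ?thesis using parent_line(3)[OF WL(2) o] ne by (simp add: T.adj_def)
    next
      case False
      then have "W \<noteq> W0" using over_W0[of L] o vdeg_W0 by auto
      moreover have "vdeg L < vdeg W" using False unique_plane_of_same_degree(2)[OF WL(2) o] by simp
      ultimately show ?thesis using parent_plane(3)[OF WL(1) _ o] ne by (simp add: T.adj_def)
    qed
  qed
  then show "over u v \<or> over v u \<Longrightarrow> T.adj u v" using T.adj_sym by blast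
qed

lemma over_image: "\<sigma> \<in> autG \<Longrightarrow> over W L \<Longrightarrow> over (\<sigma> ` W) (\<sigma> ` L)"
  by (auto simp: over_def planes_image lines_image)

lemma verts_image: "\<sigma> \<in> autG \<Longrightarrow> v \<in> verts \<Longrightarrow> \<sigma> ` v \<in> verts"
  by (auto simp: verts_def planes_image lines_image)

lemma isom_autG: assumes "\<sigma> \<in> autG" shows "T.isom ((`) \<sigma>)"
proof (rule T.isomI)
  have am: "T.adj_map ((`) \<tau>)" if "\<tau> \<in> autG" for \<tau>
    unfolding T.adj_map_def using that verts_image over_image adj_iff by (metis (no_types, lifting))
  show "T.adj_map ((`) \<sigma>)" "T.adj_map ((`) (finv \<sigma>))" using am assms autG_inv by blast+
  show "finv \<sigma> ` \<sigma> ` v = v" for v using assms by (rule image_finv)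
qed

lemma even_card_anc: "v \<in> verts \<Longrightarrow> even (card (T.anc v)) \<longleftrightarrow> v \<in> lines"
proof (induction "height v" arbitrary: v rule: less_induct)
  case less
  show ?case
  proof (cases "v = W0")
    case True
    then show ?thesis using lines_planes_disjoint W0_plane by (auto simp: T.anc_root)
  next
    case False
    have IH: "even (card (T.anc (parent v))) \<longleftrightarrow> parent v \<in> lines"
      using less.hyps[OF T.ht_less[OF less.prems False]] T.p_in[OF less.prems] by blast
    have "parent v \<in> lines \<longleftrightarrow> v \<notin> lines"
    proof (cases "v \<in> lines")
      case True
      then have "parent v \<in> planes" using parent_line(1)[OF True] by (simp add: over_def)
      then show ?thesis using True lines_planes_disjoint by blast
    next
      case F: False
      then have "v \<in> planes" using less.prems by (simp add: verts_def)
      then show ?thesis using parent_plane(1)[OF _ False] F by (simp add: over_def)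
    qed
    then show ?thesis using IH T.card_anc[OF less.prems False] by simp
  qed
qed

lemma even_displacement: assumes "\<sigma> \<in> autG" "v \<in> verts" shows "even (T.d v (\<sigma> ` v))"
proof -
  have "\<sigma> ` v \<in> lines \<longleftrightarrow> v \<in> lines"
    using assms lines_image[OF assms(1)] planes_image[OF assms(1)] lines_planes_disjoint by (auto simp: verts_def)
  then have "even (card (T.anc v)) \<longleftrightarrow> even (card (T.anc (\<sigma> ` v)))"
    using even_card_anc assms verts_image by simp
  then show ?thesis by (auto simp: T.d_def)
qed

text \<open>The number of ancestors of a vertex is bounded by its height, hence by the degree.\<close>

lemma displacement_root: assumes "\<sigma> \<in> autG" shows "T.d W0 (\<sigma> ` W0) \<le> 2 * int (mdeg \<sigma>)"
proof -
  have W: "\<sigma> ` W0 \<in> planes" using planes_image[OF assms W0_plane] .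
  then have V: "\<sigma> ` W0 \<in> verts" by (simp add: verts_def)
  have "\<sigma> ` W0 \<notin> lines" using W lines_planes_disjoint by blast
  then have "card (T.anc (\<sigma> ` W0)) \<le> 2 * mdeg \<sigma> + 1"
    using T.finite_anc[OF V] vdeg_plane[OF assms] by (simp add: height_def)
  moreover have "T.anc W0 \<inter> T.anc (\<sigma> ` W0) = {W0}" using T.finite_anc[OF V] by (auto simp: T.anc_root)
  ultimately show ?thesis by (simp add: T.d_def T.anc_root)
qed

section \<open>Stabilisers of long paths\<close>

text \<open>Such a polynomial is linear on the multiples of \<open>\<delta>\<close>, and there are infinitely many of these if \<open>\<delta>\<close> is not zero.\<close>

lemma poly_shift_const:
  fixes q :: "complex poly"
  assumes q: "degree q \<ge> 2" and eq: "\<And>t. poly q (t + \<delta>) = poly q t + k" shows "\<delta> = 0"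
proof (rule ccontr)
  assume d: "\<delta> \<noteq> 0"
  have val: "poly q (of_nat j * \<delta>) = poly q 0 + of_nat j * k" for j
  proof (induction j)
    case (Suc j)
    then show ?case using eq[of "of_nat j * \<delta>"] by (simp add: algebra_simps)
  qed simp
  define p where "p = q - [:poly q 0, k / \<delta>:]"
  have "range (\<lambda>j. of_nat j * \<delta>) \<subseteq> {z. poly p z = 0}"
    using d by (auto simp: p_def val)
  moreover have "infinite (range (\<lambda>j. of_nat j * \<delta> :: complex))"
    using d by (intro range_inj_infinite injI) simp
  ultimately have "infinite {z. poly p z = 0}" using finite_subset by blast
  then have "p = 0" using poly_roots_finite by blast
  then have "q = [:poly q 0, k / \<delta>:]" by (simp add: p_def)
  then have "degree q \<le> 1" by (metis degree_pCons_le degree_pCons_0 One_nat_def)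
  then show False using q by simp
qed

text \<open>The affine automorphisms fixing the lines of \<open>x\<close> and of \<open>y\<close>.\<close>

definition tri3 :: "complex \<Rightarrow> complex \<Rightarrow> complex \<Rightarrow> free_alg \<Rightarrow> free_alg" where
  "tri3 a e h = aff a 0 e 0 (1 / a) h"

text \<open>Comparison of the coefficients of \<open>x\<close> shows that \<open>x + q(y)\<close> is multiplied by \<open>a\<close>, up to a constant.\<close>

lemma side_relation:
  assumes a: "a \<noteq> 0" and fix1: "tri3 a e h ` line (gen_x + pol q gen_y) = line (gen_x + pol q gen_y)"
  shows "\<exists>k. pcompose q [:h, 1 / a:] = smult a q + [:k:]"
proof -
  have s: "tri3 a e h \<in> autG" unfolding tri3_def by (rule aff_in_autG) (use a in simp)
  have "tri3 a e h (gen_x + pol q gen_y) \<in> line (gen_x + pol q gen_y)"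
    using fix1 line_self line_image[OF s] by metis
  then obtain c k where "tri3 a e h (gen_x + pol q gen_y) = scalar c * (gen_x + pol q gen_y) + scalar k"
    by (auto simp: line_def)
  moreover have "tri3 a e h gen_y = pol [:h, 1 / a:] gen_y"
    by (simp add: tri3_def aff_gens affine_def pol_pCons)
  moreover have "tri3 a e h gen_x = scalar a * gen_x + scalar e" by (simp add: tri3_def aff_gens affine_def)
  ultimately have eq: "scalar a * gen_x + scalar e + pol (pcompose q [:h, 1 / a:]) gen_y
      = scalar c * gen_x + pol (smult c q) gen_y + scalar k"
    by (simp add: autG_simps[OF s] autG_pol[OF s] pol_pcompose distrib_left pol_smult)
  have nox: "coef (pol u gen_y) [Letter_x] = 0" for u
    unfolding pol_def lookup_sum
    by (intro sum.neutral) (auto simp: term1_replicate(2)[symmetric] lookup_single when_def dest: sym)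
  have "c = a" using arg_cong[OF eq, of "\<lambda>p. coef p [Letter_x]"]
    by (simp add: lookup_add coef_gens coef_scalar nox)
  then have "pol (pcompose q [:h, 1 / a:]) gen_y = pol (smult a q + [:k - e:]) gen_y"
    using eq by (simp add: pol_add scalar_diff algebra_simps)
  then have "pol (pcompose q [:h, 1 / a:] - (smult a q + [:k - e:])) gen_y = 0"
    unfolding diff_conv_add_uminus pol_add pol_minus by simp
  then have "pcompose q [:h, 1 / a:] - (smult a q + [:k - e:]) = 0" using pol_eq_0_iff[of gen_y] by simp
  then show ?thesis by auto
qed

text \<open>Leading coefficients in the functional equation of \<open>q\<close> make \<open>a\<close> a root of unity of order dividing \<open>n + 1\<close>. For given
  \<open>a\<close>, two solutions \<open>h\<close> differ by a shift under which \<open>q\<close> changes by a constant, so they are equal.\<close>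

lemma side_finite:
  assumes q: "degree q \<ge> 2"
  shows "finite {(a, h). a \<noteq> 0 \<and> (\<exists>e. tri3 a e h ` line (gen_x + pol q gen_y) = line (gen_x + pol q gen_y))}"
    (is "finite ?F")
proof -
  define n where "n = degree q"
  have rel: "\<exists>k. pcompose q [:h, 1 / a:] = smult a q + [:k:]" if "(a, h) \<in> ?F" for a h
    using that unfolding mem_Collect_eq prod.case by (elim conjE exE) (rule side_relation)
  have root: "a ^ (n + 1) = 1" if ah: "(a, h) \<in> ?F" for a h
  proof -
    obtain k where k: "pcompose q [:h, 1 / a:] = smult a q + [:k:]" using rel[OF ah] by blast
    have a: "a \<noteq> 0" using ah by simp
    \<comment> \<open>Comparing leading coefficients on both sides of q(h + t / a) = a q(t) + k.\<close>
    have "lead_coeff (pcompose q [:h, 1 / a:]) = lead_coeff q * (1 / a) ^ n"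
      using a by (subst lead_coeff_comp) (simp_all add: n_def)
    moreover have "degree (pcompose q [:h, 1 / a:]) = n" using a by (simp add: degree_pcompose n_def)
    moreover have "coeff (smult a q + [:k:]) n = a * lead_coeff q"
      using q by (simp add: n_def coeff_pCons split: nat.split)
    ultimately have "lead_coeff q * (1 / a) ^ n = a * lead_coeff q" using k by metis
    moreover have "lead_coeff q \<noteq> 0" using q by auto
    ultimately have "(1 / a) ^ n = a" by simp
    then have "a ^ n * (1 / a) ^ n = a ^ n * a" by simp
    then show ?thesis using a by (simp add: power_mult_distrib[symmetric] power_add)
  qed
  have inj: "inj_on fst ?F"
  proof (rule inj_onI)
    fix z z' assume z: "z \<in> ?F" "z' \<in> ?F" "fst z = fst z'"
    obtain a h where zh: "z = (a, h)" by (cases z)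
    obtain h' where zh': "z' = (a, h')" using z(3) zh by (cases z') simp
    have a: "a \<noteq> 0" using z zh by simp
    obtain e e' where "tri3 a e h ` line (gen_x + pol q gen_y) = line (gen_x + pol q gen_y)"
      "tri3 a e' h' ` line (gen_x + pol q gen_y) = line (gen_x + pol q gen_y)"
      using z(1,2) unfolding zh zh' mem_Collect_eq prod.case by (elim conjE exE)
    then obtain k k' where k: "pcompose q [:h, 1 / a:] = smult a q + [:k:]" "pcompose q [:h', 1 / a:] = smult a q + [:k':]"
      using side_relation[OF a] by metis
    have ev: "poly q (h + t / a) = a * poly q t + k" "poly q (h' + t / a) = a * poly q t + k'" for t
      using arg_cong[OF k(1), of "\<lambda>p. poly p t"] arg_cong[OF k(2), of "\<lambda>p. poly p t"]
      by (simp_all add: poly_pcompose)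
    have "poly q (s + (h - h')) = poly q s + (k - k')" for s
    proof -
      have t: "h + (s - h') * a / a = s + (h - h')" "h' + (s - h') * a / a = s" using a by simp_all
      show ?thesis using ev(1)[of "(s - h') * a"] ev(2)[of "(s - h') * a"] unfolding t by simp
    qed
    then have "h - h' = 0" using poly_shift_const[OF q] by blast
    then show "z = z'" using zh zh' by simp
  qed
  have "fst ` ?F \<subseteq> {a. poly (monom 1 (n + 1) - 1) a = 0}"
  proof (rule image_subsetI)
    fix z assume "z \<in> ?F"
    then have "(fst z, snd z) \<in> ?F" by simp
    from root[OF this] show "fst z \<in> {a. poly (monom 1 (n + 1) - 1) a = 0}" by (simp add: poly_monom)
  qed
  moreover have "finite {a. poly (monom 1 (n + 1) - 1 :: complex poly) a = 0}"
  proof (rule poly_roots_finite)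
    have "coeff (monom 1 (n + 1) - 1 :: complex poly) (n + 1) = 1" by (simp add: coeff_eq_0)
    then show "monom 1 (n + 1) - 1 \<noteq> (0 :: complex poly)" by (metis coeff_0 zero_neq_one)
  qed
  ultimately have "finite (fst ` ?F)" by (rule finite_subset)
  then show ?thesis using inj by (rule finite_imageD)
qed

text \<open>The lines that are two steps from the base plane, on the far side of the line of \<open>y\<close>.\<close>

lemma far_line:
  assumes "over Wa (line gen_y)" "Wa \<noteq> W0" "over Wa La" "La \<noteq> line gen_y"
  shows "\<exists>q. degree q \<ge> 2 \<and> La = line (gen_x + pol q gen_y)"
proof -
  have "Wa \<in> planes" "id gen_y \<in> Wa" using assms(1) line_self by (auto simp: over_def)
  then obtain q where "Wa = (id \<circ> el q) ` W0" "q = 0 \<or> degree q \<ge> 2"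
    using planes_over_line[OF autG_id] by blast
  then have W: "Wa = el q ` W0" and q: "degree q \<ge> 2" using assms(2) el_0 by auto
  obtain \<rho> where r: "\<rho> \<in> autG" "La = line (\<rho> gen_y)" using assms(3) by (auto simp: over_def lines_def)
  then have "\<rho> gen_y \<in> Wa" using assms(3) line_self by (auto simp: over_def)
  then obtain a b e where ab: "\<rho> gen_y = scalar a * (gen_x + pol q gen_y) + scalar b * gen_y + scalar e"
    unfolding W plane_mem[OF el_in_autG] by auto
  have a: "a \<noteq> 0"
  proof
    assume "a = 0"
    then have "\<rho> gen_y \<in> line gen_y" using ab by (auto simp: line_def)
    then show False using line_eq_of_mem dg_gens_ge_1(2)[OF r(1)] assms(4) r(2) by blast
  qed
  define q' where "q' = q + [:0, b / a:]"
  have "\<rho> gen_y = scalar a * (gen_x + pol q' gen_y) + scalar e"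
    using a by (simp add: ab q'_def pol_add pol_pCons distrib_left mult.assoc[symmetric] scalar_mult[symmetric] add.assoc)
  then have "La = line (gen_x + pol q' gen_y)" using r(2) line_eqI[OF a] by metis
  moreover have "degree q' = degree q" unfolding q'_def using q by (intro degree_add_eq_left) simp
  ultimately show ?thesis using q by metis
qed

lemma finv_swap_lines: "finv swap ` line gen_x = line gen_y" "finv swap ` line gen_y = line gen_x" "finv swap ` W0 = W0"
proof -
  note i = autG_inv[OF swap_in_autG]
  have "line (- gen_y) = line gen_y" using line_eqI[of "- 1" gen_y 0] by (simp add: scalar_minus)
  then show "finv swap ` line gen_x = line gen_y" "finv swap ` line gen_y = line gen_x" by (simp_all add: line_image[OF i])
  show "finv swap ` W0 = W0" using Aff_iff[OF i] Aff_inv swap_in_Aff by blast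
qed

text \<open>The stabiliser of the middle consists of the maps \<open>tri3 a e h\<close>. The side next to the line of \<open>y\<close> leaves finitely many
  pairs \<open>(a, h)\<close>, and the other side, after exchanging \<open>x\<close> and \<open>y\<close>, finitely many pairs \<open>(1 / a, - e)\<close>.\<close>

lemma finite_path_stabilizer_base:
  assumes "over Wa La" "over Wa (line gen_y)" "Wa \<noteq> W0" "La \<noteq> line gen_y"
    and "over Wb Lb" "over Wb (line gen_x)" "Wb \<noteq> W0" "Lb \<noteq> line gen_x"
  shows "finite {\<sigma> \<in> autG. \<sigma> ` W0 = W0 \<and> \<sigma> ` line gen_y = line gen_y \<and> \<sigma> ` line gen_x = line gen_x \<and>
    \<sigma> ` La = La \<and> \<sigma> ` Lb = Lb}" (is "finite ?S")
proof -
  obtain q where q: "degree q \<ge> 2" "La = line (gen_x + pol q gen_y)"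
    using far_line assms(1-4) by blast
  note sw = swap_in_autG and i = autG_inv[OF swap_in_autG]
  have "over (finv swap ` Wb) (line gen_y)" "over (finv swap ` Wb) (finv swap ` Lb)"
    using over_image[OF i assms(6)] over_image[OF i assms(5)] finv_swap_lines by simp_all
  moreover have "finv swap ` Wb \<noteq> W0" "finv swap ` Lb \<noteq> line gen_y"
    using assms(7,8) finv_swap_lines image_finv(2)[OF sw] by metis+
  ultimately obtain r where r: "degree r \<ge> 2" "finv swap ` Lb = line (gen_x + pol r gen_y)"
    using far_line by blast
  let ?F = "\<lambda>q. {(a, h). a \<noteq> 0 \<and> (\<exists>e. tri3 a e h ` line (gen_x + pol q gen_y) = line (gen_x + pol q gen_y))}"
  have "?S \<subseteq> (\<lambda>((a, h), (b, e)). tri3 a (- e) h) ` (?F q \<times> ?F r)"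
  proof
    fix \<sigma> assume s: "\<sigma> \<in> ?S"
    then have sG: "\<sigma> \<in> autG" and "\<sigma> \<in> Aff" using Aff_iff by auto
    then obtain a b e c d h where al: "a * d - b * c = 1" "\<sigma> = aff a b e c d h" using Aff_D by blast
    have "affine c d h \<in> line gen_y" "affine a b e \<in> line gen_x"
      using s line_self[of "\<sigma> gen_y"] line_self[of "\<sigma> gen_x"] line_image[OF sG, of gen_y] line_image[OF sG, of gen_x]
      by (simp_all add: al(2) aff_gens)
    then obtain u v u' v' where "affine c d h = affine 0 u v" "affine a b e = affine u' 0 v'"
      by (auto simp: line_def affine_def)
    then have "c = 0" "b = 0" by (simp_all add: affine_eq_iff)
    then have ad: "a * d = 1" using al by simp
    then have a: "a \<noteq> 0" by auto
    then have d: "d = 1 / a" using ad by (simp add: nonzero_eq_divide_eq mult.commute)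
    have st: "\<sigma> = tri3 a e h" using al(2) \<open>c = 0\<close> \<open>b = 0\<close> d by (simp add: tri3_def)
    have "(a, h) \<in> ?F q" using s a st q(2) by auto
    moreover have "(1 / a, - e) \<in> ?F r"
    proof -
      define \<tau> where "\<tau> = finv swap \<circ> (\<sigma> \<circ> swap)"
      have "\<tau> = tri3 (1 / a) h (- e)"
      proof (rule autG_eqI)
        show "\<tau> \<in> autG" using sw i sG by (simp add: \<tau>_def autG_comp)
        show "tri3 (1 / a) h (- e) \<in> autG" unfolding tri3_def by (rule aff_in_autG) (use a in simp)
        show "\<tau> gen_x = tri3 (1 / a) h (- e) gen_x" "\<tau> gen_y = tri3 (1 / a) h (- e) gen_y"
          by (simp_all add: \<tau>_def st tri3_def aff_gens autG_affine[OF i] autG_simps[OF i] subst_simps aff_def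
              autG_simps[OF sG])
            (simp_all add: affine_def scalar_minus)
      qed
      moreover have "\<tau> ` finv swap ` Lb = finv swap ` Lb"
      proof -
        have "\<tau> ` finv swap ` Lb = finv swap ` \<sigma> ` swap ` finv swap ` Lb" by (simp add: \<tau>_def image_image)
        also have "\<dots> = finv swap ` \<sigma> ` Lb" using image_finv(2)[OF sw] by simp
        finally show ?thesis using s by simp
      qed
      ultimately show ?thesis using a unfolding r(2) by auto
    qed
    ultimately have "((a, h), (1 / a, - e)) \<in> ?F q \<times> ?F r" by (rule SigmaI)
    then show "\<sigma> \<in> (\<lambda>((a, h), (b, e)). tri3 a (- e) h) ` (?F q \<times> ?F r)"
      using st by (intro image_eqI[of _ _ "((a, h), (1 / a, - e))"]) simp_all
  qed
  then show ?thesis by (rule finite_subset) (intro finite_imageI finite_cartesian_product side_finite q r)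
qed

lemma move_to_base:
  assumes "over W L1" "over W L2" "L1 \<noteq> L2"
  shows "\<exists>\<tau>\<in>autG. \<tau> ` W0 = W \<and> \<tau> ` line gen_y = L1 \<and> \<tau> ` line gen_x = L2"
proof -
  obtain \<rho> where r: "\<rho> \<in> autG" "W = \<rho> ` W0" using assms by (auto simp: over_def planes_def)
  have rep: "\<exists>u v w. (u \<noteq> 0 \<or> v \<noteq> 0) \<and> L = line (\<rho> (affine u v w))" if L: "over W L" for L
  proof -
    obtain \<sigma> where s: "\<sigma> \<in> autG" "L = line (\<sigma> gen_y)" using L by (auto simp: over_def lines_def)
    then have "\<sigma> gen_y \<in> \<rho> ` W0" using L line_self r by (auto simp: over_def)
    then obtain p where "p \<in> W0" "\<sigma> gen_y = \<rho> p" by blast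
    then obtain u v w where u: "\<sigma> gen_y = \<rho> (affine u v w)" unfolding W0_iff by blast
    then have "u \<noteq> 0 \<or> v \<noteq> 0" using dg_gens_ge_1(2)[OF s(1)] autG_affine_nonconst[OF r(1)] by simp
    then show ?thesis using s u by metis
  qed
  obtain u v w where 1: "u \<noteq> 0 \<or> v \<noteq> 0" "L1 = line (\<rho> (affine u v w))" using rep[OF assms(1)] by blast
  obtain u' v' w' where 2: "u' \<noteq> 0 \<or> v' \<noteq> 0" "L2 = line (\<rho> (affine u' v' w'))" using rep[OF assms(2)] by blast
  define D where "D = u' * v - v' * u"
  have D: "D \<noteq> 0"
  proof
    assume "D = 0"
    then have pr: "u' * v = v' * u" by (simp add: D_def)
    obtain k where k: "u' = k * u" "v' = k * v"
    proof (cases "u = 0")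
      case True
      then show ?thesis using that[of "v' / v"] pr 1 by auto
    next
      case False
      then show ?thesis using that[of "u' / u"] pr by (simp add: field_simps)
    qed
    have "affine u' v' w' = scalar k * affine u v w + scalar (w' - k * w)"
      unfolding affine_gens(3)[of "w' - k * w"] affine_scalar affine_add by (simp add: k)
    then have "\<rho> (affine u' v' w') = scalar k * \<rho> (affine u v w) + scalar (w' - k * w)"
      by (simp add: autG_simps[OF r(1)])
    moreover have "k \<noteq> 0" using 2 k by auto
    ultimately show False using assms(3) 1 2 line_eqI by metis
  qed
  define \<alpha> where "\<alpha> = aff (u' / D) (v' / D) 0 u v w"
  have "u' / D * v - v' / D * u = (u' * v - v' * u) / D" by (simp add: diff_divide_distrib)
  then have "u' / D * v - v' / D * u = D / D" by (simp only: D_def)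
  then have a: "\<alpha> \<in> Aff" unfolding \<alpha>_def using D by (intro Aff_I) simp
  have aG: "\<alpha> \<in> autG" using a Aff_subset by blast
  have "\<alpha> gen_x = scalar (1 / D) * affine u' v' w' + scalar (- w' / D)"
    unfolding affine_gens(3)[of "- w' / D"] affine_scalar affine_add by (simp add: \<alpha>_def aff_gens)
  then have "\<rho> (\<alpha> gen_x) = scalar (1 / D) * \<rho> (affine u' v' w') + scalar (- w' / D)"
    by (simp add: autG_simps[OF r(1)])
  then have "line (\<rho> (\<alpha> gen_x)) = L2" using 2 line_eqI[of "1 / D"] D by simp
  moreover have "line (\<rho> (\<alpha> gen_y)) = L1" using 1 by (simp add: \<alpha>_def aff_gens)
  moreover have "(\<rho> \<circ> \<alpha>) ` W0 = W" using Aff_iff[OF aG] a r(2) by (metis image_comp)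
  ultimately show ?thesis
    using line_image[OF autG_comp[OF r(1) aG]] autG_comp[OF r(1) aG] by (intro bexI[of _ "\<rho> \<circ> \<alpha>"]) simp_all
qed

lemma finite_path_stabilizer:
  assumes "over Wa La" "over Wa L1" "over W L1" "over W L2" "over Wb L2" "over Wb Lb"
    and ne: "La \<noteq> L1" "Wa \<noteq> W" "L1 \<noteq> L2" "Wb \<noteq> W" "Lb \<noteq> L2"
  shows "finite {\<sigma> \<in> autG. \<sigma> ` W = W \<and> \<sigma> ` L1 = L1 \<and> \<sigma> ` L2 = L2 \<and> \<sigma> ` La = La \<and> \<sigma> ` Lb = Lb}" (is "finite ?S")
proof -
  obtain \<tau> where t: "\<tau> \<in> autG" "\<tau> ` W0 = W" "\<tau> ` line gen_y = L1" "\<tau> ` line gen_x = L2"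
    using move_to_base[OF assms(3,4) ne(3)] by blast
  note i = autG_inv[OF t(1)]
  let ?i = "finv \<tau>"
  have inv: "?i ` W = W0" "?i ` L1 = line gen_y" "?i ` L2 = line gen_x"
    by (metis t(2) image_finv(1)[OF t(1)], metis t(3) image_finv(1)[OF t(1)], metis t(4) image_finv(1)[OF t(1)])
  have neq: "?i ` u \<noteq> ?i ` v" if "u \<noteq> v" for u v using that image_finv(2)[OF t(1)] by metis
  define S' where "S' = {\<sigma> \<in> autG. \<sigma> ` W0 = W0 \<and> \<sigma> ` line gen_y = line gen_y \<and> \<sigma> ` line gen_x = line gen_x \<and>
    \<sigma> ` ?i ` La = ?i ` La \<and> \<sigma> ` ?i ` Lb = ?i ` Lb}"
  have "finite S'" unfolding S'_def
  proof (rule finite_path_stabilizer_base)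
    show "over (?i ` Wa) (?i ` La)" "over (?i ` Wb) (?i ` Lb)" using over_image[OF i] assms by blast+
    show "over (?i ` Wa) (line gen_y)" "over (?i ` Wb) (line gen_x)" using over_image[OF i] assms inv by metis+
    show "?i ` Wa \<noteq> W0" "?i ` La \<noteq> line gen_y" "?i ` Wb \<noteq> W0" "?i ` Lb \<noteq> line gen_x"
      using neq ne inv by metis+
  qed
  moreover have "?S \<subseteq> (\<lambda>\<sigma>. \<tau> \<circ> \<sigma> \<circ> ?i) ` S'"
  proof
    fix \<sigma> assume s: "\<sigma> \<in> ?S"
    define \<rho> where "\<rho> = ?i \<circ> (\<sigma> \<circ> \<tau>)"
    have fx: "\<rho> ` ?i ` v = ?i ` v" if "\<sigma> ` v = v" for v
    proof -
      have "\<rho> ` ?i ` v = ?i ` \<sigma> ` \<tau> ` ?i ` v" by (simp add: \<rho>_def image_image)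
      then show ?thesis using that image_finv(2)[OF t(1)] by simp
    qed
    have "\<rho> \<in> S'" unfolding S'_def
      using s t i fx[of W] fx[of L1] fx[of L2] fx[of La] fx[of Lb] inv by (simp add: \<rho>_def autG_comp)
    moreover have "\<sigma> = \<tau> \<circ> \<rho> \<circ> ?i" using t(1) by (auto simp: \<rho>_def)
    ultimately show "\<sigma> \<in> (\<lambda>\<sigma>. \<tau> \<circ> \<sigma> \<circ> ?i) ` S'" by blast
  qed
  ultimately show ?thesis by (rule finite_surj)
qed

text \<open>Among the eight consecutive vertices of a path of length seven there are seven that begin with a line.\<close>

lemma finite_far_stabilizer:
  assumes V: "u \<in> verts" "w \<in> verts" and far: "T.d u w \<ge> 7"
  shows "finite {\<sigma> \<in> autG. \<sigma> ` u = u \<and> \<sigma> ` w = w}"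
proof -
  have far': "int 7 \<le> T.d u w" using far by simp
  obtain x where x: "\<And>i. i \<le> 7 \<Longrightarrow> x i \<in> verts" "\<And>i. i < 7 \<Longrightarrow> T.adj (x i) (x (Suc i))"
    "\<And>i. Suc i < 7 \<Longrightarrow> x i \<noteq> x (Suc (Suc i))"
    "\<And>g i. T.isom g \<Longrightarrow> g u = u \<Longrightarrow> g w = w \<Longrightarrow> i \<le> 7 \<Longrightarrow> g (x i) = x i"
    by (rule T.geodesic_sequence[OF V far']) (rule that)
  have alt: "over (x i) (x (Suc i)) \<or> over (x (Suc i)) (x i)" if "i < 7" for i
    using x(1,2) adj_iff that by (metis Suc_leI less_imp_le)
  have dis: "\<not> (over a b \<and> over b c)" for a b c using lines_planes_disjoint by (auto simp: over_def)
  have dis2: "\<not> (over a b \<and> over c a)" for a b c using lines_planes_disjoint by (auto simp: over_def)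
  \<comment> \<open>The first or the second vertex is a line; it serves as the start y 0.\<close>
  obtain k where k: "k \<le> 1" "over (x (k + 1)) (x k)"

  proof (cases "over (x 1) (x 0)")
    case True
    then show ?thesis using that[of 0] by simp
  next
    case False
    then have "over (x 0) (x 1)" using alt[of 0] by (simp add: One_nat_def)
    then have "over (x 2) (x 1)" using alt[of 1] dis[of "x 0" "x 1" "x 2"] by (simp add: numeral_2_eq_2 One_nat_def)
    then show ?thesis using that[of 1] by (simp add: numeral_2_eq_2 One_nat_def)
  qed
  define y where "y i = x (k + i)" for i
  have yalt: "over (y i) (y (i + 1)) \<or> over (y (i + 1)) (y i)" if "i < 6" for i
  proof -
    have e: "k + (i + 1) = Suc (k + i)" by simp
    show ?thesis using alt[of "k + i"] k(1) that unfolding y_def e by simp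
  qed
  have yne: "y i \<noteq> y (i + 2)" if "i < 5" for i
  proof -
    have e: "k + (i + 2) = Suc (Suc (k + i))" by simp
    show ?thesis using x(3)[of "k + i"] k(1) that unfolding y_def e by simp
  qed
  have o1: "over (y 1) (y 0)" using k(2) by (simp add: y_def)
  have o2: "over (y 1) (y 2)" using yalt[of 1] o1 dis by auto
  have o3: "over (y 3) (y 2)" using yalt[of 2] o2 dis by auto
  have o4: "over (y 3) (y 4)" using yalt[of 3] o3 dis by auto
  have o5: "over (y 5) (y 4)" using yalt[of 4] o4 dis by auto
  have o6: "over (y 5) (y 6)" using yalt[of 5] o5 dis by auto
  have n: "y 0 \<noteq> y 2" "y 1 \<noteq> y 3" "y 2 \<noteq> y 4" "y 5 \<noteq> y 3" "y 6 \<noteq> y 4"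
    using yne[of 0, unfolded add_0] yne[of 1] yne[of 2] yne[of 3, symmetric] yne[of 4, symmetric] by simp_all
  from finite_path_stabilizer[OF o1 o2 o3 o4 o5 o6 n]
  show ?thesis
  proof (rule finite_subset[rotated])
    have "\<sigma> ` x j = x j" if "\<sigma> \<in> autG" "\<sigma> ` u = u" "\<sigma> ` w = w" "j \<le> 7" for \<sigma> j
      by (rule x(4)[OF isom_autG[OF that(1)] that(2-4)])
    then have "\<sigma> ` y j = y j" if "\<sigma> \<in> autG" "\<sigma> ` u = u" "\<sigma> ` w = w" "j \<le> 6" for \<sigma> j
      using that k(1) by (simp add: y_def)
    then show "{\<sigma> \<in> autG. \<sigma> ` u = u \<and> \<sigma> ` w = w} \<subseteq> {\<sigma> \<in> autG. \<sigma> ` y 3 = y 3 \<and> \<sigma> ` y 2 = y 2 \<and>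
        \<sigma> ` y 4 = y 4 \<and> \<sigma> ` y 0 = y 0 \<and> \<sigma> ` y 6 = y 6}"
      by (intro Collect_mono) simp
  qed
qed

section \<open>Closed sets and polynomial families\<close>

lemma filtration_iff: "\<sigma> \<in> filtration k \<longleftrightarrow> \<sigma> \<in> autG \<and> mdeg \<sigma> \<le> k"
  by (simp add: filtration_def as_pair_def mdeg_def degree_le_iff)

lemma closedin_filtration_top:
  "closedin (filtration_top k) S \<longleftrightarrow>
     (\<exists>F\<subseteq>poly_functions. S = {\<sigma> \<in> filtration k. \<forall>f\<in>F. f (as_pair \<sigma>) = 0})"
proof
  assume "closedin (filtration_top k) S"
  then have S: "S \<subseteq> filtration k" "openin (filtration_top k) (filtration k - S)"
    by (auto simp: closedin_def topspace_filtration_top)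
  then obtain U where U: "openin (zariski k) U" "filtration k - S = as_pair -` U \<inter> filtration k"
    unfolding filtration_top_def openin_pullback_topology by blast
  then obtain F where F: "F \<subseteq> poly_functions"
      "degree_le k \<times> degree_le k - U = {v \<in> degree_le k \<times> degree_le k. \<forall>f\<in>F. f v = 0}"
    unfolding openin_zariski zariski_closed_def by blast
  have "\<sigma> \<in> S \<longleftrightarrow> (\<forall>f\<in>F. f (as_pair \<sigma>) = 0)" if s: "\<sigma> \<in> filtration k" for \<sigma>
  proof -
    have v: "as_pair \<sigma> \<in> degree_le k \<times> degree_le k" using s unfolding filtration_def by blast
    have "\<sigma> \<in> S \<longleftrightarrow> as_pair \<sigma> \<notin> U" using U(2) s by blast
    also have "\<dots> \<longleftrightarrow> as_pair \<sigma> \<in> degree_le k \<times> degree_le k - U" using v by blast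
    also have "\<dots> \<longleftrightarrow> (\<forall>f\<in>F. f (as_pair \<sigma>) = 0)" unfolding F(2) using v by blast
    finally show ?thesis .
  qed
  then have "S = {\<sigma> \<in> filtration k. \<forall>f\<in>F. f (as_pair \<sigma>) = 0}" using S(1) by blast
  then show "\<exists>F\<subseteq>poly_functions. S = {\<sigma> \<in> filtration k. \<forall>f\<in>F. f (as_pair \<sigma>) = 0}" using F(1) by blast
next
  assume "\<exists>F\<subseteq>poly_functions. S = {\<sigma> \<in> filtration k. \<forall>f\<in>F. f (as_pair \<sigma>) = 0}"
  then obtain F where F: "F \<subseteq> poly_functions" "S = {\<sigma> \<in> filtration k. \<forall>f\<in>F. f (as_pair \<sigma>) = 0}" by blast
  let ?A = "degree_le k \<times> degree_le k"
  define Z where "Z = {v \<in> ?A. \<forall>f\<in>F. f v = 0}"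
  have "zariski_closed k Z" unfolding zariski_closed_def Z_def using F(1) by blast
  moreover have "?A - (?A - Z) = Z" by (auto simp: Z_def)
  ultimately have "openin (zariski k) (?A - Z)" unfolding openin_zariski by simp
  moreover have "filtration k - S = as_pair -` (?A - Z) \<inter> filtration k"
  proof (rule Set.set_eqI)
    fix \<sigma>
    have "as_pair \<sigma> \<in> ?A" if "\<sigma> \<in> filtration k" using that unfolding filtration_def by simp
    then show "\<sigma> \<in> filtration k - S \<longleftrightarrow> \<sigma> \<in> as_pair -` (?A - Z) \<inter> filtration k"
      unfolding F(2) Z_def by auto
  qed
  ultimately have "openin (filtration_top k) (filtration k - S)"
    unfolding filtration_top_def openin_pullback_topology by (intro exI[of _ "?A - Z"]) simp
  then show "closedin (filtration_top k) S" using F(2) by (auto simp: closedin_def topspace_filtration_top)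
qed

lemma topspace_ind_zariski: "topspace ind_zariski = autG"
proof -
  have "openin ind_zariski autG"
  proof -
    have "closedin (filtration_top k) {}" for k by simp
    then show ?thesis unfolding openin_ind_zariski by simp
  qed
  then show ?thesis by (auto simp: topspace_def openin_ind_zariski)
qed

lemma closedin_ind_zariski_iff:
  "closedin ind_zariski S \<longleftrightarrow> S \<subseteq> autG \<and>
     (\<forall>k. \<exists>F\<subseteq>poly_functions. S \<inter> filtration k = {\<sigma> \<in> filtration k. \<forall>f\<in>F. f (as_pair \<sigma>) = 0})"
  unfolding closedin_ind_zariski closedin_filtration_top ..

lemma poly_functions_sum: "finite I \<Longrightarrow> (\<And>i. i \<in> I \<Longrightarrow> f i \<in> poly_functions) \<Longrightarrow> (\<lambda>v. \<Sum>i\<in>I. f i v) \<in> poly_functions"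
proof (induction I rule: finite_induct)
  case empty then show ?case using poly_functions.const[of 0] by simp
next
  case (insert i I)
  then show ?case using poly_functions.add[of "f i" "\<lambda>v. \<Sum>i\<in>I. f i v"] by simp
qed

text \<open>A family of elements of the algebra whose coefficients are polynomial functions of the parameter.\<close>

definition polyfam :: "(free_alg \<times> free_alg \<Rightarrow> free_alg) \<Rightarrow> bool" where
  "polyfam \<Phi> \<longleftrightarrow> (\<forall>w. (\<lambda>v. coef (\<Phi> v) w) \<in> poly_functions)"

lemma polyfam_coef: "polyfam \<Phi> \<Longrightarrow> (\<lambda>v. coef (\<Phi> v) w) \<in> poly_functions"
  by (simp add: polyfam_def)

lemma polyfam_const: "polyfam (\<lambda>_. p)" by (simp add: polyfam_def poly_functions.const)
lemma polyfam_fst: "polyfam fst" and polyfam_snd: "polyfam snd"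
  using poly_functions.coord_fst poly_functions.coord_snd by (simp_all add: polyfam_def)

lemma polyfam_add: "polyfam \<Phi> \<Longrightarrow> polyfam \<Psi> \<Longrightarrow> polyfam (\<lambda>v. \<Phi> v + \<Psi> v)"
  by (simp add: polyfam_def lookup_add poly_functions.add)

lemma polyfam_scalar: "f \<in> poly_functions \<Longrightarrow> polyfam \<Phi> \<Longrightarrow> polyfam (\<lambda>v. scalar (f v) * \<Phi> v)"
  using poly_functions.mult[of f] by (simp add: polyfam_def)

lemma polyfam_mult: "polyfam \<Phi> \<Longrightarrow> polyfam \<Psi> \<Longrightarrow> polyfam (\<lambda>v. \<Phi> v * \<Psi> v)"
  unfolding polyfam_def coef_mult
  by (intro allI poly_functions_sum poly_functions.mult) simp_all

lemma polyfam_diff: assumes "polyfam \<Phi>" "polyfam \<Psi>" shows "polyfam (\<lambda>v. \<Phi> v - \<Psi> v)"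
proof -
  have "polyfam (\<lambda>v. \<Phi> v + scalar (- 1) * \<Psi> v)"
    using assms by (intro polyfam_add polyfam_scalar poly_functions.const)
  then show ?thesis by (simp add: scalar_minus)
qed

lemma polyfam_sum: "finite I \<Longrightarrow> (\<And>i. i \<in> I \<Longrightarrow> polyfam (f i)) \<Longrightarrow> polyfam (\<lambda>v. \<Sum>i\<in>I. f i v)"
  unfolding polyfam_def lookup_sum by (intro allI poly_functions_sum) simp_all

lemma poly_functions_comp:
  assumes "f \<in> poly_functions" "polyfam \<Phi>" "polyfam \<Psi>" shows "(\<lambda>v. f (\<Phi> v, \<Psi> v)) \<in> poly_functions"
  using assms(1)
  by induction (use assms in \<open>auto intro: poly_functions.intros polyfam_coef\<close>)

lemma UNIV_letter: "UNIV = {Letter_x, Letter_y}"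
  using letter.exhaust by auto

definition short :: "nat \<Rightarrow> letter list set" where "short n = {w. length w \<le> n}"

lemma finite_short: "finite (short n)"
  using finite_lists_length_le[of "UNIV :: letter set" n] finite.intros by (simp add: short_def) (simp add: UNIV_letter)

text \<open>Substitution into a family of bounded degree, written as a finite sum so that its coefficients are visibly
  polynomial.\<close>

definition subst_fam where
  "subst_fam K \<Phi> \<Psi> \<Theta> v = (\<Sum>w\<in>short K. scalar (coef (\<Theta> v) w) * prod_list (map (case_letter (\<Phi> v) (\<Psi> v)) w))"

lemma polyfam_subst_fam:
  assumes "polyfam \<Phi>" "polyfam \<Psi>" "polyfam \<Theta>" shows "polyfam (subst_fam K \<Phi> \<Psi> \<Theta>)"
proof -
  have w: "polyfam (\<lambda>v. prod_list (map (case_letter (\<Phi> v) (\<Psi> v)) w))" for w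
  proof (induction w)
    case (Cons a w)
    then show ?case by (cases a) (simp_all add: polyfam_mult assms)
  qed (simp add: polyfam_const)
  have "polyfam (\<lambda>v. \<Sum>w\<in>short K. scalar (coef (\<Theta> v) w) * prod_list (map (case_letter (\<Phi> v) (\<Psi> v)) w))"
    by (intro polyfam_sum finite_short polyfam_scalar polyfam_coef assms w)
  then show ?thesis unfolding subst_fam_def[abs_def] .
qed

lemma subst_fam_eq:
  assumes s: "alg_endo \<sigma>" and "\<Phi> v = \<sigma> gen_x" "\<Psi> v = \<sigma> gen_y" and K: "dg (\<Theta> v) \<le> K"
  shows "subst_fam K \<Phi> \<Psi> \<Theta> v = \<sigma> (\<Theta> v)"
proof -
  have "\<sigma> = subst (\<Phi> v) (\<Psi> v)" using assms by (intro subst_eqI) simp_all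
  then have "\<sigma> (\<Theta> v) = (\<Sum>w\<in>words (\<Theta> v). scalar (coef (\<Theta> v) w) * prod_list (map (case_letter (\<Phi> v) (\<Psi> v)) w))"
    by (simp add: subst_def linext_def)
  also have "\<dots> = subst_fam K \<Phi> \<Psi> \<Theta> v"
    unfolding subst_fam_def using K coef_eq_0_above_dg[of "\<Theta> v"]
    by (intro sum.mono_neutral_left finite_short) (force simp: short_def in_keys_iff)+
  finally show ?thesis ..
qed

text \<open>Morphisms of ind-varieties, on automorphisms of degree at most \<open>k\<close>: the values have bounded degree and depend polynomially on the argument.\<close>

definition reg :: "nat \<Rightarrow> ((free_alg \<Rightarrow> free_alg) \<Rightarrow> free_alg \<Rightarrow> free_alg) \<Rightarrow> bool" where
  "reg k T \<longleftrightarrow> (\<exists>K \<Phi> \<Psi>. polyfam \<Phi> \<and> polyfam \<Psi> \<and> (\<forall>\<sigma>\<in>filtration k. T \<sigma> \<in> filtration K \<and>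
     T \<sigma> gen_x = \<Phi> (as_pair \<sigma>) \<and> T \<sigma> gen_y = \<Psi> (as_pair \<sigma>)))"

lemma regE:
  assumes "reg k T"
  obtains K \<Phi> \<Psi> where "polyfam \<Phi>" "polyfam \<Psi>" "\<And>\<sigma>. \<sigma> \<in> filtration k \<Longrightarrow> T \<sigma> \<in> filtration K \<and>
     T \<sigma> gen_x = \<Phi> (as_pair \<sigma>) \<and> T \<sigma> gen_y = \<Psi> (as_pair \<sigma>)"
  using assms unfolding reg_def by (elim exE conjE) (rule that, assumption, assumption, erule bspec, assumption)

lemma regI:
  assumes "polyfam \<Phi>" "polyfam \<Psi>" "\<And>\<sigma>. \<sigma> \<in> filtration k \<Longrightarrow> T \<sigma> \<in> filtration K \<and>
     T \<sigma> gen_x = \<Phi> (as_pair \<sigma>) \<and> T \<sigma> gen_y = \<Psi> (as_pair \<sigma>)"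
  shows "reg k T"
  unfolding reg_def by (rule exI[of _ K], rule exI[of _ \<Phi>], rule exI[of _ \<Psi>], rule conjI, rule assms(1), rule conjI, rule assms(2),
      rule ballI, rule assms(3))

lemma reg_id: "reg k (\<lambda>\<sigma>. \<sigma>)"
  unfolding reg_def using polyfam_fst polyfam_snd
  by (intro exI[of _ k] exI[of _ fst] exI[of _ snd]) (simp add: as_pair_def)

lemma reg_const: "g \<in> autG \<Longrightarrow> reg k (\<lambda>_. g)"
  unfolding reg_def using polyfam_const
  by (intro exI[of _ "mdeg g"] exI[of _ "\<lambda>_. g gen_x"] exI[of _ "\<lambda>_. g gen_y"]) (simp add: filtration_iff)

lemma reg_comp: assumes "reg k S" "reg k T" shows "reg k (\<lambda>\<sigma>. S \<sigma> \<circ> T \<sigma>)"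
proof -
  obtain K \<Phi> \<Psi> where S: "polyfam \<Phi>" "polyfam \<Psi>" "\<And>\<sigma>. \<sigma> \<in> filtration k \<Longrightarrow> S \<sigma> \<in> filtration K \<and>
     S \<sigma> gen_x = \<Phi> (as_pair \<sigma>) \<and> S \<sigma> gen_y = \<Psi> (as_pair \<sigma>)" by (rule regE[OF assms(1)]) (rule that)
  obtain L \<Phi>' \<Psi>' where T: "polyfam \<Phi>'" "polyfam \<Psi>'" "\<And>\<sigma>. \<sigma> \<in> filtration k \<Longrightarrow> T \<sigma> \<in> filtration L \<and>
     T \<sigma> gen_x = \<Phi>' (as_pair \<sigma>) \<and> T \<sigma> gen_y = \<Psi>' (as_pair \<sigma>)" by (rule regE[OF assms(2)]) (rule that)
  have "(S \<sigma> \<circ> T \<sigma>) \<in> filtration (L * K) \<and> (S \<sigma> \<circ> T \<sigma>) gen_x = subst_fam L \<Phi> \<Psi> \<Phi>' (as_pair \<sigma>) \<and>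
     (S \<sigma> \<circ> T \<sigma>) gen_y = subst_fam L \<Phi> \<Psi> \<Psi>' (as_pair \<sigma>)" if s: "\<sigma> \<in> filtration k" for \<sigma>
  proof -
    have St: "S \<sigma> \<in> autG" "mdeg (S \<sigma>) \<le> K" "T \<sigma> \<in> autG" "mdeg (T \<sigma>) \<le> L"
      using S(3)[OF s] T(3)[OF s] by (simp_all add: filtration_iff)
    have "mdeg (S \<sigma> \<circ> T \<sigma>) \<le> mdeg (T \<sigma>) * mdeg (S \<sigma>)" using St mdeg_comp_le by blast
    also have "\<dots> \<le> L * K" using St by (intro mult_mono) auto
    finally have "S \<sigma> \<circ> T \<sigma> \<in> filtration (L * K)" using St autG_comp filtration_iff by blast
    moreover have "dg (\<Phi>' (as_pair \<sigma>)) \<le> L" "dg (\<Psi>' (as_pair \<sigma>)) \<le> L"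
      using St(4) T(3)[OF s] by (simp_all add: mdeg_def)
    ultimately show ?thesis
      using subst_fam_eq[OF autG_alg_endo[OF St(1)], of \<Phi> "as_pair \<sigma>" \<Psi>] S(3)[OF s] T(3)[OF s] by simp
  qed
  with polyfam_subst_fam[OF S(1,2) T(1)] polyfam_subst_fam[OF S(1,2) T(2)]
  show ?thesis by (rule regI)
qed

section \<open>Inversion is continuous\<close>

definition low :: "nat \<Rightarrow> free_alg \<Rightarrow> bool" where "low n p \<longleftrightarrow> (\<forall>w. length w < n \<longrightarrow> coef p w = 0)"

lemma low_add: "low n p \<Longrightarrow> low n q \<Longrightarrow> low n (p + q)" by (simp add: low_def lookup_add)
lemma low_diff: "low n p \<Longrightarrow> low n q \<Longrightarrow> low n (p - q)" by (simp add: low_def lookup_minus)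
lemma low_scalar: "low n p \<Longrightarrow> low n (scalar c * p)" by (simp add: low_def)
lemma low_0: "low n 0" by (simp add: low_def)
lemma low_mono: "low n p \<Longrightarrow> m \<le> n \<Longrightarrow> low m p" by (simp add: low_def)
lemma low_sum: "(\<And>i. i \<in> I \<Longrightarrow> low n (f i)) \<Longrightarrow> low n (sum f I)"
  by (induction I rule: infinite_finite_induct) (simp_all add: low_add low_0)

lemma low_mult: assumes "low m p" "low n q" shows "low (m + n) (p * q)"
  unfolding low_def
proof (intro allI impI)
  fix w :: "letter list" assume w: "length w < m + n"
  have "coef p (take i w) * coef q (drop i w) = 0" if "i \<le> length w" for i
  proof (cases "i < m")
    case True then show ?thesis using assms(1) that by (simp add: low_def)
  next
    case False
    then have "length (drop i w) < n" using w that by simp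
    then show ?thesis using assms(2) by (simp add: low_def)
  qed
  then have "(\<Sum>i\<le>length w. coef p (take i w) * coef q (drop i w)) = 0" by (intro sum.neutral) blast
  then show "coef (p * q) w = 0" by (simp only: coef_mult)
qed

lemma low_term1: "low (length w) (term1 w c)"
  by (auto simp: low_def lookup_single when_def)

text \<open>The identity up to terms of degree at least two, a normalisation which makes the inverse a convergent series.\<close>

definition unip :: "(free_alg \<Rightarrow> free_alg) \<Rightarrow> bool" where
  "unip u \<longleftrightarrow> alg_endo u \<and> low 2 (u gen_x - gen_x) \<and> low 2 (u gen_y - gen_y)"

text \<open>For such \<open>u\<close> the operator \<open>1 - u\<close> raises the lowest degree.\<close>

lemma unip_raises:
  assumes u: "unip u" and p: "low n p" shows "low (Suc n) (p - u p)"
proof -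
  note s = alg_endo_simps[of u]
  have e: "alg_endo u" using u by (simp add: unip_def)
  have w: "low (Suc (length w)) (term1 w 1 - u (term1 w 1))" for w
  proof (induction w)
    case Nil then show ?case by (simp add: term1_gens s[OF e] low_0)
  next
    case (Cons a w)
    define g where "g = (case a of Letter_x \<Rightarrow> gen_x | Letter_y \<Rightarrow> gen_y)"
    have g: "low 1 g" "low 2 (g - u g)"
    proof -
      show "low 1 g" by (cases a) (auto simp: g_def low_def coef_gens)
      have "low 2 (u g - g)" using u by (cases a) (simp_all add: g_def unip_def)
      then have "low 2 (scalar (- 1) * (u g - g))" by (rule low_scalar)
      then show "low 2 (g - u g)" by (simp add: scalar_minus)
    qed
    have ug: "low 1 (u g)" using low_diff[OF g(1) low_mono[OF g(2), of 1]] by simp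
    have "low (2 + length w) ((g - u g) * term1 w 1)" by (rule low_mult[OF g(2) low_term1])
    moreover have "low (1 + Suc (length w)) (u g * (term1 w 1 - u (term1 w 1)))" by (rule low_mult[OF ug Cons])
    ultimately have "low (Suc (length (a # w))) ((g - u g) * term1 w 1 + u g * (term1 w 1 - u (term1 w 1)))"
      by (intro low_add) (simp_all only: list.size add_2_eq_Suc plus_1_eq_Suc add_0_right add_Suc_right One_nat_def add_Suc add_0)
    then show ?case by (simp add: term1_Cons g_def[symmetric] s[OF e] left_diff_distrib right_diff_distrib)
  qed
  have "p - u p = (\<Sum>w\<in>words p. scalar (coef p w) * (term1 w 1 - u (term1 w 1)))"
    by (subst (1 2) free_alg_as_sum[of p]) (simp add: s[OF e] right_diff_distrib sum_subtractf)
  moreover have "low (Suc n) (\<Sum>w\<in>words p. scalar (coef p w) * (term1 w 1 - u (term1 w 1)))"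
  proof (intro low_sum low_scalar)
    fix v assume "v \<in> words p"
    then have "length v \<ge> n" using p by (force simp: low_def in_keys_iff)
    then show "low (Suc n) (term1 v 1 - u (term1 v 1))" using low_mono[OF w[of v]] by simp
  qed
  ultimately show ?thesis by simp
qed

definition nil_iter :: "(free_alg \<Rightarrow> free_alg) \<Rightarrow> nat \<Rightarrow> free_alg \<Rightarrow> free_alg" where
  "nil_iter u j = ((\<lambda>p. p - u p) ^^ j)"

lemma low_nil_iter: "unip u \<Longrightarrow> low n p \<Longrightarrow> low (n + j) (nil_iter u j p)"
  by (induction j) (simp_all add: nil_iter_def unip_raises)

lemma unip_preserves_low:
  assumes "unip u" "low n (u r)" shows "low n r"
  using assms(2)
proof (induction n)
  case 0 then show ?case by (simp add: low_def)
next
  case (Suc n)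
  then have "low n r" using low_mono by force
  then have "low (Suc n) (r - u r)" using unip_raises assms(1) by blast
  from low_add[OF this Suc.prems] show ?case by simp
qed

text \<open>The inverse is the geometric series of \<open>1 - u\<close>, and the terms beyond the \<open>K\<close>-th have no coefficients in degrees up
  to \<open>K\<close>.\<close>

lemma unip_inverse_coef:
  assumes u: "unip u" "u \<in> autG" and w: "length w \<le> K"
  shows "coef (finv u p) w = coef (\<Sum>j\<le>K. nil_iter u j p) w"
proof -
  define E where "E = (\<Sum>j\<le>K. nil_iter u j p)"
  have tel: "u (\<Sum>j\<le>K. nil_iter u j p) = p - nil_iter u (Suc K) p" for K
    by (induction K) (simp_all add: autG_simps[OF u(2)] nil_iter_def)
  have "u (finv u p - E) = nil_iter u (Suc K) p"
    using u(2) tel[of K] by (simp add: E_def autG_simps)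
  moreover have "low (0 + Suc K) (nil_iter u (Suc K) p)" by (rule low_nil_iter[OF u(1)]) (simp add: low_def)
  ultimately have "low (Suc K) (finv u p - E)" using unip_preserves_low[OF u(1)] by simp
  then show ?thesis using w by (simp add: low_def lookup_minus E_def)
qed

definition trunc :: "nat \<Rightarrow> free_alg \<Rightarrow> free_alg" where
  "trunc K p = (\<Sum>w\<in>short K. scalar (coef p w) * term1 w 1)"

lemma coef_trunc: "coef (trunc K p) w = (if length w \<le> K then coef p w else 0)"
proof -
  have "coef (trunc K p) w = (\<Sum>v\<in>short K. if v = w then coef p w else 0)"
    unfolding trunc_def lookup_sum by (intro sum.cong) (auto simp: lookup_single)
  then show ?thesis using finite_short by (simp add: short_def)
qed

lemma polyfam_trunc: "polyfam \<Phi> \<Longrightarrow> polyfam (\<lambda>v. trunc K (\<Phi> v))"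
  unfolding trunc_def by (intro polyfam_sum finite_short polyfam_scalar polyfam_coef polyfam_const)

text \<open>The degree of the inverse is bounded by that of the automorphism, so the geometric series may be truncated: a
  fixed finite part of it determines the inverse polynomially.\<close>

lemma reg_unip_inverse:
  assumes U: "reg k U" "\<And>\<sigma>. \<sigma> \<in> filtration k \<Longrightarrow> unip (U \<sigma>)"
  shows "reg k (\<lambda>\<sigma>. finv (U \<sigma>))"
proof -
  obtain K \<Phi> \<Psi> where S: "polyfam \<Phi>" "polyfam \<Psi>" "\<And>\<sigma>. \<sigma> \<in> filtration k \<Longrightarrow> U \<sigma> \<in> filtration K \<and>
     U \<sigma> gen_x = \<Phi> (as_pair \<sigma>) \<and> U \<sigma> gen_y = \<Psi> (as_pair \<sigma>)" by (rule regE[OF U(1)]) (rule that)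
  have iter: "\<exists>L \<Theta>. polyfam \<Theta> \<and> (\<forall>\<sigma>\<in>filtration k. nil_iter (U \<sigma>) j p = \<Theta> (as_pair \<sigma>) \<and> dg (\<Theta> (as_pair \<sigma>)) \<le> L)" for j p
  proof (induction j)
    case 0
    show ?case using polyfam_const by (intro exI[of _ "dg p"] exI[of _ "\<lambda>_. p"]) (simp add: nil_iter_def)
  next
    case (Suc j)
    then obtain L \<Theta> where L: "polyfam \<Theta>" "\<And>\<sigma>. \<sigma> \<in> filtration k \<Longrightarrow> nil_iter (U \<sigma>) j p = \<Theta> (as_pair \<sigma>) \<and> dg (\<Theta> (as_pair \<sigma>)) \<le> L"
      by blast
    define \<Theta>' where "\<Theta>' v = \<Theta> v - subst_fam L \<Phi> \<Psi> \<Theta> v" for v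
    have "polyfam \<Theta>'" unfolding \<Theta>'_def by (intro polyfam_diff polyfam_subst_fam L S)
    moreover have "nil_iter (U \<sigma>) (Suc j) p = \<Theta>' (as_pair \<sigma>) \<and> dg (\<Theta>' (as_pair \<sigma>)) \<le> L + L * K"
      if s: "\<sigma> \<in> filtration k" for \<sigma>
    proof -
      have Us: "U \<sigma> \<in> autG" "mdeg (U \<sigma>) \<le> K" using S(3)[OF s] by (simp_all add: filtration_iff)
      have eq: "subst_fam L \<Phi> \<Psi> \<Theta> (as_pair \<sigma>) = U \<sigma> (\<Theta> (as_pair \<sigma>))"
        using S(3)[OF s] L(2)[OF s] by (intro subst_fam_eq autG_alg_endo Us) simp_all
      have "dg (U \<sigma> (\<Theta> (as_pair \<sigma>))) \<le> dg (\<Theta> (as_pair \<sigma>)) * mdeg (U \<sigma>)"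
        by (rule dg_le_mdeg[OF autG_alg_endo[OF Us(1)]])
      also have "\<dots> \<le> L * K" using L(2)[OF s] Us by (intro mult_mono) auto
      finally have d2: "dg (U \<sigma> (\<Theta> (as_pair \<sigma>))) \<le> L * K" .
      have "dg (\<Theta> (as_pair \<sigma>) + - U \<sigma> (\<Theta> (as_pair \<sigma>))) \<le> L + L * K"
        using L(2)[OF s] d2 by (intro dg_add_le) simp_all
      moreover have "nil_iter (U \<sigma>) (Suc j) p = nil_iter (U \<sigma>) j p - U \<sigma> (nil_iter (U \<sigma>) j p)"
        by (simp add: nil_iter_def)
      ultimately show ?thesis using L(2)[OF s] by (simp add: \<Theta>'_def eq)
    qed
    ultimately show ?case by blast
  qed
  have fam: "\<exists>\<Theta>. polyfam \<Theta> \<and> (\<forall>\<sigma>\<in>filtration k. finv (U \<sigma>) p = \<Theta> (as_pair \<sigma>))" if p: "dg p \<le> 1" for p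
  proof -
    obtain \<Theta> where T: "\<And>j. polyfam (\<Theta> j)" "\<And>j \<sigma>. \<sigma> \<in> filtration k \<Longrightarrow> nil_iter (U \<sigma>) j p = \<Theta> j (as_pair \<sigma>)"
      using iter[of _ p] by metis
    have "finv (U \<sigma>) p = trunc K (\<Sum>j\<le>K. \<Theta> j (as_pair \<sigma>))" if s: "\<sigma> \<in> filtration k" for \<sigma>
    proof (rule poly_mapping_eqI)
      fix w
      have Us: "U \<sigma> \<in> autG" "mdeg (U \<sigma>) \<le> K" using S(3)[OF s] by (simp_all add: filtration_iff)
      have m: "mdeg (finv (U \<sigma>)) \<le> K" using mdeg_inv_le[OF Us(1)] Us(2) by simp
      have "dg (finv (U \<sigma>) p) \<le> dg p * mdeg (finv (U \<sigma>))"
        using Us autG_inv autG_alg_endo dg_le_mdeg by blast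
      also have "\<dots> \<le> 1 * K" using p m by (intro mult_mono) auto
      finally have d: "dg (finv (U \<sigma>) p) \<le> K" by simp
      show "coef (finv (U \<sigma>) p) w = coef (trunc K (\<Sum>j\<le>K. \<Theta> j (as_pair \<sigma>))) w"
      proof (cases "length w \<le> K")
        case True
        then show ?thesis
          using unip_inverse_coef[OF U(2)[OF s] Us(1) True, of p] T(2)[OF s] by (simp add: coef_trunc)
      next
        case False
        then show ?thesis using d coef_eq_0_above_dg[of "finv (U \<sigma>) p" w] by (simp add: coef_trunc)
      qed
    qed
    moreover have "polyfam (\<lambda>v. trunc K (\<Sum>j\<le>K. \<Theta> j v))"
      by (intro polyfam_trunc polyfam_sum T) simp
    ultimately show ?thesis by blast
  qed
  obtain X where X: "polyfam X" "\<forall>\<sigma>\<in>filtration k. finv (U \<sigma>) gen_x = X (as_pair \<sigma>)" using fam[of gen_x] by auto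
  obtain Y where Y: "polyfam Y" "\<forall>\<sigma>\<in>filtration k. finv (U \<sigma>) gen_y = Y (as_pair \<sigma>)" using fam[of gen_y] by auto
  have "finv (U \<sigma>) \<in> filtration K" if "\<sigma> \<in> filtration k" for \<sigma>
  proof -
    have "U \<sigma> \<in> autG" "mdeg (U \<sigma>) \<le> K" using S(3)[OF that] by (simp_all add: filtration_iff)
    then show ?thesis using mdeg_inv_le[of "U \<sigma>"] autG_inv by (simp add: filtration_iff)
  qed
  with X Y show ?thesis by (intro regI[OF X(1) Y(1), of k _ K] conjI) simp_all
qed

text \<open>The inverse of the affine part. It has determinant one, so no division is needed.\<close>

definition aff_inv :: "(free_alg \<Rightarrow> free_alg) \<Rightarrow> free_alg \<Rightarrow> free_alg" where
  "aff_inv \<sigma> = (let a = coef (\<sigma> gen_x) [Letter_x]; b = coef (\<sigma> gen_x) [Letter_y]; e = coef (\<sigma> gen_x) [];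
      c = coef (\<sigma> gen_y) [Letter_x]; d = coef (\<sigma> gen_y) [Letter_y]; h = coef (\<sigma> gen_y) []
    in aff d (- b) (b * h - d * e) (- c) a (c * e - a * h))"

text \<open>The coefficient of \<open>x y\<close> in \<open>[x, y]\<close>.\<close>

lemma jacobian_at_0:
  assumes s: "\<sigma> \<in> autG"
  shows "coef (\<sigma> gen_x) [Letter_x] * coef (\<sigma> gen_y) [Letter_y] - coef (\<sigma> gen_x) [Letter_y] * coef (\<sigma> gen_y) [Letter_x] = 1"
proof -
  have c2: "coef (p * q) [a, b] = coef p [] * coef q [a, b] + coef p [a] * coef q [b] + coef p [a, b] * coef q []" for p q a b
  proof -
    have "{..length [a, b]} = {0, 1, 2}" by auto
    then show ?thesis by (simp add: coef_mult One_nat_def numeral_2_eq_2)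
  qed
  have "coef (commutator (\<sigma> gen_x) (\<sigma> gen_y)) [Letter_x, Letter_y] = coef (commutator gen_x gen_y) [Letter_x, Letter_y]"
    using autG_commutator'[OF s] by simp
  then show ?thesis by (simp add: commutator_def lookup_minus c2 coef_gens algebra_simps)
qed

lemma aff_inv_props:
  assumes s: "\<sigma> \<in> autG" shows "aff_inv \<sigma> \<in> Aff" "unip (\<sigma> \<circ> aff_inv \<sigma>)"
proof -
  define a b e c d h where abc: "a = coef (\<sigma> gen_x) [Letter_x]" "b = coef (\<sigma> gen_x) [Letter_y]" "e = coef (\<sigma> gen_x) []"
      "c = coef (\<sigma> gen_y) [Letter_x]" "d = coef (\<sigma> gen_y) [Letter_y]" "h = coef (\<sigma> gen_y) []"
  have det: "a * d - b * c = 1" using jacobian_at_0[OF s] by (simp add: abc)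
  have A: "aff_inv \<sigma> = aff d (- b) (b * h - d * e) (- c) a (c * e - a * h)" by (simp add: aff_inv_def abc Let_def)
  show "aff_inv \<sigma> \<in> Aff" unfolding A by (rule Aff_I) (use det in \<open>simp add: algebra_simps\<close>)
  have sh: "w = [] \<or> w = [Letter_x] \<or> w = [Letter_y]" if "length w < 2" for w :: "letter list"
    using that by (cases w; cases "hd w") (auto simp: less_Suc_eq numeral_2_eq_2)
  have det': "d * a - b * c = 1" "a * d - c * b = 1" using det by (simp_all add: mult.commute)
  show "unip (\<sigma> \<circ> aff_inv \<sigma>)"
    unfolding unip_def
  proof (intro conjI)
    show "alg_endo (\<sigma> \<circ> aff_inv \<sigma>)" using s autG_alg_endo alg_endo_comp alg_endo_aff A by metis
    show "low 2 ((\<sigma> \<circ> aff_inv \<sigma>) gen_x - gen_x)"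
      unfolding low_def
    proof (intro allI impI)
      fix w :: "letter list" assume "length w < 2"
      then show "coef ((\<sigma> \<circ> aff_inv \<sigma>) gen_x - gen_x) w = 0"
        using sh[of w] det' by (auto simp: A aff_gens autG_affine[OF s] lookup_minus lookup_add coef_gens coef_scalar abc[symmetric] algebra_simps)
    qed
    show "low 2 ((\<sigma> \<circ> aff_inv \<sigma>) gen_y - gen_y)"
      unfolding low_def
    proof (intro allI impI)
      fix w :: "letter list" assume "length w < 2"
      then show "coef ((\<sigma> \<circ> aff_inv \<sigma>) gen_y - gen_y) w = 0"
        using sh[of w] det' by (auto simp: A aff_gens autG_affine[OF s] lookup_minus lookup_add coef_gens coef_scalar abc[symmetric] algebra_simps)
    qed
  qed
qed

lemma reg_aff_inv: "reg k aff_inv"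
proof -
  define X where "X v = scalar (coef (snd v) [Letter_y]) * gen_x + scalar ((- 1) * coef (fst v) [Letter_y]) * gen_y
     + scalar (coef (fst v) [Letter_y] * coef (snd v) [] + (- 1) * (coef (snd v) [Letter_y] * coef (fst v) [])) * 1" for v :: "free_alg \<times> free_alg"
  define Y where "Y v = scalar ((- 1) * coef (snd v) [Letter_x]) * gen_x + scalar (coef (fst v) [Letter_x]) * gen_y
     + scalar (coef (snd v) [Letter_x] * coef (fst v) [] + (- 1) * (coef (fst v) [Letter_x] * coef (snd v) [])) * 1" for v :: "free_alg \<times> free_alg"
  have "polyfam X" "polyfam Y" unfolding X_def Y_def
    by (intro polyfam_add polyfam_scalar polyfam_const poly_functions.intros)+
  moreover have "aff_inv \<sigma> gen_x = X (as_pair \<sigma>)" "aff_inv \<sigma> gen_y = Y (as_pair \<sigma>)" for \<sigma>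
    by (simp_all add: aff_inv_def Let_def aff_gens affine_def X_def Y_def as_pair_def)
  moreover have "aff_inv \<sigma> \<in> filtration 1" if "\<sigma> \<in> filtration k" for \<sigma>
    using aff_inv_props(1)[of \<sigma>] that by (simp add: filtration_iff mdeg_def Aff_def)
  ultimately show ?thesis by (intro regI[of X Y k _ 1] conjI) simp_all
qed

text \<open>Composition with the inverse of the affine part reduces inversion to the unipotent case.\<close>

lemma reg_inverse: "reg k (\<lambda>\<sigma>. finv \<sigma>)"
proof -
  have "reg k (\<lambda>\<sigma>. finv (\<sigma> \<circ> aff_inv \<sigma>))"
    using aff_inv_props(2) by (intro reg_unip_inverse reg_comp reg_id reg_aff_inv) (simp add: filtration_iff)
  then have R: "reg k (\<lambda>\<sigma>. aff_inv \<sigma> \<circ> finv (\<sigma> \<circ> aff_inv \<sigma>))" by (intro reg_comp reg_aff_inv)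
  have eq: "aff_inv \<sigma> \<circ> finv (\<sigma> \<circ> aff_inv \<sigma>) = finv \<sigma>" if "\<sigma> \<in> filtration k" for \<sigma>
  proof -
    have "\<sigma> \<in> autG" "aff_inv \<sigma> \<in> autG" using that aff_inv_props(1)[of \<sigma>] Aff_subset by (auto simp: filtration_iff)
    then show ?thesis by (auto simp: inv_comp)
  qed
  show ?thesis using R unfolding reg_def by (simp add: eq)
qed

lemma continuous_map_reg:
  assumes "\<And>k. reg k T" shows "continuous_map ind_zariski ind_zariski T"
  unfolding continuous_map_closedin topspace_ind_zariski
proof (intro conjI allI impI)
  have in_filt: "\<sigma> \<in> filtration (mdeg \<sigma>)" if "\<sigma> \<in> autG" for \<sigma> using that by (simp add: filtration_iff)
  show "T \<in> autG \<rightarrow> autG"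
  proof
    fix \<sigma> assume "\<sigma> \<in> autG"
    then show "T \<sigma> \<in> autG" using assms[of "mdeg \<sigma>"] in_filt unfolding reg_def by (auto simp: filtration_iff)
  qed
  fix C assume C: "closedin ind_zariski C"
  show "closedin ind_zariski {\<sigma> \<in> autG. T \<sigma> \<in> C}"
    unfolding closedin_ind_zariski_iff
  proof (intro conjI allI)
    fix k
    obtain K \<Phi> \<Psi> where T: "polyfam \<Phi>" "polyfam \<Psi>" "\<And>\<sigma>. \<sigma> \<in> filtration k \<Longrightarrow> T \<sigma> \<in> filtration K \<and>
       T \<sigma> gen_x = \<Phi> (as_pair \<sigma>) \<and> T \<sigma> gen_y = \<Psi> (as_pair \<sigma>)" by (rule regE[OF assms[of k]]) (rule that)
    obtain F where F: "F \<subseteq> poly_functions" "C \<inter> filtration K = {\<sigma> \<in> filtration K. \<forall>f\<in>F. f (as_pair \<sigma>) = 0}"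
    proof -
      have "\<exists>F\<subseteq>poly_functions. C \<inter> filtration K = {\<sigma> \<in> filtration K. \<forall>f\<in>F. f (as_pair \<sigma>) = 0}"
        using C unfolding closedin_ind_zariski_iff by (elim conjE) (erule allE)
      then show ?thesis by (elim exE conjE) (rule that)
    qed
    define F' where "F' = (\<lambda>f v. f (\<Phi> v, \<Psi> v)) ` F"
    have "F' \<subseteq> poly_functions"
      unfolding F'_def by (intro image_subsetI poly_functions_comp[OF _ T(1,2)]) (use F(1) in blast)
    moreover have "T \<sigma> \<in> C \<longleftrightarrow> (\<forall>f\<in>F'. f (as_pair \<sigma>) = 0)" if s: "\<sigma> \<in> filtration k" for \<sigma>
    proof -
      have "as_pair (T \<sigma>) = (\<Phi> (as_pair \<sigma>), \<Psi> (as_pair \<sigma>))" using T(3)[OF s] by (simp add: as_pair_def)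
      then have "(\<forall>f\<in>F'. f (as_pair \<sigma>) = 0) \<longleftrightarrow> (\<forall>f\<in>F. f (as_pair (T \<sigma>)) = 0)" by (simp add: F'_def)
      also have "\<dots> \<longleftrightarrow> T \<sigma> \<in> C \<inter> filtration K" unfolding F(2) using T(3)[OF s] by simp
      also have "\<dots> \<longleftrightarrow> T \<sigma> \<in> C" using T(3)[OF s] by simp
      finally show ?thesis ..
    qed
    moreover have "{\<sigma> \<in> autG. T \<sigma> \<in> C} \<inter> filtration k = {\<sigma> \<in> filtration k. T \<sigma> \<in> C}" by (auto simp: filtration_iff)
    ultimately show "\<exists>F\<subseteq>poly_functions. {\<sigma> \<in> autG. T \<sigma> \<in> C} \<inter> filtration k = {\<sigma> \<in> filtration k. \<forall>f\<in>F. f (as_pair \<sigma>) = 0}"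
      by (intro exI[of _ F']) auto
  qed auto
qed

section \<open>Connected sets of automorphisms\<close>

abbreviation conn :: "(free_alg \<Rightarrow> free_alg) set \<Rightarrow> bool" where "conn \<equiv> connectedin ind_zariski"

lemma conn_subset: "conn S \<Longrightarrow> S \<subseteq> autG"
  by (metis connectedin_subset_topspace topspace_ind_zariski)

lemma continuous_left_mult: "g \<in> autG \<Longrightarrow> continuous_map ind_zariski ind_zariski (\<lambda>\<sigma>. g \<circ> \<sigma>)"
  by (intro continuous_map_reg reg_comp reg_const reg_id)

lemma continuous_conjugation: "g \<in> autG \<Longrightarrow> continuous_map ind_zariski ind_zariski (\<lambda>\<sigma>. g \<circ> \<sigma> \<circ> finv g)"
  by (intro continuous_map_reg reg_comp reg_const reg_id autG_inv)

lemma continuous_commutator: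
  "h \<in> autG \<Longrightarrow> continuous_map ind_zariski ind_zariski (\<lambda>\<sigma>. \<sigma> \<circ> h \<circ> finv \<sigma> \<circ> finv h)"
  by (intro continuous_map_reg reg_comp reg_const reg_id reg_inverse autG_inv)

lemma subgroup_autGI:
  assumes "H \<subseteq> autG" "id \<in> H" "\<And>\<sigma> \<tau>. \<sigma> \<in> H \<Longrightarrow> \<tau> \<in> H \<Longrightarrow> \<sigma> \<circ> \<tau> \<in> H" "\<And>\<sigma>. \<sigma> \<in> H \<Longrightarrow> finv \<sigma> \<in> H"
  shows "subgroup H sympl_aut"
proof (rule G.subgroupI)
  show "H \<subseteq> autG" "H \<noteq> {}" using assms(1,2) by auto
  show "inv\<^bsub>sympl_aut\<^esub> \<sigma> \<in> H" if "\<sigma> \<in> H" for \<sigma>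
  proof -
    have "\<sigma> \<in> autG" using that assms(1) by (rule rev_subsetD)
    then show ?thesis using assms(4)[OF that] by (simp add: inv_sympl_aut)
  qed
  show "\<sigma> \<otimes>\<^bsub>sympl_aut\<^esub> \<tau> \<in> H" if "\<sigma> \<in> H" "\<tau> \<in> H" for \<sigma> \<tau> using assms(3)[OF that] by simp
qed

lemma subgroup_autGD:
  assumes "subgroup H sympl_aut"
  shows "\<sigma> \<in> H \<Longrightarrow> \<sigma> \<in> autG" "id \<in> H" "\<sigma> \<in> H \<Longrightarrow> \<tau> \<in> H \<Longrightarrow> \<sigma> \<circ> \<tau> \<in> H" "\<sigma> \<in> H \<Longrightarrow> finv \<sigma> \<in> H"
proof -
  show m: "\<sigma> \<in> autG" if "\<sigma> \<in> H" for \<sigma> using subgroup.mem_carrier[OF assms that] .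
  show "id \<in> H" using subgroup.one_closed[OF assms] by (simp add: sympl_aut_def)
  show "\<sigma> \<in> H \<Longrightarrow> \<tau> \<in> H \<Longrightarrow> \<sigma> \<circ> \<tau> \<in> H" using subgroup.m_closed[OF assms] by simp
  show "finv \<sigma> \<in> H" if "\<sigma> \<in> H" using subgroup.m_inv_closed[OF assms that] by (simp add: inv_sympl_aut m[OF that])
qed

lemma derived_set_iff:
  assumes "H \<subseteq> autG"
  shows "\<sigma> \<in> derived_set sympl_aut H \<longleftrightarrow> (\<exists>a\<in>H. \<exists>b\<in>H. \<sigma> = a \<circ> b \<circ> finv a \<circ> finv b)"
proof -
  have "inv\<^bsub>sympl_aut\<^esub> a = finv a" if "a \<in> H" for a using that assms by (simp add: inv_sympl_aut subsetD)
  then show ?thesis by simp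
qed

text \<open>Every element of the derived subgroup lies in a connected subset that contains the identity. For a
  commutator this is the image of the group under commutation with a fixed element, for a product a union of two such
  sets of which one is translated.\<close>

lemma connected_derived:
  assumes H: "subgroup H sympl_aut" and c: "conn H"
  shows "conn (derived sympl_aut H)"
proof -
  note HD = subgroup_autGD[OF H]
  have HG: "H \<subseteq> autG" using HD(1) by (rule subsetI)
  define D where "D = derived sympl_aut H"
  have DS: "subgroup D sympl_aut" unfolding D_def using HG by (rule G.derived_is_subgroup)
  note DD = subgroup_autGD[OF DS]
  have "\<exists>S. conn S \<and> S \<subseteq> D \<and> id \<in> S \<and> \<sigma> \<in> S" if "\<sigma> \<in> D" for \<sigma>
    using that[unfolded D_def derived_def]
  proof (induction rule: generate.induct)
    case one
    have "conn {id}" by (simp add: connectedin_sing topspace_ind_zariski autG_id)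
    moreover have "\<one>\<^bsub>sympl_aut\<^esub> = id" by (simp only: sympl_aut_def monoid.simps partial_object.simps)
    ultimately show ?case using DD(2) by (intro exI[of _ "{id}"]) (simp only: singleton_iff insert_subset empty_subsetI simp_thms)
  next
    case (incl \<sigma>)
    then obtain a b where ab: "a \<in> H" "b \<in> H" "\<sigma> = a \<circ> b \<circ> finv a \<circ> finv b" unfolding derived_set_iff[OF HG] by (elim bexE) (rule that)
    define S where "S = (\<lambda>\<tau>. \<tau> \<circ> b \<circ> finv \<tau> \<circ> finv b) ` H"
    have "conn S" unfolding S_def
      by (rule connectedin_continuous_map_image[OF continuous_commutator c]) (rule HD(1)[OF ab(2)])
    moreover have "S \<subseteq> D"
    proof
      fix \<rho> assume "\<rho> \<in> S"
      then have "\<rho> \<in> derived_set sympl_aut H" unfolding S_def derived_set_iff[OF HG] using ab(2) by (elim imageE) (intro bexI)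
      then show "\<rho> \<in> D" unfolding D_def derived_def by (rule generate.incl)
    qed
    moreover have "id \<in> S" unfolding S_def
      by (rule image_eqI[OF _ HD(2)]) (simp add: autG_inv_comp HD(1)[OF ab(2)])
    moreover have "\<sigma> \<in> S" unfolding S_def ab(3) using ab(1) by (rule imageI)
    ultimately show ?case by (intro exI[of _ S] conjI)
  next
    case (inv \<sigma>)
    then obtain a b where ab: "a \<in> H" "b \<in> H" "\<sigma> = a \<circ> b \<circ> finv a \<circ> finv b" unfolding derived_set_iff[OF HG] by (elim bexE) (rule that)
    have sD: "\<sigma> \<in> D" unfolding D_def derived_def by (rule generate.incl[OF inv])
    have sG: "\<sigma> \<in> autG" using DD(1)[OF sD] .
    have "finv \<sigma> = b \<circ> a \<circ> finv b \<circ> finv a"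
      unfolding ab(3) using HD(1)[OF ab(1)] HD(1)[OF ab(2)] by (simp add: inv_comp autG_comp autG_inv autG_inv_comp o_assoc)
    define S where "S = (\<lambda>\<tau>. \<tau> \<circ> a \<circ> finv \<tau> \<circ> finv a) ` H"
    have "conn S" unfolding S_def
      by (rule connectedin_continuous_map_image[OF continuous_commutator c]) (rule HD(1)[OF ab(1)])
    moreover have "S \<subseteq> D"
    proof
      fix \<rho> assume "\<rho> \<in> S"
      then have "\<rho> \<in> derived_set sympl_aut H" unfolding S_def derived_set_iff[OF HG] using ab(1) by (elim imageE) (intro bexI)
      then show "\<rho> \<in> D" unfolding D_def derived_def by (rule generate.incl)
    qed
    moreover have "id \<in> S" unfolding S_def
      by (rule image_eqI[OF _ HD(2)]) (simp add: autG_inv_comp HD(1)[OF ab(1)])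
    moreover have "inv\<^bsub>sympl_aut\<^esub> \<sigma> \<in> S" unfolding S_def inv_sympl_aut[OF sG] \<open>finv \<sigma> = _\<close> using ab(2) by (rule imageI)
    ultimately show ?case by (intro exI[of _ S] conjI)
  next
    case (eng \<sigma> \<tau>)
    obtain S where S: "conn S" "S \<subseteq> D" "id \<in> S" "\<sigma> \<in> S" using eng.IH(1) by (elim exE conjE) (rule that)
    obtain T where T: "conn T" "T \<subseteq> D" "id \<in> T" "\<tau> \<in> T" using eng.IH(2) by (elim exE conjE) (rule that)
    define T' where "T' = (\<lambda>\<rho>. \<sigma> \<circ> \<rho>) ` T"
    have sD: "\<sigma> \<in> D" using S(2,4) by (rule subsetD)
    have "conn T'" unfolding T'_def by (rule connectedin_continuous_map_image[OF continuous_left_mult T(1)]) (rule DD(1)[OF sD])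
    moreover have s: "\<sigma> \<in> T'" unfolding T'_def by (rule image_eqI[OF _ T(3)]) simp
    moreover have "T' \<subseteq> D" unfolding T'_def by (intro image_subsetI DD(3)[OF sD]) (rule subsetD[OF T(2)])
    moreover have "\<sigma> \<circ> \<tau> \<in> T'" unfolding T'_def using T(4) by (rule imageI)
    moreover have "conn (S \<union> T')" using S(4) s by (intro connectedin_Un S(1) \<open>conn T'\<close>) (metis IntI emptyE)
    ultimately show ?case unfolding mult_sympl_aut
      by (intro exI[of _ "S \<union> T'"] conjI Un_least UnI1[OF S(3)] S(2)) (assumption | rule UnI2)+
  qed
  then have ex: "\<exists>S. conn S \<and> S \<subseteq> D \<and> id \<in> S \<and> \<sigma> \<in> S" if "\<sigma> \<in> D" for \<sigma> using that .
  define U where "U = {S. conn S \<and> S \<subseteq> D \<and> id \<in> S}"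
  have "conn (\<Union>U)"
  proof (rule connectedin_Union)
    show "conn S" if "S \<in> U" for S using that by (simp add: U_def)
    have "id \<in> \<Inter>U" by (simp add: U_def)
    then show "\<Inter>U \<noteq> {}" by (metis emptyE)
  qed
  moreover have "\<Union>U = D"
  proof
    show "\<Union>U \<subseteq> D" by (rule Union_least) (simp add: U_def)
    show "D \<subseteq> \<Union>U"
    proof
      fix \<sigma> assume "\<sigma> \<in> D"
      from ex[OF this] obtain S where "conn S" "S \<subseteq> D" "id \<in> S" "\<sigma> \<in> S" by (elim exE conjE) (rule that)
      then show "\<sigma> \<in> \<Union>U" by (intro UnionI[of S]) (simp_all add: U_def)
    qed
  qed
  ultimately show ?thesis by (simp add: D_def)
qed

lemma connected_derived_series:
  assumes "subgroup H sympl_aut" "conn H" shows "conn ((derived sympl_aut ^^ i) H)"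
  by (induction i) (simp_all add: assms connected_derived G.exp_of_derived_is_subgroup)

lemma solvable_subgroup_iff:
  assumes H: "subgroup H sympl_aut"
  shows "solvable (sympl_aut\<lparr>carrier := H\<rparr>) \<longleftrightarrow> (\<exists>n. (derived sympl_aut ^^ n) H = {id})"
proof -
  have "(derived (sympl_aut\<lparr>carrier := H\<rparr>) ^^ n) H = (derived sympl_aut ^^ n) H \<and> (derived sympl_aut ^^ n) H \<subseteq> H" for n
    by (induction n) (simp_all add: G.derived_consistent[OF _ H] G.derived_incl[OF _ H])
  then show ?thesis
    using group.solvable_iff_trivial_derived_seq[OF G.subgroup_imp_group[OF H]] by (simp add: sympl_aut_def)
qed

lemma point_closed: assumes "\<sigma> \<in> filtration k" shows "closedin (filtration_top k) {\<sigma>}"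
  unfolding closedin_filtration_top
proof (intro exI conjI)
  let ?F = "range (\<lambda>w v. coef (fst v) w + - coef (\<sigma> gen_x) w) \<union> range (\<lambda>w v. coef (snd v) w + - coef (\<sigma> gen_y) w)"
  show "?F \<subseteq> poly_functions" by (intro Un_least image_subsetI poly_functions.intros)
  show "{\<sigma>} = {\<tau> \<in> filtration k. \<forall>f\<in>?F. f (as_pair \<tau>) = 0}"
  proof (rule Set.set_eqI)
    fix \<tau>
    have "\<tau> = \<sigma>" if t: "\<tau> \<in> filtration k" "\<forall>f\<in>?F. f (as_pair \<tau>) = 0"
    proof (rule autG_eqI)
      show "\<tau> \<in> autG" "\<sigma> \<in> autG" using t(1) assms by (simp_all add: filtration_iff)
      show "\<tau> gen_x = \<sigma> gen_x" "\<tau> gen_y = \<sigma> gen_y"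
        using t(2) by (auto simp: as_pair_def ball_Un intro!: poly_mapping_eqI)
    qed
    then show "\<tau> \<in> {\<sigma>} \<longleftrightarrow> \<tau> \<in> {\<tau> \<in> filtration k. \<forall>f\<in>?F. f (as_pair \<tau>) = 0}"
      using assms by (auto simp: as_pair_def)
  qed
qed

lemma closed_of_finite_levels:
  assumes "S \<subseteq> autG" "\<And>k. finite (S \<inter> filtration k)" shows "closedin ind_zariski S"
proof -
  have fin: "T \<subseteq> filtration k \<Longrightarrow> closedin (filtration_top k) T" if "finite T" for T k
    using that
  proof (induction T rule: finite_induct)
    case (insert \<sigma> T)
    then have "closedin (filtration_top k) ({\<sigma>} \<union> T)" by (intro closedin_Un point_closed) simp_all
    then show ?case by simp
  qed simp
  show ?thesis unfolding closedin_ind_zariski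
    by (intro conjI allI assms(1) fin[OF assms(2)] Int_lower2)
qed

text \<open>If the set is finite in each degree, all its subsets are closed.\<close>

lemma connected_finite_levels:
  assumes "conn S" and fin: "\<And>k. finite (S \<inter> filtration k)" and ab: "a \<in> S" "b \<in> S" shows "a = b"
proof (rule ccontr)
  assume ne: "a \<noteq> b"
  note SG = conn_subset[OF assms(1)]
  have cl: "closedin ind_zariski T" if "T \<subseteq> S" for T
  proof (rule closed_of_finite_levels)
    show "T \<subseteq> autG" using that SG by (rule subset_trans)
    show "finite (T \<inter> filtration k)" for k using that by (intro finite_subset[OF _ fin[of k]] Int_mono subset_refl)
  qed
  have "closedin ind_zariski {a}" "closedin ind_zariski (S - {a})" using ab by (auto intro: cl)
  moreover have "S \<subseteq> {a} \<union> (S - {a})" "{a} \<inter> (S - {a}) \<inter> S = {}" "{a} \<inter> S \<noteq> {}" by (auto simp: ab)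
  moreover have "(S - {a}) \<inter> S \<noteq> {}" using ab ne by auto
  ultimately show False using assms(1) unfolding connectedin_closedin by metis
qed

lemma connectedin_closed_piece:
  assumes "connectedin X S" "closedin X A" "closedin X E" "S \<subseteq> A \<union> E" "A \<inter> E \<inter> S = {}" "A \<inter> S \<noteq> {}"
  shows "E \<inter> S = {}"
proof (rule ccontr)
  assume "E \<inter> S \<noteq> {}"
  with assms(2-) have "\<exists>E1 E2. closedin X E1 \<and> closedin X E2 \<and>
      S \<subseteq> E1 \<union> E2 \<and> E1 \<inter> E2 \<inter> S = {} \<and> E1 \<inter> S \<noteq> {} \<and> E2 \<inter> S \<noteq> {}"
    by (intro exI conjI)
  then show False using assms(1) by (simp only: connectedin_closedin simp_thms)
qed

text \<open>Being proportional modulo constants is the vanishing of two-by-two minors, a polynomial condition.\<close>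

lemma in_line_iff:
  assumes "w0 \<noteq> []" "coef q w0 \<noteq> 0"
  shows "z \<in> line q \<longleftrightarrow> (\<forall>w. w \<noteq> [] \<longrightarrow> coef z w * coef q w0 = coef q w * coef z w0)"
proof
  assume "z \<in> line q"
  then obtain c h where z: "z = scalar c * q + scalar h" by (auto simp: line_def)
  show "\<forall>w. w \<noteq> [] \<longrightarrow> coef z w * coef q w0 = coef q w * coef z w0"
    using assms(1) by (simp add: z lookup_add coef_scalar)
next
  assume r: "\<forall>w. w \<noteq> [] \<longrightarrow> coef z w * coef q w0 = coef q w * coef z w0"
  define c where "c = coef z w0 / coef q w0"
  have "z = scalar c * q + scalar (coef z [] - c * coef q [])"
  proof (rule poly_mapping_eqI)
    fix w
    show "coef z w = coef (scalar c * q + scalar (coef z [] - c * coef q [])) w"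
    proof (cases "w = []")
      case True then show ?thesis by (simp add: lookup_add coef_scalar)
    next
      case False
      then have "coef z w * coef q w0 = coef q w * coef z w0" using r by simp
      then have "coef z w = c * coef q w" using assms(2) by (simp add: c_def eq_divide_eq mult.commute)
      then show ?thesis using False by (simp add: lookup_add coef_scalar)
    qed
  qed
  then show "z \<in> line q" unfolding line_def by (intro CollectI exI)
qed

lemma transporter_closed:
  assumes "dg q \<ge> 1" shows "closedin ind_zariski {\<sigma> \<in> autG. \<sigma> p \<in> line q}"
proof -
  obtain w0 where w0: "w0 \<noteq> []" "coef q w0 \<noteq> 0"
  proof -
    have "\<not> dg q \<le> 0" using assms by simp
    then have "q \<notin> degree_le 0" by (simp add: degree_le_iff)
    then show ?thesis using that by (auto simp: degree_le_def in_keys_iff)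
  qed
  show ?thesis unfolding closedin_ind_zariski_iff
  proof (intro conjI allI exI)
    fix k
    let ?\<Phi> = "subst_fam (dg p) fst snd (\<lambda>_. p)"
    let ?F = "(\<lambda>w v. coef (?\<Phi> v) w * coef q w0 + (- coef q w) * coef (?\<Phi> v) w0) ` {w. w \<noteq> []}"
    have \<Phi>: "polyfam ?\<Phi>" by (intro polyfam_subst_fam polyfam_fst polyfam_snd polyfam_const)
    show "{\<sigma> \<in> autG. \<sigma> p \<in> line q} \<subseteq> autG" by (rule Collect_restrict)
    show "?F \<subseteq> poly_functions" by (intro image_subsetI poly_functions.intros(1,4,5) polyfam_coef \<Phi>)
    have "\<sigma> p \<in> line q \<longleftrightarrow> (\<forall>f\<in>?F. f (as_pair \<sigma>) = 0)" if "\<sigma> \<in> autG" for \<sigma>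
    proof -
      have "?\<Phi> (as_pair \<sigma>) = \<sigma> p"
        by (rule subst_fam_eq[OF autG_alg_endo[OF that]]) (simp_all add: as_pair_def)
      then show ?thesis unfolding in_line_iff[OF w0] by simp
    qed
    then show "{\<sigma> \<in> autG. \<sigma> p \<in> line q} \<inter> filtration k = {\<sigma> \<in> filtration k. \<forall>f\<in>?F. f (as_pair \<sigma>) = 0}"
      by (intro Set.set_eqI) (simp only: Int_iff mem_Collect_eq filtration_iff conj_ac simp_thms cong: conj_cong)
  qed
qed

text \<open>The transporters of the line to the members of a finite set of lines are disjoint closed sets, and the identity
  lies in the one that fixes the line.\<close>

lemma connected_fixes_line:
  assumes S: "conn S" "id \<in> S" and F: "finite F" "F \<subseteq> lines" "\<And>\<sigma>. \<sigma> \<in> S \<Longrightarrow> \<sigma> ` L \<in> F" and s: "\<sigma> \<in> S"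
  shows "\<sigma> ` L = L"
proof -
  have LF: "L \<in> F" using F(3)[OF S(2)] by simp
  note SG = conn_subset[OF S(1)]
  have cl: "closedin ind_zariski {\<sigma> \<in> autG. \<sigma> ` L = M}" if MF: "M \<in> F" for M
  proof -
    obtain \<tau> where l: "\<tau> \<in> autG" "L = line (\<tau> gen_y)" using LF F(2) by (auto simp: lines_def)
    obtain \<mu> where m: "\<mu> \<in> autG" "M = line (\<mu> gen_y)" using MF F(2) by (auto simp: lines_def)
    have "\<sigma> ` L = M \<longleftrightarrow> \<sigma> (\<tau> gen_y) \<in> line (\<mu> gen_y)" if "\<sigma> \<in> autG" for \<sigma>
    proof -
      have d: "dg ((\<sigma> \<circ> \<tau>) gen_y) \<ge> 1" using dg_gens_ge_1[OF autG_comp[OF that l(1)]] by simp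
      show ?thesis unfolding l(2) m(2) line_image[OF that]
      proof
        show "line (\<sigma> (\<tau> gen_y)) = line (\<mu> gen_y) \<Longrightarrow> \<sigma> (\<tau> gen_y) \<in> line (\<mu> gen_y)"
          by (erule subst) (rule line_self)
        show "line (\<sigma> (\<tau> gen_y)) = line (\<mu> gen_y)" if "\<sigma> (\<tau> gen_y) \<in> line (\<mu> gen_y)"
          using that d by (intro line_eq_of_mem) simp_all
      qed
    qed
    then have "{\<sigma> \<in> autG. \<sigma> ` L = M} = {\<sigma> \<in> autG. \<sigma> (\<tau> gen_y) \<in> line (\<mu> gen_y)}" by (intro Collect_cong conj_cong refl)
    then show ?thesis using transporter_closed[of "\<mu> gen_y"] dg_gens_ge_1[OF m(1)] by simp
  qed
  define E where "E = (\<Union>M\<in>F - {L}. {\<sigma> \<in> autG. \<sigma> ` L = M})"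
  have "closedin ind_zariski {\<sigma> \<in> autG. \<sigma> ` L = L}" using cl[OF LF] .
  moreover have "closedin ind_zariski E" unfolding E_def
    using F(1) cl by (intro closedin_Union) auto
  moreover have "S \<subseteq> {\<sigma> \<in> autG. \<sigma> ` L = L} \<union> E"
  proof
    fix \<rho> assume r: "\<rho> \<in> S"
    then have "\<rho> \<in> autG" "\<rho> ` L \<in> F" using subsetD[OF SG] F(3) by simp_all
    then show "\<rho> \<in> {\<sigma> \<in> autG. \<sigma> ` L = L} \<union> E" by (cases "\<rho> ` L = L") (simp_all add: E_def)
  qed
  moreover have "{\<sigma> \<in> autG. \<sigma> ` L = L} \<inter> E \<inter> S = {}"
  proof (rule equals0I)
    fix \<rho> assume "\<rho> \<in> {\<sigma> \<in> autG. \<sigma> ` L = L} \<inter> E \<inter> S"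
    then have "\<rho> ` L = L" "\<rho> \<in> E" by (simp_all only: Int_iff mem_Collect_eq)
    then show False by (simp add: E_def)
  qed
  moreover have "{\<sigma> \<in> autG. \<sigma> ` L = L} \<inter> S \<noteq> {}"
  proof -
    have "id \<in> {\<sigma> \<in> autG. \<sigma> ` L = L} \<inter> S" using S(2) autG_id by simp
    then show ?thesis by (metis emptyE)
  qed
  ultimately have "E \<inter> S = {}" by (rule connectedin_closed_piece[OF S(1)])
  then have "\<sigma> \<notin> E" using s by (metis IntI emptyE)
  then show ?thesis using subsetD[OF SG s] F(3)[OF s] by (simp add: E_def)
qed

section \<open>The triangular group is connected and solvable\<close>

definition laurent :: "(complex \<Rightarrow> complex) \<Rightarrow> bool" where
  "laurent \<phi> \<longleftrightarrow> (\<exists>P n. \<forall>t. t \<noteq> 0 \<longrightarrow> \<phi> t * t ^ n = poly P t)"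

lemma laurentI: "(\<And>t. t \<noteq> 0 \<Longrightarrow> \<phi> t * t ^ n = poly P t) \<Longrightarrow> laurent \<phi>"
  unfolding laurent_def by (intro exI[of _ P] exI[of _ n]) simp

lemma laurent_const: "laurent (\<lambda>_. c)" by (rule laurentI[of _ 0 "[:c:]"]) simp
lemma laurent_id: "laurent (\<lambda>t. t)" by (rule laurentI[of _ 0 "[:0, 1:]"]) simp
lemma laurent_inverse: "laurent (\<lambda>t. inverse t)" by (rule laurentI[of _ 1 "[:1:]"]) simp

lemma laurent_add: assumes "laurent \<phi>" "laurent \<psi>" shows "laurent (\<lambda>t. \<phi> t + \<psi> t)"
proof -
  obtain P n Q m where "\<And>t. t \<noteq> 0 \<Longrightarrow> \<phi> t * t ^ n = poly P t" "\<And>t. t \<noteq> 0 \<Longrightarrow> \<psi> t * t ^ m = poly Q t"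
    using assms unfolding laurent_def by metis
  moreover have "(\<phi> t + \<psi> t) * t ^ (n + m) = (\<phi> t * t ^ n) * t ^ m + (\<psi> t * t ^ m) * t ^ n" for t
    by (simp add: power_add algebra_simps)
  ultimately show ?thesis
    by (intro laurentI[of _ "n + m" "P * monom 1 m + Q * monom 1 n"]) (simp add: poly_monom)
qed

lemma laurent_mult: assumes "laurent \<phi>" "laurent \<psi>" shows "laurent (\<lambda>t. \<phi> t * \<psi> t)"
proof -
  obtain P n Q m where *: "\<And>t. t \<noteq> 0 \<Longrightarrow> \<phi> t * t ^ n = poly P t" "\<And>t. t \<noteq> 0 \<Longrightarrow> \<psi> t * t ^ m = poly Q t"
    using assms unfolding laurent_def by metis
  have "\<phi> t * \<psi> t * t ^ (n + m) = poly P t * poly Q t" if "t \<noteq> 0" for t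
    unfolding *(1)[OF that, symmetric] *(2)[OF that, symmetric] by (simp add: power_add)
  then show ?thesis by (intro laurentI[of _ "n + m" "P * Q"]) (simp add: *)
qed

lemma laurent_zero_or_finite:
  assumes "laurent \<phi>" "t0 \<noteq> 0" "\<phi> t0 \<noteq> 0" shows "finite {t. t \<noteq> 0 \<and> \<phi> t = 0}"
proof -
  obtain P n where P: "\<And>t. t \<noteq> 0 \<Longrightarrow> \<phi> t * t ^ n = poly P t" using assms(1) unfolding laurent_def by metis
  have "P \<noteq> 0" using P[OF assms(2)] assms by auto
  then have "finite {t. poly P t = 0}" by (rule poly_roots_finite)
  moreover have "{t. t \<noteq> 0 \<and> \<phi> t = 0} \<subseteq> {t. poly P t = 0}" using P by force
  ultimately show ?thesis by (rule finite_subset[rotated])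
qed

text \<open>The punctured line is irreducible: a product of two Laurent polynomials vanishes identically only if one of them
  does. So its image under an algebraic map cannot be covered by two disjoint proper closed sets.\<close>

lemma connected_curve:
  assumes \<gamma>: "\<And>t. t \<noteq> 0 \<Longrightarrow> \<gamma> t \<in> filtration K"
    and x: "\<And>w. laurent (\<lambda>t. coef (\<gamma> t gen_x) w)" and y: "\<And>w. laurent (\<lambda>t. coef (\<gamma> t gen_y) w)"
  shows "conn (\<gamma> ` (- {0}))"
proof -
  have L: "laurent (\<lambda>t. f (as_pair (\<gamma> t)))" if "f \<in> poly_functions" for f
    using that by induction (simp_all add: as_pair_def x y laurent_const laurent_add laurent_mult)
  have SG: "\<gamma> ` (- {0}) \<subseteq> autG" using \<gamma> by (auto simp: filtration_iff)
  have *: "\<gamma> ` (- {0}) \<subseteq> E1 \<or> \<gamma> ` (- {0}) \<subseteq> E2"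
    if E: "closedin ind_zariski E1" "closedin ind_zariski E2" "\<gamma> ` (- {0}) \<subseteq> E1 \<union> E2" for E1 E2
  proof (rule ccontr)
    assume "\<not> ?thesis"
    then obtain t1 t2 where t: "t1 \<noteq> 0" "\<gamma> t1 \<notin> E1" "t2 \<noteq> 0" "\<gamma> t2 \<notin> E2" by auto
    have ex: "\<exists>f\<in>poly_functions. f (as_pair (\<gamma> s)) \<noteq> 0 \<and> (\<forall>t. t \<noteq> 0 \<longrightarrow> \<gamma> t \<in> E \<longrightarrow> f (as_pair (\<gamma> t)) = 0)"
      if E: "closedin ind_zariski E" and s: "s \<noteq> 0" "\<gamma> s \<notin> E" for E s
    proof -
      have "\<exists>F\<subseteq>poly_functions. E \<inter> filtration K = {\<sigma> \<in> filtration K. \<forall>f\<in>F. f (as_pair \<sigma>) = 0}"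
        using E unfolding closedin_ind_zariski_iff by (elim conjE) (erule allE)
      then obtain F where F: "F \<subseteq> poly_functions" "E \<inter> filtration K = {\<sigma> \<in> filtration K. \<forall>f\<in>F. f (as_pair \<sigma>) = 0}"
        by (elim exE conjE) (rule that)
      have m: "\<gamma> t \<in> E \<longleftrightarrow> (\<forall>f\<in>F. f (as_pair (\<gamma> t)) = 0)" if "t \<noteq> 0" for t
      proof -
        have "\<gamma> t \<in> E \<longleftrightarrow> \<gamma> t \<in> E \<inter> filtration K" using \<gamma>[OF that] by simp
        also have "\<dots> \<longleftrightarrow> (\<forall>f\<in>F. f (as_pair (\<gamma> t)) = 0)" unfolding F(2) using \<gamma>[OF that] by simp
        finally show ?thesis .
      qed
      obtain f where "f \<in> F" "f (as_pair (\<gamma> s)) \<noteq> 0" using m[OF s(1)] s(2) by auto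
      then show ?thesis using F(1) m by (intro bexI[of _ f]) auto
    qed
    obtain f where f: "f \<in> poly_functions" "f (as_pair (\<gamma> t1)) \<noteq> 0" "\<And>t. t \<noteq> 0 \<Longrightarrow> \<gamma> t \<in> E1 \<Longrightarrow> f (as_pair (\<gamma> t)) = 0"
      using ex[OF E(1) t(1,2)] by auto
    obtain g where g: "g \<in> poly_functions" "g (as_pair (\<gamma> t2)) \<noteq> 0" "\<And>t. t \<noteq> 0 \<Longrightarrow> \<gamma> t \<in> E2 \<Longrightarrow> g (as_pair (\<gamma> t)) = 0"
      using ex[OF E(2) t(3,4)] by auto
    have "finite ({t. t \<noteq> 0 \<and> f (as_pair (\<gamma> t)) = 0} \<union> {t. t \<noteq> 0 \<and> g (as_pair (\<gamma> t)) = 0})"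
      using laurent_zero_or_finite[OF L[OF f(1)] t(1) f(2)] laurent_zero_or_finite[OF L[OF g(1)] t(3) g(2)] by simp
    moreover have "- {0} \<subseteq> {t. t \<noteq> 0 \<and> f (as_pair (\<gamma> t)) = 0} \<union> {t. t \<noteq> 0 \<and> g (as_pair (\<gamma> t)) = 0}"
      using E(3) f(3) g(3) by auto
    ultimately have "finite (- {0 :: complex})" by (rule finite_subset[rotated])
    then show False using infinite_UNIV_char_0[where 'a=complex] by (simp add: Compl_eq_Diff_UNIV)
  qed
  show ?thesis unfolding connectedin_closedin topspace_ind_zariski
  proof (intro conjI notI SG)
    assume "\<exists>E1 E2. closedin ind_zariski E1 \<and> closedin ind_zariski E2 \<and> \<gamma> ` (- {0}) \<subseteq> E1 \<union> E2 \<and>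
      E1 \<inter> E2 \<inter> \<gamma> ` (- {0}) = {} \<and> E1 \<inter> \<gamma> ` (- {0}) \<noteq> {} \<and> E2 \<inter> \<gamma> ` (- {0}) \<noteq> {}"
    then obtain E1 E2 where E: "closedin ind_zariski E1" "closedin ind_zariski E2" "\<gamma> ` (- {0}) \<subseteq> E1 \<union> E2"
      "E1 \<inter> E2 \<inter> \<gamma> ` (- {0}) = {}" "E1 \<inter> \<gamma> ` (- {0}) \<noteq> {}" "E2 \<inter> \<gamma> ` (- {0}) \<noteq> {}" by (elim exE conjE) (rule that)
    from *[OF E(1,2,3)] show False
    proof
      assume "\<gamma> ` (- {0}) \<subseteq> E1"
      then have "E1 \<inter> E2 \<inter> \<gamma> ` (- {0}) = E2 \<inter> \<gamma> ` (- {0})" by (auto simp only: subset_iff Int_iff set_eq_iff)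
      then show False using E(4,6) by simp
    next
      assume "\<gamma> ` (- {0}) \<subseteq> E2"
      then have "E1 \<inter> E2 \<inter> \<gamma> ` (- {0}) = E1 \<inter> \<gamma> ` (- {0})" by (auto simp only: subset_iff Int_iff set_eq_iff)
      then show False using E(4,5) by simp
    qed
  qed
qed

lemma id_triangular: "id \<in> triangular"
  by (simp add: triangular_iff autG_id) (metis add.right_neutral mult_1 scalar_0 scalar_1)

lemma subgroup_triangular: "subgroup triangular sympl_aut"
  by (rule subgroup_autGI) (auto simp: id_triangular triangular_comp triangular_inv triangular_subset)

text \<open>A triangular automorphism is joined to the identity by a punctured line. If its diagonal entry is not one, the
  parameter is this entry, and the other coefficients are scaled by an affine function of it; otherwise these
  coefficients alone are scaled.\<close>

lemma triangular_on_curve: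
  assumes s: "\<sigma> \<in> triangular"
  shows "\<exists>S\<subseteq>triangular. conn S \<and> id \<in> S \<and> \<sigma> \<in> S"
proof -
  obtain a h q where a: "a \<noteq> 0" "\<sigma> gen_x = scalar a * gen_x + pol q gen_y" "\<sigma> gen_y = scalar (inverse a) * gen_y + scalar h"
    using triangular_decomp[OF s] by (elim exE conjE) (rule that)
  define \<epsilon> where "\<epsilon> t = (if a = 1 then 1 else t)" for t :: complex
  define \<kappa> where "\<kappa> t = (if a = 1 then t - 1 else (t - 1) / (a - 1))" for t
  define \<gamma> where "\<gamma> t = el (smult (\<kappa> t / \<epsilon> t) q) \<circ> aff (\<epsilon> t) 0 0 0 (inverse (\<epsilon> t)) (\<kappa> t * h)" for t
  have \<epsilon>: "\<epsilon> t \<noteq> 0" if "t \<noteq> 0" for t using that by (simp add: \<epsilon>_def)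
  have x: "\<gamma> t gen_x = scalar (\<epsilon> t) * gen_x + scalar (\<kappa> t) * pol q gen_y" if "t \<noteq> 0" for t
    using \<epsilon>[OF that] by (simp add: \<gamma>_def aff_gens affine_def alg_endo_simps[OF alg_endo_el] distrib_left pol_smult
        scalar_mult[symmetric] mult.assoc[symmetric])
  have y: "\<gamma> t gen_y = scalar (inverse (\<epsilon> t)) * gen_y + scalar (\<kappa> t * h)" for t
    by (simp add: \<gamma>_def aff_gens affine_def alg_endo_simps[OF alg_endo_el])
  have tri: "\<gamma> t \<in> triangular" if "t \<noteq> 0" for t
  proof (rule triangularI(1)[where c = "inverse (\<epsilon> t)" and h = "\<kappa> t * h"])
    show "\<gamma> t gen_y = scalar (inverse (\<epsilon> t)) * gen_y + scalar (\<kappa> t * h)" by (rule y)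
    have "aff (\<epsilon> t) 0 0 0 (inverse (\<epsilon> t)) (\<kappa> t * h) \<in> autG"
      by (rule Aff_subset, rule Aff_I) (simp add: \<epsilon>[OF that])
    then show "\<gamma> t \<in> autG" unfolding \<gamma>_def by (intro autG_comp el_in_autG)
  qed
  have "conn (\<gamma> ` (- {0}))"
  proof (rule connected_curve[where K = "max 1 (dg (pol q gen_y))"])
    fix t :: complex assume t: "t \<noteq> 0"
    have "dg (\<gamma> t gen_x) \<le> max 1 (dg (pol q gen_y))" unfolding x[OF t]
      by (intro dg_add_le order_trans[OF dg_scalar_mult_le]) simp_all
    moreover have "dg (\<gamma> t gen_y) \<le> max 1 (dg (pol q gen_y))" unfolding y
      by (intro dg_add_le order_trans[OF dg_scalar_mult_le]) simp_all
    ultimately show "\<gamma> t \<in> filtration (max 1 (dg (pol q gen_y)))"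
      using triangular_subset[OF tri[OF t]] unfolding filtration_iff mdeg_def by simp
  next
    have e: "laurent \<epsilon>" "laurent (\<lambda>t. inverse (\<epsilon> t))" "laurent \<kappa>"
    proof -
      show "laurent \<epsilon>" unfolding \<epsilon>_def[abs_def] using laurent_const[of 1] laurent_id by (cases "a = 1") simp_all
      show "laurent (\<lambda>t. inverse (\<epsilon> t))" unfolding \<epsilon>_def[abs_def] using laurent_const[of 1] laurent_inverse by (cases "a = 1") simp_all
      have "laurent (\<lambda>t. (if a = 1 then 1 else 1 / (a - 1)) * (t + - 1))"
        by (intro laurent_mult laurent_add laurent_const laurent_id)
      moreover have "(\<lambda>t. (if a = 1 then 1 else 1 / (a - 1)) * (t + - 1)) = \<kappa>" by (rule ext) (simp add: \<kappa>_def)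
      ultimately show "laurent \<kappa>" by simp
    qed
    fix w
    have "laurent (\<lambda>t. \<epsilon> t * coef gen_x w + \<kappa> t * coef (pol q gen_y) w)"
      by (intro laurent_add laurent_mult laurent_const e)
    moreover have "coef (\<gamma> t gen_x) w = \<epsilon> t * coef gen_x w + \<kappa> t * coef (pol q gen_y) w" if "t \<noteq> 0" for t
      unfolding x[OF that] by (simp add: lookup_add)
    ultimately show "laurent (\<lambda>t. coef (\<gamma> t gen_x) w)" unfolding laurent_def by simp
    have "laurent (\<lambda>t. inverse (\<epsilon> t) * coef gen_y w + \<kappa> t * coef (scalar h) w)"
      by (intro laurent_add laurent_mult laurent_const e)
    moreover have "coef (\<gamma> t gen_y) w = inverse (\<epsilon> t) * coef gen_y w + \<kappa> t * coef (scalar h) w" for t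
      unfolding y by (simp add: lookup_add coef_scalar)
    ultimately show "laurent (\<lambda>t. coef (\<gamma> t gen_y) w)" by simp
  qed
  moreover have "\<gamma> ` (- {0}) \<subseteq> triangular" using tri by (intro image_subsetI) simp
  moreover have "id \<in> \<gamma> ` (- {0})"
  proof (rule image_eqI[of _ _ 1])
    show "id = \<gamma> 1"
    proof (rule autG_eqI[OF autG_id triangular_subset[OF tri]])
      show "id gen_x = \<gamma> 1 gen_x" "id gen_y = \<gamma> 1 gen_y" using x[of 1] y[of 1] by (simp_all add: \<epsilon>_def \<kappa>_def)
    qed simp
  qed simp
  moreover have "\<sigma> \<in> \<gamma> ` (- {0})"
  proof -
    define s where "s = (if a = 1 then 2 else a)"
    have s0: "s \<noteq> 0" using a(1) by (simp add: s_def)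
    have s1: "\<epsilon> s = a" "\<kappa> s = 1" by (simp_all add: \<epsilon>_def \<kappa>_def s_def)
    have "\<sigma> = \<gamma> s"
    proof (rule autG_eqI[OF triangular_subset[OF s] triangular_subset[OF tri[OF s0]]])
      show "\<sigma> gen_x = \<gamma> s gen_x" "\<sigma> gen_y = \<gamma> s gen_y" using x[OF s0] y[of s] a(2,3) by (simp_all add: s1)
    qed
    then show ?thesis using s0 by (intro image_eqI[of _ _ s]) simp_all
  qed
  ultimately show ?thesis by (intro exI[of _ "\<gamma> ` (- {0})"] conjI)
qed

lemma connected_triangular: "conn triangular"
proof -
  define U where "U = {S. conn S \<and> S \<subseteq> triangular \<and> id \<in> S}"
  have "conn (\<Union>U)"
  proof (rule connectedin_Union)
    show "conn S" if "S \<in> U" for S using that by (simp add: U_def)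
    have "id \<in> \<Inter>U" by (simp add: U_def)
    then show "\<Inter>U \<noteq> {}" by (metis emptyE)
  qed
  moreover have "\<Union>U = triangular"
  proof
    show "\<Union>U \<subseteq> triangular" by (rule Union_least) (simp add: U_def)
    show "triangular \<subseteq> \<Union>U"
    proof
      fix \<sigma> assume "\<sigma> \<in> triangular"
      from triangular_on_curve[OF this] obtain S where "conn S" "S \<subseteq> triangular" "id \<in> S" "\<sigma> \<in> S" by (elim exE conjE) (rule that)
      then show "\<sigma> \<in> \<Union>U" by (intro UnionI[of S]) (simp_all add: U_def)
    qed
  qed
  ultimately show ?thesis by simp
qed

text \<open>The action on the line of \<open>y\<close> is through the affine group of the complex line, whose commutators are translations.\<close>

lemma commutator_on_line:
  assumes st: "\<sigma> \<in> autG" "\<tau> \<in> autG"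
    and y: "\<sigma> gen_y = scalar c * gen_y + scalar h" "\<tau> gen_y = scalar c' * gen_y + scalar h'" and c: "c \<noteq> 0" "c' \<noteq> 0"
  shows "(\<sigma> \<circ> \<tau> \<circ> finv \<sigma> \<circ> finv \<tau>) gen_y = gen_y + scalar (((c' * h + h') - (c * h' + h)) / (c * c'))"
proof -
  define \<rho> where "\<rho> = \<sigma> \<circ> \<tau> \<circ> finv \<sigma> \<circ> finv \<tau>"
  have r: "\<rho> \<in> autG" unfolding \<rho>_def by (intro autG_comp autG_inv st)
  have "\<rho> (\<tau> (\<sigma> gen_y)) = \<sigma> (\<tau> gen_y)" using st by (simp add: \<rho>_def)
  moreover have "\<rho> (\<tau> (\<sigma> gen_y)) = scalar (c * c') * \<rho> gen_y + scalar (c * h' + h)"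
    by (simp add: y autG_simps[OF r] autG_simps[OF st(2)] distrib_left scalar_mult scalar_add mult.assoc add.assoc)
  moreover have "\<sigma> (\<tau> gen_y) = scalar (c * c') * gen_y + scalar (c' * h + h')"
    by (simp add: y autG_simps[OF st(1)] distrib_left scalar_mult[symmetric] scalar_add mult.assoc[symmetric] add.assoc mult.commute[of c c'])
  ultimately have e: "scalar (c * c') * \<rho> gen_y = scalar (c * c') * gen_y + (scalar (c' * h + h') - scalar (c * h' + h))"
    by (simp add: algebra_simps)
  have cancel: "scalar (inverse (c * c')) * (scalar (c * c') * p) = p" for p
  proof -
    have "inverse (c * c') * (c * c') = 1" using c by (intro left_inverse) simp
    then show ?thesis by (subst mult.assoc[symmetric]) (simp only: scalar_mult[symmetric] scalar_1 mult_1)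
  qed
  have "\<rho> gen_y = scalar (inverse (c * c')) * (scalar (c * c') * \<rho> gen_y)" by (rule cancel[symmetric])
  also have "\<dots> = gen_y + scalar (inverse (c * c') * ((c' * h + h') - (c * h' + h)))"
    unfolding e distrib_left cancel scalar_diff[symmetric] scalar_mult[symmetric] ..
  finally show ?thesis by (simp add: \<rho>_def divide_inverse mult.commute)
qed

lemma derived_subset:
  assumes "H \<subseteq> autG" "subgroup K sympl_aut" "\<And>\<sigma> \<tau>. \<sigma> \<in> H \<Longrightarrow> \<tau> \<in> H \<Longrightarrow> \<sigma> \<circ> \<tau> \<circ> finv \<sigma> \<circ> finv \<tau> \<in> K"
  shows "derived sympl_aut H \<subseteq> K"
  unfolding derived_def
proof (rule G.generate_subgroup_incl[OF _ assms(2)], rule subsetI)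
  fix \<rho> assume "\<rho> \<in> derived_set sympl_aut H"
  then show "\<rho> \<in> K" unfolding derived_set_iff[OF assms(1)] using assms(3) by (elim bexE) simp
qed

text \<open>The derived subgroup acts on the line of \<open>y\<close> by translations, the second one fixes \<open>y\<close>, and the automorphisms
  fixing \<open>y\<close> are elementary and commute.\<close>

lemma derived_triangular: "(derived sympl_aut ^^ 3) triangular = {id}"
proof -
  define K1 where "K1 = {\<sigma> \<in> autG. \<exists>h. \<sigma> gen_y = gen_y + scalar h}"
  define K2 where "K2 = {\<sigma> \<in> autG. \<sigma> gen_y = gen_y}"
  have K1: "subgroup K1 sympl_aut"
  proof (rule subgroup_autGI)
    show "id \<in> K1" unfolding K1_def by (rule CollectI, rule conjI[OF autG_id], rule exI[of _ 0]) simp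
    show "\<sigma> \<circ> \<tau> \<in> K1" if st: "\<sigma> \<in> K1" "\<tau> \<in> K1" for \<sigma> \<tau>
    proof -
      obtain h h' where "\<sigma> gen_y = gen_y + scalar h" "\<tau> gen_y = gen_y + scalar h'" "\<sigma> \<in> autG" "\<tau> \<in> autG"
        using st by (auto simp: K1_def)
      then show ?thesis by (auto simp: K1_def autG_comp autG_simps add.assoc scalar_add[symmetric])
    qed
    show "finv \<sigma> \<in> K1" if K: "\<sigma> \<in> K1" for \<sigma>
    proof -
      obtain h where s: "\<sigma> gen_y = gen_y + scalar h" "\<sigma> \<in> autG" using K by (auto simp: K1_def)
      have "gen_y = finv \<sigma> (\<sigma> gen_y)" using s(2) by simp
      also have "\<dots> = finv \<sigma> gen_y + scalar h" by (simp add: s autG_simps[OF autG_inv[OF s(2)]])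
      finally have "finv \<sigma> gen_y = gen_y + scalar (- h)" by (simp add: scalar_minus algebra_simps)
      then show ?thesis using autG_inv[OF s(2)] by (auto simp: K1_def)
    qed
  qed (auto simp: K1_def)
  have K2: "subgroup K2 sympl_aut"
  proof (rule subgroup_autGI)
    show "finv \<sigma> \<in> K2" if "\<sigma> \<in> K2" for \<sigma>
      using that autG_inv_simps(2)[of \<sigma> gen_y] by (simp add: K2_def autG_inv)
  qed (auto simp: K2_def autG_id autG_comp)
  have d1: "derived sympl_aut triangular \<subseteq> K1"
  proof (rule derived_subset[OF _ K1])
    show "triangular \<subseteq> autG" using triangular_subset by (rule subsetI)
    fix \<sigma> \<tau> assume st: "\<sigma> \<in> triangular" "\<tau> \<in> triangular"
    obtain a h q where a: "a \<noteq> 0" "\<sigma> gen_x = scalar a * gen_x + pol q gen_y" "\<sigma> gen_y = scalar (inverse a) * gen_y + scalar h"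
      using triangular_decomp[OF st(1)] by (elim exE conjE) (rule that)
    obtain a' h' q' where a': "a' \<noteq> 0" "\<tau> gen_x = scalar a' * gen_x + pol q' gen_y" "\<tau> gen_y = scalar (inverse a') * gen_y + scalar h'"
      using triangular_decomp[OF st(2)] by (elim exE conjE) (rule that)
    note g = triangular_subset[OF st(1)] triangular_subset[OF st(2)]
    have "\<sigma> \<circ> \<tau> \<circ> finv \<sigma> \<circ> finv \<tau> \<in> autG" by (intro autG_comp autG_inv g)
    moreover have "\<exists>k. (\<sigma> \<circ> \<tau> \<circ> finv \<sigma> \<circ> finv \<tau>) gen_y = gen_y + scalar k"
      using commutator_on_line[OF g a(3) a'(3)] a(1) a'(1) nonzero_imp_inverse_nonzero by metis
    ultimately show "\<sigma> \<circ> \<tau> \<circ> finv \<sigma> \<circ> finv \<tau> \<in> K1" unfolding K1_def by simp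
  qed
  have d2: "derived sympl_aut K1 \<subseteq> K2"
  proof (rule derived_subset[OF _ K2])
    show "K1 \<subseteq> autG" by (auto simp: K1_def)
    fix \<sigma> \<tau> assume "\<sigma> \<in> K1" "\<tau> \<in> K1"
    then obtain h h' where st: "\<sigma> gen_y = scalar 1 * gen_y + scalar h" "\<tau> gen_y = scalar 1 * gen_y + scalar h'" "\<sigma> \<in> autG" "\<tau> \<in> autG"
      by (auto simp: K1_def)
    have "\<sigma> \<circ> \<tau> \<circ> finv \<sigma> \<circ> finv \<tau> \<in> autG" by (intro autG_comp autG_inv st)
    then show "\<sigma> \<circ> \<tau> \<circ> finv \<sigma> \<circ> finv \<tau> \<in> K2"
      using commutator_on_line[OF st(3,4,1,2)] unfolding K2_def by simp
  qed
  have d3: "derived sympl_aut K2 \<subseteq> {id}"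
  proof (rule derived_subset)
    show "K2 \<subseteq> autG" by (auto simp: K2_def)
    show "subgroup {id} sympl_aut" by (rule subgroup_autGI) (auto simp: autG_id)
    have K2el: "\<exists>q. \<sigma> = el q" if s: "\<sigma> \<in> K2" for \<sigma>
    proof -
      have "\<sigma> \<in> triangular" using s by (intro triangularI(1)[of _ 1 0]) (simp_all add: K2_def)
      from triangular_decomp[OF this] obtain a h q where a: "a \<noteq> 0" "\<sigma> gen_x = scalar a * gen_x + pol q gen_y"
        "\<sigma> gen_y = scalar (inverse a) * gen_y + scalar h" by (elim exE conjE) (rule that)
      have "affine 0 (inverse a) h = affine 0 1 0" using a(3) s by (simp add: K2_def affine_def)
      then have "a = 1" unfolding affine_eq_iff using a(1) by (auto simp: field_simps)
      then have "\<sigma> = el q" using a(2) s by (intro autG_eqI el_in_autG) (simp_all add: K2_def)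
      then show ?thesis by blast
    qed
    fix \<sigma> \<tau> assume "\<sigma> \<in> K2" "\<tau> \<in> K2"
    then obtain q r where "\<sigma> = el q" "\<tau> = el r" using K2el by metis
    then show "\<sigma> \<circ> \<tau> \<circ> finv \<sigma> \<circ> finv \<tau> \<in> {id}" by (simp add: inv_el el_comp el_0 o_assoc)
  qed
  have "(derived sympl_aut ^^ 3) triangular \<subseteq> {id}"
  proof -
    have "derived sympl_aut (derived sympl_aut triangular) \<subseteq> K2"
      using G.mono_derived[OF d1] d2 by (rule subset_trans)
    then have "derived sympl_aut (derived sympl_aut (derived sympl_aut triangular)) \<subseteq> {id}"
      using d3 by (rule subset_trans[OF G.mono_derived])
    then show ?thesis by (simp add: numeral_3_eq_3)
  qed
  moreover have "id \<in> (derived sympl_aut ^^ 3) triangular"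
    by (rule subgroup_autGD(2)[OF G.exp_of_derived_is_subgroup[OF subgroup_triangular]])
  ultimately show ?thesis by (intro subset_antisym) simp_all
qed

lemma triangular_connected_solvable: "connected_solvable_subgroup sympl_aut ind_zariski triangular"
  unfolding connected_solvable_subgroup_def solvable_subgroup_iff[OF subgroup_triangular]
  using subgroup_triangular connected_triangular derived_triangular by (intro conjI exI)

section \<open>Conjugation\<close>

abbreviation conj_by :: "(free_alg \<Rightarrow> free_alg) \<Rightarrow> (free_alg \<Rightarrow> free_alg) \<Rightarrow> free_alg \<Rightarrow> free_alg" where
  "conj_by g \<sigma> \<equiv> g \<circ> \<sigma> \<circ> finv g"

abbreviation css :: "(free_alg \<Rightarrow> free_alg) set \<Rightarrow> bool" where
  "css \<equiv> connected_solvable_subgroup sympl_aut ind_zariski"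

lemma group_hom_conj_by: assumes "g \<in> autG" shows "group_hom sympl_aut sympl_aut (conj_by g)"
proof (rule group_hom.intro[OF group_sympl_aut group_sympl_aut], rule group_hom_axioms.intro, rule homI)
  show "conj_by g \<sigma> \<in> autG" if "\<sigma> \<in> autG" for \<sigma> by (intro autG_comp autG_inv assms that)
  show "conj_by g (\<sigma> \<otimes>\<^bsub>sympl_aut\<^esub> \<tau>) = conj_by g \<sigma> \<otimes>\<^bsub>sympl_aut\<^esub> conj_by g \<tau>" for \<sigma> \<tau>
    using assms by (simp add: fun_eq_iff)
qed

lemma derived_series_conj:
  assumes "g \<in> autG" "H \<subseteq> autG"
  shows "(derived sympl_aut ^^ n) (conj_by g ` H) = conj_by g ` (derived sympl_aut ^^ n) H"
  by (rule group_hom.exp_of_derived_img[OF group_hom_conj_by[OF assms(1)] assms(2)])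

lemma cssD:
  assumes "css H"
  shows "subgroup H sympl_aut" "conn H" "\<exists>n. (derived sympl_aut ^^ n) H = {id}"
proof -
  show s: "subgroup H sympl_aut" and "conn H" using assms by (simp_all add: connected_solvable_subgroup_def)
  show "\<exists>n. (derived sympl_aut ^^ n) H = {id}"
    using assms solvable_subgroup_iff[OF s] by (simp add: connected_solvable_subgroup_def)
qed

lemma css_conj: assumes "css H" "g \<in> autG" shows "css (conj_by g ` H)"
proof -
  note H = cssD[OF assms(1)]
  have HG: "H \<subseteq> autG" using subgroup_autGD(1)[OF H(1)] by (rule subsetI)
  have s: "subgroup (conj_by g ` H) sympl_aut"
    by (rule group_hom.subgroup_img_is_subgroup[OF group_hom_conj_by[OF assms(2)] H(1)])
  obtain n where "(derived sympl_aut ^^ n) H = {id}" using H(3) by (elim exE) (rule that)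
  then have "(derived sympl_aut ^^ n) (conj_by g ` H) = {id}"
    using assms(2) by (simp add: derived_series_conj[OF assms(2) HG] autG_inv_comp)
  moreover have "conn (conj_by g ` H)"
    by (rule connectedin_continuous_map_image[OF continuous_conjugation[OF assms(2)] H(2)])
  ultimately show ?thesis
    using s unfolding connected_solvable_subgroup_def solvable_subgroup_iff[OF s] by (intro conjI exI)
qed

lemma derived_series_normal:
  assumes H: "subgroup H sympl_aut" and h: "h \<in> H" and s: "\<sigma> \<in> (derived sympl_aut ^^ n) H"
  shows "conj_by h \<sigma> \<in> (derived sympl_aut ^^ n) H"
proof -
  note HD = subgroup_autGD[OF H]
  have hG: "h \<in> autG" and HG: "H \<subseteq> autG" using HD(1) h by (simp_all add: subsetI)
  have "conj_by h ` H = H"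
  proof
    show "conj_by h ` H \<subseteq> H" by (intro image_subsetI HD(3,4) h)
    show "H \<subseteq> conj_by h ` H"
    proof
      fix \<rho> assume "\<rho> \<in> H"
      then have "finv h \<circ> \<rho> \<circ> h \<in> H" by (intro HD(3,4) h)
      moreover have "\<rho> = conj_by h (finv h \<circ> \<rho> \<circ> h)" using hG by (simp add: fun_eq_iff)
      ultimately show "\<rho> \<in> conj_by h ` H" by (metis imageI)
    qed
  qed
  then have eq: "(derived sympl_aut ^^ n) H = conj_by h ` (derived sympl_aut ^^ n) H"
    using derived_series_conj[OF hG HG, of n] by simp
  show ?thesis by (subst eq) (rule imageI[OF s])
qed

lemma derived_step:
  assumes "H \<subseteq> autG" "a \<in> (derived sympl_aut ^^ n) H" "b \<in> (derived sympl_aut ^^ n) H"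
  shows "a \<circ> b \<circ> finv a \<circ> finv b \<in> (derived sympl_aut ^^ Suc n) H"
proof -
  have D: "(derived sympl_aut ^^ n) H \<subseteq> autG" by (rule G.exp_of_derived_in_carrier[OF assms(1)])
  have "a \<circ> b \<circ> finv a \<circ> finv b \<in> derived_set sympl_aut ((derived sympl_aut ^^ n) H)"
    unfolding derived_set_iff[OF D] by (intro bexI[of _ a] bexI[of _ b] refl assms)
  then show ?thesis by (simp add: derived_def generate.incl)
qed

section \<open>A connected solvable group fixes a vertex\<close>

text \<open>If infinitely many automorphisms moved both ends of a long path only a little, infinitely many would
  agree on a segment of length seven in its middle, contradicting the finiteness of its stabiliser.\<close>

lemma distance_bounded_by_infinite:
  assumes S: "infinite S" "S \<subseteq> autG" and w: "w \<in> verts"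
    and D: "\<And>s. s \<in> S \<Longrightarrow> T.d W0 (s ` W0) \<le> D \<and> T.d w (s ` w) \<le> D"
  shows "T.d W0 w < 2 * D + 9"
proof (rule ccontr)
  assume "\<not> T.d W0 w < 2 * D + 9"
  then have long: "T.d W0 w \<ge> 2 * D + 7 + 2" by simp
  have inj: "inj_on (\<lambda>\<sigma>. (`) \<sigma>) S"
  proof (rule inj_onI)
    fix \<sigma> \<tau> :: "free_alg \<Rightarrow> free_alg" assume eq: "(`) \<sigma> = (`) \<tau>"
    show "\<sigma> = \<tau>"
    proof
      fix p
      have "\<sigma> ` {p} = \<tau> ` {p}" unfolding eq ..
      then show "\<sigma> p = \<tau> p" by simp
    qed
  qed
  have inf: "infinite ((\<lambda>\<sigma>. (`) \<sigma>) ` S)" using S(1) inj by (simp add: finite_image_iff)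
  have W0V: "W0 \<in> verts" using W0_plane by (simp add: verts_def)
  have iso: "T.isom s" if "s \<in> (\<lambda>\<sigma>. (`) \<sigma>) ` S" for s using that isom_autG subsetD[OF S(2)] by (elim imageE) simp
  have disp: "T.d W0 (s W0) \<le> D \<and> T.d w (s w) \<le> D" if "s \<in> (\<lambda>\<sigma>. (`) \<sigma>) ` S" for s
    using that D by (elim imageE) simp
  obtain a b T where ab: "a \<in> verts" "b \<in> verts" "T.d a b \<ge> 7" and T: "T \<subseteq> (\<lambda>\<sigma>. (`) \<sigma>) ` S" "infinite T"
     "\<forall>s\<in>T. \<forall>t\<in>T. s a = t a \<and> s b = t b"
  proof -
    have "\<exists>a\<in>verts. \<exists>b\<in>verts. T.d a b \<ge> 7 \<and> (\<exists>T\<subseteq>(\<lambda>\<sigma>. (`) \<sigma>) ` S. infinite T \<and> (\<forall>s\<in>T. \<forall>t\<in>T. s a = t a \<and> s b = t b))"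
      by (rule T.agree_on_segment[OF inf _ W0V w _ long]) (erule iso, erule disp, simp)
    then show ?thesis by (elim bexE exE conjE) (rule that)
  qed
  obtain R where R: "R \<subseteq> S" "T = (\<lambda>\<sigma>. (`) \<sigma>) ` R" using T(1) by (rule subset_imageE) (rule that)
  have Rinf: "infinite R" using T(2) R(2) by auto
  then obtain \<tau> where t: "\<tau> \<in> R" by (metis finite.emptyI ex_in_conv)
  have tG: "\<tau> \<in> autG" using t R(1) S(2) by (meson subsetD)
  have "(\<lambda>\<sigma>. finv \<tau> \<circ> \<sigma>) ` R \<subseteq> {\<sigma> \<in> autG. \<sigma> ` a = a \<and> \<sigma> ` b = b}"
  proof (rule image_subsetI)
    fix \<sigma> assume s: "\<sigma> \<in> R"
    have sG: "\<sigma> \<in> autG" using s R(1) S(2) by (meson subsetD)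
    have "\<sigma> ` a = \<tau> ` a" "\<sigma> ` b = \<tau> ` b" using bspec[OF bspec[OF T(3)[unfolded R(2)] imageI[OF s]] imageI[OF t]] by (rule conjunct1, rule conjunct2)
    then show "finv \<tau> \<circ> \<sigma> \<in> {\<sigma> \<in> autG. \<sigma> ` a = a \<and> \<sigma> ` b = b}"
      using autG_comp[OF autG_inv[OF tG] sG] image_finv(1)[OF tG] by (simp only: image_comp[symmetric] mem_Collect_eq)
  qed
  moreover have "finite {\<sigma> \<in> autG. \<sigma> ` a = a \<and> \<sigma> ` b = b}" by (rule finite_far_stabilizer[OF ab])
  ultimately have "finite ((\<lambda>\<sigma>. finv \<tau> \<circ> \<sigma>) ` R)" by (rule finite_subset)
  moreover have "inj_on (\<lambda>\<sigma>. finv \<tau> \<circ> \<sigma>) R"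
  proof (rule inj_onI)
    fix \<sigma> \<rho> assume "finv \<tau> \<circ> \<sigma> = finv \<tau> \<circ> \<rho>"
    then have "\<tau> \<circ> finv \<tau> \<circ> \<sigma> = \<tau> \<circ> finv \<tau> \<circ> \<rho>" by (simp add: comp_assoc)
    then show "\<sigma> = \<rho>" by (simp add: autG_inv_comp[OF tG])
  qed
  ultimately show False using Rinf by (simp add: finite_image_iff)
qed

lemma distance_translate:
  assumes "h \<in> autG" "s \<in> autG"
  shows "T.d (h ` W0) (s ` h ` W0) = T.d W0 ((finv h \<circ> s \<circ> h) ` W0)"
proof -
  have W0V: "W0 \<in> verts" using W0_plane by (simp add: verts_def)
  have "h ` (finv h \<circ> s \<circ> h) ` W0 = s ` h ` W0" using assms(1) by (simp add: image_image)
  moreover have "(finv h \<circ> s \<circ> h) ` W0 \<in> verts" by (intro verts_image autG_comp autG_inv assms W0V)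
  then have "T.d (h ` W0) (h ` (finv h \<circ> s \<circ> h) ` W0) = T.d W0 ((finv h \<circ> s \<circ> h) ` W0)"
    using isom_autG[OF assms(1)] W0V by (simp add: T.isom_def)
  ultimately show ?thesis by simp
qed

text \<open>The last nontrivial derived subgroup \<open>N\<close> is connected, hence infinite in some degree \<open>k\<close>, and abelian. Its elements of degree
  at most \<open>k\<close> move the root a bounded distance and commute with \<open>N\<close>, so the \<open>N\<close>-orbit of the root is bounded. As \<open>N\<close> is normal
  and infinite, the same argument with all of \<open>N\<close> in place of its elements of bounded degree bounds the orbit of the whole group.\<close>

lemma css_fixes_vertex:
  assumes "css H" shows "\<exists>v\<in>verts. \<forall>h\<in>H. h ` v = v"
proof (cases "H = {id}")
  case True
  then show ?thesis using W0_plane by (intro bexI[of _ W0]) (simp_all add: verts_def)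
next
  case False
  note H = cssD[OF assms]
  note HD = subgroup_autGD[OF H(1)]
  have HG: "H \<subseteq> autG" using HD(1) by (rule subsetI)
  have W0V: "W0 \<in> verts" using W0_plane by (simp add: verts_def)
  define n where "n = (LEAST n. (derived sympl_aut ^^ n) H = {id})"
  have n: "(derived sympl_aut ^^ n) H = {id}" unfolding n_def using H(3) by (rule LeastI_ex)
  have "n \<noteq> 0" using n False by (cases n) simp_all
  then obtain m where m: "n = Suc m" by (cases n) simp_all
  define N where "N = (derived sympl_aut ^^ m) H"
  have N1: "N \<noteq> {id}" using not_less_Least[of m "\<lambda>n. (derived sympl_aut ^^ n) H = {id}"] m by (simp add: N_def n_def)
  have Nsub: "subgroup N sympl_aut" unfolding N_def by (rule G.exp_of_derived_is_subgroup[OF H(1)])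
  note ND = subgroup_autGD[OF Nsub]
  have NG: "N \<subseteq> autG" using ND(1) by (rule subsetI)
  have comm: "a \<circ> b = b \<circ> a" if ab: "a \<in> N" "b \<in> N" for a b
  proof -
    have "a \<circ> b \<circ> finv a \<circ> finv b \<in> {id}"
      using derived_step[OF HG ab[unfolded N_def]] by (simp only: n m[symmetric])
    moreover have "a \<circ> b \<circ> finv a \<circ> finv b \<circ> (b \<circ> a) = a \<circ> b"
      using ND(1)[OF ab(1)] ND(1)[OF ab(2)] by (simp add: fun_eq_iff)
    ultimately show ?thesis by (simp only: singleton_iff id_comp)
  qed
  obtain k where k: "infinite (N \<inter> filtration k)"
  proof -
    have cN: "conn N" unfolding N_def by (rule connected_derived_series[OF H(1,2)])
    obtain b where b: "b \<in> N" "b \<noteq> id" using N1 ND(2) by (metis singletonI subsetI subset_antisym singletonD)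
    have "\<exists>k. infinite (N \<inter> filtration k)"
    proof (rule ccontr)
      assume "\<nexists>k. infinite (N \<inter> filtration k)"
      then have "b = id" by (intro connected_finite_levels[OF cN _ b(1) ND(2)]) simp
      then show False using b(2) by simp
    qed
    then show ?thesis by (elim exE) (rule that)
  qed
  have dN: "T.d W0 (a ` W0) < 4 * int k + 9" if a: "a \<in> N" for a
  proof -
    have "T.d W0 (a ` W0) < 2 * (2 * int k) + 9"
    proof (rule distance_bounded_by_infinite[OF k])
      show "N \<inter> filtration k \<subseteq> autG" using NG by (rule subset_trans[OF Int_lower1])
      show "a ` W0 \<in> verts" by (rule verts_image[OF ND(1)[OF a] W0V])
      fix s assume "s \<in> N \<inter> filtration k"
      then have s: "s \<in> N" "s \<in> autG" "mdeg s \<le> k" by (simp_all add: filtration_iff)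
      have d: "T.d W0 (s ` W0) \<le> 2 * int k" using displacement_root[OF s(2)] s(3) by simp
      have "finv a \<circ> s \<circ> a = finv a \<circ> (a \<circ> s)" by (simp only: comm[OF a s(1)] comp_assoc)
      also have "\<dots> = s" using ND(1)[OF a] by (simp add: fun_eq_iff)
      finally have "finv a \<circ> s \<circ> a = s" .
      then show "T.d W0 (s ` W0) \<le> 2 * int k \<and> T.d (a ` W0) (s ` a ` W0) \<le> 2 * int k"
        using d distance_translate[OF ND(1)[OF a] s(2)] by simp
    qed
    then show ?thesis by simp
  qed
  have dH: "T.d W0 (h ` W0) < 2 * (4 * int k + 9) + 9" if h: "h \<in> H" for h
  proof (rule distance_bounded_by_infinite)
    show "infinite N" using k by (metis finite_Int)
    show "N \<subseteq> autG" by (rule NG)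
    show "h ` W0 \<in> verts" by (rule verts_image[OF HD(1)[OF h] W0V])
    fix s assume s: "s \<in> N"
    have "conj_by (finv h) s \<in> N"
      using derived_series_normal[OF H(1) HD(4)[OF h] s[unfolded N_def]] by (simp add: N_def)
    then have "finv h \<circ> s \<circ> h \<in> N" by (simp add: autG_inv_comp(3)[OF HD(1)[OF h]])
    then show "T.d W0 (s ` W0) \<le> 4 * int k + 9 \<and> T.d (h ` W0) (s ` h ` W0) \<le> 4 * int k + 9"
      using dN[OF s] dN[of "finv h \<circ> s \<circ> h"] distance_translate[OF HD(1)[OF h] ND(1)[OF s]] by simp
  qed
  have "\<exists>v\<in>verts. \<forall>g\<in>(\<lambda>\<sigma>. (`) \<sigma>) ` H. g v = v"
  proof (rule T.bounded_orbit_fixed_point[where O' = "(\<lambda>h. h ` W0) ` H" and ?v0.0 = W0])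
    show "W0 \<in> verts" by (rule W0V)
    show "T.isom g" if "g \<in> (\<lambda>\<sigma>. (`) \<sigma>) ` H" for g using that isom_autG HD(1) by (elim imageE) simp
    show "even (T.d v (g v))" if "g \<in> (\<lambda>\<sigma>. (`) \<sigma>) ` H" "v \<in> verts" for g v
      using that even_displacement HD(1) by (elim imageE) simp
    show "(\<lambda>h. h ` W0) ` H \<subseteq> verts" using verts_image[OF HD(1) W0V] by (intro image_subsetI)
    show "(\<lambda>h. h ` W0) ` H \<noteq> {}" using HD(2) by (metis empty_iff image_is_empty)
    show "T.d W0 x \<le> 2 * (4 * int k + 9) + 9" if "x \<in> (\<lambda>h. h ` W0) ` H" for x
      using that less_imp_le[OF dH] by (elim imageE) simp
    show "g ` (\<lambda>h. h ` W0) ` H = (\<lambda>h. h ` W0) ` H" if gH: "g \<in> (\<lambda>\<sigma>. (`) \<sigma>) ` H" for g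
    proof -
      obtain \<sigma> where s: "\<sigma> \<in> H" "g = (`) \<sigma>" using gH by (elim imageE) (rule that)
      have "g ` (\<lambda>h. h ` W0) ` H = (\<lambda>h. h ` W0) ` (\<lambda>h. \<sigma> \<circ> h) ` H"
        by (simp add: s(2) image_image)
      also have "(\<lambda>h. \<sigma> \<circ> h) ` H = H"
      proof
        show "(\<lambda>h. \<sigma> \<circ> h) ` H \<subseteq> H" by (intro image_subsetI HD(3) s(1))
        show "H \<subseteq> (\<lambda>h. \<sigma> \<circ> h) ` H"
        proof
          fix h assume "h \<in> H"
          then have "finv \<sigma> \<circ> h \<in> H" by (intro HD(3,4) s(1))
          moreover have "h = \<sigma> \<circ> (finv \<sigma> \<circ> h)" using HD(1)[OF s(1)] by (simp add: fun_eq_iff)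
          ultimately show "h \<in> (\<lambda>h. \<sigma> \<circ> h) ` H" by (metis imageI)
        qed
      qed
      finally show ?thesis .
    qed
  qed
  then show ?thesis by simp
qed

section \<open>A connected solvable group of affine automorphisms fixes a line\<close>

text \<open>The lines in the root plane, parametrised by the projective line.\<close>

definition base_lines :: "free_alg set set" where
  "base_lines = insert (line (affine 1 0 0)) (range (\<lambda>u. line (affine u 1 0)))"

lemma base_linesI: assumes "u \<noteq> 0 \<or> v \<noteq> 0" shows "line (affine u v w) \<in> base_lines"
proof (cases "v = 0")
  case True
  then have "line (scalar u * affine 1 0 0 + scalar w) = line (affine 1 0 0)" using assms by (intro line_eqI) simp
  then show ?thesis using True by (simp add: base_lines_def affine_scalar affine_gens(3)[of w] affine_add)
next
  case False
  then have "line (scalar v * affine (u / v) 1 0 + scalar w) = line (affine (u / v) 1 0)" by (intro line_eqI) simp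
  moreover have "scalar v * affine (u / v) 1 0 + scalar w = affine u v w"
    using False by (simp add: affine_scalar affine_gens(3)[of w] affine_add)
  ultimately show ?thesis by (simp add: base_lines_def)
qed

lemma base_lines_subset: "base_lines \<subseteq> lines"
proof -
  have "line (affine u v 0) \<in> lines" if uv: "u \<noteq> 0 \<or> v \<noteq> 0" for u v
  proof -
    obtain \<alpha> where "\<alpha> \<in> Aff" "\<alpha> gen_y = affine u v 0" using Aff_with_gen_y[OF uv, of 0] by (elim bexE) (rule that)
    then show ?thesis unfolding lines_def using Aff_subset by (intro image_eqI[of _ _ \<alpha>]) simp_all
  qed
  then show ?thesis by (auto simp: base_lines_def)
qed

lemma line_affine_eq_iff:
  assumes "u \<noteq> 0 \<or> v \<noteq> 0" "u' \<noteq> 0 \<or> v' \<noteq> 0"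
  shows "line (affine u v w) = line (affine u' v' w') \<longleftrightarrow> u * v' = u' * v"
proof
  assume "line (affine u v w) = line (affine u' v' w')"
  then have "affine u v w \<in> line (affine u' v' w')" using line_self[of "affine u v w"] by simp
  then obtain c h where "affine u v w = scalar c * affine u' v' w' + scalar h" unfolding line_def by auto
  also have "\<dots> = affine (c * u') (c * v') (c * w' + h)" by (simp add: affine_scalar affine_gens(3)[of h] affine_add)
  finally show "u * v' = u' * v" by (simp add: affine_eq_iff)
next
  assume eq: "u * v' = u' * v"
  obtain c where c: "c \<noteq> 0" "u = c * u'" "v = c * v'"
  proof (cases "v' = 0")
    case True
    then show ?thesis using assms eq that[of "u / u'"] by auto
  next
    case False
    then have "u = (v / v') * u'" using eq by (simp add: field_simps)
    then show ?thesis using False assms that[of "v / v'"] by auto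
  qed
  have "line (scalar c * affine u' v' w' + scalar (w - c * w')) = line (affine u' v' w')" using c(1) by (rule line_eqI)
  then show "line (affine u v w) = line (affine u' v' w')"
    by (simp add: c affine_scalar affine_gens(3)[of "w - c * w'"] affine_add)
qed

lemma Aff_base_lines:
  assumes "m \<in> Aff" "L \<in> base_lines" shows "m ` L \<in> base_lines"
proof -
  obtain u v where L: "L = line (affine u v 0)" "u \<noteq> 0 \<or> v \<noteq> 0" using assms(2) by (auto simp: base_lines_def)
  obtain a b e c d h where m: "a * d - b * c = 1" "m = aff a b e c d h" using Aff_D[OF assms(1)] by (elim exE conjE) (rule that)
  have "u * a + v * c \<noteq> 0 \<or> u * b + v * d \<noteq> 0"
  proof (rule ccontr)
    assume "\<not> ?thesis"
    then have z: "u * a + v * c = 0" "u * b + v * d = 0" by simp_all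
    have "u * (a * d - b * c) = (u * a + v * c) * d - (u * b + v * d) * c"
      "v * (a * d - b * c) = (u * b + v * d) * a - (u * a + v * c) * b" by (simp_all add: algebra_simps)
    then show False using z L(2) by (simp add: m(1))
  qed
  then show ?thesis unfolding L(1) line_image[OF Aff_subset[OF assms(1)]] unfolding m(2) aff_affine by (rule base_linesI)
qed

text \<open>The fixed lines are the zeros of a binary quadratic form, which is not zero if some line is moved.\<close>

lemma fixed_base_lines:
  assumes m: "m \<in> Aff" and L: "L \<in> base_lines" "m ` L \<noteq> L"
  shows "finite {L \<in> base_lines. m ` L = L}" "{L \<in> base_lines. m ` L = L} \<noteq> {}"
proof -
  obtain a b e c d h where det: "a * d - b * c = 1" and ma: "m = aff a b e c d h"
    using Aff_D[OF m] by (elim exE conjE) (rule that)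
  have im: "m ` line (affine u v 0) = line (affine (u * a + v * c) (u * b + v * d) (u * e + v * h))" for u v
    unfolding line_image[OF Aff_subset[OF m]] unfolding ma aff_affine by simp
  have fix_iff: "m ` line (affine u v 0) = line (affine u v 0) \<longleftrightarrow> (u * a + v * c) * v = u * (u * b + v * d)"
    if uv: "u \<noteq> 0 \<or> v \<noteq> 0" for u v
    unfolding im
  proof (rule line_affine_eq_iff[OF _ uv])
    have "u * (a * d - b * c) = (u * a + v * c) * d - (u * b + v * d) * c"
      "v * (a * d - b * c) = (u * b + v * d) * a - (u * a + v * c) * b" by (simp_all add: algebra_simps)
    then have "u = (u * a + v * c) * d - (u * b + v * d) * c" "v = (u * b + v * d) * a - (u * a + v * c) * b"
      by (simp_all add: det)
    then show "u * a + v * c \<noteq> 0 \<or> u * b + v * d \<noteq> 0" using uv by (metis diff_0_right mult_zero_left)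
  qed
  define p where "p = [:- c, d - a, b:]"
  have px: "m ` line (affine 1 0 0) = line (affine 1 0 0) \<longleftrightarrow> b = 0" using fix_iff[of 1 0] by auto
  have pu: "m ` line (affine u 1 0) = line (affine u 1 0) \<longleftrightarrow> poly p u = 0" for u
    using fix_iff[of u 1] by (auto simp: p_def algebra_simps)
  have p0: "p \<noteq> 0"
  proof
    assume "p = 0"
    then have "b = 0" "\<And>u. poly p u = 0" by (simp_all add: p_def)
    then have "m ` L = L" using L(1) px pu unfolding base_lines_def by (elim insertE rangeE) simp_all
    then show False using L(2) by simp
  qed
  have "{L \<in> base_lines. m ` L = L} \<subseteq> insert (line (affine 1 0 0)) ((\<lambda>u. line (affine u 1 0)) ` {u. poly p u = 0})"
    using pu by (auto simp: base_lines_def)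
  moreover have "finite {u. poly p u = 0}" using p0 by (rule poly_roots_finite)
  ultimately show "finite {L \<in> base_lines. m ` L = L}" by (meson finite.insertI finite_imageI finite_subset)
  show "{L \<in> base_lines. m ` L = L} \<noteq> {}"
  proof (cases "b = 0")
    case True
    then have "line (affine 1 0 0) \<in> {L \<in> base_lines. m ` L = L}" using px by (simp add: base_lines_def)
    then show ?thesis by (metis emptyE)
  next
    case False
    then have "\<not> constant (poly p)" by (simp add: constant_degree p_def)
    from fundamental_theorem_of_algebra[OF this] obtain u where "poly p u = 0" by (elim exE) (rule that)
    then have "line (affine u 1 0) \<in> {L \<in> base_lines. m ` L = L}" using pu by (simp add: base_lines_def)
    then show ?thesis by (metis emptyE)
  qed
qed

text \<open>The argument of Lie and Kolchin for the action on the lines in the root plane. The last derived subgroup \<open>M\<close>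
  that moves one of these lines has commutators acting trivially, so it permutes the finitely many fixed
  lines of one of its elements; being connected it fixes them, and they are then all the fixed lines
  of \<open>M\<close>, a finite set which the whole group permutes.\<close>

lemma css_affine_fixes_line:
  assumes "css H" and HA: "H \<subseteq> Aff" shows "\<exists>L\<in>lines. \<forall>h\<in>H. h ` L = L"
proof -
  note H = cssD[OF assms(1)]
  note HD = subgroup_autGD[OF H(1)]
  have HG: "H \<subseteq> autG" using HD(1) by (rule subsetI)
  define P where "P n \<longleftrightarrow> (\<forall>h\<in>(derived sympl_aut ^^ n) H. \<forall>L\<in>base_lines. h ` L = L)" for n
  define n where "n = (LEAST n. P n)"
  have "\<exists>n. P n"
  proof -
    obtain n where "(derived sympl_aut ^^ n) H = {id}" using H(3) by (elim exE) (rule that)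
    then have "P n" by (simp add: P_def)
    then show ?thesis by (rule exI)
  qed
  then have n: "P n" unfolding n_def by (rule LeastI_ex)
  show ?thesis
  proof (cases n)
    case 0
    have "line (affine 1 0 0) \<in> base_lines" by (simp add: base_lines_def)
    then show ?thesis using n[unfolded 0 P_def] base_lines_subset by (intro bexI[of _ "line (affine 1 0 0)"]) auto
  next
    case (Suc i)
    have "\<not> P i" using not_less_Least[of i P] Suc by (simp add: n_def)
    define M where "M = (derived sympl_aut ^^ i) H"
    obtain m0 L0 where m0: "m0 \<in> M" "L0 \<in> base_lines" "m0 ` L0 \<noteq> L0"
      using \<open>\<not> P i\<close> unfolding P_def M_def by auto
    have MH: "M \<subseteq> H"
    proof -
      have "(derived sympl_aut ^^ j) H \<subseteq> H" for j
        by (induction j) (simp_all add: G.derived_incl[OF _ H(1)])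
      then show ?thesis by (simp add: M_def)
    qed
    have MA: "m \<in> Aff" if "m \<in> M" for m using that MH HA by (meson subsetD)
    have Msub: "subgroup M sympl_aut" unfolding M_def by (rule G.exp_of_derived_is_subgroup[OF H(1)])
    note MD = subgroup_autGD[OF Msub]
    have cM: "conn M" unfolding M_def by (rule connected_derived_series[OF H(1,2)])
    define F where "F = {L \<in> base_lines. m0 ` L = L}"
    have F: "finite F" "F \<noteq> {}" unfolding F_def by (rule fixed_base_lines[OF MA[OF m0(1)] m0(2,3)])+
    have Fl: "F \<subseteq> lines" using base_lines_subset by (auto simp: F_def)
    have perm: "m ` L \<in> F" if m: "m \<in> M" and L: "L \<in> F" for m L
    proof -
      have LB: "L \<in> base_lines" "m0 ` L = L" using L by (simp_all add: F_def)
      define z where "z = m \<circ> m0 \<circ> finv m \<circ> finv m0"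
      have "z \<in> (derived sympl_aut ^^ n) H" unfolding z_def Suc
        by (rule derived_step[OF HG m[unfolded M_def] m0(1)[unfolded M_def]])
      moreover have B: "m0 ` m ` L \<in> base_lines" by (intro Aff_base_lines MA m m0(1) LB)
      ultimately have zL: "z ` m0 ` m ` L = m0 ` m ` L" using n by (simp add: P_def)
      have "z ` m0 ` m ` L = m ` m0 ` L"
        using MD(1)[OF m] MD(1)[OF m0(1)] by (simp add: z_def image_image)
      then have "m0 ` m ` L = m ` L" using zL LB(2) by simp
      then show ?thesis using Aff_base_lines[OF MA[OF m] LB(1)] by (simp add: F_def)
    qed
    have fixM: "m ` L = L" if m: "m \<in> M" and L: "L \<in> F" for m L
      by (rule connected_fixes_line[OF cM MD(2) F(1) Fl perm[OF _ L] m])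
    have permH: "h ` L \<in> F" if h: "h \<in> H" and L: "L \<in> F" for h L
    proof -
      have hG: "h \<in> autG" using HD(1)[OF h] .
      have "conj_by (finv h) m0 \<in> M"
        using derived_series_normal[OF H(1) HD(4)[OF h] m0(1)[unfolded M_def]] by (simp add: M_def)
      then have "finv h \<circ> m0 \<circ> h \<in> M" by (simp add: autG_inv_comp(3)[OF hG])
      then have "(finv h \<circ> m0 \<circ> h) ` L = L" using L by (rule fixM)
      then have "h ` (finv h \<circ> m0 \<circ> h) ` L = h ` L" by simp
      then have "m0 ` h ` L = h ` L" using hG by (simp add: image_image)
      moreover have "h ` L \<in> base_lines" using Aff_base_lines subsetD[OF HA h] L by (simp add: F_def)
      ultimately show ?thesis by (simp add: F_def)
    qed
    obtain L where L: "L \<in> F" using F(2) by auto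
    have "h ` L = L" if h: "h \<in> H" for h
      by (rule connected_fixes_line[OF H(2) HD(2) F(1) Fl permH[OF _ L] h])
    then show ?thesis using L Fl by (intro bexI[of _ L]) auto
  qed
qed

lemma conj_by_image: "g \<in> autG \<Longrightarrow> conj_by (finv g) h ` L = L \<longleftrightarrow> h ` g ` L = g ` L"
proof -
  assume g: "g \<in> autG"
  have "conj_by (finv g) h ` L = finv g ` h ` g ` L" by (simp only: image_comp autG_inv_comp(3)[OF g] comp_assoc)
  moreover have "finv g ` h ` g ` L = L \<longleftrightarrow> h ` g ` L = g ` L"
    using image_finv(1)[OF g, of L] image_finv(2)[OF g, of "h ` g ` L"] by (intro iffI) simp_all
  ultimately show ?thesis by simp
qed

lemma css_fixes_line:
  assumes "css H" shows "\<exists>L\<in>lines. \<forall>h\<in>H. h ` L = L"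
proof -
  obtain v where v: "v \<in> verts" "\<forall>h\<in>H. h ` v = v" using css_fixes_vertex[OF assms] by (elim bexE) (rule that)
  show ?thesis
  proof (cases "v \<in> lines")
    case True then show ?thesis using v(2) by (intro bexI[of _ v])
  next
    case False
    then obtain g where g: "g \<in> autG" "v = g ` W0" using v(1) by (auto simp: verts_def planes_def)
    have gi: "finv g \<in> autG" using autG_inv[OF g(1)] .
    have "conj_by (finv g) ` H \<subseteq> Aff"
    proof (rule image_subsetI)
      fix h assume h: "h \<in> H"
      have "conj_by (finv g) h ` W0 = W0" using v(2) h unfolding g(2) conj_by_image[OF g(1)] by simp
      moreover have "conj_by (finv g) h \<in> autG"
        using subgroup_autGD(1)[OF cssD(1)[OF assms] h] by (intro autG_comp autG_inv gi)
      ultimately show "conj_by (finv g) h \<in> Aff" by (simp add: Aff_iff)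
    qed
    from css_affine_fixes_line[OF css_conj[OF assms gi] this]
    obtain L where L: "L \<in> lines" "\<forall>h\<in>conj_by (finv g) ` H. h ` L = L" by (elim bexE) (rule that)
    have "h ` g ` L = g ` L" if "h \<in> H" for h using L(2) that conj_by_image[OF g(1)] by simp
    then show ?thesis using lines_image[OF g(1) L(1)] by (intro bexI[of _ "g ` L"]) simp_all
  qed
qed

text \<open>The stabiliser of the line \<open>g(\<complex> + \<complex>y)\<close> is the conjugate by \<open>g\<close> of the triangular subgroup.\<close>

lemma css_subset_conj_triangular:
  assumes "css H" shows "\<exists>g\<in>autG. H \<subseteq> conj_by g ` triangular"
proof -
  obtain L where L: "L \<in> lines" "\<forall>h\<in>H. h ` L = L" using css_fixes_line[OF assms] by (elim bexE) (rule that)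
  obtain g where g: "g \<in> autG" "L = line (g gen_y)" using L(1) by (auto simp: lines_def)
  have "h \<in> conj_by g ` triangular" if h: "h \<in> H" for h
  proof (rule image_eqI)
    have hG: "h \<in> autG" using subgroup_autGD(1)[OF cssD(1)[OF assms] h] .
    have "h ` g ` line gen_y = g ` line gen_y" using L(2) h unfolding g(2) line_image[OF g(1)] by simp
    then have "conj_by (finv g) h ` line gen_y = line gen_y" unfolding conj_by_image[OF g(1)] .
    moreover have "conj_by (finv g) h \<in> autG" by (intro autG_comp autG_inv g hG)
    ultimately show "conj_by (finv g) h \<in> triangular" by (simp add: triangular_iff_line)
    show "h = conj_by g (conj_by (finv g) h)" using g(1) by (simp add: fun_eq_iff autG_inv_comp(3))
  qed
  then show ?thesis using g(1) by (intro bexI[of _ g] subsetI)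
qed

theorem theorem3:
  fixes H :: "(free_alg \<Rightarrow> free_alg) set"
  assumes "borel_subgroup sympl_aut ind_zariski H"
  shows "\<exists>g \<in> carrier sympl_aut.
           H = g <#\<^bsub>sympl_aut\<^esub> triangular #>\<^bsub>sympl_aut\<^esub> inv\<^bsub>sympl_aut\<^esub> g"
proof -
  have H: "css H" "\<And>K. css K \<Longrightarrow> H \<subseteq> K \<Longrightarrow> K = H" using assms by (simp_all add: borel_subgroup_def)
  obtain g where g: "g \<in> autG" "H \<subseteq> conj_by g ` triangular" using css_subset_conj_triangular[OF H(1)] by (elim bexE) (rule that)
  have "conj_by g ` triangular = H" using H(2) css_conj[OF triangular_connected_solvable g(1)] g(2) by simp
  moreover have "g <#\<^bsub>sympl_aut\<^esub> triangular #>\<^bsub>sympl_aut\<^esub> inv\<^bsub>sympl_aut\<^esub> g = conj_by g ` triangular"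
    by (auto simp: l_coset_def r_coset_def inv_sympl_aut[OF g(1)])
  ultimately show ?thesis using g(1) by (intro bexI[of _ g]) simp_all
qed

end
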